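(* Let $w=w_{17}$ be the Atkin-Lehner involution of $X_0(34)$ attached to $17$. There exist $x,y,t\in\mathbb{Q}(X_0(34))$ such that $\mathbb{Q}(X_0(34))=\mathbb{Q}(x,y,t)$, the subfield of functions invariant under $w^*$ is $\mathbb{Q}(x,y)$, $w^*(t)=-t$, and $$y^2+xy=x^3-3x+1,\qquad t^2=-48-32x+20x^2+24x^3+x^4+8(2+2x+x^2)y .$$ In particular these two equations are equations for $X_0(34)$ over $\mathbb{Q}$ (up to birational equivalence over $\mathbb{Q}$).
   Context: $X_0(N)$ denotes the smooth projective curve over $\mathbb{Q}$ attached to $\Gamma_0(N)$, where $\mathbb{Q}(X_0(N))$ is the subfield of $\mathbb{C}(X_0(N))$ of functions with rational $q$-expansion at the cusp $\infty$, $q=e^{2\pi i z}$. For a positive divisor $d$ of $N$ coprime to $N/d$, the Atkin-Lehner involution $w_d$ of $X_0(N)$ is induced by any matrix $\frac{1}{\sqrt d}\begin{pmatrix} A d & B\\ N C & D d\end{pmatrix}$ of determinant $1$ with $A,B,C,D\in\mathbb{Z}$; it is defined over $\mathbb{Q}$. *)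

theory Defs
  imports
    "HOL-Complex_Analysis.Complex_Analysis"
    "HOL-Algebra.Generated_Fields"
    "HOL-Algebra.Algebraic_Closure_Type"
begin

no_notation fps_nth (infixl \<open>$\<close> 75)

section \<open>The field of meromorphic functions on the upper half-plane\<close>

definition uhp :: "complex set" where
  "uhp = {z. Im z > 0}"

lemma open_uhp [simp]: "open uhp"
  by (simp add: uhp_def open_halfspace_Im_gt)

lemma connected_uhp [simp]: "connected uhp"
  unfolding uhp_def by (intro convex_connected convex_halfspace_Im_gt)

lemma imaginary_unit_in_uhp [simp]: "\<i> \<in> uhp"
  by (simp add: uhp_def)

lemma uhp_nonempty [simp]: "uhp \<noteq> {}"
  using imaginary_unit_in_uhp by blast

text \<open>
  A meromorphic function is represented by the unique function that has no removable
  singularities, takes the value 0 at its poles, and is 0 outside the upper half-plane.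
\<close>
typedef uhp_mero = "{f. f nicely_meromorphic_on uhp \<and> (\<forall>z. z \<notin> uhp \<longrightarrow> f z = 0)}"
  morphisms mero_eval Abs_uhp_mero
  by (rule exI[of _ "\<lambda>_. 0"]) auto

lemma nicely_meromorphic_mero_eval: "mero_eval f nicely_meromorphic_on uhp"
  using mero_eval[of f] by auto

lemma meromorphic_mero_eval: "mero_eval f meromorphic_on uhp"
  using nicely_meromorphic_mero_eval[of f] by (auto simp: nicely_meromorphic_on_def)

lemma mero_eval_outside: "z \<notin> uhp \<Longrightarrow> mero_eval f z = 0"
  using mero_eval[of f] by auto

definition mk_mero :: "(complex \<Rightarrow> complex) \<Rightarrow> uhp_mero" where
  "mk_mero g = Abs_uhp_mero (\<lambda>z. if z \<in> uhp then remove_sings g z else 0)"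

lemma eventually_at_uhp: "z \<in> uhp \<Longrightarrow> \<forall>\<^sub>F w in at z. w \<in> uhp"
  by (simp add: eventually_at_in_open')

lemma mero_eval_mk_mero:
  assumes "g meromorphic_on uhp"
  shows "mero_eval (mk_mero g) = (\<lambda>z. if z \<in> uhp then remove_sings g z else 0)"
proof -
  let ?h = "\<lambda>z. if z \<in> uhp then remove_sings g z else 0"
  have nice: "remove_sings g nicely_meromorphic_on uhp"
    using assms by (rule remove_sings_nicely_meromorphic)
  have ev: "\<forall>\<^sub>F w in at z. ?h w = remove_sings g w" if "z \<in> uhp" for z
    using eventually_at_uhp[OF that] by eventually_elim auto
  have "?h meromorphic_on uhp \<longleftrightarrow> remove_sings g meromorphic_on uhp"
    by (intro meromorphic_on_cong ev refl)
  moreover have "is_pole ?h z \<longleftrightarrow> is_pole (remove_sings g) z" if "z \<in> uhp" for z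
    by (intro is_pole_cong ev that refl)
  moreover have "?h \<midarrow>z\<rightarrow> c \<longleftrightarrow> remove_sings g \<midarrow>z\<rightarrow> c" if "z \<in> uhp" for z c
    by (intro tendsto_cong ev that)
  ultimately have "?h nicely_meromorphic_on uhp"
    using nice unfolding nicely_meromorphic_on_def by auto
  thus ?thesis
    unfolding mk_mero_def by (subst Abs_uhp_mero_inverse) auto
qed

lemma mk_mero_eq:
  assumes "g meromorphic_on uhp"
  shows "\<forall>\<^sub>\<approx>z\<in>uhp. mero_eval (mk_mero g) z = g z"
proof -
  have "\<forall>\<^sub>\<approx>z\<in>uhp. z \<in> uhp"
    by (simp add: eventually_in_cosparse)
  thus ?thesis
    using eventually_remove_sings_eq[OF assms]
    by eventually_elim (simp add: mero_eval_mk_mero[OF assms])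
qed

lemma mero_eval_mk_mero_nice:
  assumes "g nicely_meromorphic_on uhp" "z \<in> uhp"
  shows "mero_eval (mk_mero g) z = g z"
proof -
  have "g meromorphic_on uhp"
    using assms by (auto simp: nicely_meromorphic_on_def)
  moreover have "is_pole g z \<and> g z = 0 \<or> g \<midarrow>z\<rightarrow> g z"
    using assms by (auto simp: nicely_meromorphic_on_def)
  ultimately show ?thesis
    using assms(2) by (auto simp: mero_eval_mk_mero)
qed

lemma uhp_mero_eqI:
  assumes "\<forall>\<^sub>\<approx>z\<in>uhp. mero_eval f z = mero_eval g z"
  shows "f = g"
proof -
  have "mero_eval f z = mero_eval g z" if z: "z \<in> uhp" for z
  proof -
    have ev: "\<forall>\<^sub>F w in at z. mero_eval f w = mero_eval g w"
      using assms z by (simp add: eventually_cosparse_open_eq)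
    have pole: "is_pole (mero_eval f) z \<longleftrightarrow> is_pole (mero_eval g) z"
      by (intro is_pole_cong ev refl)
    have f: "is_pole (mero_eval f) z \<and> mero_eval f z = 0 \<or> mero_eval f \<midarrow>z\<rightarrow> mero_eval f z"
      and g: "is_pole (mero_eval g) z \<and> mero_eval g z = 0 \<or> mero_eval g \<midarrow>z\<rightarrow> mero_eval g z"
      using nicely_meromorphic_mero_eval z by (auto simp: nicely_meromorphic_on_def)
    show ?thesis
    proof (cases "is_pole (mero_eval f) z")
      case True
      have "mero_eval f z = 0" "mero_eval g z = 0"
        using is_pole_zero_at_nicely_mero[OF nicely_meromorphic_mero_eval _ z] True pole by auto
      thus ?thesis by simp
    next
      case False
      hence "mero_eval f \<midarrow>z\<rightarrow> mero_eval f z" "mero_eval g \<midarrow>z\<rightarrow> mero_eval g z"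
        using f g pole by auto
      moreover have "mero_eval f \<midarrow>z\<rightarrow> mero_eval g z \<longleftrightarrow> mero_eval g \<midarrow>z\<rightarrow> mero_eval g z"
        by (intro tendsto_cong ev)
      ultimately show ?thesis
        using LIM_unique by blast
    qed
  qed
  hence "mero_eval f = mero_eval g"
    using mero_eval_outside by (metis ext)
  thus ?thesis
    by (simp add: mero_eval_inject)
qed

instantiation uhp_mero :: field
begin

definition "0 = mk_mero (\<lambda>_. 0)"
definition "1 = mk_mero (\<lambda>_. 1)"
definition "f + g = mk_mero (\<lambda>z. mero_eval f z + mero_eval g z)"
definition "f - g = mk_mero (\<lambda>z. mero_eval f z - mero_eval g z)"
definition "- f = mk_mero (\<lambda>z. - mero_eval f z)"
definition "f * g = mk_mero (\<lambda>z. mero_eval f z * mero_eval g z)"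
definition "inverse f = mk_mero (\<lambda>z. inverse (mero_eval f z))"
definition "f div g = mk_mero (\<lambda>z. mero_eval f z / mero_eval g z)"

lemma mero_eval_0: "\<forall>\<^sub>\<approx>z\<in>uhp. mero_eval 0 z = 0"
  and mero_eval_1: "\<forall>\<^sub>\<approx>z\<in>uhp. mero_eval 1 z = 1"
  and mero_eval_add: "\<forall>\<^sub>\<approx>z\<in>uhp. mero_eval (f + g) z = mero_eval f z + mero_eval g z"
  and mero_eval_diff: "\<forall>\<^sub>\<approx>z\<in>uhp. mero_eval (f - g) z = mero_eval f z - mero_eval g z"
  and mero_eval_uminus: "\<forall>\<^sub>\<approx>z\<in>uhp. mero_eval (- f) z = - mero_eval f z"
  and mero_eval_mult: "\<forall>\<^sub>\<approx>z\<in>uhp. mero_eval (f * g) z = mero_eval f z * mero_eval g z"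
  and mero_eval_inverse: "\<forall>\<^sub>\<approx>z\<in>uhp. mero_eval (inverse f) z = inverse (mero_eval f z)"
  and mero_eval_divide: "\<forall>\<^sub>\<approx>z\<in>uhp. mero_eval (f div g) z = mero_eval f z / mero_eval g z"
  for f g :: uhp_mero
  unfolding zero_uhp_mero_def one_uhp_mero_def plus_uhp_mero_def minus_uhp_mero_def
    uminus_uhp_mero_def times_uhp_mero_def inverse_uhp_mero_def divide_uhp_mero_def
  by (intro mk_mero_eq meromorphic_intros meromorphic_mero_eval)+

lemma mero_nonzero:
  fixes f :: uhp_mero
  assumes "f \<noteq> 0"
  shows "\<forall>\<^sub>\<approx>z\<in>uhp. mero_eval f z \<noteq> 0"
proof (rule ccontr)
  assume "\<not> ?thesis"
  hence "\<forall>\<^sub>\<approx>z\<in>uhp. mero_eval f z = 0"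
    using meromorphic_imp_constant_or_avoid[OF meromorphic_mero_eval[of f], of 0] by auto
  hence "\<forall>\<^sub>\<approx>z\<in>uhp. mero_eval f z = mero_eval 0 z"
    using mero_eval_0 by eventually_elim simp
  thus False
    using assms uhp_mero_eqI by blast
qed

instance
proof
  fix a b c :: uhp_mero
  show "a + b + c = a + (b + c)"
    by (rule uhp_mero_eqI)
      (use mero_eval_add[of "a + b" c] mero_eval_add[of a b] mero_eval_add[of a "b + c"]
        mero_eval_add[of b c] in \<open>eventually_elim, simp\<close>)
  show "a + b = b + a"
    by (rule uhp_mero_eqI)
      (use mero_eval_add[of a b] mero_eval_add[of b a] in \<open>eventually_elim, simp\<close>)
  show "0 + a = a"
    by (rule uhp_mero_eqI) (use mero_eval_add[of 0 a] mero_eval_0 in \<open>eventually_elim, simp\<close>)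
  show "- a + a = 0"
    by (rule uhp_mero_eqI)
      (use mero_eval_add[of "-a" a] mero_eval_0 mero_eval_uminus[of a] in \<open>eventually_elim, simp\<close>)
  show "a - b = a + - b"
    by (rule uhp_mero_eqI)
      (use mero_eval_diff[of a b] mero_eval_add[of a "-b"] mero_eval_uminus[of b]
        in \<open>eventually_elim, simp\<close>)
  show "a * b * c = a * (b * c)"
    by (rule uhp_mero_eqI)
      (use mero_eval_mult[of "a * b" c] mero_eval_mult[of a b] mero_eval_mult[of a "b * c"]
        mero_eval_mult[of b c] in \<open>eventually_elim, simp\<close>)
  show "a * b = b * a"
    by (rule uhp_mero_eqI)
      (use mero_eval_mult[of a b] mero_eval_mult[of b a] in \<open>eventually_elim, simp\<close>)
  show "1 * a = a"
    by (rule uhp_mero_eqI) (use mero_eval_mult[of 1 a] mero_eval_1 in \<open>eventually_elim, simp\<close>)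
  show "(a + b) * c = a * c + b * c"
    by (rule uhp_mero_eqI)
      (use mero_eval_mult[of "a + b" c] mero_eval_add[of a b] mero_eval_add[of "a * c" "b * c"]
        mero_eval_mult[of a c] mero_eval_mult[of b c]
        in \<open>eventually_elim, simp add: algebra_simps\<close>)
  show "(0 :: uhp_mero) \<noteq> 1"
  proof
    assume *: "(0 :: uhp_mero) = 1"
    have "\<forall>\<^sub>\<approx>z\<in>uhp. False"
      using mero_eval_0 mero_eval_1 by eventually_elim (simp add: *)
    thus False
      by simp
  qed
  show "inverse a * a = 1" if "a \<noteq> 0"
    by (rule uhp_mero_eqI)
      (use mero_eval_mult[of "inverse a" a] mero_eval_inverse[of a] mero_nonzero[OF that]
        mero_eval_1 in \<open>eventually_elim, simp\<close>)
  show "a div b = a * inverse b"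
    by (rule uhp_mero_eqI)
      (use mero_eval_mult[of a "inverse b"] mero_eval_inverse[of b] mero_eval_divide[of a b]
        in \<open>eventually_elim, simp add: divide_inverse\<close>)
  show "inverse (0 :: uhp_mero) = 0"
    by (rule uhp_mero_eqI)
      (use mero_eval_inverse[of 0] mero_eval_0 in \<open>eventually_elim, simp\<close>)
qed

end

lemma mero_eval_of_nat: "\<forall>\<^sub>\<approx>z\<in>uhp. mero_eval (of_nat n) z = of_nat n"
proof (induction n)
  case 0
  show ?case using mero_eval_0 by simp
next
  case (Suc n)
  show ?case
    using Suc mero_eval_1 mero_eval_add[of 1 "of_nat n"] by eventually_elim simp
qed

instance uhp_mero :: field_char_0
proof
  show "inj (of_nat :: nat \<Rightarrow> uhp_mero)"
  proof (rule injI)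
    fix m n :: nat
    assume *: "(of_nat m :: uhp_mero) = of_nat n"
    have "\<forall>\<^sub>\<approx>z\<in>uhp. mero_eval (of_nat n) z = of_nat m"
      using mero_eval_of_nat[of m] unfolding * .
    hence "\<forall>\<^sub>\<approx>z\<in>uhp. m = n"
      using mero_eval_of_nat[of n] by eventually_elim simp
    thus "m = n"
      by simp
  qed
qed


section \<open>Moebius transformations\<close>

definition moebius_act :: "real^2^2 \<Rightarrow> complex \<Rightarrow> complex" where
  "moebius_act A = moebius (of_real (A$1$1)) (of_real (A$1$2)) (of_real (A$2$1)) (of_real (A$2$2))"

lemma moebius_act_eq:
  "moebius_act A z =
     (of_real (A$1$1) * z + of_real (A$1$2)) / (of_real (A$2$1) * z + of_real (A$2$2))"
  by (simp add: moebius_act_def moebius_def)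

lemma moebius_denom_nonzero:
  fixes A :: "real^2^2"
  assumes "det A \<noteq> 0" "z \<in> uhp"
  shows "of_real (A$2$1) * z + of_real (A$2$2) \<noteq> (0 :: complex)"
proof
  assume *: "of_real (A$2$1) * z + of_real (A$2$2) = (0 :: complex)"
  have "Im (of_real (A$2$1) * z + of_real (A$2$2)) = A$2$1 * Im z"
    by simp
  hence "A$2$1 = 0"
    using * assms(2) by (auto simp: uhp_def)
  moreover from this have "A$2$2 = 0"
    using * by simp
  ultimately show False
    using assms(1) by (simp add: det_2)
qed

lemma Im_moebius:
  "Im (moebius_act A z) = det A * Im z / (cmod (of_real (A$2$1) * z + of_real (A$2$2)))\<^sup>2"
proof -
  let ?n = "of_real (A$1$1) * z + of_real (A$1$2) :: complex"
  let ?d = "of_real (A$2$1) * z + of_real (A$2$2) :: complex"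
  have "Im ?n * Re ?d - Re ?n * Im ?d = det A * Im z"
    by (simp add: det_2 algebra_simps)
  thus ?thesis
    unfolding moebius_act_eq Im_divide cmod_power2 by (rule arg_cong)
qed

lemma moebius_in_uhp:
  assumes "det A > 0" "z \<in> uhp"
  shows "moebius_act A z \<in> uhp"
proof -
  have "of_real (A$2$1) * z + of_real (A$2$2) \<noteq> (0 :: complex)"
    using assms by (intro moebius_denom_nonzero) auto
  thus ?thesis
    using assms by (simp add: uhp_def Im_moebius)
qed

lemma moebius_mult:
  fixes A B :: "real^2^2"
  assumes "det B > 0" "z \<in> uhp"
  shows "moebius_act (A ** B) z = moebius_act A (moebius_act B z)"
proof -
  define n d where "n = of_real (B$1$1) * z + of_real (B$1$2)"
    and "d = of_real (B$2$1) * z + of_real (B$2$2)"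
  have d: "d \<noteq> 0"
    unfolding d_def by (rule moebius_denom_nonzero) (use assms in simp_all)
  have eq: "p * (n / d) + q = (p * n + q * d) / d" for p q :: complex
    using d by (simp add: add_divide_distrib)
  have cancel: "(u / d) / (v / d) = u / v" for u v :: complex
    using d by simp
  have num: "of_real ((A ** B)$1$1) * z + of_real ((A ** B)$1$2) =
      of_real (A$1$1) * n + of_real (A$1$2) * d"
    by (simp add: matrix_matrix_mult_def sum_2 n_def d_def algebra_simps)
  have den: "of_real ((A ** B)$2$1) * z + of_real ((A ** B)$2$2) =
      of_real (A$2$1) * n + of_real (A$2$2) * d"
    by (simp add: matrix_matrix_mult_def sum_2 n_def d_def algebra_simps)
  have B: "moebius_act B z = n / d"
    unfolding moebius_act_eq n_def d_def by (rule refl)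
  show ?thesis
    unfolding B moebius_act_eq[of A] moebius_act_eq[of "A ** B"] num den eq cancel by (rule refl)
qed

lemma inj_on_moebius:
  assumes "det A > 0"
  shows "inj_on (moebius_act A) uhp"
proof (rule inj_onI)
  fix z w
  assume zw: "z \<in> uhp" "w \<in> uhp" "moebius_act A z = moebius_act A w"
  have nz: "of_real (A$2$1) * z + of_real (A$2$2) \<noteq> (0 :: complex)"
           "of_real (A$2$1) * w + of_real (A$2$2) \<noteq> (0 :: complex)"
    using assms zw(1,2) by (simp_all add: moebius_denom_nonzero)
  have "(of_real (A$1$1) * z + of_real (A$1$2)) * (of_real (A$2$1) * w + of_real (A$2$2)) =
        (of_real (A$1$1) * w + of_real (A$1$2)) * (of_real (A$2$1) * z + of_real (A$2$2))"
    using zw(3) nz unfolding moebius_act_eq by (simp add: frac_eq_eq)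
  moreover have "of_real (det A) * (z - w) =
      (of_real (A$1$1) * z + of_real (A$1$2)) * (of_real (A$2$1) * w + of_real (A$2$2)) -
      (of_real (A$1$1) * w + of_real (A$1$2)) * (of_real (A$2$1) * z + of_real (A$2$2))"
    by (simp add: det_2 algebra_simps)
  ultimately have "of_real (det A) * (z - w) = 0"
    by simp
  thus "z = w"
    using assms by simp
qed

lemma analytic_moebius:
  assumes "det A > 0"
  shows "moebius_act A analytic_on uhp"
proof -
  have "(\<lambda>z. (of_real (A$1$1) * z + of_real (A$1$2)) / (of_real (A$2$1) * z + of_real (A$2$2)))
          analytic_on uhp"
    using assms by (intro analytic_intros moebius_denom_nonzero) auto
  thus ?thesis
    by (simp add: moebius_act_eq[abs_def])
qed

definition moebius_pullback :: "real^2^2 \<Rightarrow> uhp_mero \<Rightarrow> uhp_mero" where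
  "moebius_pullback A f = mk_mero (\<lambda>z. mero_eval f (moebius_act A z))"

lemma mero_eval_moebius_pullback:
  assumes A: "det A > 0" and z: "z \<in> uhp"
  shows "mero_eval (moebius_pullback A f) z = mero_eval f (moebius_act A z)"
  unfolding moebius_pullback_def
proof (rule mero_eval_mk_mero_nice[OF _ z])
  show "(\<lambda>z. mero_eval f (moebius_act A z)) nicely_meromorphic_on uhp"
    unfolding nicely_meromorphic_on_def
  proof (intro conjI ballI)
    show "(\<lambda>z. mero_eval f (moebius_act A z)) meromorphic_on uhp"
      by (rule meromorphic_on_compose[OF meromorphic_mero_eval analytic_moebius])
        (use A moebius_in_uhp in auto)
  next
    fix w assume w: "w \<in> uhp"
    have "moebius_act A analytic_on {w}"
      using analytic_moebius[OF A] w by (simp add: analytic_on_subset)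
    hence lim: "moebius_act A \<midarrow>w\<rightarrow> moebius_act A w"
      using analytic_at_imp_isCont isContD by blast
    have ne: "\<forall>\<^sub>F z in at w. moebius_act A z \<noteq> moebius_act A w"
    proof -
      have "\<forall>\<^sub>F z in at w. z \<in> uhp - {w}"
        using w by (intro eventually_at_in_open) auto
      thus ?thesis
        by eventually_elim (use inj_on_moebius[OF A] w in \<open>auto simp: inj_on_def\<close>)
    qed
    have mw: "moebius_act A w \<in> uhp"
      using moebius_in_uhp[OF A w] .
    have "is_pole (mero_eval f) (moebius_act A w) \<and> mero_eval f (moebius_act A w) = 0 \<or>
          mero_eval f \<midarrow>moebius_act A w\<rightarrow> mero_eval f (moebius_act A w)"
      using nicely_meromorphic_mero_eval[of f] mw by (auto simp: nicely_meromorphic_on_def)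
    thus "is_pole (\<lambda>z. mero_eval f (moebius_act A z)) w \<and> mero_eval f (moebius_act A w) = 0 \<or>
          (\<lambda>z. mero_eval f (moebius_act A z)) \<midarrow>w\<rightarrow> mero_eval f (moebius_act A w)"
    proof (elim disjE conjE)
      assume "is_pole (mero_eval f) (moebius_act A w)" "mero_eval f (moebius_act A w) = 0"
      thus ?thesis using is_pole_compose[OF _ lim ne] by blast
    next
      assume "mero_eval f \<midarrow>moebius_act A w\<rightarrow> mero_eval f (moebius_act A w)"
      hence "(\<lambda>z. mero_eval f (moebius_act A z)) \<midarrow>w\<rightarrow> mero_eval f (moebius_act A w)"
        by (rule tendsto_compose_eventually[OF _ lim ne])
      thus ?thesis ..
    qed
  qed
qed


section \<open>The function field of the modular curve\<close>

definition SL2Z :: "(real^2^2) set" where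
  "SL2Z = {A. det A = 1 \<and> (\<forall>i j. A$i$j \<in> \<int>)}"

definition Gamma0 :: "nat \<Rightarrow> (real^2^2) set" where
  "Gamma0 N = {A \<in> SL2Z. \<exists>k::int. A$2$1 = of_int (int N * k)}"

text \<open>\<open>L\<close> is the expansion of \<open>f\<close> in powers of \<open>exp (2 \<pi> \<i> z / h)\<close>, near \<open>Im z = \<infinity>\<close>.\<close>
definition has_q_expansion :: "(complex \<Rightarrow> complex) \<Rightarrow> nat \<Rightarrow> complex fls \<Rightarrow> bool" where
  "has_q_expansion f h L \<longleftrightarrow>
     fls_conv_radius L > 0 \<and>
     (\<exists>Y. \<forall>z. Im z > Y \<longrightarrow> f z = eval_fls L (exp (2 * of_real pi * \<i> * z / of_nat h)))"

text \<open>
  \<open>\<complex>(X\<^sub>0(N))\<close>: the meromorphic functions on the upper half-plane that are invariant under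
  \<open>\<Gamma>\<^sub>0(N)\<close> and meromorphic at all cusps \<open>A \<infinity>\<close>, with \<open>A \<in> SL\<^sub>2(\<int>)\<close>.
\<close>
definition X0_complex_functions :: "nat \<Rightarrow> uhp_mero set" where
  "X0_complex_functions N =
     {f. (\<forall>A\<in>Gamma0 N. \<forall>z\<in>uhp. mero_eval f (moebius_act A z) = mero_eval f z) \<and>
         (\<forall>A\<in>SL2Z. \<exists>h L. h > 0 \<and> has_q_expansion (\<lambda>z. mero_eval f (moebius_act A z)) h L)}"

definition X0_rational_functions :: "nat \<Rightarrow> uhp_mero set" where
  "X0_rational_functions N =
     {f \<in> X0_complex_functions N.
        \<exists>L. has_q_expansion (mero_eval f) 1 L \<and> (\<forall>n. fls_nth L n \<in> \<rat>)}"

definition X0_field :: "nat \<Rightarrow> uhp_mero ring" where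
  "X0_field N = ring_of_type_algebra \<lparr>carrier := X0_rational_functions N\<rparr>"


section \<open>Atkin--Lehner involutions\<close>

definition atkin_lehner_matrices :: "nat \<Rightarrow> nat \<Rightarrow> (real^2^2) set" where
  "atkin_lehner_matrices N d =
     {W. det W = 1 \<and> (\<exists>A B C D :: int.
        W = (1 / sqrt (real d)) *\<^sub>R
              vector [vector [of_int (A * int d), of_int B],
                      vector [of_int (int N * C), of_int (D * int d)]])}"

text \<open>
  The action \<open>f \<mapsto> f \<circ> w\<^sub>d\<close> on functions. Lemma \<open>atkin_lehner_eq\<close> below shows that the
  choice of matrix is immaterial for functions on \<open>X\<^sub>0(N)\<close>.
\<close>
definition atkin_lehner :: "nat \<Rightarrow> nat \<Rightarrow> uhp_mero \<Rightarrow> uhp_mero" where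
  "atkin_lehner N d f = moebius_pullback (SOME W. W \<in> atkin_lehner_matrices N d) f"

lemma det_atkin_lehner_form:
  assumes "d > 0"
  shows "det ((1 / sqrt (real d)) *\<^sub>R vector [vector [a, b], vector [c, e]] :: real^2^2) =
           (a * e - b * c) / real d"
  using assms by (simp add: det_2 field_simps)

lemma atkin_lehner_matrices_nonempty:
  assumes "N > 0" "d dvd N" "coprime d (N div d)"
  shows "atkin_lehner_matrices N d \<noteq> {}"
proof -
  have d: "d > 0" using assms by (auto intro: Nat.gr0I)
  obtain M where M: "N = d * M" using assms(2) by blast
  have "coprime (int d) (int M)" using assms(3) d M by simp
  then obtain u v where uv: "int d * u + int M * v = 1"
    by (metis bezout_int coprime_iff_gcd_eq_1 mult.commute)
  let ?W = "(1 / sqrt (real d)) *\<^sub>R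
     vector [vector [of_int (u * int d), of_int (- v)],
             vector [of_int (int N * 1), of_int (1 * int d)]] :: real^2^2"
  have "det ?W = of_int (u * int d * (1 * int d) - (- v) * (int N * 1)) / real d"
    unfolding det_atkin_lehner_form[OF d] by simp
  also have "u * int d * (1 * int d) - (- v) * (int N * 1) = int d * (int d * u + int M * v)"
    by (simp add: M algebra_simps)
  also have "of_int \<dots> / real d = 1"
    unfolding uv using d by simp
  finally have "det ?W = 1" .
  hence "?W \<in> atkin_lehner_matrices N d"
    unfolding atkin_lehner_matrices_def
    by - (rule CollectI, rule conjI, assumption, rule exI[of _ u], rule exI[of _ "- v"], rule exI[of _ 1],
        rule exI[of _ 1], rule refl)
  thus ?thesis by blast
qed

lemma atkin_lehner_matrices_quotient:
  assumes "N > 0" "d dvd N"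
    and "V \<in> atkin_lehner_matrices N d" "W \<in> atkin_lehner_matrices N d"
  shows "\<exists>G\<in>Gamma0 N. V = G ** W"
proof -
  have d: "d > 0" using assms by (auto intro: Nat.gr0I)
  obtain M where M: "N = d * M" using assms(2) by blast
  obtain a b c e where V: "V = (1 / sqrt (real d)) *\<^sub>R
     vector [vector [of_int (a * int d), of_int b], vector [of_int (int N * c), of_int (e * int d)]]"
    and dV: "det V = 1"
    using assms(3) unfolding atkin_lehner_matrices_def by blast
  obtain a' b' c' e' where W: "W = (1 / sqrt (real d)) *\<^sub>R
     vector [vector [of_int (a' * int d), of_int b'], vector [of_int (int N * c'), of_int (e' * int d)]]"
    and dW: "det W = 1"
    using assms(4) unfolding atkin_lehner_matrices_def by blast
  have unimodular: "p * s * int d - q * int M * r = 1"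
    if "(of_int (p * int d) * of_int (s * int d) - of_int q * of_int (int N * r)) / real d = 1"
    for p q r s :: int
  proof -
    have "real_of_int (p * int d * (s * int d) - q * (int N * r)) = real_of_int (int d)"
      using that d by (simp add: divide_eq_eq)
    hence "p * int d * (s * int d) - q * (int N * r) = int d"
      by (simp only: of_int_eq_iff)
    moreover have "p * int d * (s * int d) - q * (int N * r) =
        int d * (p * s * int d - q * int M * r)"
      by (simp add: M algebra_simps)
    ultimately show ?thesis
      using d by simp
  qed
  have iV: "a * e * int d - b * int M * c = 1"
    using dV unfolding V det_atkin_lehner_form[OF d] by (rule unimodular)
  have iW: "a' * e' * int d - b' * int M * c' = 1"
    using dW unfolding W det_atkin_lehner_form[OF d] by (rule unimodular)
  define G :: "real^2^2" where "G = vector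
     [vector [of_int (a * e' * int d - b * int M * c'), of_int (b * a' - a * b')],
      vector [of_int (int N * (c * e' - e * c')), of_int (e * a' * int d - int M * c * b')]]"
  have GW: "G ** W = V"
  proof -
    have "(a * e' * int d - b * int M * c') * (a' * int d) + (b * a' - a * b') * (int N * c')
          = a * int d * (a' * e' * int d - b' * int M * c')"
      by (simp add: M algebra_simps)
    hence 1: "(a * e' * int d - b * int M * c') * (a' * int d) + (b * a' - a * b') * (int N * c')
          = a * int d" using iW by simp
    have "(a * e' * int d - b * int M * c') * b' + (b * a' - a * b') * (e' * int d)
          = b * (a' * e' * int d - b' * int M * c')"
      by (simp add: algebra_simps)
    hence 2: "(a * e' * int d - b * int M * c') * b' + (b * a' - a * b') * (e' * int d) = b"
      using iW by simp
    have "int N * (c * e' - e * c') * (a' * int d) + (e * a' * int d - int M * c * b') * (int N * c')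
          = int N * c * (a' * e' * int d - b' * int M * c')"
      by (simp add: algebra_simps)
    hence 3: "int N * (c * e' - e * c') * (a' * int d) + (e * a' * int d - int M * c * b') * (int N * c')
          = int N * c" using iW by simp
    have "int N * (c * e' - e * c') * b' + (e * a' * int d - int M * c * b') * (e' * int d)
          = e * int d * (a' * e' * int d - b' * int M * c')"
      by (simp add: M algebra_simps)
    hence 4: "int N * (c * e' - e * c') * b' + (e * a' * int d - int M * c * b') * (e' * int d)
          = e * int d" using iW by simp
    note eqs = 1 2 3 4
    note reqs = eqs[THEN arg_cong[where f = real_of_int], unfolded of_int_add of_int_mult[of _ b']
        of_int_mult[of _ "e' * int d"] of_int_mult[of _ "a' * int d"] of_int_mult[of _ "int N * c'"]]
    have "G ** vector [vector [of_int (a' * int d), of_int b'],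
        vector [of_int (int N * c'), of_int (e' * int d)]] =
        (vector [vector [of_int (a * int d), of_int b],
        vector [of_int (int N * c), of_int (e * int d)]] :: real^2^2)"
      unfolding vec_eq_iff forall_2 matrix_matrix_mult_def G_def
      by (simp only: vec_lambda_beta sum_2 vector_2 reqs)
    thus ?thesis
      unfolding V W by (simp add: matrix_scalar_ac scalar_matrix_assoc [symmetric])
  qed
  have "det G = 1"
    using GW dV dW by (metis det_mul mult.right_neutral)
  moreover have "\<forall>i j. G$i$j \<in> \<int>"
    unfolding forall_2 G_def vector_2 by (intro conjI Ints_of_int)
  moreover have "G$2$1 = of_int (int N * (c * e' - e * c'))"
    unfolding G_def vector_2 ..
  ultimately have "G \<in> Gamma0 N"
    unfolding Gamma0_def SL2Z_def by blast
  thus ?thesis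
    using GW by blast
qed

lemma atkin_lehner_eq:
  assumes "N > 0" "d dvd N" "f \<in> X0_complex_functions N" "W \<in> atkin_lehner_matrices N d"
  shows "atkin_lehner N d f = moebius_pullback W f"
proof -
  define V where "V = (SOME W. W \<in> atkin_lehner_matrices N d)"
  have V: "V \<in> atkin_lehner_matrices N d"
    unfolding V_def by (rule someI) (rule assms(4))
  have det: "det V > 0" "det W > 0"
    using V assms(4) unfolding atkin_lehner_matrices_def by simp_all
  obtain G where G: "G \<in> Gamma0 N" "V = G ** W"
    using atkin_lehner_matrices_quotient[OF assms(1,2) V assms(4)] by blast
  have "mero_eval (moebius_pullback V f) z = mero_eval (moebius_pullback W f) z" for z
  proof (cases "z \<in> uhp")
    case True
    have "mero_eval f (moebius_act V z) = mero_eval f (moebius_act G (moebius_act W z))"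
      using moebius_mult[OF det(2) True, of G] G(2) by simp
    also have "\<dots> = mero_eval f (moebius_act W z)"
      using assms(3) G(1) moebius_in_uhp[OF det(2) True] unfolding X0_complex_functions_def by blast
    finally show ?thesis
      using True det by (simp add: mero_eval_moebius_pullback)
  qed (simp add: mero_eval_outside)
  hence "moebius_pullback V f = moebius_pullback W f"
    using mero_eval_inject by blast
  thus ?thesis
    unfolding atkin_lehner_def V_def .
qed


section \<open>Affine equations for a curve over the rationals\<close>

text \<open>The polynomial ring \<open>\<rat>[X, Y, T]\<close>, realised as \<open>\<rat>[X][Y][T]\<close>.\<close>
abbreviation rat_poly3 :: "rat poly poly poly ring" where
  "rat_poly3 \<equiv> ring_of_type_algebra"

definition X_var :: "rat poly poly poly" where "X_var = [:[:[:0, 1:]:]:]"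
definition Y_var :: "rat poly poly poly" where "Y_var = [:[:0, 1:]:]"
definition T_var :: "rat poly poly poly" where "T_var = [:0, 1:]"

text \<open>
  The subscheme of affine 3-space over \<open>\<rat>\<close> cut out by \<open>S\<close> is integral and has function
  field \<open>K\<close>: the field \<open>K\<close> is a field of fractions of \<open>\<rat>[X, Y, T] / (S)\<close>. A curve over
  \<open>\<rat>\<close> with function field \<open>K\<close> is then birational over \<open>\<rat>\<close> to that subscheme.
\<close>
definition has_affine_equations ::
    "('a, 'b) ring_scheme \<Rightarrow> rat poly poly poly set \<Rightarrow> bool" where
  "has_affine_equations K S \<longleftrightarrow>
     field K \<and>
     (\<exists>\<phi> \<in> ring_hom rat_poly3 K.
        a_kernel rat_poly3 K \<phi> = genideal rat_poly3 S \<and>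
        carrier K = {\<phi> p \<otimes>\<^bsub>K\<^esub> inv\<^bsub>K\<^esub> \<phi> q | p q. \<phi> q \<noteq> \<zero>\<^bsub>K\<^esub>})"

end

(*
  Put phi(z) = eta(z)^2, U(z) = (phi(z) phi(17z) / (phi(2z) phi(34z)))^2, v(z) = phi(2z)^2 phi(17z) / (phi(z) phi(34z)^2).
  Both are functions on X_0(34) without poles or zeros on the upper half-plane, U is fixed by w = w_17, and w maps v
  to 17/v. With s = v + 17/v the functions X = (U^2 - 60 U + 16 s - 288) / (s + 238 - 9 U), x = X + 2,
  y = U + 2 x - 3 and t = v - 17/v satisfy X^2 + 16 X + 18 + 4 U = s (a finite check of q-coefficients) and
  X^3 = U^2 + 5 U X + 4 U, and these two relations are the two equations.

  The poles of x, y, t lie at the cusp infinity and at its image under w, with orders 2, 3 and 4. Hence, for a function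
  f on X_0(34), a power of X times a polynomial in x removes all other poles from f, and counting coefficients at the
  two cusps gives a linear relation between 1, y, t, y t and f over C(x). The first four are independent, by applying w
  and by degrees on the elliptic curve, so f lies in C(x, y, t). If f has rational q-expansion, a Q-linear functional
  C -> Q applied to the coefficients of the relation makes it rational.
*)
theory Submission
  imports Defs "HOL-Number_Theory.Cong"
begin

section \<open>Lambert series\<close>

text \<open>The quotient defining \<open>X\<close> is forced by the two relations: multiply
  \<open>X^2 + 16 X + 18 + 4 U = s\<close> by \<open>X\<close> and eliminate \<open>X^3\<close> and
  \<open>X^2\<close> by means of both relations; what remains is linear in \<open>X\<close>, namely
  \<open>X (s + 238 - 9 U) = U^2 - 60 U + 16 s - 288\<close>. So a single identity has to be
  verified on q-coefficients, and the cubic is then contained in the definition of \<open>X\<close>.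

  Two analytic facts make that finite check conclusive. The behaviour of eta under
  \<open>SL2Z\<close> comes from Eisenstein's cotangent series: up to a linear term, the series for
  \<open>z\<close> and for \<open>- 1 / z\<close> differ by a doubly periodic function without
  poles, hence by a constant, and the derivative at 0 is the inversion law for the logarithmic
  derivative of eta. The valence formula is replaced by the maximum principle for the product of all
  translates of a function.

  Of the four cusps, infinity and 1/2 are exchanged by \<open>W17\<close>, so expansions at infinity
  serve for both. At the two cusps with odd denominator no expansion is computed; bounds for
  \<open>U\<close>, \<open>v\<close> and \<open>17 / v\<close> are all that enters there.\<close>

definition e2pi :: "complex \<Rightarrow> complex" where
  "e2pi u = exp (2 * of_real pi * \<i> * u)"

lemma e2pi_add: "e2pi (u + v) = e2pi u * e2pi v"
  by (simp add: e2pi_def ring_distribs exp_add)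

lemma e2pi_minus: "e2pi (- u) = inverse (e2pi u)"
  by (simp add: e2pi_def exp_minus)

lemma e2pi_diff: "e2pi (u - v) = e2pi u / e2pi v"
  using e2pi_add[of u "-v"] by (simp add: e2pi_minus divide_inverse)

lemma e2pi_nonzero [simp]: "e2pi u \<noteq> 0"
  by (simp add: e2pi_def)

lemma e2pi_0 [simp]: "e2pi 0 = 1"
  by (simp add: e2pi_def)

lemma e2pi_of_int [simp]: "e2pi (of_int n) = 1"
  using exp_integer_2pi[of "of_int n"] by (simp add: e2pi_def mult_ac)

lemma e2pi_1 [simp]: "e2pi 1 = 1"
  using e2pi_of_int[of 1] by simp

lemma e2pi_of_nat_mult: "e2pi (of_nat n * u) = e2pi u ^ n"
  using exp_of_nat_mult[of n "2 * of_real pi * \<i> * u"] by (simp add: e2pi_def mult_ac)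

lemma norm_e2pi: "norm (e2pi u) = exp (- 2 * pi * Im u)"
  by (simp add: e2pi_def)

lemma norm_e2pi_less_1_iff [simp]: "norm (e2pi u) < 1 \<longleftrightarrow> Im u > 0"
  using pi_gt_zero by (simp add: norm_e2pi zero_less_mult_iff)

lemma has_field_derivative_e2pi:
  "(e2pi has_field_derivative 2 * of_real pi * \<i> * e2pi u) (at u)"
  unfolding e2pi_def by (auto intro!: derivative_eq_intros)

lemma has_field_derivative_e2pi' [derivative_intros]:
  assumes "(f has_field_derivative f') (at u within A)"
  shows "((\<lambda>u. e2pi (f u)) has_field_derivative 2 * of_real pi * \<i> * e2pi (f u) * f') (at u within A)"
  using DERIV_chain2[OF has_field_derivative_e2pi assms] .

text \<open>For \<open>norm W < 1\<close> this is the geometric series \<open>W + W^2 + ...\<close>;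
  the closed form also makes sense outside the disc, as the reflection
  \<open>W \<mapsto> 1 / W\<close> in \<open>cot_series_add_period\<close> requires.\<close>

definition geo :: "complex \<Rightarrow> complex" where "geo W = W / (1 - W)"

text \<open>The rows \<open>m \<ge> 1\<close> of Eisenstein's double series: by
  \<open>cot_eq_geo\<close> each term is \<open>pi * cot (pi * (u + m * z))\<close> up to the factor
  \<open>- 2 * pi * \<i>\<close> and an additive constant.\<close>

definition cot_tail :: "complex \<Rightarrow> complex \<Rightarrow> complex" where
  "cot_tail z u = (\<Sum>m. geo (e2pi (of_nat (Suc m) * z + u)))"

text \<open>Equals \<open>(1 - E_2) / 24\<close> for the weight 2 Eisenstein series
  \<open>E_2\<close>; in this shape it arises as the derivative of \<open>cot_tail z\<close> at
  0.\<close>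

definition lambert :: "complex \<Rightarrow> complex" where
  "lambert q = (\<Sum>m. q ^ Suc m / (1 - q ^ Suc m)\<^sup>2)"

lemma cot_tail_aux:
  assumes z: "Im z > 0"
  shows "\<exists>g g'. \<forall>u\<in>{u. Im u > - Im z}.
      ((\<lambda>m. geo (e2pi (of_nat (Suc m) * z + u))) sums g u) \<and>
      ((\<lambda>m. 2 * of_real pi * \<i> * e2pi (of_nat (Suc m) * z + u) / (1 - e2pi (of_nat (Suc m) * z + u))\<^sup>2) sums g' u) \<and>
      (g has_field_derivative g' u) (at u)"
proof (rule series_and_derivative_comparison_complex)
  show "open {u. Im u > - Im z}"
    by (rule open_halfspace_Im_gt)
next
  fix m :: nat and u :: complex assume u: "u \<in> {u. Im u > - Im z}"
  let ?w = "of_nat (Suc m) * z + u"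
  have "Im ?w > 0"
  proof -
    have "0 \<le> Im z * real m" using z by simp
    moreover have "Im ?w = Im z + Im z * real m + Im u" by (simp add: algebra_simps)
    ultimately show ?thesis using u by simp
  qed
  hence "e2pi ?w \<noteq> 1"
    by (metis less_irrefl norm_e2pi_less_1_iff norm_one)
  thus "((\<lambda>u. geo (e2pi (of_nat (Suc m) * z + u))) has_field_derivative
      2 * of_real pi * \<i> * e2pi ?w / (1 - e2pi ?w)\<^sup>2) (at u)"
    unfolding geo_def by (auto intro!: derivative_eq_intros simp: divide_simps power2_eq_square) (simp add: algebra_simps)?
next
  fix u0 :: complex assume u0: "u0 \<in> {u. Im u > - Im z}"
  \<comment> \<open>Half the distance of \<open>u0\<close> from the boundary line: on the ball of
    radius \<open>d\<close> the height of \<open>z + y\<close> stays above \<open>d\<close>, so the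
    term of index \<open>m\<close> is dominated by \<open>r * Q ^ m / (1 - r)\<close>.\<close>
  define d where "d = (Im u0 + Im z) / 2"
  have d: "d > 0" using u0 by (simp add: d_def)
  define r where "r = exp (- 2 * pi * d)"
  have r: "r > 0" "r < 1" using d by (auto simp: r_def)
  define Q where "Q = norm (e2pi z)"
  have Q: "Q < 1" "Q > 0" using z by (auto simp: Q_def)
  define h where "h = (\<lambda>m. complex_of_real (r * Q ^ m / (1 - r)))"
  have "norm (geo (e2pi (of_nat (Suc m) * z + y))) \<le> norm (h m)"
    if y: "y \<in> ball u0 d \<inter> {u. Im u > - Im z}" for m y
  proof -
    let ?W = "e2pi (of_nat (Suc m) * z + y)"
    have "\<bar>Im (y - u0)\<bar> < d"
      using y abs_Im_le_cmod[of "y - u0"] by (auto simp: dist_norm norm_minus_commute)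
    hence "Im y > Im u0 - d" by (simp add: abs_less_iff)
    moreover have "Im z + Im u0 = 2 * d" by (simp add: d_def)
    ultimately have y': "Im (z + y) > d" by simp
    have "?W = e2pi (of_nat m * z) * e2pi (z + y)"
      by (simp add: e2pi_add[symmetric] algebra_simps)
    hence "norm ?W = Q ^ m * norm (e2pi (z + y))"
      by (simp add: norm_mult e2pi_of_nat_mult norm_power Q_def)
    also have "norm (e2pi (z + y)) \<le> r"
      using y' by (simp add: norm_e2pi r_def)
    finally have W: "norm ?W \<le> r * Q ^ m"
      using Q by (simp add: mult_ac)
    also have "\<dots> \<le> r * 1"
      using Q r by (intro mult_left_mono power_le_one) auto
    finally have X1: "norm ?W \<le> r" by simp
    have "1 - r \<le> norm (1 - ?W)"
      using X1 norm_triangle_ineq2[of 1 ?W] by simp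
    hence "norm ?W / norm (1 - ?W) \<le> r * Q ^ m / (1 - r)"
      using W r Q by (intro frac_le) auto
    also have "\<dots> = norm (h m)"
      unfolding h_def norm_of_real using r Q by (intro abs_of_nonneg[symmetric]) simp
    finally show ?thesis by (simp add: geo_def norm_divide)
  qed
  moreover have "summable h"
    unfolding h_def using Q by (intro summable_of_real summable_divide summable_mult summable_geometric) auto
  moreover have "h m \<in> \<real>\<^sub>\<ge>\<^sub>0" for m
    unfolding h_def nonneg_Reals_of_real_iff using r Q by simp
  hence "range h \<subseteq> \<real>\<^sub>\<ge>\<^sub>0" by blast
  ultimately show "\<exists>d h. 0 < d \<and> summable h \<and> range h \<subseteq> \<real>\<^sub>\<ge>\<^sub>0 \<and>
      (\<forall>\<^sub>F m in sequentially. \<forall>y\<in>ball u0 d \<inter> {u. Im u > - Im z}.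
         cmod (geo (e2pi (of_nat (Suc m) * z + y))) \<le> cmod (h m))"
    using d by (intro exI[of _ d] exI[of _ h]) auto
qed

lemma
  assumes z: "Im z > 0" and u: "Im u > - Im z"
  shows sums_cot_tail: "(\<lambda>m. geo (e2pi (of_nat (Suc m) * z + u))) sums cot_tail z u"
    and has_field_derivative_cot_tail:
      "(cot_tail z has_field_derivative
         (\<Sum>m. 2 * of_real pi * \<i> * e2pi (of_nat (Suc m) * z + u) / (1 - e2pi (of_nat (Suc m) * z + u))\<^sup>2)) (at u)"
proof -
  obtain g g' where g: "\<And>u. Im u > - Im z \<Longrightarrow> (\<lambda>m. geo (e2pi (of_nat (Suc m) * z + u))) sums g u"
      "\<And>u. Im u > - Im z \<Longrightarrow> (\<lambda>m. 2 * of_real pi * \<i> * e2pi (of_nat (Suc m) * z + u) / (1 - e2pi (of_nat (Suc m) * z + u))\<^sup>2) sums g' u"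
      "\<And>u. Im u > - Im z \<Longrightarrow> (g has_field_derivative g' u) (at u)"
    using cot_tail_aux[OF z] by auto
  have eq: "cot_tail z u = g u" if "Im u > - Im z" for u
    using g(1)[OF that] by (simp add: cot_tail_def sums_iff)
  show "(\<lambda>m. geo (e2pi (of_nat (Suc m) * z + u))) sums cot_tail z u"
    using g(1)[OF u] eq[OF u] by simp
  have "(cot_tail z has_field_derivative g' u) (at u)"
    by (rule has_field_derivative_transform_within_open[OF g(3)[OF u] open_halfspace_Im_gt[of "- Im z"]])
      (use u eq in auto)
  thus "(cot_tail z has_field_derivative
         (\<Sum>m. 2 * of_real pi * \<i> * e2pi (of_nat (Suc m) * z + u) / (1 - e2pi (of_nat (Suc m) * z + u))\<^sup>2)) (at u)"
    using g(2)[OF u] by (simp add: sums_iff)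
qed

lemma sums_lambert:
  assumes "norm q < 1"
  shows "(\<lambda>m. q ^ Suc m / (1 - q ^ Suc m)\<^sup>2) sums lambert q"
proof -
  have "norm (q ^ Suc m / (1 - q ^ Suc m)\<^sup>2) \<le> norm q ^ Suc m / (1 - norm q)\<^sup>2" for m
  proof -
    have "norm q ^ Suc m \<le> norm q * 1"
      unfolding power_Suc using assms by (intro mult_left_mono power_le_one) auto
    hence "1 - norm q \<le> norm (1 - q ^ Suc m)"
      using norm_triangle_ineq2[of 1 "q ^ Suc m"] by (simp add: norm_mult norm_power)
    hence "(1 - norm q)\<^sup>2 \<le> norm (1 - q ^ Suc m) ^ 2"
      using assms by (intro power_mono) auto
    thus ?thesis
      using assms unfolding norm_divide norm_power by (intro frac_le) auto
  qed
  moreover have "summable (\<lambda>m. norm q ^ Suc m / (1 - norm q)\<^sup>2)"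
  proof -
    have "summable (\<lambda>m. norm q ^ m)" using assms by (simp add: summable_geometric_iff)
    from summable_divide[OF summable_mult[OF this, of "norm q"], of "(1 - norm q)\<^sup>2"]
    show ?thesis by simp
  qed
  ultimately have "summable (\<lambda>m. q ^ Suc m / (1 - q ^ Suc m)\<^sup>2)"
    by (rule summable_comparison_test'[where N = 0, rotated])
  thus ?thesis unfolding lambert_def by (rule summable_sums)
qed

lemma has_field_derivative_cot_tail_0:
  assumes z: "Im z > 0"
  shows "(cot_tail z has_field_derivative 2 * of_real pi * \<i> * lambert (e2pi z)) (at 0)"
proof -
  have "(\<lambda>m. 2 * of_real pi * \<i> * (e2pi z ^ Suc m / (1 - e2pi z ^ Suc m)\<^sup>2)) sums
      (2 * of_real pi * \<i> * lambert (e2pi z))"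
    using z by (intro sums_mult sums_lambert) auto
  hence "(\<Sum>m. 2 * of_real pi * \<i> * e2pi (of_nat (Suc m) * z + 0) / (1 - e2pi (of_nat (Suc m) * z + 0))\<^sup>2) =
      2 * of_real pi * \<i> * lambert (e2pi z)"
    by (simp add: sums_iff e2pi_of_nat_mult del: of_nat_Suc)
  thus ?thesis
    using has_field_derivative_cot_tail[OF z, of 0] z by simp
qed

lemma cot_tail_add_1 [simp]: "cot_tail z (u + 1) = cot_tail z u"
proof -
  have "e2pi (of_nat m * z + (u + 1)) = e2pi (of_nat m * z + u)" for m
    by (simp add: e2pi_add)
  thus ?thesis by (simp add: cot_tail_def del: of_nat_Suc)
qed

lemma cot_tail_diff_1 [simp]: "cot_tail z (u - 1) = cot_tail z u"
  using cot_tail_add_1[of z "u - 1"] by simp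

lemma cot_tail_add_period:
  assumes z: "Im z > 0" and u: "Im u > - Im z"
  shows "cot_tail z (u + z) = cot_tail z u - geo (e2pi (u + z))"
proof -
  have "(\<lambda>m. geo (e2pi (of_nat (Suc (Suc m)) * z + u))) sums (cot_tail z u - geo (e2pi (of_nat (Suc 0) * z + u)))"
    using sums_cot_tail[OF z u] by (subst sums_Suc_iff) simp
  thus ?thesis
    by (simp add: cot_tail_def sums_iff algebra_simps)
qed

section \<open>Eisenstein's cotangent series and its periods\<close>

definition cot_reg :: "complex \<Rightarrow> complex" where
  "cot_reg u = (if u = 0 then 0 else of_real pi * cot (of_real pi * u) - 1 / u)"

lemma cot_eq_geo:
  assumes "e2pi u \<noteq> 1"
  shows "of_real pi * cot (of_real pi * u) = - of_real pi * \<i> - 2 * of_real pi * \<i> * geo (e2pi u)"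
proof -
  define W where "W = exp (\<i> * (of_real pi * u))"
  have W: "W \<noteq> 0" "e2pi u = W * W"
    by (simp_all add: W_def e2pi_def exp_add[symmetric] mult_ac)
  have X1: "W * W \<noteq> 1" using assms W by simp
  have "exp (- (\<i> * (of_real pi * u))) = inverse W"
    by (simp add: W_def exp_minus)
  hence "cos (of_real pi * u) = (W + inverse W) / 2" "sin (of_real pi * u) = (W - inverse W) / (2 * \<i>)"
    unfolding cos_exp_eq sin_exp_eq by (simp_all only: W_def)
  hence "cot (of_real pi * u) = ((W + inverse W) / 2) / ((W - inverse W) / (2 * \<i>))"
    by (simp only: cot_def)
  also have "\<dots> = \<i> * (W * W + 1) / (W * W - 1)"
  proof -
    have "W + inverse W = (W * W + 1) / W" "W - inverse W = (W * W - 1) / W"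
      using W(1) by (simp_all add: add_divide_distrib diff_divide_distrib inverse_eq_divide)
    moreover have "(n / W / 2) / (d / W / (2 * \<i>)) = \<i> * n / d" if "d \<noteq> 0" for n d
      using that W(1) by (simp add: divide_eq_eq eq_divide_eq)
    ultimately show ?thesis using X1 by simp
  qed
  also have "\<dots> = - \<i> - 2 * \<i> * geo (W * W)"
  proof -
    have *: "1 - W * W \<noteq> 0" using X1 by simp
    have "\<i> * (W * W + 1) / (W * W - 1) = (- (\<i> * (W * W + 1))) / (1 - W * W)"
      using minus_divide_divide[of "\<i> * (W * W + 1)" "W * W - 1"] by simp
    also have "- (\<i> * (W * W + 1)) = (- \<i>) * (1 - W * W) - 2 * \<i> * (W * W)"
      by (simp add: ring_distribs)
    also have "\<dots> / (1 - W * W) = - \<i> - 2 * \<i> * (W * W / (1 - W * W))"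
      by (subst diff_divide_distrib) (use * in simp)
    finally show ?thesis by (simp add: geo_def)
  qed
  finally have cot: "cot (of_real pi * u) = - \<i> - 2 * \<i> * geo (W * W)" .
  show ?thesis
    unfolding W(2) cot by (simp add: algebra_simps)
qed

lemma e2pi_neq_1:
  assumes "Im u \<noteq> 0"
  shows "e2pi u \<noteq> 1"
proof
  assume "e2pi u = 1"
  hence "exp (- 2 * pi * Im u) = 1" by (metis norm_e2pi norm_one)
  thus False using assms by simp
qed

text \<open>Since \<open>w cos w - sin w = - w^3 / 3 + ...\<close>; the Taylor bounds for sine and
  cosine give two quotients whose difference tends to \<open>- 1 / 2 + 1 / 6\<close>. This single
  limit yields both the continuity of \<open>cot_reg\<close> at 0 and its derivative there.\<close>

lemma tendsto_cot_reg_over: "((\<lambda>u. cot_reg u / u) \<longlongrightarrow> - (of_real pi ^ 2) / 3) (at 0)"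
proof -
  have sin_sum: "(\<Sum>k\<le>3. complex_of_real (sin_coeff k) * w ^ k) = w - w ^ 3 / 6" for w
  proof -
    have "{..3::nat} = {0, 1, 2, 3}" by auto
    moreover have "sin_coeff 0 = 0" "sin_coeff 1 = 1" "sin_coeff 2 = 0" "sin_coeff 3 = - 1 / 6"
      by (simp_all add: sin_coeff_def fact_numeral)
    ultimately show ?thesis by simp
  qed
  have cos_sum: "(\<Sum>k\<le>2. complex_of_real (cos_coeff k) * w ^ k) = 1 - w ^ 2 / 2" for w
  proof -
    have "{..2::nat} = {0, 1, 2}" by auto
    moreover have "cos_coeff 0 = 1" "cos_coeff 1 = 0" "cos_coeff 2 = - 1 / 2"
      by (simp_all add: cos_coeff_def)
    ultimately show ?thesis by simp
  qed
  have s: "((\<lambda>w::complex. (sin w - w) / w ^ 3) \<longlongrightarrow> - 1 / 6) (at 0)"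
  proof -
    have "((\<lambda>w::complex. (sin w - w) / w ^ 3 + 1 / 6) \<longlongrightarrow> 0) (at 0)"
    proof (rule tendsto_0_le)
      show "((\<lambda>w::complex. exp \<bar>Im w\<bar> * norm w) \<longlongrightarrow> 0) (at 0)"
        by (auto intro!: tendsto_eq_intros)
      show "\<forall>\<^sub>F w in at 0. norm ((sin w - w) / w ^ 3 + 1 / 6) \<le> norm (exp \<bar>Im w\<bar> * norm w) * 1"
        using eventually_neq_at_within[of 0 "0::complex" UNIV]
      proof eventually_elim
        case (elim w)
        have "norm (sin w - (w - w ^ 3 / 6)) \<le> exp \<bar>Im w\<bar> * norm w ^ 4 / 6"
          using Taylor_sin[of w 3] unfolding sin_sum by (simp add: fact_numeral)
        also have "\<dots> \<le> exp \<bar>Im w\<bar> * norm w ^ 4" by simp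
        finally have *: "norm (sin w - (w - w ^ 3 / 6)) \<le> exp \<bar>Im w\<bar> * norm w ^ 4" .
        have "(sin w - w) / w ^ 3 + 1 / 6 = (sin w - (w - w ^ 3 / 6)) / w ^ 3"
          using elim by (simp add: diff_divide_distrib add_divide_distrib)
        hence "norm ((sin w - w) / w ^ 3 + 1 / 6) = norm (sin w - (w - w ^ 3 / 6)) / norm w ^ 3"
          by (simp only: norm_divide norm_power)
        also have "\<dots> \<le> exp \<bar>Im w\<bar> * norm w ^ 4 / norm w ^ 3"
          by (intro divide_right_mono *) auto
        also have "\<dots> = exp \<bar>Im w\<bar> * norm w" using elim by (simp add: eval_nat_numeral)
        finally show ?case by simp
      qed
    qed
    from tendsto_diff[OF this tendsto_const[of "1/6"]] show ?thesis by simp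
  qed
  have c: "((\<lambda>w::complex. (cos w - 1) / w ^ 2) \<longlongrightarrow> - 1 / 2) (at 0)"
  proof -
    have "((\<lambda>w::complex. (cos w - 1) / w ^ 2 + 1 / 2) \<longlongrightarrow> 0) (at 0)"
    proof (rule tendsto_0_le)
      show "((\<lambda>w::complex. exp \<bar>Im w\<bar> * norm w) \<longlongrightarrow> 0) (at 0)"
        by (auto intro!: tendsto_eq_intros)
      show "\<forall>\<^sub>F w in at 0. norm ((cos w - 1) / w ^ 2 + 1 / 2) \<le> norm (exp \<bar>Im w\<bar> * norm w) * 1"
        using eventually_neq_at_within[of 0 "0::complex" UNIV]
      proof eventually_elim
        case (elim w)
        have "norm (cos w - (1 - w ^ 2 / 2)) \<le> exp \<bar>Im w\<bar> * norm w ^ 3 / 2"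
          using Taylor_cos[of w 2] unfolding cos_sum by (simp add: fact_numeral)
        also have "\<dots> \<le> exp \<bar>Im w\<bar> * norm w ^ 3" by simp
        finally have *: "norm (cos w - (1 - w ^ 2 / 2)) \<le> exp \<bar>Im w\<bar> * norm w ^ 3" .
        have "(cos w - 1) / w ^ 2 + 1 / 2 = (cos w - (1 - w ^ 2 / 2)) / w ^ 2"
          using elim by (simp add: diff_divide_distrib add_divide_distrib)
        hence "norm ((cos w - 1) / w ^ 2 + 1 / 2) = norm (cos w - (1 - w ^ 2 / 2)) / norm w ^ 2"
          by (simp only: norm_divide norm_power)
        also have "\<dots> \<le> exp \<bar>Im w\<bar> * norm w ^ 3 / norm w ^ 2"
          by (intro divide_right_mono *) auto
        also have "\<dots> = exp \<bar>Im w\<bar> * norm w" using elim by (simp add: eval_nat_numeral)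
        finally show ?case by simp
      qed
    qed
    from tendsto_diff[OF this tendsto_const[of "1/2"]] show ?thesis by simp
  qed
  have s1: "((\<lambda>w::complex. sin w / w) \<longlongrightarrow> 1) (at 0)"
    using DERIV_sin[of "0::complex"] by (simp add: has_field_derivative_iff)
  have lim: "((\<lambda>w::complex. ((cos w - 1) / w ^ 2 - (sin w - w) / w ^ 3) / (sin w / w)) \<longlongrightarrow> - 1 / 3) (at 0)"
    by (rule tendsto_eq_intros s c s1 refl | simp)+
  have flim: "filterlim (\<lambda>u::complex. of_real pi * u) (at 0) (at 0)"
    unfolding filterlim_at by (auto intro!: tendsto_eq_intros simp: eventually_at_filter)
  have "((\<lambda>u. of_real pi ^ 2 * (((cos (of_real pi * u) - 1) / (of_real pi * u) ^ 2 -
      (sin (of_real pi * u) - of_real pi * u) / (of_real pi * u) ^ 3) / (sin (of_real pi * u) / (of_real pi * u))))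
      \<longlongrightarrow> of_real pi ^ 2 * (- 1 / 3)) (at (0::complex))"
    by (intro tendsto_mult tendsto_const filterlim_compose[OF lim flim])
  moreover have "\<forall>\<^sub>F u in at (0::complex). sin (of_real pi * u) / (of_real pi * u) \<noteq> 0"
    using tendsto_imp_eventually_ne[OF filterlim_compose[OF s1 flim], of 0] by simp
  hence "\<forall>\<^sub>F u in at (0::complex). of_real pi ^ 2 * (((cos (of_real pi * u) - 1) / (of_real pi * u) ^ 2 -
      (sin (of_real pi * u) - of_real pi * u) / (of_real pi * u) ^ 3) / (sin (of_real pi * u) / (of_real pi * u))) =
      cot_reg u / u"
    using eventually_neq_at_within[of 0 "0::complex" UNIV]
  proof eventually_elim
    case (elim u)
    define w where "w = complex_of_real pi * u"
    have w: "w \<noteq> 0" "sin w \<noteq> 0" using elim by (auto simp: w_def)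
    have "(cos w - 1) / w ^ 2 - (sin w - w) / w ^ 3 = (w * cos w - sin w) / w ^ 3"
      using w by (simp add: field_simps power2_eq_square power3_eq_cube)
    hence "of_real pi ^ 2 * (((cos w - 1) / w ^ 2 - (sin w - w) / w ^ 3) / (sin w / w)) =
        of_real pi ^ 2 * ((w * cos w - sin w) / w ^ 3 / (sin w / w))" by simp
    also have "\<dots> = of_real pi * (cos w / sin w - 1 / w) * (of_real pi / w)"
      using w by (simp add: divide_simps power2_eq_square power3_eq_cube)
    also have "\<dots> = (of_real pi * (cos w / sin w) - 1 / u) / u"
      using elim(2) unfolding w_def by (simp add: field_simps)
    finally show ?case
      unfolding w_def[symmetric] cot_reg_def cot_def using elim(2) by simp
  qed
  ultimately have "((\<lambda>u. cot_reg u / u) \<longlongrightarrow> of_real pi ^ 2 * (- 1 / 3)) (at 0)"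
    by (rule Lim_transform_eventually)
  thus ?thesis by simp
qed

lemma sin_pi_eq_0_iff: "sin (of_real pi * u) = (0::complex) \<longleftrightarrow> u \<in> \<int>"
proof
  assume "sin (of_real pi * u) = (0::complex)"
  then obtain n :: int where "of_real pi * u = of_real (of_int n * pi)"
    unfolding sin_eq_0 by (auto simp: mult_ac)
  hence "of_real pi * (u - of_int n) = 0" by (simp add: algebra_simps)
  thus "u \<in> \<int>" by simp
next
  assume "u \<in> \<int>"
  then obtain n :: int where "u = of_int n" by (auto elim: Ints_cases)
  thus "sin (of_real pi * u) = (0::complex)"
    unfolding sin_eq_0 by (intro exI[of _ n]) simp
qed

lemma has_field_derivative_cot_reg_0: "(cot_reg has_field_derivative - (of_real pi ^ 2) / 3) (at 0)"
  using tendsto_cot_reg_over by (simp add: has_field_derivative_iff cot_reg_def[of 0])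

lemma holomorphic_on_cot_reg: "cot_reg holomorphic_on (- (\<int> - {0}))"
proof (rule no_isolated_singularity')
  show "open (- (\<int> - {0}) :: complex set)"
    by (intro open_Compl closed_subset_Ints) auto
  have "(\<lambda>u. of_real pi * (cos (of_real pi * u) / sin (of_real pi * u)) - 1 / u)
     holomorphic_on (- (\<int> - {0}) - {0 :: complex})"
    by (intro holomorphic_intros) (auto simp: sin_pi_eq_0_iff)
  thus "cot_reg holomorphic_on (- (\<int> - {0}) - {0})"
    by (rule holomorphic_transform) (auto simp: cot_reg_def cot_def)
  have "cot_reg \<midarrow>0\<rightarrow> cot_reg 0"
    using DERIV_isCont[OF has_field_derivative_cot_reg_0] by (simp add: isCont_def)
  thus "(cot_reg \<longlongrightarrow> cot_reg z) (at z within - (\<int> - {0}))" if "z \<in> {0}" for z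
    using that by (auto intro: tendsto_within_subset[OF _ subset_UNIV])
qed auto

text \<open>
  The logarithmic derivative of a theta function without its pole at 0, following Eisenstein:
  \<open>cot_series z u + 1 / u\<close> is periodic in \<open>u\<close> modulo 1 and changes by a constant under \<open>u \<mapsto> u + z\<close>.
\<close>
definition cot_series :: "complex \<Rightarrow> complex \<Rightarrow> complex" where
  "cot_series z u = cot_reg u + 2 * of_real pi * \<i> * (cot_tail z (- u) - cot_tail z u)"

lemma cot_series_eq:
  assumes "Im u \<noteq> 0"
  shows "cot_series z u + 1 / u =
    - of_real pi * \<i> - 2 * of_real pi * \<i> * (geo (e2pi u) - cot_tail z (- u) + cot_tail z u)"
proof -
  have "u \<noteq> 0" using assms by auto
  thus ?thesis
    using cot_eq_geo[OF e2pi_neq_1[OF assms]]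
    by (simp add: cot_series_def cot_reg_def algebra_simps)
qed

lemma cot_series_add_1:
  assumes "Im u \<noteq> 0"
  shows "cot_series z (u + 1) + 1 / (u + 1) = cot_series z u + 1 / u"
proof -
  have "cot_tail z (- (u + 1)) = cot_tail z (- u)"
    using cot_tail_diff_1[of z "-u"] by simp
  moreover have "e2pi (u + 1) = e2pi u" by (simp add: e2pi_add)
  ultimately show ?thesis
    using assms by (simp add: cot_series_eq)
qed

text \<open>The shift moves the terms along by one row. The one that changes sides has its argument
  inverted, and \<open>geo (1 / W) = - geo W - 1\<close>; this stray \<open>- 1\<close> is the
  origin of the quasi-period \<open>- 2 * pi * \<i>\<close>.\<close>

lemma cot_series_add_period:
  assumes z: "Im z > 0" and u: "Im u < 0" "Im u > - Im z"
  shows "cot_series z (u + z) + 1 / (u + z) = cot_series z u + 1 / u - 2 * of_real pi * \<i>"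
proof -
  have 1: "cot_tail z (u + z) = cot_tail z u - geo (e2pi (u + z))"
    by (rule cot_tail_add_period) (use assms in auto)
  have "cot_tail z ((- u - z) + z) = cot_tail z (- u - z) - geo (e2pi ((- u - z) + z))"
    by (rule cot_tail_add_period) (use assms in auto)
  hence 2: "cot_tail z (- (u + z)) = cot_tail z (- u) + geo (inverse (e2pi u))"
    by (simp add: e2pi_minus)
  have tw: "cot_tail z (- u - z) = cot_tail z (- u) + geo (inverse (e2pi u))"
    using 2 by simp
  have "e2pi u \<noteq> 1" using u by (intro e2pi_neq_1) auto
  hence n: "1 - e2pi u \<noteq> 0" "e2pi u - 1 \<noteq> 0" by auto
  have "geo (inverse (e2pi u)) = 1 / (e2pi u - 1)"
  proof -
    have "(1 - inverse (e2pi u)) = (e2pi u - 1) * inverse (e2pi u)"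
      by (simp add: ring_distribs)
    thus ?thesis unfolding geo_def using n by (simp add: divide_simps)
  qed
  also have "\<dots> = - (1 / (1 - e2pi u))"
    using minus_divide_right[of 1 "1 - e2pi u"] by simp
  also have "geo (e2pi u) = 1 / (1 - e2pi u) - 1"
    using n unfolding geo_def by (simp add: divide_simps)
  hence "1 / (1 - e2pi u) = geo (e2pi u) + 1" by simp
  finally have 3: "geo (inverse (e2pi u)) = - geo (e2pi u) - 1" by simp
  show ?thesis
    using u by (subst (1 2) cot_series_eq) (simp_all add: 1 tw 3 ring_distribs)
qed

lemma holomorphic_on_cot_tail:
  assumes "Im z > 0"
  shows "cot_tail z holomorphic_on {u. Im u > - Im z}"
proof (rule holomorphic_onI)
  fix u assume "u \<in> {u. Im u > - Im z}"
  hence "Im u > - Im z" by simp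
  from has_field_derivative_cot_tail[OF assms this]
  show "cot_tail z field_differentiable at u within {u. Im u > - Im z}"
    using field_differentiable_def field_differentiable_at_within by blast
qed

text \<open>The inversion law of \<open>E_2\<close> with its non-modular term. \<open>E\<close>
  compares the cotangent series of the lattice spanned by 1 and \<open>z\<close> with that of the
  same lattice divided by \<open>z\<close>. The poles at 0 are already removed on both sides, and
  the linear term absorbs the two quasi-periods. So \<open>E\<close> is holomorphic and doubly
  periodic, hence constant by the maximum principle, and the vanishing of its derivative at 0 is the
  formula.\<close>

lemma lambert_inversion:
  assumes z: "Im z > 0"
  shows "8 * of_real pi ^ 2 * lambert (e2pi z) - of_real pi ^ 2 / 3 + 2 * of_real pi * \<i> / z =
         (8 * of_real pi ^ 2 * lambert (e2pi (- 1 / z)) - of_real pi ^ 2 / 3) / z\<^sup>2"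
proof -
  have z0: "z \<noteq> 0" using z by auto
  define z' where "z' = - 1 / z"
  have z': "Im z' > 0" using z z0 by (simp add: z'_def Im_divide cmod_power2[symmetric] zero_less_divide_iff)
  have Imz: "Im (1 / z) = - Im z'" by (simp add: z'_def)
  \<comment> \<open>In real coordinates \<open>u = a + b * z\<close>, the set \<open>P\<close> is
    given by \<open>\<bar>a\<bar> < 1\<close> and \<open>\<bar>b\<bar> < 1\<close>, and
    \<open>K\<close> by the bound \<open>1 / 2\<close>. Both series converge on \<open>P\<close>,
    the only lattice point in \<open>P\<close> is 0, and \<open>K\<close> is a period
    parallelogram.\<close>
  define P where "P = {u. \<bar>Im u\<bar> < Im z \<and> \<bar>Im (u / z)\<bar> < Im z'}"
  define K where "K = {u. \<bar>Im u\<bar> \<le> Im z / 2 \<and> \<bar>Im (u / z)\<bar> \<le> Im z' / 2}"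
  define E where "E = (\<lambda>u. cot_series z u - cot_series z' (u / z) / z + 2 * of_real pi * \<i> * u / z)"
  have P_alt: "P = {u. Im u < Im z} \<inter> {u. Im u > - Im z} \<inter> {u. Im (u / z) < Im z'} \<inter> {u. Im (u / z) > - Im z'}"
    by (auto simp: P_def abs_less_iff)
  have "open P"
    unfolding P_alt
    by (intro open_Int open_Collect_less continuous_intros) (use z0 in auto)
  have "convex P"
  proof -
    have lin: "linear (\<lambda>u. Im (u / z))"
    proof (intro linearI)
      show "Im ((r *\<^sub>R b) / z) = r *\<^sub>R Im (b / z)" for r b
      proof -
        have "(r *\<^sub>R b) / z = r *\<^sub>R (b / z)" by (simp add: scaleR_conv_of_real)
        thus ?thesis by (simp only: scaleR_complex.sel real_scaleR_def)
      qed
    qed (simp add: add_divide_distrib)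
    have "convex {u. Im u < Im z}" "convex {u. Im u > - Im z}"
      by (auto intro: convex_halfspace_Im_lt convex_halfspace_Im_gt)
    moreover have "convex {u. Im (u / z) < Im z'}" "convex {u. Im (u / z) > - Im z'}"
      using convex_linear_vimage[OF lin, of "{..<Im z'}"] convex_linear_vimage[OF lin, of "{- Im z'<..}"]
      by (auto simp: vimage_def)
    ultimately show ?thesis unfolding P_alt by (intro convex_Int)
  qed
  have nonint: "u \<notin> \<int> - {0}" "u / z \<notin> \<int> - {0}" if u: "u \<in> P" for u
  proof -
    show "u \<notin> \<int> - {0}"
    proof
      assume "u \<in> \<int> - {0}"
      then obtain n :: int where n: "u = of_int n" "n \<noteq> 0" by (auto elim!: Ints_cases)
      have "u / z = real_of_int n *\<^sub>R (1 / z)" by (simp add: n scaleR_conv_of_real)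
      hence "Im (u / z) = - of_int n * Im z'"
        by (simp only: scaleR_complex.sel Imz)
      hence "\<bar>Im (u / z)\<bar> = \<bar>real_of_int n\<bar> * Im z'" using z' by (simp add: abs_mult)
      moreover have "\<bar>real_of_int n\<bar> \<ge> 1" using n by linarith
      hence "\<bar>real_of_int n\<bar> * Im z' \<ge> 1 * Im z'" using z' by (intro mult_right_mono) auto
      ultimately show False using u by (simp add: P_def)
    qed
    show "u / z \<notin> \<int> - {0}"
    proof
      assume "u / z \<in> \<int> - {0}"
      then obtain n :: int where n: "u / z = of_int n" by (blast elim: Ints_cases)
      have "n \<noteq> 0" using \<open>u / z \<in> \<int> - {0}\<close> n by auto
      have "u = of_int n * z" using n using z0 by (simp add: divide_eq_eq)
      hence "\<bar>Im u\<bar> = \<bar>real_of_int n\<bar> * Im z" using z by (simp add: abs_mult)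
      moreover have "\<bar>real_of_int n\<bar> \<ge> 1" using \<open>n \<noteq> 0\<close> by linarith
      hence "\<bar>real_of_int n\<bar> * Im z \<ge> 1 * Im z" using z by (intro mult_right_mono) auto
      ultimately show False using u by (simp add: P_def)
    qed
  qed
  have hol1: "cot_series z holomorphic_on P"
    unfolding cot_series_def
  proof (intro holomorphic_on_add holomorphic_on_mult holomorphic_on_diff holomorphic_on_const)
    show "cot_reg holomorphic_on P"
      by (rule holomorphic_on_subset[OF holomorphic_on_cot_reg]) (use nonint(1) in blast)
    show "cot_tail z holomorphic_on P"
      by (rule holomorphic_on_subset[OF holomorphic_on_cot_tail[OF z]]) (auto simp: P_def)
    show "(\<lambda>u. cot_tail z (- u)) holomorphic_on P"
      by (rule holomorphic_on_compose_gen[OF _ holomorphic_on_cot_tail[OF z], unfolded o_def])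
        (auto simp: P_def intro: holomorphic_intros)
  qed
  have "(\<lambda>u. cot_series z' (u / z)) holomorphic_on P"
    unfolding cot_series_def
  proof (intro holomorphic_on_add holomorphic_on_mult holomorphic_on_diff holomorphic_on_const)
    have h: "(\<lambda>u. u / z) holomorphic_on P" "(\<lambda>u. - (u / z)) holomorphic_on P"
      using z0 by (auto intro!: holomorphic_intros)
    show "(\<lambda>u. cot_reg (u / z)) holomorphic_on P"
      by (rule holomorphic_on_compose_gen[OF h(1) holomorphic_on_cot_reg, unfolded o_def])
        (use nonint(2) in blast)
    have im: "Im (u / z) > - Im z'" "Im (- (u / z)) > - Im z'" if "u \<in> P" for u
      using that unfolding P_def uminus_complex.sel by auto
    show "(\<lambda>u. cot_tail z' (u / z)) holomorphic_on P"
      by (rule holomorphic_on_compose_gen[OF h(1) holomorphic_on_cot_tail[OF z'], unfolded o_def])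
        (use im in blast)
    show "(\<lambda>u. cot_tail z' (- (u / z))) holomorphic_on P"
      by (rule holomorphic_on_compose_gen[OF h(2) holomorphic_on_cot_tail[OF z'], unfolded o_def])
        (use im in blast)
  qed
  with hol1 have hol: "E holomorphic_on P"
    unfolding E_def using z0 by (intro holomorphic_intros) auto
  \<comment> \<open>Divided by \<open>z\<close>, the shift by 1 becomes the shift by
    \<open>- z'\<close>, so here the quasi-period comes from the second series; in
    \<open>per2\<close> it comes from the first.\<close>
  have per1: "E (u + 1) = E u" if "u \<in> P" "u + 1 \<in> P" for u
  proof -
    define w where "w = (u + 1) / z"
    have w: "u / z = w + z'" using z0 by (simp add: w_def z'_def add_divide_distrib)
    have "\<bar>Im (u / z)\<bar> < Im z'" "\<bar>Im w\<bar> < Im z'" "Im (u / z) = Im w + Im z'"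
      using that by (simp_all add: P_def w w_def)
    hence w': "Im w < 0" "Im w > - Im z'" "Im (u / z) > 0" by auto
    have "Im u \<noteq> 0 \<or> Im u = 0" by simp
    have ne: "u \<noteq> 0" "u + 1 \<noteq> 0" using w' by (auto simp: w_def)
    \<comment> \<open>Off the real axis the exponential form applies; on it the periodicity of
      \<open>cot\<close> is used directly.\<close>
    have A: "cot_series z (u + 1) + 1 / (u + 1) = cot_series z u + 1 / u"
    proof (cases "Im u = 0")
      case False thus ?thesis by (rule cot_series_add_1)
    next
      case True
      have "e2pi (u + 1) = e2pi u" by (simp add: e2pi_add)
      have ct: "cot_tail z (- (u + 1)) = cot_tail z (- u)"
        using cot_tail_diff_1[of z "-u"] by simp
      have "cot (of_real pi * (u + 1)) = cot (of_real pi * u)"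
        by (simp add: cot_def ring_distribs sin_add cos_add)
      thus ?thesis using ne ct by (simp add: cot_series_def cot_reg_def)
    qed
    have B: "cot_series z' (w + z') + 1 / (w + z') = cot_series z' w + 1 / w - 2 * of_real pi * \<i>"
      using cot_series_add_period[OF z'] w' by blast
    have "cot_series z' (u / z) / z = (cot_series z' w + 1 / w - 2 * of_real pi * \<i> - 1 / (u / z)) / z"
      using B unfolding w by (simp add: algebra_simps)
    also have "\<dots> = cot_series z' w / z + 1 / (u + 1) - 2 * of_real pi * \<i> / z - 1 / u"
    proof -
      have "1 / w / z = 1 / (u + 1)" "1 / (u / z) / z = 1 / u"
        using z0 by (simp_all add: w_def)
      thus ?thesis by (simp only: add_divide_distrib diff_divide_distrib)
    qed
    finally have B': "cot_series z' (u / z) / z =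
      cot_series z' w / z + 1 / (u + 1) - 2 * of_real pi * \<i> / z - 1 / u" .
    have A': "cot_series z (u + 1) = cot_series z u + 1 / u - 1 / (u + 1)"
      using A by (simp add: eq_diff_eq)
    have lin: "2 * of_real pi * \<i> * (u + 1) / z = 2 * of_real pi * \<i> * u / z + 2 * of_real pi * \<i> / z"
      by (simp add: ring_distribs add_divide_distrib)
    show ?thesis
      unfolding E_def w_def[symmetric] A' B' lin by simp
  qed
  have per2: "E (u + z) = E u" if "u \<in> P" "u + z \<in> P" for u
  proof -
    have w': "Im u < 0" "Im u > - Im z" using that by (auto simp: P_def)
    have ne: "u \<noteq> 0" "u + z \<noteq> 0" using w' by (auto simp: complex_eq_iff)
    have A: "cot_series z (u + z) + 1 / (u + z) = cot_series z u + 1 / u - 2 * of_real pi * \<i>"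
      by (rule cot_series_add_period[OF z w'(1,2)])
    have uz: "(u + z) / z = u / z + 1" using z0 by (simp add: add_divide_distrib)
    have ne': "u / z \<noteq> 0" "u / z + 1 \<noteq> 0" using ne z0 uz by (metis divide_eq_0_iff)+
    have B: "cot_series z' (u / z + 1) + 1 / (u / z + 1) = cot_series z' (u / z) + 1 / (u / z)"
    proof -
      have ct: "cot_tail z' (- (u / z + 1)) = cot_tail z' (- (u / z))"
        using cot_tail_diff_1[of z' "-(u / z)"] by simp
      have "cot (of_real pi * (u / z + 1)) = cot (of_real pi * (u / z))"
        unfolding ring_distribs by (simp add: cot_def sin_add cos_add)
      thus ?thesis using ne' ct by (simp add: cot_series_def cot_reg_def)
    qed
    have "cot_series z' ((u + z) / z) / z = (cot_series z' (u / z) + 1 / (u / z) - 1 / ((u + z) / z)) / z"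
      using B unfolding uz by (simp add: algebra_simps)
    also have "\<dots> = cot_series z' (u / z) / z + 1 / u - 1 / (u + z)"
    proof -
      have "1 / ((u + z) / z) / z = 1 / (u + z)" "1 / (u / z) / z = 1 / u"
        using z0 by (simp_all del: add_divide_distrib)
      thus ?thesis by (simp only: add_divide_distrib diff_divide_distrib)
    qed
    finally have B': "cot_series z' ((u + z) / z) / z =
      cot_series z' (u / z) / z + 1 / u - 1 / (u + z)" .
    have A': "cot_series z (u + z) = cot_series z u + 1 / u - 2 * of_real pi * \<i> - 1 / (u + z)"
      using A by (simp add: eq_diff_eq)
    have lin: "2 * of_real pi * \<i> * (u + z) / z = 2 * of_real pi * \<i> * u / z + 2 * of_real pi * \<i>"
      using z0 by (simp add: ring_distribs add_divide_distrib)
    show ?thesis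
      unfolding E_def A' B' lin by simp
  qed
  have KP: "K \<subseteq> P" using z z' by (auto simp: K_def P_def)
  have 0: "0 \<in> K" "0 \<in> P" using z z' by (auto simp: K_def P_def)
  have "compact K"
  proof (rule compact_eq_bounded_closed[THEN iffD2], intro conjI)
    have "closed ({u. \<bar>Im u\<bar> \<le> Im z / 2} \<inter> {u. \<bar>Im (u / z)\<bar> \<le> Im z' / 2})"
      by (intro closed_Int closed_Collect_le continuous_intros) (use z0 in auto)
    also have "\<dots> = K" by (auto simp: K_def)
    finally show "closed K" .
    have "norm u \<le> 1 + norm z" if "u \<in> K" for u
    proof -
      define r s where "r = Im u / Im z" and "s = - Im (u / z) / Im z'"
      have rs: "\<bar>r\<bar> \<le> 1" "\<bar>s\<bar> \<le> 1"
        using that z z' by (auto simp: r_def s_def K_def abs_divide divide_le_eq)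
      have "Im (u - (of_real s + of_real r * z)) = 0" using z by (simp add: r_def)
      then obtain t where t: "u - (of_real s + of_real r * z) = of_real t"
        by (metis complex_is_Real_iff Reals_cases)
      hence "u = of_real (s + t) + of_real r * z" by (simp add: algebra_simps)
      hence "u / z = of_real (s + t) * (1 / z) + of_real r" using z0 by (simp add: add_divide_distrib)
      hence "u / z = (s + t) *\<^sub>R (1 / z) + of_real r" by (simp add: scaleR_conv_of_real)
      hence "Im (u / z) = (s + t) * Im (1 / z)"
        by (simp only: plus_complex.sel scaleR_complex.sel Im_complex_of_real add_0_right)
      moreover have "Im (u / z) = - s * Im z'" using z' by (simp add: s_def)
      ultimately have "t * Im z' = 0" unfolding Imz by (simp add: ring_distribs)
      hence "t = 0" using z' by simp
      hence "u = of_real s + of_real r * z" using t by simp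
      hence "norm u \<le> \<bar>s\<bar> + \<bar>r\<bar> * norm z"
        using norm_triangle_ineq[of "of_real s" "of_real r * z"] by (simp add: norm_mult)
      also have "\<dots> \<le> 1 + 1 * norm z" using rs by (intro add_mono mult_right_mono) auto
      finally show ?thesis by simp
    qed
    thus "bounded K" by (auto simp: bounded_iff)
  qed
  moreover have "continuous_on K (\<lambda>u. norm (E u))"
    using holomorphic_on_imp_continuous_on[OF hol] KP by (intro continuous_intros) (rule continuous_on_subset)
  ultimately obtain u0 where u0: "u0 \<in> K" "\<And>u. u \<in> K \<Longrightarrow> norm (E u) \<le> norm (E u0)"
    using continuous_attains_sup[of K "\<lambda>u. norm (E u)"] 0 by blast
  \<comment> \<open>At most one shift by \<open>z\<close> and one by 1 bring a point of
    \<open>P\<close> into \<open>K\<close> without leaving \<open>P\<close>. So a maximum of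
    \<open>norm (E u)\<close> on the compact set \<open>K\<close> is a maximum on the open set
    \<open>P\<close>.\<close>
  have shift: "\<exists>w. w \<in> K \<and> E w = E u" if u: "u \<in> P" for u
  proof -
    have "\<exists>w. w \<in> P \<and> \<bar>Im w\<bar> \<le> Im z / 2 \<and> E w = E u"
    proof -
      have Imdiv: "Im ((u - z) / z) = Im (u / z)" "Im ((u + z) / z) = Im (u / z)"
        using z0 by (simp_all add: add_divide_distrib diff_divide_distrib)
      consider "\<bar>Im u\<bar> \<le> Im z / 2" | "Im u > Im z / 2" | "Im u < - Im z / 2" by linarith
      thus ?thesis
      proof cases
        case 1 thus ?thesis using u by blast
      next
        case 2
        have "u - z \<in> P" using u 2 z by (auto simp: P_def Imdiv)
        moreover have "E (u - z + z) = E (u - z)" by (rule per2) (use calculation u in auto)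
        ultimately show ?thesis using 2 u z
          by (intro exI[of _ "u - z"]) (auto simp: P_def)
      next
        case 3
        have "u + z \<in> P" using u 3 z by (auto simp: P_def Imdiv)
        moreover have "E (u + z) = E u" by (rule per2) (use calculation u in auto)
        ultimately show ?thesis using 3 u z
          by (intro exI[of _ "u + z"]) (auto simp: P_def)
      qed
    qed
    then obtain v where v: "v \<in> P" "\<bar>Im v\<bar> \<le> Im z / 2" "E v = E u" by blast
    have Imdiv: "Im ((v - 1) / z) = Im (v / z) + Im z'" "Im ((v + 1) / z) = Im (v / z) - Im z'"
      using Imz by (simp_all add: add_divide_distrib diff_divide_distrib)
    consider "\<bar>Im (v / z)\<bar> \<le> Im z' / 2" | "Im (v / z) > Im z' / 2" | "Im (v / z) < - Im z' / 2" by linarith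
    thus ?thesis
    proof cases
      case 1 thus ?thesis using v by (auto simp: K_def)
    next
      case 3
      have "v - 1 \<in> P" "v - 1 \<in> K" using v 3 z' by (auto simp: P_def K_def Imdiv)
      moreover have "E (v - 1 + 1) = E (v - 1)" by (rule per1) (use calculation v in auto)
      ultimately show ?thesis using v by auto
    next
      case 2
      have "v + 1 \<in> P" "v + 1 \<in> K" using v 2 z' by (auto simp: P_def K_def Imdiv)
      moreover have "E (v + 1) = E v" by (rule per1) (use calculation v in auto)
      ultimately show ?thesis using v by auto
    qed
  qed
  have "E constant_on P"
  proof (rule maximum_modulus_principle[OF hol \<open>open P\<close> convex_connected[OF \<open>convex P\<close>] \<open>open P\<close> subset_refl])
    show "u0 \<in> P" using u0 KP by blast
    show "norm (E u) \<le> norm (E u0)" if "u \<in> P" for u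
      using shift[OF that] u0(2) by metis
  qed
  then obtain c where c: "\<And>u. u \<in> P \<Longrightarrow> E u = c" by (auto simp: constant_on_def)
  have "E 0 = 0" using z0 by (simp add: E_def cot_series_def cot_reg_def)
  with c 0 have E0: "E u = 0" if "u \<in> P" for u using that by metis
  have d: "(cot_series w has_field_derivative
      (- (of_real pi ^ 2) / 3 + 2 * of_real pi * \<i> * (- (2 * of_real pi * \<i> * lambert (e2pi w)) - 2 * of_real pi * \<i> * lambert (e2pi w)))) (at 0)"
    if w: "Im w > 0" for w
  proof -
    have 1: "((\<lambda>u. cot_tail w (- u)) has_field_derivative (2 * of_real pi * \<i> * lambert (e2pi w)) * (- 1)) (at 0)"
      by (rule DERIV_chain2[where g = uminus]) (use has_field_derivative_cot_tail_0[OF w] in \<open>auto intro!: derivative_eq_intros\<close>)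
    show ?thesis
      unfolding cot_series_def
      by (intro DERIV_add DERIV_cmult DERIV_diff has_field_derivative_cot_reg_0
          has_field_derivative_cot_tail_0[OF w] 1[simplified])
  qed
  have dd: "(cot_series w has_field_derivative (8 * of_real pi ^ 2 * lambert (e2pi w) - of_real pi ^ 2 / 3)) (at 0)"
    if w: "Im w > 0" for w
    using d[OF w] by (simp add: algebra_simps power2_eq_square)
  have d2: "((\<lambda>u. cot_series z' (u / z)) has_field_derivative
     (8 * of_real pi ^ 2 * lambert (e2pi z') - of_real pi ^ 2 / 3) * (1 / z)) (at 0)"
    by (rule DERIV_chain2[where g = "\<lambda>u. u / z"]) (use dd[OF z'] z0 in \<open>auto intro!: derivative_eq_intros\<close>)
  have "(E has_field_derivative
     (8 * of_real pi ^ 2 * lambert (e2pi z) - of_real pi ^ 2 / 3)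
     - (8 * of_real pi ^ 2 * lambert (e2pi z') - of_real pi ^ 2 / 3) * (1 / z) / z + 2 * of_real pi * \<i> / z) (at 0)"
    unfolding E_def
    by (intro DERIV_add DERIV_diff DERIV_cdivide dd[OF z] d2) (auto intro!: derivative_eq_intros)
  moreover have "(E has_field_derivative 0) (at 0)"
    by (rule has_field_derivative_transform_within_open[OF DERIV_const[of 0] \<open>open P\<close> 0(2)]) (use E0 in auto)
  ultimately have "(8 * of_real pi ^ 2 * lambert (e2pi z) - of_real pi ^ 2 / 3)
     - (8 * of_real pi ^ 2 * lambert (e2pi z') - of_real pi ^ 2 / 3) * (1 / z) / z + 2 * of_real pi * \<i> / z = 0"
    by (rule DERIV_unique)
  moreover have "a * (1 / z) / z = a / z\<^sup>2" for a by (simp add: power2_eq_square)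
  ultimately show ?thesis unfolding z'_def by (simp only: diff_add_eq right_minus_eq)
qed

section \<open>The modular group\<close>

definition int_mat2 :: "int \<Rightarrow> int \<Rightarrow> int \<Rightarrow> int \<Rightarrow> real^2^2" where
  "int_mat2 a b c d = vector [vector [of_int a, of_int b], vector [of_int c, of_int d]]"

lemma int_mat2_nth [simp]:
  "int_mat2 a b c d $ 1 $ 1 = of_int a" "int_mat2 a b c d $ 1 $ 2 = of_int b"
  "int_mat2 a b c d $ 2 $ 1 = of_int c" "int_mat2 a b c d $ 2 $ 2 = of_int d"
  by (simp_all add: int_mat2_def)

lemma det_int_mat2: "det (int_mat2 a b c d) = of_int (a * d - b * c)"
  by (simp add: det_2)

lemma moebius_act_int_mat2:
  "moebius_act (int_mat2 a b c d) z = (of_int a * z + of_int b) / (of_int c * z + of_int d)"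
  by (simp add: moebius_act_eq)

lemma int_mat2_in_SL2Z_iff: "int_mat2 a b c d \<in> SL2Z \<longleftrightarrow> a * d - b * c = 1"
proof -
  have "int_mat2 a b c d $ i $ j \<in> \<int>" for i j
    using exhaust_2[of i] exhaust_2[of j] by auto
  moreover have "real_of_int (a * d - b * c) = 1 \<longleftrightarrow> a * d - b * c = 1"
    by linarith
  ultimately show ?thesis by (simp add: SL2Z_def det_int_mat2 del: of_int_diff of_int_mult)
qed

lemma SL2Z_cases:
  assumes "A \<in> SL2Z"
  obtains a b c d where "A = int_mat2 a b c d" "a * d - b * c = 1"
proof -
  have "\<forall>i j. A $ i $ j \<in> \<int>" using assms by (simp add: SL2Z_def)
  then obtain a b c d where abcd: "A $ 1 $ 1 = of_int a" "A $ 1 $ 2 = of_int b" "A $ 2 $ 1 = of_int c" "A $ 2 $ 2 = of_int d"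
    by (metis Ints_cases)
  have "A = int_mat2 a b c d"
    by (simp add: vec_eq_iff forall_2 abcd)
  with assms that show ?thesis using int_mat2_in_SL2Z_iff by blast
qed

lemma int_mat2_mult:
  "int_mat2 a b c d ** int_mat2 a' b' c' d' =
   int_mat2 (a * a' + b * c') (a * b' + b * d') (c * a' + d * c') (c * b' + d * d')"
  by (simp add: vec_eq_iff forall_2 matrix_matrix_mult_def sum_2)

lemma int_mat2_in_Gamma0_iff:
  "int_mat2 a b c d \<in> Gamma0 N \<longleftrightarrow> a * d - b * c = 1 \<and> int N dvd c"
proof -
  have "(\<exists>k::int. real_of_int c = of_int (int N * k)) \<longleftrightarrow> int N dvd c"
    unfolding of_int_eq_iff by (auto simp: dvd_def)
  thus ?thesis by (simp add: Gamma0_def int_mat2_in_SL2Z_iff)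
qed

lemma SL2Z_mult:
  assumes "A \<in> SL2Z" "B \<in> SL2Z"
  shows "A ** B \<in> SL2Z"
proof -
  obtain a b c d where A: "A = int_mat2 a b c d" "a * d - b * c = 1" using assms(1) by (rule SL2Z_cases)
  obtain a' b' c' d' where B: "B = int_mat2 a' b' c' d'" "a' * d' - b' * c' = 1" using assms(2) by (rule SL2Z_cases)
  have "(a * a' + b * c') * (c * b' + d * d') - (a * b' + b * d') * (c * a' + d * c') =
    (a * d - b * c) * (a' * d' - b' * c')" by (simp add: algebra_simps)
  thus ?thesis using A B by (simp add: int_mat2_mult int_mat2_in_SL2Z_iff)
qed

lemma SL2Z_inverse:
  assumes "A \<in> SL2Z"
  obtains B where "B \<in> SL2Z" "A ** B = mat 1" "B ** A = mat 1"
proof -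
  obtain a b c d where A: "A = int_mat2 a b c d" "a * d - b * c = 1" using assms(1) by (rule SL2Z_cases)
  have r: "real_of_int a * real_of_int d - real_of_int b * real_of_int c = 1"
    using A(2) by (metis of_int_1 of_int_diff of_int_mult)
  have "int_mat2 d (- b) (- c) a \<in> SL2Z" using A(2) by (simp add: int_mat2_in_SL2Z_iff algebra_simps)
  moreover have "A ** int_mat2 d (- b) (- c) a = mat 1" "int_mat2 d (- b) (- c) a ** A = mat 1"
    using r unfolding A(1) int_mat2_mult by (simp_all add: vec_eq_iff forall_2 mat_def algebra_simps)
  ultimately show ?thesis using that by blast
qed

lemma mat_1_in_SL2Z [simp]: "mat 1 \<in> SL2Z"
proof -
  have "mat 1 = int_mat2 1 0 0 1" by (simp add: vec_eq_iff forall_2 mat_def)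
  thus ?thesis by (simp add: int_mat2_in_SL2Z_iff)
qed

lemma moebius_act_mat_1 [simp]: "moebius_act (mat 1) z = z"
  by (simp add: moebius_act_eq mat_def)

lemma SL2Z_det [simp]: "A \<in> SL2Z \<Longrightarrow> det A = 1"
  by (simp add: SL2Z_def)

lemma SL2Z_moebius_in_uhp [simp]: "A \<in> SL2Z \<Longrightarrow> z \<in> uhp \<Longrightarrow> moebius_act A z \<in> uhp"
  by (simp add: moebius_in_uhp)

lemma SL2Z_moebius_mult:
  "B \<in> SL2Z \<Longrightarrow> z \<in> uhp \<Longrightarrow> moebius_act (A ** B) z = moebius_act A (moebius_act B z)"
  by (rule moebius_mult) simp_all

text \<open>A coprime pair minimising \<open>norm (c * z + d)\<close> is taken as bottom row, and a
  translation centres the real part. The top row is then a coprime pair too, so minimality gives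
  \<open>norm (moebius_act A z) \<ge> 1\<close>. The height \<open>1 / 2\<close> is cruder than
  \<open>sqrt 3 / 2\<close>, but it only serves to cut out a compact set.\<close>

lemma SL2Z_fundamental_domain:
  assumes z: "z \<in> uhp"
  obtains A where "A \<in> SL2Z" "\<bar>Re (moebius_act A z)\<bar> \<le> 1 / 2" "Im (moebius_act A z) \<ge> 1 / 2"
proof -
  have y: "Im z > 0" using z by (simp add: uhp_def)
  \<comment> \<open>The bound 1 makes the set finite, and \<open>(0, 1)\<close> lies in it, so the
    minimum over \<open>S\<close> is the minimum over all coprime pairs.\<close>
  define S where "S = {(c :: int, d :: int). coprime c d \<and> norm (of_int c * z + of_int d) \<le> 1}"
  have "finite S"
  proof (rule finite_subset)
    define M where "M = \<lceil>1 / Im z\<rceil>"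
    define K where "K = \<lceil>1 + M * norm z\<rceil>"
    show "S \<subseteq> {- M..M} \<times> {- K..K}"
    proof clarify
      fix c d assume "(c, d) \<in> S"
      hence *: "norm (of_int c * z + of_int d) \<le> 1" by (simp add: S_def)
      have "\<bar>Im (of_int c * z + of_int d)\<bar> \<le> 1" using abs_Im_le_cmod * order_trans by blast
      hence "\<bar>real_of_int c\<bar> * Im z \<le> 1" using y by (simp add: abs_mult)
      hence "\<bar>real_of_int c\<bar> \<le> 1 / Im z" using y by (simp add: pos_le_divide_eq)
      hence c: "\<bar>real_of_int c\<bar> \<le> of_int M" unfolding M_def by linarith
      have "norm (of_int d :: complex) \<le> norm (of_int c * z + of_int d) + norm (of_int c * z)"
        using norm_triangle_ineq4[of "of_int c * z + of_int d" "of_int c * z"] by simp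
      also have "\<dots> \<le> 1 + \<bar>real_of_int c\<bar> * norm z" using * by (simp add: norm_mult)
      also have "\<dots> \<le> 1 + M * norm z" using c by (intro add_mono mult_right_mono) auto
      finally have "\<bar>real_of_int d\<bar> \<le> of_int K" unfolding K_def by (simp; linarith)
      thus "c \<in> {- M..M} \<and> d \<in> {- K..K}" using c by auto
    qed
  qed auto
  moreover have "(0, 1) \<in> S" by (simp add: S_def)
  ultimately obtain p where p: "p \<in> S" "\<And>q. q \<in> S \<Longrightarrow> norm (of_int (fst p) * z + of_int (snd p)) \<le> norm (of_int (fst q) * z + of_int (snd q))"
    using ex_is_arg_min_if_finite[of S "\<lambda>q. norm (of_int (fst q) * z + of_int (snd q))"]
    unfolding is_arg_min_linorder by blast
  obtain c d where cd: "p = (c, d)" by (cases p)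
  define j where "j = of_int c * z + of_int d"
  have cop: "coprime c d" and j1: "norm j \<le> 1" using p(1) by (simp_all add: S_def cd j_def)
  obtain a b where ab: "a * d - b * c = 1"
  proof -
    obtain u v where "u * c + v * d = 1" using cop by (metis bezout_int coprime_iff_gcd_eq_1)
    thus ?thesis using that[of v "- u"] by (simp add: algebra_simps)
  qed
  define w where "w = (of_int a * z + of_int b) / j"
  define n where "n = round (Re w)"
  define A where "A = int_mat2 (a - n * c) (b - n * d) c d"
  have det: "(a - n * c) * d - (b - n * d) * c = 1" using ab by (simp add: algebra_simps)
  hence A: "A \<in> SL2Z" by (simp add: A_def int_mat2_in_SL2Z_iff)
  have "j \<noteq> 0" using moebius_denom_nonzero[of A z] A z by (simp add: A_def j_def)
  have Aw: "moebius_act A z = (of_int (a - n * c) * z + of_int (b - n * d)) / j"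
    by (simp add: A_def moebius_act_int_mat2 j_def)
  also have "\<dots> = w - of_int n"
    using \<open>j \<noteq> 0\<close> by (simp add: w_def divide_simps) (simp add: j_def algebra_simps)
  finally have Aw2: "moebius_act A z = w - of_int n" .
  have "\<bar>Re w - of_int n\<bar> \<le> 1 / 2" using of_int_round_abs_le[of "Re w"] by (simp add: n_def abs_minus_commute)
  hence re: "\<bar>Re (moebius_act A z)\<bar> \<le> 1 / 2" by (simp add: Aw2)
  have "norm j \<le> norm (of_int (a - n * c) * z + of_int (b - n * d))"
  proof (cases "norm (of_int (a - n * c) * z + of_int (b - n * d)) \<le> 1")
    case True
    have "coprime (a - n * c) (b - n * d)"
    proof (rule coprimeI)
      fix g assume "g dvd a - n * c" "g dvd b - n * d"
      hence "g dvd (a - n * c) * d - (b - n * d) * c" by simp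
      thus "is_unit g" unfolding det .
    qed
    hence "(a - n * c, b - n * d) \<in> S" using True by (simp add: S_def)
    from p(2)[OF this] show ?thesis by (simp add: cd j_def)
  qed (use j1 in simp)
  hence "norm (moebius_act A z) \<ge> 1" unfolding Aw using \<open>j \<noteq> 0\<close> by (simp add: norm_divide)
  hence "1 \<le> Re (moebius_act A z) ^ 2 + Im (moebius_act A z) ^ 2"
    by (metis cmod_power2 one_le_power)
  moreover have "Re (moebius_act A z) ^ 2 \<le> (1 / 2) ^ 2"
    using re abs_le_square_iff[of "Re (moebius_act A z)" "1 / 2"] by simp
  ultimately have "Im (moebius_act A z) ^ 2 \<ge> (1 / 2) ^ 2" by (simp add: power2_eq_square)
  moreover have "Im (moebius_act A z) > 0" using moebius_in_uhp[of A z] A z by (simp add: uhp_def)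
  ultimately have "Im (moebius_act A z) \<ge> 1 / 2" using power2_le_imp_le by force
  with A re that show ?thesis by blast
qed

text \<open>The bottom row modulo \<open>N\<close> determines the coset: if the rows of
  \<open>A\<close> and \<open>B\<close> agree modulo \<open>N\<close>, the lower left entry
  \<open>c * d' - d * c'\<close> of the quotient is divisible by \<open>N\<close>.\<close>

lemma finite_coset_representatives:
  assumes N: "N > 0"
  obtains R where "finite R" "R \<subseteq> SL2Z" "\<And>A. A \<in> SL2Z \<Longrightarrow> \<exists>B\<in>R. \<exists>G\<in>Gamma0 N. A = G ** B"
proof -
  define key where "key = (\<lambda>A::real^2^2. (\<lfloor>A $ 2 $ 1\<rfloor> mod int N, \<lfloor>A $ 2 $ 2\<rfloor> mod int N))"
  define R where "R = (\<lambda>p. SOME B. B \<in> SL2Z \<and> key B = p) ` (key ` SL2Z)"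
  have "key ` SL2Z \<subseteq> {0..<int N} \<times> {0..<int N}" using N by (auto simp: key_def)
  hence "finite (key ` SL2Z)" by (rule finite_subset) auto
  hence fin: "finite R" by (simp add: R_def)
  have rep: "(SOME B. B \<in> SL2Z \<and> key B = key A) \<in> SL2Z \<and> key (SOME B. B \<in> SL2Z \<and> key B = key A) = key A"
    if "A \<in> SL2Z" for A
    by (rule someI[of _ A]) (use that in simp)
  have sub: "R \<subseteq> SL2Z" using rep by (auto simp: R_def)
  have "\<exists>B\<in>R. \<exists>G\<in>Gamma0 N. A = G ** B" if A: "A \<in> SL2Z" for A
  proof -
    define B where "B = (SOME B. B \<in> SL2Z \<and> key B = key A)"
    have B: "B \<in> SL2Z" "key B = key A" using rep[OF A] by (simp_all add: B_def)
    have BR: "B \<in> R" using A by (auto simp: R_def B_def)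
    obtain a b c d where abcd: "A = int_mat2 a b c d" "a * d - b * c = 1" using A by (rule SL2Z_cases)
    obtain a' b' c' d' where abcd': "B = int_mat2 a' b' c' d'" "a' * d' - b' * c' = 1" using B(1) by (rule SL2Z_cases)
    have cong: "int N dvd c' - c" "int N dvd d' - d"
      using B(2) by (simp_all add: key_def abcd abcd' mod_eq_dvd_iff)
    define G where "G = int_mat2 (a * d' - b * c') (b * a' - a * b') (c * d' - d * c') (d * a' - c * b')"
    have "c * d' - d * c' = c * (d' - d) - d * (c' - c)" by (simp add: algebra_simps)
    hence "int N dvd c * d' - d * c'" using cong by simp
    moreover have "(a * d' - b * c') * (d * a' - c * b') - (b * a' - a * b') * (c * d' - d * c') =
       (a * d - b * c) * (a' * d' - b' * c')" by (simp add: algebra_simps)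
    ultimately have "G \<in> Gamma0 N" using abcd abcd' by (simp add: G_def int_mat2_in_Gamma0_iff)
    moreover have "A = G ** B"
    proof -
      have "(a * d' - b * c') * a' + (b * a' - a * b') * c' = a * (a' * d' - b' * c')"
        "(a * d' - b * c') * b' + (b * a' - a * b') * d' = b * (a' * d' - b' * c')"
        "(c * d' - d * c') * a' + (d * a' - c * b') * c' = c * (a' * d' - b' * c')"
        "(c * d' - d * c') * b' + (d * a' - c * b') * d' = d * (a' * d' - b' * c')"
        by (simp_all add: algebra_simps)
      thus ?thesis unfolding G_def abcd abcd' int_mat2_mult by (simp only: abcd' mult_1_right)
    qed
    ultimately show ?thesis using BR by blast
  qed
  with fin sub that show ?thesis by blast
qed

lemma Gamma0_subset_SL2Z: "Gamma0 N \<subseteq> SL2Z"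
  by (auto simp: Gamma0_def)

text \<open>Prepares the countability of the zeros of a nonconstant holomorphic function on the
  half-plane.\<close>

lemma fsigma_uhp: "fsigma uhp"
proof -
  have "uhp = (\<Union>n::nat. {z. inverse (real (Suc n)) \<le> Im z})"
  proof (intro equalityI subsetI)
    fix z assume "z \<in> uhp"
    then obtain n where "inverse (real (Suc n)) < Im z"
      using reals_Archimedean[of "Im z"] by (auto simp: uhp_def)
    thus "z \<in> (\<Union>n::nat. {z. inverse (real (Suc n)) \<le> Im z})" by (intro UN_I[of n]) auto
  next
    fix z assume "z \<in> (\<Union>n::nat. {z. inverse (real (Suc n)) \<le> Im z})"
    then obtain n :: nat where "inverse (real (Suc n)) \<le> Im z" by blast
    moreover have "inverse (real (Suc n)) > 0" by simp
    ultimately have "0 < Im z" by (rule less_le_trans[rotated])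
    thus "z \<in> uhp" by (simp add: uhp_def)
  qed
  moreover have "fsigma (\<Union>n::nat. {z::complex. inverse (real (Suc n)) \<le> Im z})"
    by (rule fsigma.intros) (rule closed_halfspace_Im_ge)
  ultimately show ?thesis by (simp only:)
qed

text \<open>Takes the place of the valence formula. The product of the distinct translates of
  \<open>f\<close> is invariant under \<open>SL2Z\<close> and tends to 0 at infinity, because one
  factor decays and the others stay bounded. Its modulus therefore attains a maximum on a truncated
  fundamental domain, the maximum principle makes it constant, and the constant is 0. Then some
  translate vanishes identically, and with it \<open>f\<close>.\<close>

theorem modular_function_eq_0:
  assumes N: "N > 0" and hol: "f holomorphic_on uhp"
    and inv: "\<And>A z. A \<in> Gamma0 N \<Longrightarrow> z \<in> uhp \<Longrightarrow> f (moebius_act A z) = f z"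
    and bnd: "\<And>A. A \<in> SL2Z \<Longrightarrow> \<exists>C Y. \<forall>z. Im z > Y \<longrightarrow> norm (f (moebius_act A z)) \<le> C"
    and lim: "\<And>e. e > 0 \<Longrightarrow> \<exists>Y. \<forall>z. Im z > Y \<longrightarrow> norm (f z) < e"
    and z: "z \<in> uhp"
  shows "f z = 0"
proof -
  obtain R where R: "finite R" "R \<subseteq> SL2Z" "\<And>A. A \<in> SL2Z \<Longrightarrow> \<exists>B\<in>R. \<exists>G\<in>Gamma0 N. A = G ** B"
    using finite_coset_representatives[OF N] by blast
  define F where "F = (\<lambda>A z. if z \<in> uhp then f (moebius_act A z) else 0)"
  have FG: "F (G ** B) = F B" if "G \<in> Gamma0 N" "B \<in> SL2Z" for G B
    unfolding F_def using that inv[OF that(1)] by (auto simp: SL2Z_moebius_mult fun_eq_iff)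
  \<comment> \<open>A set of functions in place of a family over cosets: by \<open>FG\<close> it is
    finite, and right translation permutes it.\<close>
  define S where "S = F ` SL2Z"
  have "S \<subseteq> F ` R"
  proof
    fix g assume "g \<in> S"
    then obtain A where A: "A \<in> SL2Z" "g = F A" by (auto simp: S_def)
    obtain B G where "B \<in> R" "G \<in> Gamma0 N" "A = G ** B" using R(3)[OF A(1)] by blast
    thus "g \<in> F ` R" using FG A R(2) by auto
  qed
  hence fin: "finite S" using R(1) finite_surj by blast
  define P where "P = (\<lambda>z. \<Prod>g\<in>S. g z)"
  have holg: "g holomorphic_on uhp" if "g \<in> S" for g
  proof -
    obtain A where A: "A \<in> SL2Z" "g = F A" using \<open>g \<in> S\<close> by (auto simp: S_def)
    have "moebius_act A holomorphic_on uhp"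
      using analytic_moebius[of A] A(1) by (simp add: analytic_imp_holomorphic)
    from holomorphic_on_compose_gen[OF this hol] have "(f \<circ> moebius_act A) holomorphic_on uhp"
      using SL2Z_moebius_in_uhp[OF A(1)] by blast
    thus ?thesis by (rule holomorphic_transform) (simp add: A F_def)
  qed
  have holP: "P holomorphic_on uhp"
    unfolding P_def by (intro holomorphic_on_prod holg)
  have invP: "P (moebius_act B z) = P z" if B: "B \<in> SL2Z" and z: "z \<in> uhp" for B z
  proof -
    obtain B' where B': "B' \<in> SL2Z" "B ** B' = mat 1" "B' ** B = mat 1" using SL2Z_inverse[OF B] by blast
    define T where "T = (\<lambda>B g z. if z \<in> uhp then g (moebius_act B z) else (0::complex))"
    have TF: "T B (F A) = F (A ** B)" if "B \<in> SL2Z" "A \<in> SL2Z" for A B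
      using that by (auto simp: T_def F_def SL2Z_moebius_mult fun_eq_iff)
    have TS: "T B g \<in> S" if "B \<in> SL2Z" "g \<in> S" for B g
      using that TF SL2Z_mult by (auto simp: S_def)
    have TT: "T B (T B' g) = g" if "B \<in> SL2Z" "B' \<in> SL2Z" "B' ** B = mat 1" "g \<in> S" for B B' g
      using that TF SL2Z_mult by (auto simp: S_def simp flip: matrix_mul_assoc)
    have "P z = (\<Prod>g\<in>S. T B g z)"
      unfolding P_def
      by (rule prod.reindex_bij_witness[of _ "T B" "T B'"]) (use TS TT B B' in auto)
    also have "\<dots> = P (moebius_act B z)"
      unfolding P_def using z by (simp add: T_def)
    finally show ?thesis by simp
  qed
  have "\<forall>g\<in>S. \<exists>C Y. \<forall>z. Im z > Y \<longrightarrow> norm (g z) \<le> C"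
  proof
    fix g assume "g \<in> S"
    then obtain A where A: "A \<in> SL2Z" "g = F A" by (auto simp: S_def)
    obtain C Y where CY: "\<forall>z. Im z > Y \<longrightarrow> norm (f (moebius_act A z)) \<le> C" using bnd[OF A(1)] by blast
    have "\<forall>z. Im z > max Y 0 \<longrightarrow> norm (g z) \<le> C"
      using CY by (simp add: A(2) F_def uhp_def)
    thus "\<exists>C Y. \<forall>z. Im z > Y \<longrightarrow> norm (g z) \<le> C" by blast
  qed
  then obtain C Y where CY: "\<And>g z. g \<in> S \<Longrightarrow> Im z > Y g \<Longrightarrow> norm (g z) \<le> C g" by metis
  \<comment> \<open>The factor of the identity matrix is set apart: it carries the decay, and
    \<open>C0\<close> bounds the product of the others.\<close>
  define C0 where "C0 = (\<Prod>g\<in>S - {F (mat 1)}. max 1 (C g))"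
  define Y0 where "Y0 = Max (insert 0 (Y ` S))"
  have Y0: "Y g \<le> Y0" "0 \<le> Y0" if "g \<in> S" for g using fin that by (auto simp: Y0_def)
  have C0: "C0 \<ge> 1" unfolding C0_def by (intro prod_ge_1) auto
  have FS: "F (mat 1) \<in> S" by (simp add: S_def)
  have Pbound: "norm (P z) \<le> norm (f z) * C0" if "Im z > Y0" for z
  proof -
    have zu: "z \<in> uhp" using that Y0(2)[OF FS] by (simp add: uhp_def)
    have "norm (P z) = norm (F (mat 1) z) * (\<Prod>g\<in>S - {F (mat 1)}. norm (g z))"
      unfolding P_def using fin FS by (subst prod.remove[of _ "F (mat 1)"]) (auto simp: norm_mult prod_norm)
    also have "\<dots> \<le> norm (F (mat 1) z) * C0"
      unfolding C0_def
    proof (intro mult_left_mono prod_mono conjI)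
      fix g assume g: "g \<in> S - {F (mat 1)}"
      have "norm (g z) \<le> C g" using CY[of g z] Y0(1)[of g] g that by auto
      thus "norm (g z) \<le> max 1 (C g)" by simp
    qed auto
    also have "F (mat 1) z = f z" using zu by (simp add: F_def)
    finally show ?thesis .
  qed
  have P0: "P z = 0" if z0: "z \<in> uhp" for z
  proof (rule ccontr)
    assume nz: "P z \<noteq> 0"
    obtain Y1 where Y1: "\<And>w. Im w > Y1 \<Longrightarrow> norm (f w) < norm (P z) / C0"
      using lim[of "norm (P z) / C0"] nz C0 by auto
    define Y2 where "Y2 = max 1 (max Y0 Y1)"
    have small: "norm (P w) < norm (P z)" if "Im w > Y2" for w
    proof -
      have "norm (P w) \<le> norm (f w) * C0" using that by (intro Pbound) (simp add: Y2_def)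
      also have "\<dots> < norm (P z) / C0 * C0" using Y1[of w] that C0 by (intro mult_strict_right_mono) (auto simp: Y2_def)
      finally show ?thesis using C0 by simp
    qed
    define K where "K = {w. \<bar>Re w\<bar> \<le> 1 / 2 \<and> 1 / 2 \<le> Im w \<and> Im w \<le> Y2}"
    have K: "K = cbox (Complex (- 1 / 2) (1 / 2)) (Complex (1 / 2) Y2)"
      by (auto simp: K_def in_cbox_complex_iff abs_le_iff)
    have Ku: "K \<subseteq> uhp" by (auto simp: K_def uhp_def)
    have rep: "\<exists>w. \<bar>Re w\<bar> \<le> 1 / 2 \<and> 1 / 2 \<le> Im w \<and> P w = P u" if u: "u \<in> uhp" for u
      using SL2Z_fundamental_domain[OF u] invP[OF _ u] by metis
    have "K \<noteq> {}" by (auto simp: K_def Y2_def intro!: exI[of _ "Complex 0 1"])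
    moreover have "compact K" by (simp add: K)
    moreover have "continuous_on K (\<lambda>w. norm (P w))"
      using holomorphic_on_imp_continuous_on[OF holP] Ku by (intro continuous_on_norm) (rule continuous_on_subset)
    ultimately obtain w where w: "w \<in> K" "\<And>u. u \<in> K \<Longrightarrow> norm (P u) \<le> norm (P w)"
      using continuous_attains_sup[of K "\<lambda>w. norm (P w)"] by blast
    have zw: "norm (P z) \<le> norm (P w)"
    proof -
      obtain u where u: "\<bar>Re u\<bar> \<le> 1 / 2" "1 / 2 \<le> Im u" "P u = P z" using rep[OF z0] by blast
      have "Im u \<le> Y2" using small[of u] u(3) by force
      hence "u \<in> K" using u by (simp add: K_def)
      thus ?thesis using w(2) u(3) by metis
    qed
    have "P constant_on uhp"
    proof (rule maximum_modulus_principle[OF holP open_uhp connected_uhp open_uhp subset_refl])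
      show "w \<in> uhp" using w(1) Ku by blast
      fix v assume v: "v \<in> uhp"
      obtain u where u: "\<bar>Re u\<bar> \<le> 1 / 2" "1 / 2 \<le> Im u" "P u = P v" using rep[OF v] by blast
      show "norm (P v) \<le> norm (P w)"
      proof (cases "Im u \<le> Y2")
        case True
        hence "u \<in> K" using u by (simp add: K_def)
        thus ?thesis using w(2) u(3) by metis
      next
        case False
        thus ?thesis using small[of u] u(3) zw by simp
      qed
    qed
    hence "P (Complex 0 (Y2 + 1)) = P z"
      using z0 by (auto simp: constant_on_def uhp_def Y2_def)
    thus False using small[of "Complex 0 (Y2 + 1)"] by simp
  qed
  \<comment> \<open>Otherwise every factor has only countably many zeros, yet these zeros would have
    to cover the uncountable half-plane.\<close>
  have "\<exists>g\<in>S. \<forall>z\<in>uhp. g z = 0"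
  proof (rule ccontr)
    assume *: "\<not> (\<exists>g\<in>S. \<forall>z\<in>uhp. g z = 0)"
    have "countable {z\<in>uhp. g z = 0}" if g: "g \<in> S" for g
    proof (cases "g constant_on uhp")
      case True
      hence "{z\<in>uhp. g z = 0} = {}" using * g by (auto simp: constant_on_def)
      thus ?thesis by (simp only: countable_empty)
    next
      case False
      thus ?thesis using holg[OF g] by (intro holomorphic_countable_zeros fsigma_uhp) auto
    qed
    hence "countable (\<Union>g\<in>S. {z\<in>uhp. g z = 0})" using fin by (intro countable_UN) (auto intro: countable_finite)
    moreover have "uhp \<subseteq> (\<Union>g\<in>S. {z\<in>uhp. g z = 0})" using P0 fin by (auto simp: P_def)
    ultimately have "countable uhp" using countable_subset by blast
    thus False using uncountable_halfspace_Im_gt[of 0] by (simp add: uhp_def)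
  qed
  then obtain A where A: "A \<in> SL2Z" "\<And>z. z \<in> uhp \<Longrightarrow> F A z = 0" by (auto simp: S_def)
  obtain B where B: "B \<in> SL2Z" "A ** B = mat 1" using SL2Z_inverse[OF A(1)] by blast
  have "F A (moebius_act B z) = f (moebius_act (A ** B) z)"     unfolding SL2Z_moebius_mult[OF B(1) z] using B z by (simp add: F_def)
  thus ?thesis using A(2)[of "moebius_act B z"] B z by simp
qed

section \<open>Polynomial relations and subfields\<close>

text \<open>Gaussian elimination: each induction step solves the last equation for an unknown
  \<open>j0\<close> with nonzero coefficient and substitutes it into the others.\<close>

lemma homogeneous_system_nontrivial:
  fixes c :: "nat \<Rightarrow> 'i \<Rightarrow> 'a::field"
  assumes "finite J" "N < card J"
  shows "\<exists>\<alpha>. (\<exists>j\<in>J. \<alpha> j \<noteq> 0) \<and> (\<forall>i<N. (\<Sum>j\<in>J. c i j * \<alpha> j) = 0)"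
  using assms
proof (induction N arbitrary: c J)
  case 0
  then obtain j where "j \<in> J" by fastforce
  thus ?case by (intro exI[of _ "\<lambda>_. 1"]) auto
next
  case (Suc N)
  show ?case
  proof (cases "\<forall>j\<in>J. c N j = 0")
    case True
    have "N < card J" using Suc.prems by simp
    from Suc.IH[OF Suc.prems(1) this, of c] obtain \<alpha> where
      \<alpha>: "\<exists>j\<in>J. \<alpha> j \<noteq> 0" "\<forall>i<N. (\<Sum>j\<in>J. c i j * \<alpha> j) = 0" by blast
    moreover have "(\<Sum>j\<in>J. c N j * \<alpha> j) = 0" using True by simp
    ultimately show ?thesis by (metis less_Suc_eq)
  next
    case False
    then obtain j0 where j0: "j0 \<in> J" "c N j0 \<noteq> 0" by blast
    define J' where "J' = J - {j0}"
    have J': "finite J'" "N < card J'" "j0 \<notin> J'" "J = insert j0 J'"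
      using Suc.prems j0 by (auto simp: J'_def)
    define c' where "c' = (\<lambda>i j. c i j - c i j0 * c N j / c N j0)"
    from Suc.IH[OF J'(1,2), of c'] obtain \<alpha> where
      \<alpha>: "\<exists>j\<in>J'. \<alpha> j \<noteq> 0" "\<forall>i<N. (\<Sum>j\<in>J'. c' i j * \<alpha> j) = 0" by blast
    define s where "s = (\<Sum>j\<in>J'. c N j * \<alpha> j)"
    define \<beta> where "\<beta> = \<alpha>(j0 := - s / c N j0)"
    have \<beta>: "(\<Sum>j\<in>J. c i j * \<beta> j) = (\<Sum>j\<in>J'. c i j * \<alpha> j) - c i j0 * s / c N j0" for i
    proof -
      have "(\<Sum>j\<in>J'. c i j * \<beta> j) = (\<Sum>j\<in>J'. c i j * \<alpha> j)"
        using J'(3) by (intro sum.cong) (auto simp: \<beta>_def)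
      thus ?thesis using J'(1,3) unfolding J'(4) by (simp add: \<beta>_def)
    qed
    have "(\<Sum>j\<in>J. c i j * \<beta> j) = 0" if "i < Suc N" for i
    proof (cases "i = N")
      case True thus ?thesis using j0 unfolding \<beta> by (simp add: s_def)
    next
      case False
      have "(\<Sum>j\<in>J'. c' i j * \<alpha> j) = (\<Sum>j\<in>J'. c i j * \<alpha> j) - c i j0 * s / c N j0"
      proof -
        have "(\<Sum>j\<in>J'. c' i j * \<alpha> j) = (\<Sum>j\<in>J'. c i j * \<alpha> j - c i j0 / c N j0 * (c N j * \<alpha> j))"
          by (intro sum.cong) (simp_all add: c'_def left_diff_distrib right_diff_distrib mult_ac)
        also have "\<dots> = (\<Sum>j\<in>J'. c i j * \<alpha> j) - c i j0 / c N j0 * s"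
          by (simp only: sum_subtractf s_def sum_distrib_left)
        finally show ?thesis by simp
      qed
      thus ?thesis using \<alpha>(2) False that unfolding \<beta> by simp
    qed
    moreover have "\<exists>j\<in>J. \<beta> j \<noteq> 0"
      using \<alpha>(1) J'(3,4) by (auto simp: \<beta>_def)
    ultimately show ?thesis by blast
  qed
qed

section \<open>Ring homomorphisms between types and evaluation of polynomials\<close>

definition is_ring_hom :: "('a::comm_ring_1 \<Rightarrow> 'b::comm_ring_1) \<Rightarrow> bool" where
  "is_ring_hom h \<longleftrightarrow> (\<forall>a b. h (a + b) = h a + h b) \<and> (\<forall>a b. h (a * b) = h a * h b) \<and> h 1 = 1"

lemma is_ring_hom_simps:
  assumes "is_ring_hom h"
  shows "h 0 = 0" "h 1 = 1" "h (a + b) = h a + h b" "h (a * b) = h a * h b" "h (- a) = - h a"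
    "h (a - b) = h a - h b" "h (a ^ n) = h a ^ n" "h (numeral k) = numeral k"
proof -
  have add: "h (a + b) = h a + h b" and mult: "h (a * b) = h a * h b" and 1: "h 1 = 1" for a b
    using assms by (simp_all add: is_ring_hom_def)
  show 0: "h 0 = 0" using add[of 0 0] by simp
  have min: "h (- a) = - h a" for a using add[of a "- a"] 0 by (simp add: eq_neg_iff_add_eq_0 add.commute)
  show "h 1 = 1" "h (a + b) = h a + h b" "h (a * b) = h a * h b" "h (- a) = - h a" by (fact 1 add mult min)+
  show "h (a - b) = h a - h b" using add[of a "- b"] min by simp
  show "h (a ^ n) = h a ^ n" by (induction n) (simp_all add: 1 mult)
  have "h (of_nat n) = of_nat n" for n by (induction n) (simp_all add: 0 1 add)
  from this[of "numeral k"] show "h (numeral k) = numeral k" by simp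
qed

text \<open>The homomorphism that extends \<open>h\<close> and sends the variable to
  \<open>x\<close>. Because \<open>h\<close> is arbitrary it can be iterated, which gives evaluation
  on \<open>\<rat>[X][Y][T]\<close>.\<close>

definition eval_hom :: "('a::comm_ring_1 \<Rightarrow> 'b::comm_ring_1) \<Rightarrow> 'b \<Rightarrow> 'a poly \<Rightarrow> 'b" where
  "eval_hom h x p = poly (map_poly h p) x"

lemma
  assumes h: "is_ring_hom h"
  shows eval_hom_0 [simp]: "eval_hom h x 0 = 0"
    and eval_hom_pCons: "eval_hom h x (pCons a p) = h a + x * eval_hom h x p"
    and eval_hom_const: "eval_hom h x [:a:] = h a"
  by (simp_all add: eval_hom_def map_poly_pCons is_ring_hom_simps[OF h])

lemma eval_hom_add:
  assumes h: "is_ring_hom h"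
  shows "eval_hom h x (p + q) = eval_hom h x p + eval_hom h x q"
  by (induction p q rule: poly_induct2)
    (simp_all add: eval_hom_pCons[OF h] eval_hom_0[OF h] is_ring_hom_simps[OF h] algebra_simps)

lemma eval_hom_smult:
  assumes h: "is_ring_hom h"
  shows "eval_hom h x (Polynomial.smult a p) = h a * eval_hom h x p"
  by (induction p) (simp_all add: eval_hom_pCons[OF h] eval_hom_0[OF h] is_ring_hom_simps[OF h] algebra_simps)

lemma is_ring_hom_eval_hom:
  assumes h: "is_ring_hom h"
  shows "is_ring_hom (eval_hom h x)"
proof -
  have "eval_hom h x (p * q) = eval_hom h x p * eval_hom h x q" for p q
    by (induction p) (simp_all add: eval_hom_pCons[OF h] eval_hom_add[OF h] eval_hom_smult[OF h]
        eval_hom_0[OF h] is_ring_hom_simps[OF h] algebra_simps)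
  thus ?thesis
    by (simp add: is_ring_hom_def eval_hom_add[OF h] eval_hom_const[OF h] is_ring_hom_simps[OF h] one_pCons)
qed

lemma eval_hom_eq_sum:
  assumes h: "is_ring_hom h" and n: "Polynomial.degree p < n"
  shows "eval_hom h x p = (\<Sum>i<n. h (Polynomial.coeff p i) * x ^ i)"
proof -
  have "Polynomial.degree (map_poly h p) \<le> Polynomial.degree p"     by (rule degree_le) (simp add: coeff_map_poly coeff_eq_0 is_ring_hom_simps[OF h])
  hence deg: "Polynomial.degree (map_poly h p) < n" using n by simp
  have "poly (map_poly h p) x = (\<Sum>i\<le>Polynomial.degree (map_poly h p). Polynomial.coeff (map_poly h p) i * x ^ i)"
    by (rule poly_altdef)
  also have "\<dots> = (\<Sum>i<n. h (Polynomial.coeff p i) * x ^ i)"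
  proof -
    have "Polynomial.coeff (map_poly h p) i = h (Polynomial.coeff p i)" for i
      by (simp add: coeff_map_poly is_ring_hom_simps(1)[OF h])
    note cm = this[symmetric]
    show ?thesis
      using deg by (intro sum.mono_neutral_cong_left) (auto simp: cm intro: le_degree)
  qed
  finally show ?thesis by (simp add: eval_hom_def)
qed

text \<open>The norm of \<open>P + Q y\<close> down to polynomials in \<open>x\<close> is
  \<open>P^2 - x P Q - Q^2 g\<close>. It vanishes as a polynomial because \<open>x\<close> is
  transcendental, and this contradicts the odd degree of \<open>Q^2 g\<close>.\<close>

lemma elliptic_independent:
  fixes h :: "'a::{idom,ring_char_0} \<Rightarrow> 'b::idom"
  assumes h: "is_ring_hom h"
    and tr: "\<And>p. eval_hom h x p = 0 \<Longrightarrow> p = 0"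
    and eq: "y ^ 2 + x * y = x ^ 3 - 3 * x + 1"
    and PQ: "eval_hom h x P + eval_hom h x Q * y = 0"
  shows "P = 0 \<and> Q = 0"
proof -
  note hom = is_ring_hom_simps[OF is_ring_hom_eval_hom[OF h, of x]]
  define g :: "'a poly" where "g = [:1, - 3, 0, 1:]"
  have g: "eval_hom h x g = x ^ 3 - 3 * x + 1"
    by (simp add: g_def eval_hom_pCons[OF h] eval_hom_0[OF h] is_ring_hom_simps[OF h] power3_eq_cube algebra_simps)
  have X: "eval_hom h x [:0, 1:] = x"
    by (simp add: eval_hom_pCons[OF h] eval_hom_0[OF h] is_ring_hom_simps[OF h])
  define p q where "p = eval_hom h x P" and "q = eval_hom h x Q"
  have p: "p = - (q * y)" using PQ by (simp add: p_def q_def eq_neg_iff_add_eq_0)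
  have "eval_hom h x (P ^ 2 - [:0, 1:] * P * Q - Q ^ 2 * g) = p ^ 2 - x * p * q - q ^ 2 * (x ^ 3 - 3 * x + 1)"
    by (simp only: hom g X p_def q_def)
  also have "\<dots> = q ^ 2 * (y ^ 2 + x * y - (x ^ 3 - 3 * x + 1))"
    unfolding p by (simp add: algebra_simps power2_eq_square)
  also have "\<dots> = 0" using eq by simp
  finally have "P ^ 2 - [:0, 1:] * P * Q - Q ^ 2 * g = 0" by (rule tr)
  hence main: "P ^ 2 - [:0, 1:] * P * Q = Q ^ 2 * g" by simp
  have "Q = 0"
  proof (rule ccontr)
    assume Q: "Q \<noteq> 0"
    have dr: "Polynomial.degree (Q ^ 2 * g) = 2 * Polynomial.degree Q + 3" and gr: "g \<noteq> 0"
    proof -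
      have g3: "Polynomial.degree g = 3" "g \<noteq> 0" by (simp_all add: g_def)
      thus "g \<noteq> 0" by simp
      show "Polynomial.degree (Q ^ 2 * g) = 2 * Polynomial.degree Q + 3"
        using Q g3 by (subst degree_mult_eq) (simp_all add: degree_power_eq)
    qed
    have P: "P \<noteq> 0" using main Q gr by auto
    have d1: "Polynomial.degree (P ^ 2) = 2 * Polynomial.degree P" using P by (simp add: degree_power_eq)
    have d2: "Polynomial.degree ([:0, 1:] * P * Q) = Polynomial.degree P + Polynomial.degree Q + 1" using P Q by (simp add: degree_mult_eq)
    \<comment> \<open>In the first case \<open>P^2\<close> dominates, and an even degree meets an
      odd one; in the second the left side has degree at most \<open>2 deg Q + 2\<close>, one too
      small.\<close>
    show False
    proof (cases "Polynomial.degree P \<ge> Polynomial.degree Q + 2")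
      case True
      have "Polynomial.degree (P ^ 2 - [:0, 1:] * P * Q) = 2 * Polynomial.degree P"
        unfolding diff_conv_add_uminus using True d1 d2 by (subst degree_add_eq_left) auto
      hence "2 * Polynomial.degree P = 2 * Polynomial.degree Q + 3" using main dr by simp
      thus False by presburger
    next
      case False
      have "Polynomial.degree (P ^ 2 - [:0, 1:] * P * Q) \<le> 2 * Polynomial.degree Q + 2"
        using False d1 d2 by (intro degree_diff_le) auto
      thus False using main dr by simp
    qed
  qed
  moreover from this main have "P = 0" by simp
  ultimately show ?thesis by simp
qed

text \<open>Division by a monic quadratic works over any commutative ring; it is applied to
  \<open>T\<close> over \<open>\<rat>[X][Y]\<close> and to \<open>Y\<close> over
  \<open>\<rat>[X]\<close>.\<close>

lemma weierstrass_reduce: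
  fixes p :: "'a::comm_ring_1 poly poly" and c b :: "'a poly"
  shows "\<exists>u P Q. p = u * ([:0, 1:] ^ 2 + [:b:] * [:0, 1:] - [:c:]) + [:P, Q:]"
proof (induction p)
  case 0
  show ?case by (intro exI[of _ 0]) simp
next
  case (pCons a p)
  then obtain u P Q where p: "p = u * ([:0, 1:] ^ 2 + [:b:] * [:0, 1:] - [:c:]) + [:P, Q:]" by blast
  let ?M = "[:0, 1:] ^ 2 + [:b:] * [:0, 1:] - [:c:] :: 'a poly poly"
  have M: "[:0, 0, 1:] = ?M - [:b:] * [:0, 1:] + [:c:]" by (simp add: power2_eq_square)
  have "pCons a p = [:a:] + [:0, 1:] * p" by simp
  also have "\<dots> = ([:0, 1:] * u) * ?M + [:a:] + [:0, 1:] * [:P, Q:]"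
    unfolding p by (simp only: distrib_left mult.assoc add_ac)
  also have "[:0, 1:] * [:P, Q:] = [:0, P:] + [:Q:] * [:0, 0, 1:]" by simp
  also have "[:Q:] * [:0, 0, 1:] = [:Q:] * ?M - [:Q:] * ([:b:] * [:0, 1:] - [:c:])"
    unfolding M by (simp only: distrib_left right_diff_distrib) simp
  finally have "pCons a p = ([:0, 1:] * u + [:Q:]) * ?M + ([:a:] + [:0, P:] - [:Q:] * ([:b:] * [:0, 1:] - [:c:]))"
    by (simp only: distrib_right add_ac diff_conv_add_uminus)
  moreover have "[:a:] + [:0, P:] - [:Q:] * ([:b:] * [:0, 1:] - [:c:]) = [:a + Q * c, P - Q * b:]" by simp
  ultimately show ?case by metis
qed

section \<open>The function field as a ring with carrier\<close>

lemma (in ring_1) ring_of_type_algebra_simps [simp]: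
  "carrier ring_of_type_algebra = (UNIV :: 'a set)" "a \<otimes>\<^bsub>ring_of_type_algebra\<^esub> b = a * b"
  "a \<oplus>\<^bsub>ring_of_type_algebra\<^esub> b = a + b" "\<zero>\<^bsub>ring_of_type_algebra\<^esub> = 0" "\<one>\<^bsub>ring_of_type_algebra\<^esub> = 1"
  by (simp_all add: ring_of_type_algebra_def)

lemma
  shows X0_field_carrier: "carrier (X0_field N) = X0_rational_functions N"
    and X0_field_mult: "a \<otimes>\<^bsub>X0_field N\<^esub> b = a * b"
    and X0_field_add: "a \<oplus>\<^bsub>X0_field N\<^esub> b = a + b"
    and X0_field_zero: "\<zero>\<^bsub>X0_field N\<^esub> = 0"
    and X0_field_one: "\<one>\<^bsub>X0_field N\<^esub> = 1"
  by (simp_all add: X0_field_def ring_of_type_algebra_def)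

lemmas X0_field_simps = X0_field_carrier X0_field_mult X0_field_add X0_field_zero X0_field_one

text \<open>Keeps field theory apart from analysis: the closure properties assumed here are
  statements about q-expansions and are established in the lemma \<open>X0_subfield\<close>.\<close>

locale X0_subfield =
  fixes N :: nat
  assumes zero: "0 \<in> X0_rational_functions N" and one: "1 \<in> X0_rational_functions N"
    and add: "f \<in> X0_rational_functions N \<Longrightarrow> g \<in> X0_rational_functions N \<Longrightarrow> f + g \<in> X0_rational_functions N"
    and mult: "f \<in> X0_rational_functions N \<Longrightarrow> g \<in> X0_rational_functions N \<Longrightarrow> f * g \<in> X0_rational_functions N"
    and uminus: "f \<in> X0_rational_functions N \<Longrightarrow> - f \<in> X0_rational_functions N"
    and inverse: "f \<in> X0_rational_functions N \<Longrightarrow> inverse f \<in> X0_rational_functions N"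
begin

lemma field_X0_field: "field (X0_field N)"
proof (rule cring.cring_fieldI2)
  show "cring (X0_field N)"
  proof (rule cringI)
    show "abelian_group (X0_field N)"
    proof (rule abelian_groupI)
      fix f assume "f \<in> carrier (X0_field N)"
      thus "\<exists>g\<in>carrier (X0_field N). g \<oplus>\<^bsub>X0_field N\<^esub> f = \<zero>\<^bsub>X0_field N\<^esub>"
        using uminus by (intro bexI[of _ "- f"]) (simp_all add: X0_field_simps)
    qed (simp_all add: X0_field_simps zero add add_ac)
    show "comm_monoid (X0_field N)"
      by (rule comm_monoidI) (simp_all add: X0_field_simps one mult mult_ac)
  qed (simp_all add: X0_field_simps distrib_right)
  show "\<zero>\<^bsub>X0_field N\<^esub> \<noteq> \<one>\<^bsub>X0_field N\<^esub>" by (simp add: X0_field_simps)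
  fix f assume "f \<in> carrier (X0_field N)" "f \<noteq> \<zero>\<^bsub>X0_field N\<^esub>"
  thus "\<exists>g\<in>carrier (X0_field N). f \<otimes>\<^bsub>X0_field N\<^esub> g = \<one>\<^bsub>X0_field N\<^esub>"
    using inverse by (intro bexI[of _ "inverse f"]) (simp_all add: X0_field_simps)
qed

lemma X0_field_inv:
  assumes "f \<in> X0_rational_functions N" "f \<noteq> 0"
  shows "inv\<^bsub>X0_field N\<^esub> f = inverse f"
proof -
  interpret field "X0_field N" by (rule field_X0_field)
  show ?thesis
    by (rule inv_unique'[symmetric]) (use assms inverse in \<open>simp_all add: X0_field_simps\<close>)
qed

lemma X0_field_a_inv:
  assumes "f \<in> X0_rational_functions N"
  shows "\<ominus>\<^bsub>X0_field N\<^esub> f = - f"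
proof -
  interpret field "X0_field N" by (rule field_X0_field)
  have "- f \<oplus>\<^bsub>X0_field N\<^esub> f = \<zero>\<^bsub>X0_field N\<^esub>" by (simp add: X0_field_simps)
  thus ?thesis
    using assms uminus by (intro minus_equality) (simp_all add: X0_field_simps)
qed

lemma generate_field_closed:
  assumes S: "S \<subseteq> X0_rational_functions N"
  defines "G \<equiv> generate_field (X0_field N) S"
  shows "G \<subseteq> X0_rational_functions N" "S \<subseteq> G" "0 \<in> G" "1 \<in> G"
    "f \<in> G \<Longrightarrow> g \<in> G \<Longrightarrow> f + g \<in> G" "f \<in> G \<Longrightarrow> g \<in> G \<Longrightarrow> f * g \<in> G" "f \<in> G \<Longrightarrow> - f \<in> G"
    "f \<in> G \<Longrightarrow> inverse f \<in> G" "f \<in> G \<Longrightarrow> f ^ n \<in> G"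
proof -
  interpret field "X0_field N" by (rule field_X0_field)
  show sub: "G \<subseteq> X0_rational_functions N"
    unfolding G_def using generate_field_in_carrier[of S] S by (auto simp: X0_field_simps)
  show "S \<subseteq> G" by (auto simp: G_def intro: generate_field.incl)
  have one: "1 \<in> G" using generate_field.one[of "X0_field N" S] by (simp add: G_def X0_field_simps)
  show "1 \<in> G" by (fact one)
  have mult: "f * g \<in> G" if "f \<in> G" "g \<in> G" for f g
    using generate_field.eng_mult[of f "X0_field N" S g] that by (simp add: G_def X0_field_simps)
  show "f \<in> G \<Longrightarrow> g \<in> G \<Longrightarrow> f * g \<in> G" by (fact mult)
  have add: "f + g \<in> G" if "f \<in> G" "g \<in> G" for f g
    using generate_field.eng_add[of f "X0_field N" S g] that by (simp add: G_def X0_field_simps)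
  show "f \<in> G \<Longrightarrow> g \<in> G \<Longrightarrow> f + g \<in> G" by (fact add)
  have uminus: "- f \<in> G" if "f \<in> G" for f
    using generate_field.a_inv[of f "X0_field N" S] that sub X0_field_a_inv[of f] by (auto simp: G_def)
  show "f \<in> G \<Longrightarrow> - f \<in> G" by (fact uminus)
  show 0: "0 \<in> G" using add[OF one uminus[OF one]] by simp
  show "inverse f \<in> G" if "f \<in> G"
  proof (cases "f = 0")
    case False
    thus ?thesis
      using generate_field.m_inv[of f "X0_field N" S] that sub X0_field_inv[of f] by (auto simp: G_def X0_field_simps)
  qed (use 0 in simp)
  show "f \<in> G \<Longrightarrow> f ^ n \<in> G" by (induction n) (auto simp: one mult)
qed

end

section \<open>Transformation of the eta function\<close>

definition divisor_sum :: "nat \<Rightarrow> nat" where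
  "divisor_sum n = (if n = 0 then 0 else \<Sum>d | d dvd n. d)"

lemma norm_lambert_summand_summable:
  fixes q :: complex
  assumes "norm q < 1"
  shows "summable (\<lambda>m. norm q ^ Suc m / (1 - norm q ^ Suc m)\<^sup>2)"
proof -
  have "summable (\<lambda>m. complex_of_real (norm q ^ Suc m / (1 - norm q ^ Suc m)\<^sup>2))"
    using sums_lambert[of "of_real (norm q)"] assms by (simp add: sums_iff)
  thus ?thesis by (simp only: summable_complex_of_real)
qed

lemma norm_lambert_summand_le:
  fixes q :: complex
  assumes "norm q < 1"
  shows "norm (q ^ Suc m / (1 - q ^ Suc m)\<^sup>2) \<le> norm q ^ Suc m / (1 - norm q ^ Suc m)\<^sup>2"
proof -
  have lt: "norm q ^ Suc m < 1" using power_strict_mono[of "norm q" 1 "Suc m"] assms by simp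
  have "1 - norm q ^ Suc m \<le> norm (1 - q ^ Suc m)"
    using norm_triangle_ineq2[of 1 "q ^ Suc m"] by (simp add: norm_mult norm_power)
  hence "(1 - norm q ^ Suc m)\<^sup>2 \<le> norm (1 - q ^ Suc m) ^ 2"
    using lt by (intro power_mono) auto
  thus ?thesis
    using lt unfolding norm_divide norm_power by (intro divide_left_mono mult_pos_pos) auto
qed

lemma lambert_inner_has_sum:
  fixes x :: "'a :: {banach, real_normed_field}"
  assumes "norm x < 1"
  shows "((\<lambda>j. of_nat (Suc j) * x ^ Suc j) has_sum x / (1 - x)\<^sup>2) UNIV"
proof -
  have "(\<lambda>j. of_nat (Suc j) * x ^ j) sums (1 / (1 - x)\<^sup>2)"
    using assms by (rule geometric_deriv_sums)
  from sums_mult[OF this, of x] have "(\<lambda>j. of_nat (Suc j) * x ^ Suc j) sums (x / (1 - x)\<^sup>2)"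
    by (simp add: mult_ac)
  moreover have "(\<lambda>j. of_nat (Suc j) * norm x ^ j) sums (1 / (1 - norm x)\<^sup>2)"
    using assms by (intro geometric_deriv_sums) auto
  from sums_mult[OF this, of "norm x"] have "summable (\<lambda>j. norm (of_nat (Suc j) * x ^ Suc j))"
    by (simp add: sums_iff norm_mult norm_power mult_ac del: of_nat_Suc)
  ultimately show ?thesis by (rule norm_summable_imp_has_sum[rotated])
qed

text \<open>Expanding \<open>x / (1 - x)^2\<close> makes this an absolutely convergent double
  series. The pair \<open>(i, j)\<close> belongs to the exponent \<open>n = (i + 1) (j + 1)\<close>
  and to its divisor \<open>d = j + 1\<close>, so regrouping by \<open>n\<close> produces divisor
  sums.\<close>

lemma divisor_sum_sums_lambert:
  fixes q :: complex
  assumes q: "norm q < 1"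
  shows "(\<lambda>n. of_nat (divisor_sum n) * q ^ n) sums lambert q"
proof -
  define f where "f = (\<lambda>(i, j). of_nat (Suc j) * (q ^ Suc i) ^ Suc j)"
  have lt: "norm (q ^ Suc i) < 1" for i
    unfolding norm_power using power_strict_mono[of "norm q" 1 "Suc i"] q by simp
  have in1: "((\<lambda>j. f (i, j)) has_sum q ^ Suc i / (1 - q ^ Suc i)\<^sup>2) UNIV" for i
    using lambert_inner_has_sum[OF lt[of i]] by (simp add: f_def)
  have in2: "((\<lambda>j. norm (f (i, j))) has_sum norm q ^ Suc i / (1 - norm q ^ Suc i)\<^sup>2) UNIV" for i
    using lambert_inner_has_sum[of "norm (q ^ Suc i)"] lt[of i]
    by (simp add: f_def norm_mult norm_power del: of_nat_Suc power_Suc)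
  have "(\<lambda>p. norm (f p)) summable_on (UNIV \<times> UNIV)"
  proof (rule summable_on_SigmaI[OF in2])
    have "norm q ^ Suc m / (1 - norm q ^ Suc m)\<^sup>2 \<ge> 0" for m by simp
    thus "(\<lambda>i. norm q ^ Suc i / (1 - norm q ^ Suc i)\<^sup>2) summable_on UNIV"
      using norm_lambert_summand_summable[OF q] by (subst summable_on_UNIV_nonneg_real_iff) auto
  qed auto
  hence summ: "f summable_on (UNIV \<times> UNIV)" by (rule abs_summable_summable)
  have outer: "((\<lambda>i. q ^ Suc i / (1 - q ^ Suc i)\<^sup>2) has_sum lambert q) UNIV"
  proof (rule norm_summable_imp_has_sum)
    show "summable (\<lambda>i. norm (q ^ Suc i / (1 - q ^ Suc i)\<^sup>2))"
      by (rule summable_comparison_test'[OF norm_lambert_summand_summable[OF q], of 0])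
        (use norm_lambert_summand_le[OF q] in simp)
  qed (rule sums_lambert[OF q])
  have "(f has_sum lambert q) (UNIV \<times> UNIV)"
    by (rule has_sum_SigmaI[OF in1 outer summ])
  also have "(f has_sum lambert q) (UNIV \<times> UNIV) \<longleftrightarrow>
    ((\<lambda>(n, d). of_nat d * q ^ n) has_sum lambert q) (SIGMA n:{0<..}. {d. d dvd n})"
  proof (rule has_sum_reindex_bij_witness[of _ "\<lambda>(n, d). (n div d - 1, d - 1)" "\<lambda>(i, j). (Suc i * Suc j, Suc j)"])
    fix b :: "nat \<times> nat" assume "b \<in> (SIGMA n:{0<..}. {d. d dvd n})"
    then obtain d k where b: "b = (d * k, d)" "d > 0" "k > 0" by (cases b) (auto elim!: dvdE)
    obtain d' k' where "d = Suc d'" "k = Suc k'" using b by (auto simp: gr0_conv_Suc)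
    hence b': "b = (Suc k' * Suc d', Suc d')" using b(1) by (simp only: mult.commute)
    show "(case case b of (n, d) \<Rightarrow> (n div d - 1, d - 1) of (i, j) \<Rightarrow> (Suc i * Suc j, Suc j)) = b"
      unfolding b' case_prod_conv by (simp only: nonzero_mult_div_cancel_right[OF nat.distinct(2)] diff_Suc_1)
  next
    fix a :: "nat \<times> nat"
    show "(case (case a of (i, j) \<Rightarrow> (Suc i * Suc j, Suc j)) of (n, d) \<Rightarrow> of_nat d * q ^ n) = f a"
      by (cases a) (simp only: f_def case_prod_conv power_mult)
  qed (auto simp del: mult_Suc mult_Suc_right)
  finally have "((\<lambda>(n, d). of_nat d * q ^ n) has_sum lambert q) (SIGMA n:{0<..}. {d. d dvd n})" .
  moreover have "((\<lambda>d. (case (n, d) of (n, d) \<Rightarrow> of_nat d * q ^ n)) has_sum of_nat (divisor_sum n) * q ^ n) {d. d dvd n}"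
    if "n \<in> {0<..}" for n
  proof (rule has_sum_finiteI)
    show "finite {d. d dvd n}" using that by auto
    show "of_nat (divisor_sum n) * q ^ n = (\<Sum>d | d dvd n. (case (n, d) of (n, d) \<Rightarrow> of_nat d * q ^ n))"
      using that by (simp add: divisor_sum_def sum_distrib_right)
  qed
  ultimately have "((\<lambda>n. of_nat (divisor_sum n) * q ^ n) has_sum lambert q) {0<..}"
    by (rule has_sum_Sigma')
  also have "?this \<longleftrightarrow> ((\<lambda>n. of_nat (divisor_sum n) * q ^ n) has_sum lambert q) UNIV"
    by (rule has_sum_cong_neutral) (auto simp: divisor_sum_def)
  finally show ?thesis by (rule has_sum_imp_sums)
qed

text \<open>This is minus the logarithm of Euler's product of all \<open>1 - q^n\<close>: the
  coefficient of \<open>q^n\<close> is the sum of \<open>1 / k\<close> over the divisors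
  \<open>k\<close> of \<open>n\<close>. Starting from the logarithm avoids infinite products and
  branches, and it makes \<open>eta2\<close> visibly free of zeros.\<close>

definition log_euler_fps :: "complex fps" where
  "log_euler_fps = Abs_fps (\<lambda>n. of_nat (divisor_sum n) / of_nat n)"

lemma fps_conv_radius_log_euler: "fps_conv_radius log_euler_fps \<ge> 1"
  unfolding fps_conv_radius_def
proof (rule conv_radius_geI_ex')
  fix r :: real assume r: "0 < r" "ereal r < 1"
  have "summable (\<lambda>n. of_nat (divisor_sum n) * complex_of_real r ^ n)"
    using divisor_sum_sums_lambert[of "of_real r"] r by (simp add: sums_iff)
  hence "summable (\<lambda>n. complex_of_real (of_nat (divisor_sum n) * r ^ n))" by simp
  hence "summable (\<lambda>n. of_nat (divisor_sum n) * r ^ n)" by (simp only: summable_complex_of_real)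
  moreover have "norm (fps_nth log_euler_fps n * of_real r ^ n) \<le> of_nat (divisor_sum n) * r ^ n" for n
  proof (cases "n = 0")
    case False
    have "real (divisor_sum n) / real n \<le> real (divisor_sum n) / 1"
      using False by (intro divide_left_mono) auto
    from mult_right_mono[OF this, of "r ^ n"] show ?thesis
      using r by (simp add: log_euler_fps_def norm_mult norm_divide norm_power)
  qed (simp add: log_euler_fps_def divisor_sum_def)
  ultimately show "summable (\<lambda>n. fps_nth log_euler_fps n * of_real r ^ n)"
    by (rule summable_comparison_test'[where N = 0])
qed

definition log_euler :: "complex \<Rightarrow> complex" where
  "log_euler = eval_fps log_euler_fps"

lemma log_euler_0 [simp]: "log_euler 0 = 0"
  by (simp add: log_euler_def eval_fps_at_0 log_euler_fps_def)

lemma norm_less_conv_radius_log_euler: "norm q < 1 \<Longrightarrow> ereal (norm q) < fps_conv_radius log_euler_fps"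
  by (rule less_le_trans[OF _ fps_conv_radius_log_euler]) (simp add: one_ereal_def)

lemma has_field_derivative_log_euler:
  assumes q: "norm q < 1"
  shows "\<exists>D. (log_euler has_field_derivative D) (at q) \<and> q * D = lambert q"
proof (intro exI conjI)
  show "(log_euler has_field_derivative eval_fps (fps_deriv log_euler_fps) q) (at q)"
    unfolding log_euler_def by (intro has_field_derivative_eval_fps norm_less_conv_radius_log_euler q)
  have "ereal (norm q) < fps_conv_radius (fps_deriv log_euler_fps)"
    using norm_less_conv_radius_log_euler[OF q] fps_conv_radius_deriv less_le_trans by blast
  hence "(\<lambda>n. fps_nth (fps_deriv log_euler_fps) n * q ^ n) sums eval_fps (fps_deriv log_euler_fps) q"
    by (rule sums_eval_fps)
  hence "(\<lambda>n. of_nat (divisor_sum (Suc n)) * q ^ n) sums eval_fps (fps_deriv log_euler_fps) q"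
    by (simp add: log_euler_fps_def del: of_nat_Suc)
  from sums_mult[OF this, of q] have "(\<lambda>n. of_nat (divisor_sum (Suc n)) * q ^ Suc n) sums (q * eval_fps (fps_deriv log_euler_fps) q)"
    by (simp add: mult_ac)
  hence "(\<lambda>n. of_nat (divisor_sum n) * q ^ n) sums (q * eval_fps (fps_deriv log_euler_fps) q)"
    by (subst (asm) sums_Suc_iff) (simp add: divisor_sum_def)
  thus "q * eval_fps (fps_deriv log_euler_fps) q = lambert q"
    using divisor_sum_sums_lambert[OF q] sums_unique2 by blast
qed

lemma holomorphic_on_log_euler: "log_euler holomorphic_on ball 0 1"
  using has_field_derivative_log_euler by (intro holomorphic_onI)
    (metis dist_0_norm field_differentiable_at_within field_differentiable_def mem_ball)

text \<open>The square of the Dedekind eta function; squaring turns its multiplier system into a character.\<close>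
definition eta2 :: "complex \<Rightarrow> complex" where
  "eta2 z = e2pi (z / 12) * exp (- 2 * log_euler (e2pi z))"

lemma eta2_nonzero [simp]: "eta2 z \<noteq> 0"
  by (simp add: eta2_def)

lemma eta2_add_of_int: "eta2 (z + of_int n) = e2pi (of_int n / 12) * eta2 z"
  by (simp add: eta2_def e2pi_add add_divide_distrib)

lemma has_field_derivative_eta2:
  assumes z: "z \<in> uhp"
  shows "(eta2 has_field_derivative
     (2 * of_real pi * \<i> / 12 - 4 * of_real pi * \<i> * lambert (e2pi z)) * eta2 z) (at z)"
proof -
  have "norm (e2pi z) < 1" using z by (simp add: uhp_def)
  then obtain D where D: "(log_euler has_field_derivative D) (at (e2pi z))" "e2pi z * D = lambert (e2pi z)"
    using has_field_derivative_log_euler by blast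
  have 1: "((\<lambda>z. log_euler (e2pi z)) has_field_derivative D * (2 * of_real pi * \<i> * e2pi z)) (at z)"
    by (rule DERIV_chain2[OF D(1) has_field_derivative_e2pi])
  have "((\<lambda>z. e2pi (z / 12) * exp (- 2 * log_euler (e2pi z))) has_field_derivative
     (2 * of_real pi * \<i> * e2pi (z / 12) * (1 / 12)) * exp (- 2 * log_euler (e2pi z)) +
     (exp (- 2 * log_euler (e2pi z)) * (- 2 * (D * (2 * of_real pi * \<i> * e2pi z)))) * e2pi (z / 12)) (at z)"
    by (rule DERIV_mult has_field_derivative_e2pi' DERIV_fun_exp[where g = "\<lambda>z. - 2 * log_euler (e2pi z)"] DERIV_cmult 1 DERIV_cdivide DERIV_ident)+
  also have "(2 * of_real pi * \<i> * e2pi (z / 12) * (1 / 12)) * exp (- 2 * log_euler (e2pi z)) +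
     (exp (- 2 * log_euler (e2pi z)) * (- 2 * (D * (2 * of_real pi * \<i> * e2pi z)))) * e2pi (z / 12) =
     (2 * of_real pi * \<i> / 12 - 4 * of_real pi * \<i> * (e2pi z * D)) * eta2 z"
    by (simp add: eta2_def algebra_simps)
  finally show ?thesis unfolding D(2) eta2_def[abs_def] .
qed

lemma eta2_holomorphic: "eta2 holomorphic_on uhp"
  using has_field_derivative_eta2
  by (intro holomorphic_onI) (metis field_differentiable_at_within field_differentiable_def)

lemma inversion_in_uhp: "z \<in> uhp \<Longrightarrow> - 1 / z \<in> uhp"
  by (auto simp: uhp_def Im_divide zero_less_divide_iff sum_power2_gt_zero_iff)

text \<open>\<open>D\<close> is the logarithmic derivative of \<open>eta2\<close>, so
  \<open>lambert_inversion\<close> says precisely that the quotient \<open>r\<close> has derivative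
  0. The constant is read off at \<open>\<i>\<close>, the fixed point of the inversion.\<close>

lemma eta2_inversion:
  assumes z: "z \<in> uhp"
  shows "eta2 (- 1 / z) = - \<i> * z * eta2 z"
proof -
  define r where "r = (\<lambda>z. eta2 (- 1 / z) / (z * eta2 z))"
  have nz: "z \<noteq> 0" if "z \<in> uhp" for z using that by (auto simp: uhp_def)
  define D where "D = (\<lambda>z. 2 * of_real pi * \<i> / 12 - 4 * of_real pi * \<i> * lambert (e2pi z))"
  have DD: "D (- 1 / z) / z\<^sup>2 = D z + 1 / z" if z: "z \<in> uhp" for z
  proof -
    define p :: complex where "p = of_real pi"
    have p: "p \<noteq> 0" by (simp add: p_def)
    have D_alt: "D w = (- \<i> / (2 * p)) * (8 * p ^ 2 * lambert (e2pi w) - p ^ 2 / 3)" for w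
      using p by (simp add: D_def p_def[symmetric] field_simps power2_eq_square)
    have "8 * p ^ 2 * lambert (e2pi z) - p ^ 2 / 3 + 2 * p * \<i> / z =
         (8 * p ^ 2 * lambert (e2pi (- 1 / z)) - p ^ 2 / 3) / z\<^sup>2"
      using lambert_inversion[of z] z by (simp add: uhp_def p_def)
    hence "D (- 1 / z) / z\<^sup>2 = (- \<i> / (2 * p)) * (8 * p ^ 2 * lambert (e2pi z) - p ^ 2 / 3 + 2 * p * \<i> / z)"
      unfolding D_alt by (simp only: times_divide_eq_right)
    also have "\<dots> = D z + (- \<i> / (2 * p)) * (2 * p * \<i> / z)"
      unfolding D_alt by (rule distrib_left)
    also have "(- \<i> / (2 * p)) * (2 * p * \<i> / z) = 1 / z"
      using p nz[OF z] by (simp add: field_simps)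
    finally show ?thesis .
  qed
  have der: "(r has_field_derivative 0) (at z within uhp)" if z: "z \<in> uhp" for z
  proof -
    have 1: "((\<lambda>z. eta2 (- 1 / z)) has_field_derivative (D (- 1 / z) * eta2 (- 1 / z)) * (1 / z\<^sup>2)) (at z)"
      using has_field_derivative_eta2[OF inversion_in_uhp[OF z]] nz[OF z]
      by (intro DERIV_chain2[where g = "\<lambda>z. - 1 / z"])
        (auto simp: D_def power2_eq_square intro!: derivative_eq_intros)
    have 2: "((\<lambda>z. z * eta2 z) has_field_derivative (1 * eta2 z + (D z * eta2 z) * z)) (at z)"
      using has_field_derivative_eta2[OF z] by (intro DERIV_mult DERIV_ident) (simp add: D_def)
    have "(r has_field_derivative
       ((D (- 1 / z) * eta2 (- 1 / z)) * (1 / z\<^sup>2) * (z * eta2 z) - eta2 (- 1 / z) * (1 * eta2 z + (D z * eta2 z) * z))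
       / ((z * eta2 z) * (z * eta2 z))) (at z)"
      unfolding r_def by (rule DERIV_divide[OF 1 2]) (use nz[OF z] in simp)
    also have "(D (- 1 / z) * eta2 (- 1 / z)) * (1 / z\<^sup>2) * (z * eta2 z) - eta2 (- 1 / z) * (1 * eta2 z + (D z * eta2 z) * z)
      = eta2 (- 1 / z) * eta2 z * ((D (- 1 / z) / z\<^sup>2) * z - 1 - D z * z)"
      by (simp add: algebra_simps)
    also have "(D (- 1 / z) / z\<^sup>2) * z - 1 - D z * z = 0"
      unfolding DD[OF z] using nz[OF z] by (simp add: ring_distribs)
    finally show ?thesis by (simp add: has_field_derivative_at_within)
  qed
  have "convex uhp" by (simp add: uhp_def convex_halfspace_Im_gt)
  then obtain c where c: "\<And>z. z \<in> uhp \<Longrightarrow> r z = c"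
    using has_field_derivative_zero_constant[OF _ der] by blast
  have "r \<i> = 1 / \<i>" by (simp add: r_def)
  hence "c = - \<i>" using c[of \<i>] by simp
  hence "r z = - \<i>" using c[OF z] by simp
  thus ?thesis using nz[OF z] by (simp add: r_def divide_eq_eq)
qed

section \<open>The multiplier of \<open>eta2\<close> under the modular group\<close>

text \<open>Exponent modulo 12 of the multiplier of \<open>eta2\<close>.\<close>
definition eta_exponent :: "int \<Rightarrow> int \<Rightarrow> int \<Rightarrow> int \<Rightarrow> int" where
  "eta_exponent a b c d = (1 - c\<^sup>2) * (b * d + 3 * (c - 1) * d + c + 3) + c * (a + d - 3)"

text \<open>Reduces a divisibility under a determinant condition \<open>Q = 0\<close> to finitely
  many residues. Modulus 12 is treated as 3 and 4 separately, so that 81 and 256 cases replace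
  \<open>12^4\<close>.\<close>

lemma dvd_of_residues4:
  fixes P Q :: "int \<Rightarrow> int \<Rightarrow> int \<Rightarrow> int \<Rightarrow> int" and m :: int
  assumes m: "m > 0"
    and cong: "\<And>a b c d. [P (a mod m) (b mod m) (c mod m) (d mod m) = P a b c d] (mod m)"
              "\<And>a b c d. [Q (a mod m) (b mod m) (c mod m) (d mod m) = Q a b c d] (mod m)"
    and res: "\<forall>a\<in>{0..<m}. \<forall>b\<in>{0..<m}. \<forall>c\<in>{0..<m}. \<forall>d\<in>{0..<m}. Q a b c d mod m = 0 \<longrightarrow> P a b c d mod m = 0"
    and Q: "Q a b c d = 0"
  shows "m dvd P a b c d"
proof -
  have "Q (a mod m) (b mod m) (c mod m) (d mod m) mod m = 0"
    using cong(2)[of a b c d] Q by (simp add: cong_def)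
  hence "P (a mod m) (b mod m) (c mod m) (d mod m) mod m = 0" using res m by simp
  moreover have "P (a mod m) (b mod m) (c mod m) (d mod m) mod m = P a b c d mod m"
    using cong(1)[of a b c d] unfolding cong_def .
  ultimately have "P a b c d mod m = 0" by (simp only:)
  thus ?thesis by (rule mod_0_imp_dvd)
qed

lemma int_ranges: "{0..<3::int} = {0, 1, 2}" "{0..<4::int} = {0, 1, 2, 3}" by auto

lemma twelve_dvd_iff: "(12::int) dvd n \<longleftrightarrow> 3 dvd n \<and> 4 dvd n"
  by presburger

text \<open>The summand 3 matches the factor \<open>- \<i> = e2pi (- 3 / 12)\<close> in
  \<open>eta2_inversion\<close>.\<close>

lemma eta_exponent_inversion:
  assumes "a * d - b * c = 1"
  shows "12 dvd eta_exponent (- c) (- d) a b - eta_exponent a b c d + 3"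
proof -
  define P :: "int \<Rightarrow> int \<Rightarrow> int \<Rightarrow> int \<Rightarrow> int" where
    "P = (\<lambda>a b c d. ((1 - a\<^sup>2) * (3 * (a - 1) * b + a + 3 - d * b) + a * (b - c - 3)) -
       ((1 - c\<^sup>2) * (b * d + 3 * (c - 1) * d + c + 3) + c * (a + d - 3)) + 3)"
  define Q :: "int \<Rightarrow> int \<Rightarrow> int \<Rightarrow> int \<Rightarrow> int" where "Q = (\<lambda>a b c d. a * d - b * c - 1)"
  have Q0: "Q a b c d = 0" using assms by (simp add: Q_def)
  have P_cong: "[P (a mod m) (b mod m) (c mod m) (d mod m) = P a b c d] (mod m)" for a b c d m
    unfolding P_def by (intro cong_add cong_diff cong_mult cong_pow cong_refl cong_mod_left[THEN iffD2])
  have Q_cong: "[Q (a mod m) (b mod m) (c mod m) (d mod m) = Q a b c d] (mod m)" for a b c d m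
    unfolding Q_def by (intro cong_add cong_diff cong_mult cong_pow cong_refl cong_mod_left[THEN iffD2])
  have "3 dvd P a b c d"
    by (rule dvd_of_residues4[where P = P and Q = Q, OF _ P_cong Q_cong _ Q0]) (simp_all add: int_ranges P_def Q_def)
  moreover have "4 dvd P a b c d"
    by (rule dvd_of_residues4[where P = P and Q = Q, OF _ P_cong Q_cong _ Q0]) (simp_all add: int_ranges P_def Q_def)
  ultimately have "12 dvd P a b c d" by (simp add: twelve_dvd_iff)
  also have "P a b c d = eta_exponent (- c) (- d) a b - eta_exponent a b c d + 3"
    by (simp add: P_def eta_exponent_def algebra_simps)
  finally show ?thesis .
qed

text \<open>The expression equals \<open>- n (1 - c^2) (1 - d^2)\<close>. Since \<open>c\<close> and
  \<open>d\<close> are coprime, they are not both divisible by 3 nor both even, and so 12 divides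
  it.\<close>

lemma eta_exponent_translation:
  assumes "a * d - b * c = 1"
  shows "12 dvd eta_exponent (a + n * c) (b + n * d) c d - eta_exponent a b c d - n"
proof -
  define P :: "int \<Rightarrow> int \<Rightarrow> int \<Rightarrow> int \<Rightarrow> int" where "P = (\<lambda>a b c d. (1 - c\<^sup>2) * (1 - d\<^sup>2))"
  define Q :: "int \<Rightarrow> int \<Rightarrow> int \<Rightarrow> int \<Rightarrow> int" where "Q = (\<lambda>a b c d. a * d - b * c - 1)"
  have Q0: "Q a b c d = 0" using assms by (simp add: Q_def)
  have P_cong: "[P (a mod m) (b mod m) (c mod m) (d mod m) = P a b c d] (mod m)" for a b c d m
    unfolding P_def by (intro cong_add cong_diff cong_mult cong_pow cong_refl cong_mod_left[THEN iffD2])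
  have Q_cong: "[Q (a mod m) (b mod m) (c mod m) (d mod m) = Q a b c d] (mod m)" for a b c d m
    unfolding Q_def by (intro cong_add cong_diff cong_mult cong_pow cong_refl cong_mod_left[THEN iffD2])
  have "3 dvd P a b c d"
    by (rule dvd_of_residues4[where P = P and Q = Q, OF _ P_cong Q_cong _ Q0]) (simp_all add: int_ranges P_def Q_def)
  moreover have "4 dvd P a b c d"
    by (rule dvd_of_residues4[where P = P and Q = Q, OF _ P_cong Q_cong _ Q0]) (simp_all add: int_ranges P_def Q_def)
  ultimately have "12 dvd P a b c d" by (simp add: twelve_dvd_iff)
  hence "12 dvd - n * P a b c d" by simp
  also have "- n * P a b c d = eta_exponent (a + n * c) (b + n * d) c d - eta_exponent a b c d - n"
    by (simp add: P_def eta_exponent_def algebra_simps power2_eq_square)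
  finally show ?thesis .
qed

lemma e2pi_12_cong:
  assumes "12 dvd k - l"
  shows "e2pi (of_int k / 12) = e2pi (of_int l / 12)"
proof -
  obtain j where "k - l = 12 * j" using assms by blast
  hence "k = l + 12 * j" by simp
  hence "of_int k / 12 = of_int l / 12 + (of_int j :: complex)" by (simp add: add_divide_distrib)
  thus ?thesis by (simp add: e2pi_add)
qed

definition eta2_transforms :: "int \<Rightarrow> int \<Rightarrow> int \<Rightarrow> int \<Rightarrow> bool" where
  "eta2_transforms a b c d \<longleftrightarrow> (\<forall>z\<in>uhp. eta2 ((of_int a * z + of_int b) / (of_int c * z + of_int d)) =
     e2pi (of_int (eta_exponent a b c d) / 12) * (of_int c * z + of_int d) * eta2 z)"

lemma int_moebius_aux:
  assumes "a * d - b * c = 1" "z \<in> uhp"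
  shows "of_int c * z + of_int d \<noteq> 0" "(of_int a * z + of_int b) / (of_int c * z + of_int d) \<in> uhp"
    "of_int a * z + of_int b \<noteq> 0"
proof -
  have A: "int_mat2 a b c d \<in> SL2Z" using assms by (simp add: int_mat2_in_SL2Z_iff)
  show 1: "of_int c * z + of_int d \<noteq> 0"
    using moebius_denom_nonzero[of "int_mat2 a b c d" z] A assms by simp
  show 2: "(of_int a * z + of_int b) / (of_int c * z + of_int d) \<in> uhp"
    using SL2Z_moebius_in_uhp[OF A assms(2)] by (simp add: moebius_act_int_mat2)
  thus "of_int a * z + of_int b \<noteq> 0" by (auto simp: uhp_def)
qed

lemma eta2_transforms_translation:
  assumes det: "a * d - b * c = 1" and t: "eta2_transforms a b c d"
  shows "eta2_transforms (a + n * c) (b + n * d) c d"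
  unfolding eta2_transforms_def
proof
  fix z assume z: "z \<in> uhp"
  let ?j = "of_int c * z + of_int d :: complex"
  have j: "?j \<noteq> 0" using int_moebius_aux[OF det z] by simp
  have "(of_int (a + n * c) * z + of_int (b + n * d)) / ?j = (of_int a * z + of_int b) / ?j + of_int n"
  proof -
    have "of_int (a + n * c) * z + of_int (b + n * d) = (of_int a * z + of_int b) + of_int n * ?j"
      by (simp add: algebra_simps)
    moreover have "(u + v * w) / w = u / w + v" if "w \<noteq> 0" for u v w :: complex
      using that by (simp add: add_divide_distrib)
    ultimately show ?thesis using j by (simp only:)
  qed
  hence "eta2 ((of_int (a + n * c) * z + of_int (b + n * d)) / ?j) =
      e2pi (of_int n / 12) * (e2pi (of_int (eta_exponent a b c d) / 12) * ?j * eta2 z)"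
    using t z by (simp add: eta2_add_of_int eta2_transforms_def)
  also have "\<dots> = e2pi (of_int (eta_exponent a b c d + n) / 12) * ?j * eta2 z"
    by (simp add: e2pi_add add_divide_distrib)
  also have "e2pi (of_int (eta_exponent a b c d + n) / 12) = e2pi (of_int (eta_exponent (a + n * c) (b + n * d) c d) / 12)"
    using eta_exponent_translation[OF det, of n] by (intro e2pi_12_cong) (simp add: dvd_diff_commute algebra_simps)
  finally show "eta2 ((of_int (a + n * c) * z + of_int (b + n * d)) / ?j) =
    e2pi (of_int (eta_exponent (a + n * c) (b + n * d) c d) / 12) * ?j * eta2 z" .
qed

lemma e2pi_quarter: "e2pi (- 3 / 12) = - \<i>"
proof -
  have "2 * complex_of_real pi * \<i> * (- 3 / 12) = - (\<i> * (of_real pi / 2))" by simp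
  hence "e2pi (- 3 / 12) = inverse (exp (\<i> * (of_real pi / 2)))" by (simp only: e2pi_def exp_minus)
  also have "exp (\<i> * (of_real pi / 2)) = \<i>"     using cis_conv_exp[of "pi / 2"] by (simp add: cis_pi_half)
  finally show ?thesis by simp
qed

lemma eta2_transforms_inversion:
  assumes det: "a * d - b * c = 1" and t: "eta2_transforms a b c d"
  shows "eta2_transforms (- c) (- d) a b"
  unfolding eta2_transforms_def
proof
  fix z assume z: "z \<in> uhp"
  let ?j = "of_int c * z + of_int d :: complex" and ?k = "of_int a * z + of_int b :: complex"
  note aux = int_moebius_aux[OF det z]
  have "(of_int (- c) * z + of_int (- d)) / ?k = - 1 / (?k / ?j)"
  proof -
    have "of_int (- c) * z + of_int (- d) = - ?j" by simp
    thus ?thesis using aux by simp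
  qed
  hence "eta2 ((of_int (- c) * z + of_int (- d)) / ?k) = - \<i> * (?k / ?j) * (e2pi (of_int (eta_exponent a b c d) / 12) * ?j * eta2 z)"
    using eta2_inversion[OF aux(2)] t z by (simp add: eta2_transforms_def)
  also have "\<dots> = (- \<i> * e2pi (of_int (eta_exponent a b c d) / 12)) * ?k * eta2 z"
    using aux(1) by simp
  also have "- \<i> * e2pi (of_int (eta_exponent a b c d) / 12) = e2pi (of_int (eta_exponent a b c d - 3) / 12)"
    unfolding e2pi_quarter[symmetric] e2pi_add[symmetric] by (simp add: add_divide_distrib diff_divide_distrib)
  also have "\<dots> = e2pi (of_int (eta_exponent (- c) (- d) a b) / 12)"
    using eta_exponent_inversion[OF det] by (intro e2pi_12_cong) (simp add: dvd_diff_commute algebra_simps)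
  finally show "eta2 ((of_int (- c) * z + of_int (- d)) / ?k) =
    e2pi (of_int (eta_exponent (- c) (- d) a b) / 12) * ?k * eta2 z" .
qed

text \<open>Euclid's algorithm on the first column: a translation replaces \<open>a\<close> by
  \<open>a mod c\<close>, an inversion exchanges the rows up to sign, and
  \<open>\<bar>c\<bar>\<close> decreases.\<close>

theorem eta2_transforms_SL2Z:
  assumes "a * d - b * c = 1"
  shows "eta2_transforms a b c d"
  using assms
proof (induction "nat \<bar>c\<bar>" arbitrary: a b c d rule: less_induct)
  case less
  show ?case
  proof (cases "c = 0")
    case True
    have "a = 1 \<and> d = 1 \<or> a = - 1 \<and> d = - 1" using less.prems True by (auto simp: zmult_eq_1_iff)
    moreover have "eta2_transforms 1 0 0 1" by (simp add: eta2_transforms_def eta_exponent_def)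
    from eta2_transforms_translation[OF _ this, of b] have "eta2_transforms 1 b 0 1" by simp
    \<comment> \<open>The negative of the identity acts trivially on \<open>z\<close>; its exponent
      is 6, and \<open>e2pi (6 / 12) = - 1\<close> cancels the automorphy factor
      \<open>- 1\<close>.\<close>
    moreover have "eta2_transforms (- 1) 0 0 (- 1)"
    proof -
      have "2 * complex_of_real pi * \<i> * (6 / 12) = \<i> * of_real pi" by simp
      hence "e2pi (6 / 12) = exp (\<i> * of_real pi)" by (simp only: e2pi_def)
      hence "e2pi (6 / 12) = - 1" by (simp add: exp_pi_i')
      thus ?thesis by (simp add: eta2_transforms_def eta_exponent_def)
    qed
    from eta2_transforms_translation[OF _ this, of "- b"] have "eta2_transforms (- 1) b 0 (- 1)" by simp
    ultimately show ?thesis using True by auto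
  next
    case False
    define n where "n = a div c"
    define r where "r = a mod c"
    have a: "a = r + n * c" by (simp add: n_def r_def)
    have r: "\<bar>r\<bar> < \<bar>c\<bar>" using False abs_mod_less[of c a] by (simp add: r_def)
    have det: "c * (- (b - n * d)) - d * (- r) = 1" using less.prems by (simp add: a algebra_simps)
    have "eta2_transforms c d (- r) (- (b - n * d))"
      by (rule less.hyps[OF _ det]) (use r in auto)
    from eta2_transforms_inversion[OF det this] have "eta2_transforms r (b - n * d) c d" by simp
    from eta2_transforms_translation[OF _ this, of n] show ?thesis
      using less.prems by (simp add: a algebra_simps)
  qed
qed

section \<open>Expansions at the cusps\<close>

text \<open>Operations in the field agree with pointwise operations only off a sparse set, as values
  at poles are set to 0. Where the right-hand side is analytic, the normal form of representatives
  upgrades such an identity to the point itself.\<close>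

lemma mero_eval_eqI:
  assumes w: "w \<in> uhp" and k: "k analytic_on {w}"
    and ev: "\<forall>\<^sub>F z in at w. mero_eval f z = k z"
  shows "mero_eval f w = k w"
proof -
  have "k \<midarrow>w\<rightarrow> k w" using analytic_at_imp_isCont[OF k] by (simp add: isCont_def)
  hence lim: "mero_eval f \<midarrow>w\<rightarrow> k w" using ev by (subst tendsto_cong[OF ev])
  hence "\<not> is_pole (mero_eval f) w"
    unfolding is_pole_def using not_tendsto_and_filterlim_at_infinity[of "at w"] by auto
  hence "mero_eval f \<midarrow>w\<rightarrow> mero_eval f w"
    using nicely_meromorphic_mero_eval[of f] w by (auto simp: nicely_meromorphic_on_def)
  thus ?thesis using lim LIM_unique by blast
qed

lemma eventually_cosparse_uhp_at: "\<forall>\<^sub>\<approx>z\<in>uhp. P z \<Longrightarrow> w \<in> uhp \<Longrightarrow> \<forall>\<^sub>F z in at w. P z"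
  by (simp add: eventually_cosparse_open_eq)

lemma mero_eval_analytic_op:
  assumes "w \<in> uhp" "mero_eval f analytic_on {w}" "mero_eval g analytic_on {w}"
  shows mero_eval_add_at: "mero_eval (f + g) w = mero_eval f w + mero_eval g w"
    and mero_eval_mult_at: "mero_eval (f * g) w = mero_eval f w * mero_eval g w"
    and mero_eval_diff_at: "mero_eval (f - g) w = mero_eval f w - mero_eval g w"
    and mero_eval_uminus_at: "mero_eval (- f) w = - mero_eval f w"
proof -
  show "mero_eval (f + g) w = mero_eval f w + mero_eval g w"
    by (rule mero_eval_eqI[where k = "\<lambda>w. mero_eval f w + mero_eval g w"])
      (use assms mero_eval_add eventually_cosparse_uhp_at in \<open>auto intro: analytic_intros\<close>)
  show "mero_eval (f * g) w = mero_eval f w * mero_eval g w"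
    by (rule mero_eval_eqI[where k = "\<lambda>w. mero_eval f w * mero_eval g w"])
      (use assms mero_eval_mult eventually_cosparse_uhp_at in \<open>auto intro: analytic_intros\<close>)
  show "mero_eval (f - g) w = mero_eval f w - mero_eval g w"
    by (rule mero_eval_eqI[where k = "\<lambda>w. mero_eval f w - mero_eval g w"])
      (use assms mero_eval_diff eventually_cosparse_uhp_at in \<open>auto intro: analytic_intros\<close>)
  show "mero_eval (- f) w = - mero_eval f w"
    by (rule mero_eval_eqI[where k = "\<lambda>w. - mero_eval f w"])
      (use assms mero_eval_uminus eventually_cosparse_uhp_at in \<open>auto intro: analytic_intros\<close>)
qed

abbreviation q_par :: "nat \<Rightarrow> complex \<Rightarrow> complex" where
  "q_par h z \<equiv> exp (2 * of_real pi * \<i> * z / of_nat h)"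

lemma norm_q_par: "norm (q_par h z) = exp (- (2 * pi * Im z / real h))"
proof -
  have "2 * of_real pi * \<i> * z / of_nat h = (2 * pi / real h) *\<^sub>R (\<i> * z)"
    by (simp add: scaleR_conv_of_real)
  thus ?thesis by simp
qed

lemma eventually_at_0_q_par:
  assumes h: "h > 0" and ev: "\<forall>\<^sub>F w in at 0. P w"
  obtains Y where "Y \<ge> 0" "\<And>z. Im z > Y \<Longrightarrow> P (q_par h z)"
proof -
  obtain d where d: "d > 0" "\<And>w. w \<noteq> 0 \<Longrightarrow> norm w < d \<Longrightarrow> P w"
    using ev by (auto simp: eventually_at)
  define Y where "Y = max 0 (- ln d * real h / (2 * pi))"
  have "P (q_par h z)" if "Im z > Y" for z
  proof (rule d(2))
    have "- ln d * real h / (2 * pi) < Im z" using that by (simp add: Y_def)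
    hence "- ln d * real h < Im z * (2 * pi)" by (simp only: pos_divide_less_eq pi_gt_zero zero_less_mult_iff zero_less_numeral simp_thms)
    hence "- ln d < Im z * (2 * pi) / real h" using h by (simp only: pos_less_divide_eq of_nat_0_less_iff)
    hence "- ln d < 2 * pi * Im z / real h" by (simp only: mult_ac)
    hence "- (2 * pi * Im z / real h) < ln d" by simp
    hence "exp (- (2 * pi * Im z / real h)) < exp (ln d)" by (simp only: exp_less_cancel_iff)
    thus "norm (q_par h z) < d" using d(1) by (simp only: norm_q_par exp_ln)
  qed simp
  thus ?thesis using that[of Y] by (simp add: Y_def)
qed

lemma has_laurent_eventually_analytic:
  assumes "F has_laurent_expansion L"
  shows "\<forall>\<^sub>F w in at 0. F analytic_on {w}"
proof -
  have "isolated_singularity_at F 0" using assms by (rule has_laurent_expansion_isolated_0)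
  then obtain r where r: "r > 0" "F analytic_on ball 0 r - {0}" by (auto simp: isolated_singularity_at_def)
  have "\<forall>\<^sub>F w in at 0. w \<in> ball 0 r - {0 :: complex}" using r by (intro eventually_at_in_open) auto
  thus ?thesis by eventually_elim (use r analytic_on_subset in blast)
qed

lemma has_q_expansionI:
  assumes F: "F has_laurent_expansion L" and h: "h > 0"
    and g: "\<And>z. Im z > Y \<Longrightarrow> g z = F (q_par h z)"
  shows "has_q_expansion g h L"
proof -
  have "\<forall>\<^sub>F w in at 0. eval_fls L w = F w" and rad: "fls_conv_radius L > 0"
    using F by (auto simp: has_laurent_expansion_def)
  then obtain Y' where Y': "\<And>z. Im z > Y' \<Longrightarrow> eval_fls L (q_par h z) = F (q_par h z)"
    using eventually_at_0_q_par[OF h, of "\<lambda>w. eval_fls L w = F w"] by metis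
  show ?thesis
    unfolding has_q_expansion_def
    by (intro conjI rad exI[of _ "max Y Y'"]) (simp add: g Y')
qed

lemma has_q_expansionE:
  assumes "has_q_expansion g h L"
  obtains Y where "Y \<ge> 0" "eval_fls L has_laurent_expansion L" "\<And>z. Im z > Y \<Longrightarrow> g z = eval_fls L (q_par h z)"
proof -
  obtain Y where "fls_conv_radius L > 0" "\<And>z. Im z > Y \<Longrightarrow> g z = eval_fls L (q_par h z)"
    using assms by (auto simp: has_q_expansion_def)
  thus ?thesis using that[of "max Y 0"] eval_fls_has_laurent_expansion by auto
qed

lemma has_q_expansion_mero:
  assumes F: "F has_laurent_expansion L" and h: "h > 0"
    and ev: "\<And>z. Im z > Y \<Longrightarrow> \<forall>\<^sub>F w in at z. mero_eval f w = F (q_par h w)"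
  shows "has_q_expansion (mero_eval f) h L"
proof -
  obtain Y' where Y': "Y' \<ge> 0" "\<And>z. Im z > Y' \<Longrightarrow> F analytic_on {q_par h z}"
    using eventually_at_0_q_par[OF h has_laurent_eventually_analytic[OF F]] by metis
  show ?thesis
  proof (rule has_q_expansionI[OF F h])
    fix z assume z: "Im z > max Y Y'"
    have "(\<lambda>z. F (q_par h z)) analytic_on {z}"
    proof (rule analytic_on_compose_gen[where f = "q_par h" and g = F and T = "{q_par h z}", unfolded o_def])
      show "q_par h analytic_on {z}" using h by (intro analytic_intros) auto
      show "F analytic_on {q_par h z}" using Y'(2)[of z] z by simp
    qed auto
    thus "mero_eval f z = F (q_par h z)"
      using z Y' by (intro mero_eval_eqI ev) (auto simp: uhp_def)
  qed
qed

lemma eventually_Im_gt: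
  assumes "\<And>z. Im z > Y \<Longrightarrow> P z" "Im w > Y"
  shows "\<forall>\<^sub>F z in at w. P z"
proof -
  have "\<forall>\<^sub>F z in at w. z \<in> {z. Im z > Y}"
    using assms by (intro eventually_at_in_open') (auto simp: open_halfspace_Im_gt)
  thus ?thesis by eventually_elim (use assms in simp)
qed

text \<open>One argument for all field operations; negation and inversion are the instances where
  \<open>op\<close> ignores its second argument.\<close>

lemma has_q_expansion_mero_binop:
  assumes h: "h > 0" and f: "has_q_expansion (mero_eval f) h L" and g: "has_q_expansion (mero_eval g) h M"
    and op: "\<And>F G. F has_laurent_expansion L \<Longrightarrow> G has_laurent_expansion M \<Longrightarrow> (\<lambda>w. op (F w) (G w)) has_laurent_expansion K"
    and e: "\<forall>\<^sub>\<approx>z\<in>uhp. mero_eval e z = op (mero_eval f z) (mero_eval g z)"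
  shows "has_q_expansion (mero_eval e) h K"
proof -
  obtain Y where Y: "Y \<ge> 0" "eval_fls L has_laurent_expansion L" "\<And>z. Im z > Y \<Longrightarrow> mero_eval f z = eval_fls L (q_par h z)"
    using f by (rule has_q_expansionE) blast
  obtain Y' where Y': "Y' \<ge> 0" "eval_fls M has_laurent_expansion M" "\<And>z. Im z > Y' \<Longrightarrow> mero_eval g z = eval_fls M (q_par h z)"
    using g by (rule has_q_expansionE) blast
  show ?thesis
  proof (rule has_q_expansion_mero[OF op[OF Y(2) Y'(2)] h])
    fix z assume z: "Im z > max Y Y'"
    hence "z \<in> uhp" using Y by (simp add: uhp_def)
    have "\<forall>\<^sub>F w in at z. mero_eval e w = op (mero_eval f w) (mero_eval g w)"
      using e \<open>z \<in> uhp\<close> by (rule eventually_cosparse_uhp_at)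
    moreover have "\<forall>\<^sub>F w in at z. mero_eval f w = eval_fls L (q_par h w)"
      by (rule eventually_Im_gt[where Y = Y]) (use Y(3) z in auto)
    moreover have "\<forall>\<^sub>F w in at z. mero_eval g w = eval_fls M (q_par h w)"
      by (rule eventually_Im_gt[where Y = Y']) (use Y'(3) z in auto)
    ultimately show "\<forall>\<^sub>F w in at z. mero_eval e w = op (eval_fls L (q_par h w)) (eval_fls M (q_par h w))"
      by eventually_elim simp
  qed
qed

lemma
  assumes "h > 0" "has_q_expansion (mero_eval f) h L" "has_q_expansion (mero_eval g) h M"
  shows has_q_expansion_add: "has_q_expansion (mero_eval (f + g)) h (L + M)"
    and has_q_expansion_mult: "has_q_expansion (mero_eval (f * g)) h (L * M)"
  by (rule has_q_expansion_mero_binop[OF assms, where op = "(+)"])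
     (auto intro: laurent_expansion_intros mero_eval_add,
      rule has_q_expansion_mero_binop[OF assms, where op = "(*)"],
      auto intro: laurent_expansion_intros mero_eval_mult)

lemma has_q_expansion_uminus:
  assumes "h > 0" "has_q_expansion (mero_eval f) h L"
  shows "has_q_expansion (mero_eval (- f)) h (- L)"
  by (rule has_q_expansion_mero_binop[OF assms assms(2), where op = "\<lambda>x _. - x"])
    (auto intro: laurent_expansion_intros mero_eval_uminus)

lemma has_q_expansion_eq_0:
  assumes h: "h > 0" and f: "has_q_expansion (mero_eval f) h 0"
  shows "f = 0"
proof (rule ccontr)
  assume "f \<noteq> 0"
  hence nz: "\<forall>\<^sub>\<approx>z\<in>uhp. mero_eval f z \<noteq> 0" by (rule mero_nonzero)
  obtain Y where Y: "Y \<ge> 0" "\<And>z. Im z > Y \<Longrightarrow> mero_eval f z = eval_fls 0 (q_par h z)"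
    using f by (rule has_q_expansionE) blast
  define w where "w = Complex 0 (Y + 1)"
  have w: "Im w > Y" "w \<in> uhp" using Y by (auto simp: w_def uhp_def)
  have "\<forall>\<^sub>F z in at w. mero_eval f z = 0" using eventually_Im_gt[of Y "\<lambda>z. mero_eval f z = 0"] Y(2) w(1) by simp
  with eventually_cosparse_uhp_at[OF nz w(2)] have "\<forall>\<^sub>F z in at w. False" by eventually_elim simp
  thus False by simp
qed

lemma has_q_expansion_inverse:
  assumes h: "h > 0" and f: "has_q_expansion (mero_eval f) h L"
  shows "has_q_expansion (mero_eval (inverse f)) h (inverse L)"
  by (rule has_q_expansion_mero_binop[OF h f f, where op = "\<lambda>x _. inverse x"])
    (auto intro: laurent_expansion_intros mero_eval_inverse)

text \<open>If \<open>L\<close> and \<open>M\<close> differed, 0 would have the nonzero expansion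
  \<open>L - M\<close> and, since \<open>inverse 0 = 0\<close> in the field, also the expansion
  \<open>inverse (L - M)\<close>. Their product would make 1 an expansion of 0.\<close>

lemma has_q_expansion_unique:
  assumes h: "h > 0" and g: "has_q_expansion (mero_eval g) h L" "has_q_expansion (mero_eval g) h M"
  shows "L = M"
proof (rule ccontr)
  assume ne: "L \<noteq> M"
  have "has_q_expansion (mero_eval (g - g)) h (L - M)"
    by (rule has_q_expansion_mero_binop[OF h g, where op = "(-)"])
      (rule has_laurent_expansion_diff mero_eval_diff | assumption)+
  hence D: "has_q_expansion (mero_eval 0) h (L - M)" by simp
  have "has_q_expansion (mero_eval (inverse 0)) h (inverse (L - M))" by (rule has_q_expansion_inverse[OF h D])
  hence "has_q_expansion (mero_eval 0) h (inverse (L - M))" by simp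
  from has_q_expansion_mult[OF h this D] have "has_q_expansion (mero_eval 0) h (inverse (L - M) * (L - M))" by simp
  hence "has_q_expansion (mero_eval 0) h 1" using ne by simp
  then obtain Y where Y: "Y \<ge> 0" "\<And>z. Im z > Y \<Longrightarrow> mero_eval 0 z = eval_fls 1 (q_par h z)"
    by (rule has_q_expansionE) blast
  have "mero_eval 0 (Complex 0 (Y + 1)) = 0"
    using Y(1) by (intro mero_eval_eqI[where k = "\<lambda>_. 0"] eventually_cosparse_uhp_at[OF mero_eval_0]) (auto simp: uhp_def)
  thus False using Y(2)[of "Complex 0 (Y + 1)"] by simp
qed

text \<open>Allows functions expanded at different widths to be combined at a common multiple,
  through \<open>q_par h z = q_par (h * k) z ^ k\<close>.\<close>

lemma has_q_expansion_width_mult: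
  assumes h: "h > 0" and k: "k > 0" and g: "has_q_expansion g h L"
  shows "\<exists>M. has_q_expansion g (h * k) M"
proof -
  obtain Y where Y: "Y \<ge> 0" "eval_fls L has_laurent_expansion L" "\<And>z. Im z > Y \<Longrightarrow> g z = eval_fls L (q_par h z)"
    using g by (rule has_q_expansionE) blast
  have mer: "eval_fls L meromorphic_on {0}"
    using Y(2) by (auto simp: meromorphic_on_def)
  have "(\<lambda>w. eval_fls L (w ^ k)) meromorphic_on {0}"
    by (rule meromorphic_on_compose[OF mer]) (use k in \<open>auto intro!: analytic_intros\<close>)
  hence "(\<lambda>w. eval_fls L (w ^ k)) has_laurent_expansion laurent_expansion (\<lambda>w. eval_fls L (w ^ k)) 0"
    using meromorphic_on_imp_has_laurent_expansion[of _ "{0}" 0] by simp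
  moreover have "q_par (h * k) z ^ k = q_par h z" for z
    unfolding exp_of_nat_mult[symmetric] using k by simp
  ultimately show ?thesis
    using h k Y(3) by (intro exI[of _ "laurent_expansion (\<lambda>w. eval_fls L (w ^ k)) 0"] has_q_expansionI[where Y = Y]) auto
qed

section \<open>Pullbacks and constants as ring homomorphisms\<close>

lemma eventually_cosparse_moebius:
  assumes A: "det A > 0" and P: "\<forall>\<^sub>\<approx>z\<in>uhp. P z"
  shows "\<forall>\<^sub>\<approx>z\<in>uhp. P (moebius_act A z)"
  unfolding eventually_cosparse_open_eq[OF open_uhp]
proof
  fix w assume w: "w \<in> uhp"
  have "moebius_act A analytic_on {w}" using analytic_moebius[OF A] w by (simp add: analytic_on_subset)
  hence lim: "moebius_act A \<midarrow>w\<rightarrow> moebius_act A w" using analytic_at_imp_isCont isContD by blast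
  have "\<forall>\<^sub>F z in at w. z \<in> uhp - {w}" using w by (intro eventually_at_in_open) auto
  hence "\<forall>\<^sub>F z in at w. moebius_act A z \<noteq> moebius_act A w"
    by eventually_elim (use inj_on_moebius[OF A] w in \<open>auto simp: inj_on_def\<close>)
  hence "filterlim (moebius_act A) (at (moebius_act A w)) (at w)" using lim by (simp add: filterlim_at)
  moreover have "eventually P (at (moebius_act A w))"
    using eventually_cosparse_uhp_at[OF P] moebius_in_uhp[OF A w] by blast
  ultimately show "\<forall>\<^sub>F z in at w. P (moebius_act A z)" by (rule eventually_compose_filterlim[rotated])
qed

lemma moebius_pullback_eqI:
  assumes A: "det A > 0" and "\<forall>\<^sub>\<approx>z\<in>uhp. mero_eval g z = mero_eval f (moebius_act A z)"
  shows "moebius_pullback A f = g"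
proof (rule uhp_mero_eqI)
  have "\<forall>\<^sub>\<approx>z\<in>uhp. z \<in> uhp" by (simp add: eventually_in_cosparse)
  thus "\<forall>\<^sub>\<approx>z\<in>uhp. mero_eval (moebius_pullback A f) z = mero_eval g z"
    using assms(2) by eventually_elim (simp add: mero_eval_moebius_pullback[OF A])
qed

lemma eventually_moebius_pullback:
  assumes A: "det A > 0"
  shows "\<forall>\<^sub>\<approx>z\<in>uhp. mero_eval (moebius_pullback A f) z = mero_eval f (moebius_act A z)"
proof -
  have "\<forall>\<^sub>\<approx>z\<in>uhp. z \<in> uhp" by (simp add: eventually_in_cosparse)
  thus ?thesis by eventually_elim (simp add: mero_eval_moebius_pullback[OF A])
qed

lemma
  assumes A: "det A > 0"
  shows moebius_pullback_add: "moebius_pullback A (f + g) = moebius_pullback A f + moebius_pullback A g"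
    and moebius_pullback_mult: "moebius_pullback A (f * g) = moebius_pullback A f * moebius_pullback A g"
    and moebius_pullback_uminus: "moebius_pullback A (- f) = - moebius_pullback A f"
    and moebius_pullback_inverse: "moebius_pullback A (inverse f) = inverse (moebius_pullback A f)"
    and moebius_pullback_1: "moebius_pullback A 1 = 1"
proof -
  note pb = eventually_moebius_pullback[OF A]
  note ev = eventually_cosparse_moebius[OF A]
  show "moebius_pullback A (f + g) = moebius_pullback A f + moebius_pullback A g"
    by (rule moebius_pullback_eqI[OF A]) (use mero_eval_add[of "moebius_pullback A f" "moebius_pullback A g"]
      ev[OF mero_eval_add[of f g]] pb[of f] pb[of g] in eventually_elim, simp)
  show "moebius_pullback A (f * g) = moebius_pullback A f * moebius_pullback A g"
    by (rule moebius_pullback_eqI[OF A]) (use mero_eval_mult[of "moebius_pullback A f" "moebius_pullback A g"]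
      ev[OF mero_eval_mult[of f g]] pb[of f] pb[of g] in eventually_elim, simp)
  show "moebius_pullback A (- f) = - moebius_pullback A f"
    by (rule moebius_pullback_eqI[OF A]) (use mero_eval_uminus[of "moebius_pullback A f"]
      ev[OF mero_eval_uminus[of f]] pb[of f] in eventually_elim, simp)
  show "moebius_pullback A (inverse f) = inverse (moebius_pullback A f)"
    by (rule moebius_pullback_eqI[OF A]) (use mero_eval_inverse[of "moebius_pullback A f"]
      ev[OF mero_eval_inverse[of f]] pb[of f] in eventually_elim, simp)
  show "moebius_pullback A 1 = 1"
    by (rule moebius_pullback_eqI[OF A]) (use mero_eval_1 ev[OF mero_eval_1] in eventually_elim, simp)
qed

lemma is_ring_hom_moebius_pullback: "det A > 0 \<Longrightarrow> is_ring_hom (moebius_pullback A)"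
  by (simp add: is_ring_hom_def moebius_pullback_add moebius_pullback_mult moebius_pullback_1)

definition mero_const :: "complex \<Rightarrow> uhp_mero" where
  "mero_const c = mk_mero (\<lambda>_. c)"

lemma mero_eval_const: "z \<in> uhp \<Longrightarrow> mero_eval (mero_const c) z = c"
  unfolding mero_const_def by (rule mero_eval_mk_mero_nice) auto

lemma eventually_mero_const: "\<forall>\<^sub>\<approx>z\<in>uhp. mero_eval (mero_const c) z = c"
proof -
  have "\<forall>\<^sub>\<approx>z\<in>uhp. z \<in> uhp" by (simp add: eventually_in_cosparse)
  thus ?thesis by eventually_elim (simp add: mero_eval_const)
qed

lemma is_ring_hom_mero_const: "is_ring_hom mero_const"
  unfolding is_ring_hom_def
proof (intro conjI allI)
  fix a b
  note ev = eventually_mero_const[of a] eventually_mero_const[of b] eventually_mero_const[of "a + b"] eventually_mero_const[of "a * b"]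
  show "mero_const (a + b) = mero_const a + mero_const b"
    by (rule uhp_mero_eqI) (use ev mero_eval_add[of "mero_const a" "mero_const b"] in eventually_elim, simp)
  show "mero_const (a * b) = mero_const a * mero_const b"
    by (rule uhp_mero_eqI) (use ev mero_eval_mult[of "mero_const a" "mero_const b"] in eventually_elim, simp)
  show "mero_const 1 = 1"
    by (rule uhp_mero_eqI) (use eventually_mero_const[of 1] mero_eval_1 in eventually_elim, simp)
qed

lemma is_ring_hom_of_rat:
  fixes h :: "'a::field_char_0 \<Rightarrow> 'b::field_char_0"
  assumes h: "is_ring_hom h"
  shows "h (of_rat r) = of_rat r"
proof -
  note s = is_ring_hom_simps[OF h]
  have nat: "h (of_nat n) = of_nat n" for n by (induction n) (simp_all add: s)
  have int: "h (of_int n) = of_int n" for n by (cases n rule: int_cases2) (simp_all add: s nat)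
  obtain a b where r: "r = Rat.Fract a b" "b > 0" by (cases r)
  have "h (of_rat r) * of_int b = h (of_rat r * of_int b)" by (simp add: s int)
  also have "of_rat r * of_int b = (of_int a :: 'a)" using r by (simp add: of_rat_rat)
  finally have "h (of_rat r) * of_int b = of_int a" by (simp add: int)
  thus ?thesis using r by (simp add: of_rat_rat field_simps)
qed

lemma moebius_pullback_const: "det A > 0 \<Longrightarrow> moebius_pullback A (mero_const c) = mero_const c"
  by (rule moebius_pullback_eqI)
    (use eventually_mero_const[of c] eventually_cosparse_moebius[OF _ eventually_mero_const[of c], of A] in \<open>auto elim: eventually_elim2\<close>)

lemma has_q_expansion_const:
  assumes "h > 0"
  shows "has_q_expansion (mero_eval (mero_const c)) h (fls_const c)"
  by (rule has_q_expansionI[where F = "\<lambda>_. c" and Y = 0]) (use assms in \<open>auto simp: mero_eval_const uhp_def\<close>)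

definition cusp_mero :: "uhp_mero \<Rightarrow> bool" where
  "cusp_mero f \<longleftrightarrow> (\<exists>h L. h > 0 \<and> has_q_expansion (mero_eval f) h L)"

lemma cusp_mero_const: "cusp_mero (mero_const c)"
  unfolding cusp_mero_def using has_q_expansion_const zero_less_one by blast

lemma cusp_mero_ops:
  assumes "cusp_mero f" "cusp_mero g"
  shows "cusp_mero (f + g)" "cusp_mero (f * g)" "cusp_mero (- f)" "cusp_mero (inverse f)"
proof -
  obtain h L h' L' where *: "h > 0" "has_q_expansion (mero_eval f) h L" "h' > 0" "has_q_expansion (mero_eval g) h' L'"
    using assms by (auto simp: cusp_mero_def)
  obtain M M' where M: "has_q_expansion (mero_eval f) (h * h') M" "has_q_expansion (mero_eval g) (h * h') M'"
    using has_q_expansion_width_mult[OF *(1,3,2)] has_q_expansion_width_mult[OF *(3,1,4)] by (auto simp: mult.commute)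
  have "h * h' > 0" using * by simp
  with M * show "cusp_mero (f + g)" "cusp_mero (f * g)" "cusp_mero (- f)" "cusp_mero (inverse f)"
    using has_q_expansion_add has_q_expansion_mult has_q_expansion_uminus has_q_expansion_inverse
    unfolding cusp_mero_def by meson+
qed

text \<open>Phrased with pullbacks, which are ring homomorphisms, both defining conditions pass to
  sums, products and inverses formally.\<close>

lemma X0_complex_functions_altdef:
  "X0_complex_functions N = {f. (\<forall>A\<in>Gamma0 N. moebius_pullback A f = f) \<and> (\<forall>A\<in>SL2Z. cusp_mero (moebius_pullback A f))}"
proof -
  have 1: "(\<forall>z\<in>uhp. mero_eval f (moebius_act A z) = mero_eval f z) \<longleftrightarrow> moebius_pullback A f = f"
    if "A \<in> Gamma0 N" for A f
  proof -
    have A: "det A > 0" using that by (simp add: Gamma0_def)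
    show ?thesis
    proof
      assume "\<forall>z\<in>uhp. mero_eval f (moebius_act A z) = mero_eval f z"
      hence "\<forall>z\<in>uhp. mero_eval (moebius_pullback A f) z = mero_eval f z" by (simp add: mero_eval_moebius_pullback[OF A])
      hence "mero_eval (moebius_pullback A f) = mero_eval f" using mero_eval_outside by (metis ext)
      thus "moebius_pullback A f = f" by (simp add: mero_eval_inject)
    next
      assume "moebius_pullback A f = f"
      thus "\<forall>z\<in>uhp. mero_eval f (moebius_act A z) = mero_eval f z" using mero_eval_moebius_pullback[OF A, of _ f] by simp
    qed
  qed
  have 2: "has_q_expansion (\<lambda>z. mero_eval f (moebius_act A z)) h L \<longleftrightarrow> has_q_expansion (mero_eval (moebius_pullback A f)) h L"
    if A: "A \<in> SL2Z" for A f h L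
  proof -
    have eq: "mero_eval (moebius_pullback A f) z = mero_eval f (moebius_act A z)" if "Im z > max Y 0" for z Y
      using that A by (simp add: mero_eval_moebius_pullback uhp_def)
    \<comment> \<open>Replacing \<open>Y\<close> by \<open>max Y 0\<close> confines the comparison
      to the upper half-plane, where pullback and composition agree.\<close>
    have iff: "(\<exists>Y. \<forall>z. Im z > Y \<longrightarrow> g z = k z) \<longleftrightarrow> (\<exists>Y. \<forall>z. Im z > max Y 0 \<longrightarrow> g z = (k z :: complex))" for g k
      by (metis max.cobounded1 max.strict_coboundedI1 max_less_iff_conj order_le_less_trans)
    show ?thesis unfolding has_q_expansion_def
      by (subst (1 2) iff) (simp only: eq cong: imp_cong)
  qed
  show ?thesis unfolding X0_complex_functions_def cusp_mero_def using 1 2 by (auto 0 4)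
qed

lemma X0_complex_const: "mero_const c \<in> X0_complex_functions N"
  using Gamma0_subset_SL2Z by (auto simp: X0_complex_functions_altdef moebius_pullback_const cusp_mero_const subset_iff)

lemma X0_complex_ops:
  assumes f: "f \<in> X0_complex_functions N" and g: "g \<in> X0_complex_functions N"
  shows "f + g \<in> X0_complex_functions N" "f * g \<in> X0_complex_functions N" "- f \<in> X0_complex_functions N"
    "inverse f \<in> X0_complex_functions N"
proof -
  have det: "det A > 0" if "A \<in> SL2Z \<or> A \<in> Gamma0 N" for A using that Gamma0_subset_SL2Z[of N] by auto
  note pb = moebius_pullback_add moebius_pullback_mult moebius_pullback_uminus moebius_pullback_inverse
  show "f + g \<in> X0_complex_functions N" "f * g \<in> X0_complex_functions N" "- f \<in> X0_complex_functions N"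
    "inverse f \<in> X0_complex_functions N"
    using f g by (auto simp: X0_complex_functions_altdef pb det intro: cusp_mero_ops)
qed

section \<open>Rationality of expansions\<close>

definition rational_fls :: "complex fls \<Rightarrow> bool" where
  "rational_fls L \<longleftrightarrow> (\<forall>n. fls_nth L n \<in> \<rat>)"

lemma rational_fls_ops:
  assumes "rational_fls L" "rational_fls M"
  shows "rational_fls (L + M)" "rational_fls (L * M)" "rational_fls (- L)"
  using assms by (auto simp: rational_fls_def fls_times_nth(1) intro!: Rats_add Rats_mult Rats_sum)

text \<open>The recursion for the coefficients of the inverse involves earlier ones and a division
  by the constant term only.\<close>

lemma rational_fps_inverse:
  fixes f :: "complex fps"
  assumes "\<And>n. fps_nth f n \<in> \<rat>"
  shows "fps_nth (inverse f) n \<in> \<rat>"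
proof (induction n rule: less_induct)
  case (less n)
  show ?case
  proof (cases n)
    case 0 thus ?thesis using assms by (simp add: Rats_inverse)
  next
    case (Suc m)
    have "fps_nth (inverse f) (Suc m) = - inverse (fps_nth f 0) * (\<Sum>i=1..Suc m. fps_nth f i * fps_nth (inverse f) (Suc m - i))"
      by (simp add: fps_inverse_def fps_right_inverse_constructor.simps(2) algebra_simps sum_distrib_left)
    also have "\<dots> \<in> \<rat>" using assms less Suc by (intro Rats_mult Rats_sum Rats_minus_iff[THEN iffD2] Rats_inverse) auto
    finally show ?thesis using Suc by simp
  qed
qed

lemma rational_fls_inverse:
  assumes "rational_fls L"
  shows "rational_fls (inverse L)"
proof -
  have "fps_nth (inverse (fls_base_factor_to_fps L)) n \<in> \<rat>" for n
    using assms by (intro rational_fps_inverse) (simp add: rational_fls_def)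
  thus ?thesis by (auto simp: fls_inverse_def rational_fls_def)
qed

lemma X0_rational_functions_altdef:
  "X0_rational_functions N = {f \<in> X0_complex_functions N. \<exists>L. has_q_expansion (mero_eval f) 1 L \<and> rational_fls L}"
  by (simp add: X0_rational_functions_def rational_fls_def)

lemma X0_rational_ops:
  assumes "f \<in> X0_rational_functions N" "g \<in> X0_rational_functions N"
  shows "f + g \<in> X0_rational_functions N" "f * g \<in> X0_rational_functions N" "- f \<in> X0_rational_functions N"
    "inverse f \<in> X0_rational_functions N"
  using assms has_q_expansion_add[of 1 f _ g] has_q_expansion_mult[of 1 f _ g] has_q_expansion_uminus[of 1 f]
    has_q_expansion_inverse[of 1 f] rational_fls_ops rational_fls_inverse X0_complex_ops[of f N g]
  unfolding X0_rational_functions_altdef by (auto; metis zero_less_one)+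

lemma X0_rational_of_rat: "of_rat r \<in> X0_rational_functions N"
proof -
  have "mero_const (of_rat r) \<in> X0_rational_functions N"
    unfolding X0_rational_functions_altdef
    using X0_complex_const has_q_expansion_const[of 1 "of_rat r"] by (auto simp: rational_fls_def)
  thus ?thesis by (simp add: is_ring_hom_of_rat[OF is_ring_hom_mero_const])
qed

lemma X0_subfield: "X0_subfield N"
  using X0_rational_of_rat[of 0 N] X0_rational_of_rat[of 1 N] X0_rational_ops by unfold_locales auto

text \<open>The principal logarithm defines \<open>F\<close> and shows holomorphy off the negative
  axis. On the disc cut along the positive axis the same values come from
  \<open>Ln (- w) + \<i> * pi\<close>, because two logarithms of \<open>w\<close> correspond to
  arguments that differ by a multiple of the period. The two cut discs cover the punctured
  disc.\<close>

lemma holomorphic_descends_to_q: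
  assumes h: "h > 0" and g: "g holomorphic_on {z. Im z > Y}" and per: "\<And>z. Im z > Y \<Longrightarrow> g (z + of_nat h) = g z"
  obtains F where "F holomorphic_on ball 0 (exp (- (2 * pi * Y / real h))) - {0}"
    "\<And>z. Im z > Y \<Longrightarrow> g z = F (q_par h z)"
proof -
  define r where "r = exp (- (2 * pi * Y / real h))"
  define s where "s = of_nat h / (2 * of_real pi * \<i>)"
  have s0: "s \<noteq> 0" using h by (simp add: s_def)
  define F where "F = (\<lambda>w. g (s * Ln w))"
  have qs: "q_par h (s * l) = exp l" for l
    using h by (simp add: s_def)
  have Ims: "Im (s * l) = - (real h / (2 * pi)) * Re l" for l
  proof -
    have "s = - (of_real (real h / (2 * pi)) * \<i>)"
      by (simp add: s_def divide_simps) (simp add: field_simps)?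
    thus ?thesis by simp
  qed
  have in_dom: "Im (s * l) > Y" if "norm (exp l) < r" for l
  proof -
    have "exp (Re l) < exp (- (2 * pi * Y / real h))" using that by (simp add: r_def)
    hence "Re l < - (2 * pi * Y / real h)" by simp
    hence "(real h / (2 * pi)) * Re l < (real h / (2 * pi)) * (- (2 * pi * Y / real h))"
      using h by (intro mult_strict_left_mono) auto
    also have "\<dots> = - Y" using h by simp
    finally show ?thesis unfolding Ims by linarith
  qed
  have per_int: "g (z + of_int n * of_nat h) = g z" if "Im z > Y" for z n
  proof (cases n rule: int_cases2)
    case (nonneg m)
    have "g (z + of_nat m * of_nat h) = g z"
    proof (induction m)
      case (Suc m)
      have "g (z + of_nat m * of_nat h + of_nat h) = g (z + of_nat m * of_nat h)"
        using that by (intro per) simp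
      thus ?case using Suc by (simp add: algebra_simps)
    qed simp
    thus ?thesis by (simp add: nonneg)
  next
    case (nonpos m)
    have "g (z - of_nat m * of_nat h) = g z"
    proof (induction m)
      case (Suc m)
      have "g (z - of_nat (Suc m) * of_nat h + of_nat h) = g (z - of_nat (Suc m) * of_nat h)"
        using that by (intro per) simp
      thus ?case using Suc by (simp add: algebra_simps)
    qed simp
    thus ?thesis by (simp add: nonpos)
  qed
  have exp_eq: "g (s * l) = g (s * l')" if l: "exp l = exp l'" "norm (exp l') < r" for l l'
  proof -
    obtain n :: int where "l = l' + of_int (2 * n) * pi * \<i>" using l(1) unfolding exp_eq by auto
    hence "s * l = s * l' + of_int n * of_nat h" using h by (simp add: s_def field_simps)
    thus ?thesis using per_int[OF in_dom[OF l(2)]] by simp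
  qed
  have hol1: "F holomorphic_on (ball 0 r - \<real>\<^sub>\<le>\<^sub>0)"
    unfolding F_def
  proof (rule holomorphic_on_compose_gen[OF _ g, unfolded o_def])
    show "(\<lambda>w. s * Ln w) holomorphic_on (ball 0 r - \<real>\<^sub>\<le>\<^sub>0)" by (intro holomorphic_intros) auto
    show "(\<lambda>w. s * Ln w) ` (ball 0 r - \<real>\<^sub>\<le>\<^sub>0) \<subseteq> {z. Y < Im z}"
    proof safe
      fix w :: complex assume "w \<in> ball 0 r" "w \<notin> \<real>\<^sub>\<le>\<^sub>0"
      hence w: "w \<noteq> 0" "norm w < r" by auto
      have "norm (exp (Ln w)) < r" unfolding exp_Ln[OF w(1)] by (rule w(2))
      thus "Im (s * Ln w) > Y" using in_dom by blast
    qed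
  qed
  have hol2: "F holomorphic_on (ball 0 r - \<real>\<^sub>\<ge>\<^sub>0)"
  proof (rule holomorphic_transform)
    show "(\<lambda>w. g (s * (Ln (- w) + \<i> * of_real pi))) holomorphic_on (ball 0 r - \<real>\<^sub>\<ge>\<^sub>0)"
    proof (rule holomorphic_on_compose_gen[OF _ g, unfolded o_def])
      show "(\<lambda>w. s * (Ln (- w) + \<i> * of_real pi)) holomorphic_on (ball 0 r - \<real>\<^sub>\<ge>\<^sub>0)"
        by (intro holomorphic_intros) auto
      show "(\<lambda>w. s * (Ln (- w) + \<i> * of_real pi)) ` (ball 0 r - \<real>\<^sub>\<ge>\<^sub>0) \<subseteq> {z. Y < Im z}"
      proof safe
        fix w :: complex assume "w \<in> ball 0 r" "w \<notin> \<real>\<^sub>\<ge>\<^sub>0"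
        hence w: "- w \<noteq> 0" "norm w < r" by auto
        have "exp (Ln (- w) + \<i> * of_real pi) = w" unfolding exp_add exp_Ln[OF w(1)] by simp
        hence "norm (exp (Ln (- w) + \<i> * of_real pi)) < r" using w(2) by (simp only:)
        thus "Im (s * (Ln (- w) + \<i> * of_real pi)) > Y" using in_dom by blast
      qed
    qed
    fix w :: complex assume w: "w \<in> ball 0 r - \<real>\<^sub>\<ge>\<^sub>0"
    hence "w \<noteq> 0" by auto
    thus "g (s * (Ln (- w) + \<i> * of_real pi)) = F w"
      unfolding F_def using w by (intro exp_eq) (auto simp: exp_add)
  qed
  have "F holomorphic_on (ball 0 r - \<real>\<^sub>\<le>\<^sub>0) \<union> (ball 0 r - \<real>\<^sub>\<ge>\<^sub>0)"
    by (rule holomorphic_on_Un[OF hol1 hol2]) (auto intro!: open_Diff closed_nonpos_Reals_complex closed_nonneg_Reals_complex)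
  also have "(ball 0 r - \<real>\<^sub>\<le>\<^sub>0) \<union> (ball 0 r - \<real>\<^sub>\<ge>\<^sub>0) = ball 0 r - {0 :: complex}"
    by (auto simp: complex_nonpos_Reals_iff complex_nonneg_Reals_iff complex_eq_iff)
  finally have hol: "F holomorphic_on ball 0 r - {0}" .
  have "g z = F (q_par h z)" if z: "Im z > Y" for z
  proof -
    define l where "l = 2 * of_real pi * \<i> * z / of_nat h"
    have sl: "s * l = z" using h by (simp add: s_def l_def)
    have "- (2 * pi * Im z / real h) < - (2 * pi * Y / real h)"
      using z h by (simp add: divide_strict_right_mono)
    hence "norm (exp l) < r" unfolding l_def norm_q_par r_def by simp
    hence "g (s * Ln (exp l)) = g (s * l)" by (intro exp_eq) simp_all
    hence "g (s * Ln (exp l)) = g z" by (simp only: sl)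
    thus ?thesis by (simp only: F_def l_def)
  qed
  with hol show ?thesis using that unfolding r_def by blast
qed

text \<open>The growth bound says that \<open>w ^ D * G w\<close> is bounded near 0, so Riemann's
  theorem removes the singularity.\<close>

lemma q_series_of_growth:
  assumes h: "h > 0" and g: "g holomorphic_on {z. Im z > Y}" and per: "\<And>z. Im z > Y \<Longrightarrow> g (z + of_nat h) = g z"
    and bnd: "\<And>z. Im z > Y \<Longrightarrow> norm (g z) \<le> C * exp (2 * pi * Im z / real h) ^ D"
  obtains F f where "F has_fps_expansion f" "\<And>z. Im z > Y \<Longrightarrow> g z = F (q_par h z) / q_par h z ^ D"
proof -
  obtain G where G: "G holomorphic_on ball 0 (exp (- (2 * pi * Y / real h))) - {0}"
    "\<And>z. Im z > Y \<Longrightarrow> g z = G (q_par h z)"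
    using holomorphic_descends_to_q[OF h g per] by blast
  define r where "r = exp (- (2 * pi * Y / real h))"
  have r: "r > 0" by (simp add: r_def)
  have hol: "(\<lambda>w. w ^ D * G w) holomorphic_on ball 0 r - {0}"
    using G(1) by (intro holomorphic_intros) (simp add: r_def)
  have surj: "\<exists>z. Im z > Y \<and> w = q_par h z" if "w \<in> ball 0 r - {0}" for w
  proof (intro exI conjI)
    define z where "z = Ln w * of_nat h / (2 * of_real pi * \<i>)"
    show w: "w = q_par h z" using that h by (simp add: z_def)
    have "norm w < r" using that by simp
    hence "- (2 * pi * Im z / real h) < - (2 * pi * Y / real h)" unfolding w norm_q_par r_def by simp
    thus "Im z > Y" using h by (simp add: divide_less_cancel)
  qed
  have "norm (w ^ D * G w) \<le> \<bar>C\<bar>" if w: "w \<in> ball 0 r - {0}" for w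
  proof -
    obtain z where z: "Im z > Y" "w = q_par h z" using surj[OF w] by blast
    have nw: "norm w * exp (2 * pi * Im z / real h) = 1"
      unfolding z(2) norm_q_par by (simp add: exp_minus)
    have "norm (w ^ D * G w) \<le> norm w ^ D * (C * exp (2 * pi * Im z / real h) ^ D)"
      using bnd[OF z(1)] G(2)[OF z(1)] z(2) by (simp add: norm_mult norm_power mult_left_mono)
    also have "\<dots> = C * (norm w * exp (2 * pi * Im z / real h)) ^ D" by (simp add: power_mult_distrib)
    also have "\<dots> \<le> \<bar>C\<bar>" unfolding nw by simp
    finally show ?thesis .
  qed
  moreover have "\<forall>\<^sub>F w in at 0. w \<in> ball 0 r - {0 :: complex}" using r by (intro eventually_at_in_open) auto
  ultimately have "\<forall>\<^sub>F w in at 0. norm (w ^ D * G w) \<le> \<bar>C\<bar>" by (auto elim: eventually_mono)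
  hence "\<exists>B. \<forall>\<^sub>F w in at 0. norm (w ^ D * G w) \<le> B" by blast
  moreover have "(0::complex) \<in> interior (ball 0 r)" using r by simp
  ultimately obtain F where F: "F holomorphic_on ball 0 r" "\<And>w. w \<in> ball 0 r - {0} \<Longrightarrow> F w = w ^ D * G w"
    using holomorphic_on_extend_bounded[OF hol] by blast
  have "F has_fps_expansion fps_expansion F 0"
    by (rule has_fps_expansion_fps_expansion[OF _ _ F(1)]) (use r in auto)
  moreover have "g z = F (q_par h z) / q_par h z ^ D" if z: "Im z > Y" for z
  proof -
    have "- (2 * pi * Im z / real h) < - (2 * pi * Y / real h)"
      using z h by (simp add: divide_strict_right_mono)
    hence "q_par h z \<in> ball 0 r - {0}" unfolding r_def by (simp add: norm_q_par)
    thus ?thesis using F(2) G(2)[OF z] by simp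
  qed
  ultimately show ?thesis using that by blast
qed

lemma has_q_expansion_of_growth:
  assumes "h > 0" "g holomorphic_on {z. Im z > Y}" "\<And>z. Im z > Y \<Longrightarrow> g (z + of_nat h) = g z"
    and "\<And>z. Im z > Y \<Longrightarrow> norm (g z) \<le> C * exp (2 * pi * Im z / real h) ^ D"
  shows "\<exists>L. has_q_expansion g h L"
proof -
  obtain F f where F: "F has_fps_expansion f" "\<And>z. Im z > Y \<Longrightarrow> g z = F (q_par h z) / q_par h z ^ D"
    using q_series_of_growth[OF assms] by blast
  have "(\<lambda>w. F w * w powi (- int D)) has_laurent_expansion fls_shift (int D) (fps_to_fls f)"
    by (intro has_laurent_expansion_shift' has_laurent_expansion_fps F(1))
  thus ?thesis
    using F(2) by (intro exI, intro has_q_expansionI[where Y = Y] assms(1)) (auto simp: power_int_minus divide_inverse)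
qed

text \<open>Used with \<open>k\<close> the order of the pole: once the coefficients below
  \<open>k\<close> vanish there is a limit at the cusp, and it is 0 if coefficient \<open>k\<close>
  vanishes as well.\<close>

lemma fps_cusp_limit:
  assumes F: "F has_fps_expansion f" and f: "\<And>n. n < k \<Longrightarrow> fps_nth f n = 0" and h: "h > 0" and e: "e > 0"
  obtains Y where "Y \<ge> 0" "\<And>z. Im z > Y \<Longrightarrow> norm (F (q_par h z) / q_par h z ^ k - fps_nth f k) < e"
proof -
  have lim: "((\<lambda>w. F w / w ^ k) \<longlongrightarrow> fps_nth f k) (at 0)"
  proof (cases "f = 0")
    case True
    have "\<forall>\<^sub>F w in nhds 0. eval_fps f w = F w" using F by (simp add: has_fps_expansion_def)
    hence "\<forall>\<^sub>F w in at 0. F w / w ^ k = 0" unfolding True by (auto simp: eventually_nhds_conv_at elim: eventually_mono)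
    thus ?thesis by (simp add: True tendsto_eventually)
  next
    case False
    hence "k \<le> subdegree f" using f by (meson linorder_not_less nth_subdegree_nonzero)
    hence "(\<lambda>w. if w = 0 then fps_nth f k else F w / w ^ k) has_fps_expansion fps_shift k f"
      by (intro has_fps_expansion_shift F) auto
    hence "continuous (at 0) (\<lambda>w. if w = 0 then fps_nth f k else F w / w ^ k)"
      by (rule has_fps_expansion_imp_continuous)
    hence "((\<lambda>w. if w = 0 then fps_nth f k else F w / w ^ k) \<longlongrightarrow> fps_nth f k) (at 0)"
      by (simp add: continuous_within)
    thus ?thesis by (rule Lim_transform_eventually) (simp add: eventually_at_filter)
  qed
  hence "\<forall>\<^sub>F w in at 0. norm (F w / w ^ k - fps_nth f k) < e"
    using e by (simp add: tendsto_iff dist_norm)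
  from eventually_at_0_q_par[OF h this] that show ?thesis by metis
qed

section \<open>Two eta quotients on the curve\<close>

text \<open>The exponents give the divisor
  \<open>3 (0) + 3 (1/17) - 3 (1/2) - 3 (\<infinity>)\<close>, which is invariant under
  \<open>w_17\<close>.\<close>

definition eta_quot_U :: "complex \<Rightarrow> complex" where
  "eta_quot_U z = (eta2 z * eta2 (17 * z) / (eta2 (2 * z) * eta2 (34 * z))) ^ 2"

text \<open>The divisor is \<open>4 (1/2) - 4 (\<infinity>)\<close>. As \<open>w_17\<close>
  exchanges these two cusps, it can only send \<open>v\<close> to a constant multiple of
  \<open>1 / v\<close>.\<close>

definition eta_quot_v :: "complex \<Rightarrow> complex" where
  "eta_quot_v z = eta2 (2 * z) ^ 2 * eta2 (17 * z) / (eta2 z * eta2 (34 * z) ^ 2)"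

lemma eta_quot_nonzero [simp]: "eta_quot_U z \<noteq> 0" "eta_quot_v z \<noteq> 0"
  by (simp_all add: eta_quot_U_def eta_quot_v_def)

lemma numeral_mult_in_uhp [simp]: "z \<in> uhp \<Longrightarrow> numeral k * z \<in> uhp"
  by (simp add: uhp_def)

lemma holomorphic_eta2_scaled: "(\<lambda>z. eta2 (numeral k * z)) holomorphic_on uhp"
  by (rule holomorphic_on_compose_gen[OF _ eta2_holomorphic, unfolded o_def]) (auto intro!: holomorphic_intros)

lemma holomorphic_eta_quot: "eta_quot_U holomorphic_on uhp" "eta_quot_v holomorphic_on uhp"
  unfolding eta_quot_U_def[abs_def] eta_quot_v_def[abs_def]
  by (intro holomorphic_intros holomorphic_eta2_scaled eta2_holomorphic; simp)+

lemma eta2_transform: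
  assumes "a * d - b * c = 1" "z \<in> uhp"
  shows "eta2 ((of_int a * z + of_int b) / (of_int c * z + of_int d)) =
    e2pi (of_int (eta_exponent a b c d) / 12) * (of_int c * z + of_int d) * eta2 z"
  using eta2_transforms_SL2Z[OF assms(1)] assms(2) by (simp add: eta2_transforms_def)

text \<open>Multiplication by \<open>n\<close> turns the matrix with entries
  \<open>a, b, n m k, d\<close> into the one with entries \<open>a, b n, m k, d\<close>, again
  integral of determinant 1.\<close>

lemma eta2_scaled_transform:
  assumes "a * d - b * (n * m * k) = 1" "n > 0" "z \<in> uhp"
  shows "eta2 (of_int n * ((of_int a * z + of_int b) / (of_int (n * m * k) * z + of_int d))) =
    e2pi (of_int (eta_exponent a (b * n) (m * k) d) / 12) * (of_int (n * m * k) * z + of_int d) * eta2 (of_int n * z)"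
proof -
  have "a * d - (b * n) * (m * k) = 1" using assms(1) by (simp add: algebra_simps)
  from eta2_transforms_SL2Z[OF this] have
    "eta2 ((of_int a * (of_int n * z) + of_int (b * n)) / (of_int (m * k) * (of_int n * z) + of_int d)) =
     e2pi (of_int (eta_exponent a (b * n) (m * k) d) / 12) * (of_int (m * k) * (of_int n * z) + of_int d) * eta2 (of_int n * z)"
    using assms(2,3) by (simp add: eta2_transforms_def uhp_def)
  moreover have "of_int a * (of_int n * z) + of_int (b * n) = of_int n * (of_int a * z + of_int b)"
    "of_int (m * k) * (of_int n * z) + of_int d = of_int (n * m * k) * z + of_int d"
    by (simp_all add: algebra_simps)
  ultimately show ?thesis by (simp only: times_divide_eq_right)
qed

text \<open>These are the exponents of the characters by which \<open>U\<close> and \<open>v\<close>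
  transform under \<open>Gamma0 34\<close>; the powers of the automorphy factor cancel because the
  weights of numerator and denominator balance.\<close>

lemma eta_quot_exponents:
  assumes "a * d - b * (34 * k) = 1"
  shows "12 dvd 2 * eta_exponent a (b * 1) (34 * k) d + 2 * eta_exponent a (b * 17) (2 * k) d
      - 2 * eta_exponent a (b * 2) (17 * k) d - 2 * eta_exponent a (b * 34) (1 * k) d" (is "12 dvd ?X")
    and "12 dvd 2 * eta_exponent a (b * 2) (17 * k) d + eta_exponent a (b * 17) (2 * k) d
      - eta_exponent a (b * 1) (34 * k) d - 2 * eta_exponent a (b * 34) (1 * k) d" (is "12 dvd ?Y")
proof -
  let ?E = "\<lambda>a b c d :: int. (1 - c\<^sup>2) * (b * d + 3 * (c - 1) * d + c + 3) + c * (a + d - 3)"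
  define P where "P = (\<lambda>a b k d. 2 * ?E a (b * 1) (34 * k) d + 2 * ?E a (b * 17) (2 * k) d
      - 2 * ?E a (b * 2) (17 * k) d - 2 * ?E a (b * 34) (1 * k) d)"
  define R where "R = (\<lambda>a b k d. 2 * ?E a (b * 2) (17 * k) d + ?E a (b * 17) (2 * k) d
      - ?E a (b * 1) (34 * k) d - 2 * ?E a (b * 34) (1 * k) d)"
  define Q :: "int \<Rightarrow> int \<Rightarrow> int \<Rightarrow> int \<Rightarrow> int" where "Q = (\<lambda>a b k d. a * d - b * (34 * k) - 1)"
  have Q0: "Q a b k d = 0" using assms by (simp add: Q_def)
  have P_cong: "[P (a mod m) (b mod m) (c mod m) (d mod m) = P a b c d] (mod m)" for a b c d m
    unfolding P_def by (intro cong_add cong_diff cong_mult cong_pow cong_refl cong_mod_left[THEN iffD2])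
  have R_cong: "[R (a mod m) (b mod m) (c mod m) (d mod m) = R a b c d] (mod m)" for a b c d m
    unfolding R_def by (intro cong_add cong_diff cong_mult cong_pow cong_refl cong_mod_left[THEN iffD2])
  have Q_cong: "[Q (a mod m) (b mod m) (c mod m) (d mod m) = Q a b c d] (mod m)" for a b c d m
    unfolding Q_def by (intro cong_add cong_diff cong_mult cong_pow cong_refl cong_mod_left[THEN iffD2])
  have "3 dvd P a b k d"
    by (rule dvd_of_residues4[where P = P and Q = Q, OF _ P_cong Q_cong _ Q0]) (simp_all add: int_ranges P_def Q_def)
  moreover have "4 dvd P a b k d"
    by (rule dvd_of_residues4[where P = P and Q = Q, OF _ P_cong Q_cong _ Q0]) (simp_all add: int_ranges P_def Q_def)
  ultimately have "12 dvd P a b k d" by (simp add: twelve_dvd_iff)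
  thus "12 dvd ?X" by (simp add: P_def eta_exponent_def)
  have "3 dvd R a b k d"
    by (rule dvd_of_residues4[where P = R and Q = Q, OF _ R_cong Q_cong _ Q0]) (simp_all add: int_ranges R_def Q_def)
  moreover have "4 dvd R a b k d"
    by (rule dvd_of_residues4[where P = R and Q = Q, OF _ R_cong Q_cong _ Q0]) (simp_all add: int_ranges R_def Q_def)
  ultimately have "12 dvd R a b k d" by (simp add: twelve_dvd_iff)
  thus "12 dvd ?Y" by (simp add: R_def eta_exponent_def)
qed

lemma e2pi_12_eq_1: "12 dvd k \<Longrightarrow> e2pi (of_int k / 12) = 1"
  using e2pi_12_cong[of k 0] by simp

lemma eta_quot_Gamma0_int:
  assumes "a * d - b * (34 * k) = 1" "z \<in> uhp"
  shows "eta_quot_U ((of_int a * z + of_int b) / (of_int (34 * k) * z + of_int d)) = eta_quot_U z"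
    and "eta_quot_v ((of_int a * z + of_int b) / (of_int (34 * k) * z + of_int d)) = eta_quot_v z"
proof -
  define J where "J = of_int (34 * k) * z + of_int d"
  define A where "A = (of_int a * z + of_int b) / J"
  have J: "J \<noteq> 0" using int_moebius_aux(1)[OF assms] by (simp add: J_def)
  define ch where "ch = (\<lambda>n m. e2pi (of_int (eta_exponent a (b * n) (m * k) d) / 12))"
  have t: "eta2 (of_int n * A) = ch n m * J * eta2 (of_int n * z)" if "n * m = 34" "n > 0" for n m
    using eta2_scaled_transform[of a d b n m k z] assms that by (simp add: A_def J_def ch_def)
  have t': "eta2 A = ch 1 34 * J * eta2 z" "eta2 (17 * A) = ch 17 2 * J * eta2 (17 * z)"
     "eta2 (2 * A) = ch 2 17 * J * eta2 (2 * z)" "eta2 (34 * A) = ch 34 1 * J * eta2 (34 * z)"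
    using t[of 1 34] t[of 17 2] t[of 2 17] t[of 34 1] by simp_all
  have nz: "ch n m \<noteq> 0" for n m by (simp add: ch_def)
  have 1: "(ch 1 34 * ch 17 2 / (ch 2 17 * ch 34 1)) ^ 2 = 1"
    using e2pi_12_eq_1[OF eta_quot_exponents(1)[OF assms(1)]]
    by (simp only: ch_def of_int_add of_int_diff of_int_mult of_int_numeral add_divide_distrib diff_divide_distrib
        e2pi_add e2pi_diff mult_2 power2_eq_square times_divide_times_eq divide_divide_eq_left mult_ac)
  have 2: "ch 2 17 ^ 2 * ch 17 2 / (ch 1 34 * ch 34 1 ^ 2) = 1"
    using e2pi_12_eq_1[OF eta_quot_exponents(2)[OF assms(1)]]
    by (simp only: ch_def of_int_add of_int_diff of_int_mult of_int_numeral add_divide_distrib diff_divide_distrib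
        e2pi_add e2pi_diff mult_2 power2_eq_square times_divide_times_eq divide_divide_eq_left mult_ac)
  have "eta_quot_U A = (ch 1 34 * ch 17 2 / (ch 2 17 * ch 34 1)) ^ 2 * eta_quot_U z"
    unfolding eta_quot_U_def t' using J nz by (simp add: power_mult_distrib power_divide mult_ac)
  thus "eta_quot_U ((of_int a * z + of_int b) / (of_int (34 * k) * z + of_int d)) = eta_quot_U z"
    unfolding 1 by (simp add: A_def J_def)
  have "eta_quot_v A = ch 2 17 ^ 2 * ch 17 2 / (ch 1 34 * ch 34 1 ^ 2) * eta_quot_v z"
    unfolding eta_quot_v_def t' using J nz by (simp add: power_mult_distrib power_divide mult_ac)
  thus "eta_quot_v ((of_int a * z + of_int b) / (of_int (34 * k) * z + of_int d)) = eta_quot_v z"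
    unfolding 2 by (simp add: A_def J_def)
qed

lemma eta_quot_Gamma0:
  assumes "A \<in> Gamma0 34" "z \<in> uhp"
  shows "eta_quot_U (moebius_act A z) = eta_quot_U z" "eta_quot_v (moebius_act A z) = eta_quot_v z"
proof -
  obtain a b c d where A: "A = int_mat2 a b c d" using assms Gamma0_subset_SL2Z by (blast elim: SL2Z_cases)
  hence *: "a * d - b * c = 1" "34 dvd c" using assms(1) by (simp_all add: int_mat2_in_Gamma0_iff)
  then obtain k where k: "c = 34 * k" by blast
  show "eta_quot_U (moebius_act A z) = eta_quot_U z" "eta_quot_v (moebius_act A z) = eta_quot_v z"
    using eta_quot_Gamma0_int[of a d b k z] * assms(2) unfolding A moebius_act_int_mat2 k by simp_all
qed

text \<open>The Atkin-Lehner involution \<open>w\<^sub>1\<^sub>7\<close> is given by the matrix with rows \<open>(17, 8)\<close> and \<open>(34, 17)\<close>.\<close>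
lemma eta_quot_involution:
  assumes z: "z \<in> uhp"
  shows "eta_quot_U ((17 * z + 8) / (34 * z + 17)) = eta_quot_U z"
    and "eta_quot_v ((17 * z + 8) / (34 * z + 17)) = 17 / eta_quot_v z"
proof -
  define J where "J = 2 * z + 1"
  define A where "A = (17 * z + 8) / (34 * z + 17)"
  have J17: "34 * z + 17 = 17 * J" by (simp add: J_def)
  have J: "J \<noteq> 0" using int_moebius_aux(1)[of 17 1 8 2 z] z by (simp add: J_def)
  \<comment> \<open>The involution exchanges \<open>z\<close> with \<open>17 z\<close> and
    \<open>2 z\<close> with \<open>34 z\<close> up to \<open>SL2Z\<close>: each of \<open>A\<close>,
    \<open>17 A\<close>, \<open>2 A\<close>, \<open>34 A\<close> is the image of the partner under
    an integral matrix of determinant 1. The automorphy factors are \<open>17 J\<close> for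
    \<open>A\<close> and \<open>2 A\<close>, and \<open>J\<close> for the other two.\<close>
  have t1: "eta2 A = e2pi (of_int (eta_exponent 1 8 2 17) / 12) * (17 * J) * eta2 (17 * z)"
  proof -
    have "eta2 ((1 * (17 * z) + 8) / (2 * (17 * z) + 17)) =
      e2pi (of_int (eta_exponent 1 8 2 17) / 12) * (2 * (17 * z) + 17) * eta2 (17 * z)"
      using eta2_transform[of 1 17 8 2 "17 * z"] z by simp
    thus ?thesis by (simp add: A_def J_def)
  qed
  have t17: "eta2 (17 * A) = e2pi (of_int (eta_exponent 17 8 2 1) / 12) * J * eta2 z"
  proof -
    have "eta2 ((17 * z + 8) / (2 * z + 1)) = e2pi (of_int (eta_exponent 17 8 2 1) / 12) * (2 * z + 1) * eta2 z"
      using eta2_transform[of 17 1 8 2 z] z by simp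
    moreover have "17 * (u / (17 * w)) = u / w" for u w :: complex by simp
    hence "17 * A = (17 * z + 8) / (2 * z + 1)" unfolding A_def J17 by (simp only: J_def)
    ultimately show ?thesis by (simp add: J_def)
  qed
  have t2: "eta2 (2 * A) = e2pi (of_int (eta_exponent 1 16 1 17) / 12) * (17 * J) * eta2 (34 * z)"
  proof -
    have "eta2 ((1 * (34 * z) + 16) / (1 * (34 * z) + 17)) =
      e2pi (of_int (eta_exponent 1 16 1 17) / 12) * (1 * (34 * z) + 17) * eta2 (34 * z)"
      using eta2_transform[of 1 17 16 1 "34 * z"] z by simp
    moreover have "2 * A = (1 * (34 * z) + 16) / (1 * (34 * z) + 17)" unfolding A_def by simp
    ultimately show ?thesis by (simp add: J_def)
  qed
  have t34: "eta2 (34 * A) = e2pi (of_int (eta_exponent 17 16 1 1) / 12) * J * eta2 (2 * z)"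
  proof -
    have "eta2 ((17 * (2 * z) + 16) / (1 * (2 * z) + 1)) =
      e2pi (of_int (eta_exponent 17 16 1 1) / 12) * (1 * (2 * z) + 1) * eta2 (2 * z)"
      using eta2_transform[of 17 1 16 1 "2 * z"] z by simp
    moreover have "34 * A = (17 * (2 * z) + 16) / (1 * (2 * z) + 1)"
    proof -
      have "34 * (u / (17 * w)) = 2 * u / w" for u w :: complex by simp
      hence "34 * A = 2 * (17 * z + 8) / J" unfolding A_def J17 by (simp only:)
      thus ?thesis by (simp add: J_def)
    qed
    ultimately show ?thesis by (simp add: J_def)
  qed
  define ch1 ch17 ch2 ch34 where ch: "ch1 = e2pi (of_int (eta_exponent 1 8 2 17) / 12)" "ch17 = e2pi (of_int (eta_exponent 17 8 2 1) / 12)"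
    "ch2 = e2pi (of_int (eta_exponent 1 16 1 17) / 12)" "ch34 = e2pi (of_int (eta_exponent 17 16 1 1) / 12)"
  have nz: "ch1 \<noteq> 0" "ch2 \<noteq> 0" "ch17 \<noteq> 0" "ch34 \<noteq> 0" by (simp_all add: ch)
  have "12 dvd 2 * eta_exponent 1 8 2 17 + 2 * eta_exponent 17 8 2 1 - 2 * eta_exponent 1 16 1 17 - 2 * eta_exponent 17 16 1 1"
    by (simp add: eta_exponent_def)
  from e2pi_12_eq_1[OF this] have 1: "(ch1 * ch17 / (ch2 * ch34)) ^ 2 = 1"
    by (simp only: ch of_int_add of_int_diff of_int_mult of_int_numeral add_divide_distrib diff_divide_distrib
        e2pi_add e2pi_diff mult_2 power2_eq_square times_divide_times_eq divide_divide_eq_left mult_ac)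
  have "12 dvd 2 * eta_exponent 1 16 1 17 + eta_exponent 17 8 2 1 - eta_exponent 1 8 2 17 - 2 * eta_exponent 17 16 1 1"
    by (simp add: eta_exponent_def)
  from e2pi_12_eq_1[OF this] have 2: "ch2 ^ 2 * ch17 / (ch1 * ch34 ^ 2) = 1"
    by (simp only: ch of_int_add of_int_diff of_int_mult of_int_numeral add_divide_distrib diff_divide_distrib
        e2pi_add e2pi_diff mult_2 power2_eq_square times_divide_times_eq divide_divide_eq_left mult_ac)
  have "eta_quot_U A = (ch1 * ch17 / (ch2 * ch34)) ^ 2 * eta_quot_U z"
    unfolding eta_quot_U_def t1 t2 t17 t34 ch[symmetric] using J nz by (simp add: power_mult_distrib power_divide mult_ac)
  thus "eta_quot_U ((17 * z + 8) / (34 * z + 17)) = eta_quot_U z" unfolding 1 by (simp add: A_def)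
  \<comment> \<open>The factor \<open>17 J\<close> occurs squared in the numerator and once in the
    denominator, which leaves one 17.\<close>
  have "eta_quot_v A = ch2 ^ 2 * ch17 / (ch1 * ch34 ^ 2) * (17 / eta_quot_v z)"
    unfolding eta_quot_v_def t1 t2 t17 t34 ch[symmetric] using J nz by (simp add: power_mult_distrib power_divide power2_eq_square mult_ac)
  thus "eta_quot_v ((17 * z + 8) / (34 * z + 17)) = 17 / eta_quot_v z" unfolding 2 by (simp add: A_def)
qed

section \<open>Orders of the eta quotients at the cusps\<close>

lemma norm_eta2_bounds:
  obtains K where "K \<ge> 1" "\<And>z. Im z \<ge> 1 / 34 \<Longrightarrow> exp (- (pi * Im z / 6)) / K \<le> norm (eta2 z)"
    "\<And>z. Im z \<ge> 1 / 34 \<Longrightarrow> norm (eta2 z) \<le> K * exp (- (pi * Im z / 6))"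
proof -
  \<comment> \<open>Heights of at least \<open>1 / 34\<close>, the smallest value that occurs in
    \<open>eta2_cusp_bounds\<close>, keep \<open>e2pi z\<close> in a compact disc on which
    \<open>log_euler\<close> is bounded.\<close>
  define r where "r = exp (- 2 * pi / 34)"
  have r: "r < 1" by (simp add: r_def)
  have "continuous_on (cball 0 r) log_euler"
    by (rule continuous_on_subset[OF holomorphic_on_imp_continuous_on[OF holomorphic_on_log_euler]]) (use r in auto)
  hence "bounded (log_euler ` cball 0 r)" using compact_cball compact_continuous_image compact_imp_bounded by blast
  then obtain H where "\<forall>y\<in>log_euler ` cball 0 r. norm y \<le> H" unfolding bounded_iff by blast
  hence H: "\<And>q. norm q \<le> r \<Longrightarrow> norm (log_euler q) \<le> H" by (auto simp: dist_norm)
  have H0: "H \<ge> 0" using H[of 0] by (simp add: r_def)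
  define K where "K = exp (2 * H)"
  have K: "K \<ge> 1" using H0 by (simp add: K_def)
  have *: "norm (eta2 z) = exp (- (pi * Im z / 6)) * exp (- 2 * Re (log_euler (e2pi z)))
      \<and> \<bar>Re (log_euler (e2pi z))\<bar> \<le> H" if "Im z \<ge> 1 / 34" for z
  proof
    have "norm (e2pi z) \<le> r" using that by (simp add: norm_e2pi r_def)
    thus "\<bar>Re (log_euler (e2pi z))\<bar> \<le> H" using H abs_Re_le_cmod order_trans by blast
    show "norm (eta2 z) = exp (- (pi * Im z / 6)) * exp (- 2 * Re (log_euler (e2pi z)))"
      by (simp add: eta2_def norm_mult norm_e2pi)
  qed
  show ?thesis
  proof (rule that[OF K])
    fix z assume z: "Im z \<ge> 1 / 34"
    have "exp (- 2 * Re (log_euler (e2pi z))) \<le> K" "1 / K \<le> exp (- 2 * Re (log_euler (e2pi z)))"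
    proof -
      have t: "\<bar>Re (log_euler (e2pi z))\<bar> \<le> H" using *[OF z] by blast
      hence "- 2 * Re (log_euler (e2pi z)) \<le> 2 * H" "- (2 * H) \<le> - 2 * Re (log_euler (e2pi z))" by linarith+
      hence "exp (- 2 * Re (log_euler (e2pi z))) \<le> exp (2 * H)" "exp (- (2 * H)) \<le> exp (- 2 * Re (log_euler (e2pi z)))"
        by (simp_all only: exp_le_cancel_iff)
      moreover have "exp (- (2 * H)) = 1 / K" by (simp only: K_def exp_minus inverse_eq_divide)
      ultimately show "exp (- 2 * Re (log_euler (e2pi z))) \<le> K" "1 / K \<le> exp (- 2 * Re (log_euler (e2pi z)))"
        by (simp_all only: K_def)
    qed
    note le = this[THEN mult_left_mono, of "exp (- (pi * Im z / 6))"]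
    have n: "norm (eta2 z) = exp (- (pi * Im z / 6)) * exp (- 2 * Re (log_euler (e2pi z)))" using *[OF z] by blast
    show "exp (- (pi * Im z / 6)) / K \<le> norm (eta2 z)" unfolding n using le(2) by simp
    show "norm (eta2 z) \<le> K * exp (- (pi * Im z / 6))" unfolding n using le(1) by (simp only: mult.commute exp_ge_zero)
  qed
qed

text \<open>With \<open>e = gcd n c\<close> and \<open>n = e m\<close>, scaling by \<open>n\<close>
  after the given matrix factors as an element of \<open>SL2Z\<close> after the triangular map
  \<open>\<tau> = (e z + \<beta>) / m\<close>. So the eta factor behaves like
  \<open>eta2 \<tau>\<close>, and the height of \<open>\<tau>\<close> is \<open>e^2 / n\<close>
  times that of \<open>z\<close>: the usual order of an eta factor at a cusp. Bounds from both sides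
  are required because quotients are formed.\<close>

lemma eta2_cusp_bounds:
  obtains K where "K \<ge> 1"
    "\<And>a b c d n z. a * d - b * c = 1 \<Longrightarrow> n \<in> {1, 2, 17, 34} \<Longrightarrow> Im z \<ge> 1 \<Longrightarrow>
       norm (of_int c * z + of_int d) * exp (- (pi * (of_int (gcd n c) ^ 2 / of_int n) * Im z / 6)) / K
         \<le> norm (eta2 (of_int n * ((of_int a * z + of_int b) / (of_int c * z + of_int d)))) \<and>
       norm (eta2 (of_int n * ((of_int a * z + of_int b) / (of_int c * z + of_int d))))
         \<le> K * (norm (of_int c * z + of_int d) * exp (- (pi * (of_int (gcd n c) ^ 2 / of_int n) * Im z / 6)))"
proof -
  obtain K where K: "K \<ge> 1" "\<And>z. Im z \<ge> 1 / 34 \<Longrightarrow> exp (- (pi * Im z / 6)) / K \<le> norm (eta2 z)"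
    "\<And>z. Im z \<ge> 1 / 34 \<Longrightarrow> norm (eta2 z) \<le> K * exp (- (pi * Im z / 6))"
    using norm_eta2_bounds by blast
  have main: "norm (of_int c * z + of_int d) * exp (- (pi * (of_int (gcd n c) ^ 2 / of_int n) * Im z / 6)) / (34 * K)
         \<le> norm (eta2 (of_int n * ((of_int a * z + of_int b) / (of_int c * z + of_int d)))) \<and>
       norm (eta2 (of_int n * ((of_int a * z + of_int b) / (of_int c * z + of_int d))))
         \<le> (34 * K) * (norm (of_int c * z + of_int d) * exp (- (pi * (of_int (gcd n c) ^ 2 / of_int n) * Im z / 6)))"
    if det: "a * d - b * c = 1" and n: "n \<in> {1, 2, 17, 34}" and z: "Im z \<ge> 1" for a b c d n :: int and z
  proof -
    have n0: "n > 0" "n \<le> 34" using n by auto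
    define e where "e = gcd n c"
    have e0: "e > 0" using n0 by (simp add: e_def)
    have "coprime a c"
    proof (rule coprimeI)
      fix g assume "g dvd a" "g dvd c"
      hence "g dvd a * d - b * c" by simp
      thus "is_unit g" unfolding det .
    qed
    hence e: "gcd (n * a) c = e" unfolding e_def by (simp add: gcd_mult_right_right_cancel gcd_mult_left_right_cancel coprime_commute)
    \<comment> \<open>\<open>p / r\<close> is the image \<open>n a / c\<close> of infinity in lowest
      terms; \<open>q\<close> and \<open>s\<close> complete it to a unimodular matrix, and
      \<open>\<beta>\<close> is then forced by \<open>b1\<close> and \<open>b2\<close>.\<close>
    define p r m where "p = n * a div e" and "r = c div e" and "m = n div e"
    have pe: "n * a = e * p" "c = e * r" "n = e * m"
      using e e_def by (simp_all add: p_def r_def m_def)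
    have "coprime p r" unfolding p_def r_def e[symmetric] using e e0 by (intro div_gcd_coprime) auto
    then obtain s q where ps: "p * s - q * r = 1"
    proof -
      obtain u v where "u * p + v * r = 1" using \<open>coprime p r\<close> by (metis bezout_int coprime_iff_gcd_eq_1)
      thus ?thesis using that[of u "- v"] by (simp add: algebra_simps)
    qed
    have m0: "m > 0" "m \<le> 34"
    proof -
      show "m > 0" using pe(3) n0 e0 by (simp add: zero_less_mult_iff)
      have "m * 1 \<le> m * e" using \<open>m > 0\<close> e0 by (intro mult_left_mono) auto
      thus "m \<le> 34" using pe(3) n0 by (simp add: mult.commute)
    qed
    define \<beta> where "\<beta> = s * (n * b) - q * d"
    have m: "m = p * d - r * (n * b)"
    proof -
      have "e * (p * d - r * (n * b)) = (e * p) * d - (e * r) * (n * b)" by (simp add: algebra_simps)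
      also have "\<dots> = n * (a * d - b * c)" unfolding pe(1,2)[symmetric] by (simp add: algebra_simps)
      also have "\<dots> = e * m" unfolding det using pe(3) by simp
      finally show ?thesis using e0 by simp
    qed
    have b1: "p * \<beta> + q * m = n * b"
    proof -
      have "p * \<beta> + q * m = (n * b) * (p * s - q * r)" unfolding \<beta>_def m by (simp add: algebra_simps)
      thus ?thesis using ps by simp
    qed
    have b2: "r * \<beta> + s * m = d"
    proof -
      have "r * \<beta> + s * m = d * (p * s - q * r)" unfolding \<beta>_def m by (simp add: algebra_simps)
      thus ?thesis using ps by simp
    qed
    define \<tau> where "\<tau> = (of_int e * z + of_int \<beta>) / of_int m"
    have mc: "(of_int m :: complex) \<noteq> 0" using m0 by simp
    have Im\<tau>: "Im \<tau> = of_int e * Im z / of_int m"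
    proof -
      have "\<tau> = (of_int e * z + of_int \<beta>) / of_real (of_int m)" by (simp add: \<tau>_def)
      thus ?thesis by (simp only: Im_divide_of_real) simp
    qed
    have "of_int e * Im z / of_int m \<ge> 1 * 1 / (34 :: real)"
      using e0 m0 z by (intro frac_le mult_mono) auto
    hence Im34: "Im \<tau> \<ge> 1 / 34" by (simp add: Im\<tau>)
    hence \<tau>: "\<tau> \<in> uhp" by (simp add: uhp_def)
    have g2: "of_int (gcd n c) ^ 2 / of_int n * Im z = (Im \<tau> :: real)"
    proof -
      have "of_int e ^ 2 / of_int n * Im z = of_int e ^ 2 / of_int (e * m) * Im z" using pe(3) by simp
      also have "\<dots> = Im \<tau>" using e0 m0 unfolding Im\<tau> by (simp add: power2_eq_square)
      finally show ?thesis unfolding e_def .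
    qed
    have d1: "of_int r * \<tau> + of_int s = (of_int c * z + of_int d) / of_int m"
    proof -
      have "of_int r * \<tau> + of_int s = (of_int (e * r) * z + of_int (r * \<beta> + s * m)) / of_int m"
        using mc by (simp add: \<tau>_def add_divide_distrib algebra_simps)
      thus ?thesis unfolding b2 pe(2)[symmetric] .
    qed
    have d2: "of_int p * \<tau> + of_int q = of_int n * (of_int a * z + of_int b) / of_int m"
    proof -
      have "of_int p * \<tau> + of_int q = (of_int (e * p) * z + of_int (p * \<beta> + q * m)) / of_int m"
        using mc by (simp add: \<tau>_def add_divide_distrib algebra_simps)
      thus ?thesis unfolding b1 pe(1)[symmetric] by (simp add: algebra_simps)
    qed
    have zu: "z \<in> uhp" using z by (simp add: uhp_def)
    have "eta2 ((of_int p * \<tau> + of_int q) / (of_int r * \<tau> + of_int s)) =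
        e2pi (of_int (eta_exponent p q r s) / 12) * (of_int r * \<tau> + of_int s) * eta2 \<tau>"
      using eta2_transforms_SL2Z[OF ps] \<tau> by (simp add: eta2_transforms_def)
    moreover have "(of_int p * \<tau> + of_int q) / (of_int r * \<tau> + of_int s) = of_int n * ((of_int a * z + of_int b) / (of_int c * z + of_int d))"
      unfolding d1 d2 using mc by simp
    moreover have "norm (e2pi (of_int k / 12)) = 1" for k
      by (simp add: norm_e2pi)
    moreover have "norm (of_int m :: complex) = of_int m" using m0 by simp
    ultimately have norm: "norm (eta2 (of_int n * ((of_int a * z + of_int b) / (of_int c * z + of_int d)))) =
        norm (of_int c * z + of_int d) * (norm (eta2 \<tau>) / of_int m)"
      by (simp only: d1 norm_mult norm_divide) simp
    have "norm (eta2 \<tau>) / of_int m \<le> K * exp (- (pi * Im \<tau> / 6)) / 1"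
      using K(1) K(3)[OF Im34] m0 by (intro frac_le) auto
    also have "\<dots> \<le> (34 * K) * exp (- (pi * Im \<tau> / 6))" using K(1) by simp
    finally have u: "norm (eta2 \<tau>) / of_int m \<le> (34 * K) * exp (- (pi * Im \<tau> / 6))" .
    have "exp (- (pi * Im \<tau> / 6)) / (34 * K) = exp (- (pi * Im \<tau> / 6)) / K / 34" by simp
    also have "\<dots> \<le> norm (eta2 \<tau>) / of_int m"
      using K(1) K(2)[OF Im34] m0 by (intro frac_le) auto
    finally have l: "exp (- (pi * Im \<tau> / 6)) / (34 * K) \<le> norm (eta2 \<tau>) / of_int m" .
    have ex: "pi * (of_int (gcd n c) ^ 2 / of_int n) * Im z / 6 = pi * Im \<tau> / 6" by (simp only: mult.assoc g2)
    from mult_left_mono[OF u norm_ge_zero[of "of_int c * z + of_int d"]] mult_left_mono[OF l norm_ge_zero[of "of_int c * z + of_int d"]]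
    show ?thesis unfolding norm ex by (simp add: mult_ac)
  qed
  show ?thesis by (rule that[of "34 * K"]) (use K main in auto)
qed

lemma gcd_values:
  fixes c :: int
  shows "gcd 1 c = 1" "gcd 2 c = (if even c then 2 else 1)" "gcd 17 c = (if 17 dvd c then 17 else 1)"
    "gcd 34 c = (if even c then 2 else 1) * (if 17 dvd c then 17 else 1)"
proof -
  show "gcd 1 c = 1" by simp
  show g2: "gcd 2 c = (if even c then 2 else 1)"
    by (cases "even c") (simp_all add: gcd_proj1_iff coprime_iff_gcd_eq_1[symmetric])
  have p: "Factorial_Ring.prime (17::int)" by simp
  have g17: "gcd 17 k = (if 17 dvd k then 17 else 1)" for k :: int
    using prime_imp_coprime[OF p, of k] by (cases "17 dvd k") (simp_all add: gcd_proj1_iff coprime_iff_gcd_eq_1[symmetric])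
  show "gcd 17 c = (if 17 dvd c then 17 else 1)" by (rule g17)
  show "gcd 34 c = (if even c then 2 else 1) * (if 17 dvd c then 17 else 1)"
  proof (cases "even c")
    case True
    then obtain k where k: "c = 2 * k" by blast
    have "17 dvd c \<longleftrightarrow> 17 dvd k"
      unfolding k by (rule coprime_dvd_mult_right_iff) (use prime_imp_coprime[OF p, of 2] in simp)
    moreover have "gcd 34 c = 2 * gcd 17 k"
      using gcd_mult_distrib_int[of 2 17 k] by (simp add: k)
    ultimately show ?thesis using True by (simp add: g17)
  next
    case False
    have "gcd (n * a) c = gcd n c" if "coprime a c" for n a :: int
      using that by (simp add: gcd_mult_right_right_cancel gcd_mult_left_right_cancel coprime_commute)
    from this[of 2 17] have "gcd (17 * 2) c = gcd 17 c" using False by simp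
    thus ?thesis using False by (simp add: g17)
  qed
qed

text \<open>The automorphy factor \<open>J\<close> drops out because numerator and denominator have
  equal weight. The first quotient collects \<open>K ^ 4\<close> before squaring and the second
  \<open>K ^ 6\<close>, so \<open>K ^ 8\<close> covers both.\<close>

lemma power_ratio_bounds:
  fixes N1 N2 N3 N4 x1 x2 x3 x4 J K :: real
  assumes K: "K \<ge> 1" and J: "J > 0" and x: "x1 > 0" "x2 > 0" "x3 > 0" "x4 > 0"
    and N: "J * x1 / K \<le> N1" "N1 \<le> K * (J * x1)" "J * x2 / K \<le> N2" "N2 \<le> K * (J * x2)"
      "J * x3 / K \<le> N3" "N3 \<le> K * (J * x3)" "J * x4 / K \<le> N4" "N4 \<le> K * (J * x4)"
  shows "(N1 * N2 / (N3 * N4)) ^ 2 \<le> K ^ 8 * (x1 * x2 / (x3 * x4)) ^ 2"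
    and "N1 ^ 2 * N2 / (N3 * N4 ^ 2) \<le> K ^ 8 * (x1 ^ 2 * x2 / (x3 * x4 ^ 2))"
proof -
  have pos: "J * x3 / K > 0" "J * x4 / K > 0" "J * x1 / K > 0" "J * x2 / K > 0" using K J x by simp_all
  have N0: "N1 \<ge> 0" "N2 \<ge> 0" "N3 > 0" "N4 > 0" using pos N by linarith+
  have "N1 * N2 / (N3 * N4) \<le> (K * (J * x1)) * (K * (J * x2)) / ((J * x3 / K) * (J * x4 / K))"
  proof (rule frac_le)
    show "0 \<le> (K * (J * x1)) * (K * (J * x2))" using K J x by simp
    show "N1 * N2 \<le> (K * (J * x1)) * (K * (J * x2))"
      by (rule mult_mono[OF N(2,4)]) (use N0 K J x in simp_all)
    show "0 < (J * x3 / K) * (J * x4 / K)" by (rule mult_pos_pos[OF pos(1,2)])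
    show "(J * x3 / K) * (J * x4 / K) \<le> N3 * N4"
      by (rule mult_mono[OF N(5,7)]) (use N0(3) pos(2) in linarith)+
  qed
  also have "\<dots> = K ^ 4 * (x1 * x2 / (x3 * x4))"
    using K J x by (simp add: field_simps power4_eq_xxxx)
  finally have "(N1 * N2 / (N3 * N4)) ^ 2 \<le> (K ^ 4 * (x1 * x2 / (x3 * x4))) ^ 2"
    using N0 by (intro power_mono) auto
  thus "(N1 * N2 / (N3 * N4)) ^ 2 \<le> K ^ 8 * (x1 * x2 / (x3 * x4)) ^ 2"
    unfolding power_mult_distrib[of "K ^ 4"] power_mult[symmetric] by simp
  have "N1 ^ 2 * N2 / (N3 * N4 ^ 2) \<le> (K * (J * x1)) ^ 2 * (K * (J * x2)) / ((J * x3 / K) * (J * x4 / K) ^ 2)"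
  proof (rule frac_le)
    show "0 \<le> (K * (J * x1)) ^ 2 * (K * (J * x2))" using K J x by simp
    show "N1 ^ 2 * N2 \<le> (K * (J * x1)) ^ 2 * (K * (J * x2))"
      by (rule mult_mono[OF power_mono[OF N(2) N0(1)] N(4)]) (use N0 in simp_all)
    show "0 < (J * x3 / K) * (J * x4 / K) ^ 2" by (rule mult_pos_pos[OF pos(1) zero_less_power[OF pos(2)]])
    show "(J * x3 / K) * (J * x4 / K) ^ 2 \<le> N3 * N4 ^ 2"
      by (rule mult_mono[OF N(5) power_mono[OF N(7) less_imp_le[OF pos(2)]]]) (use N0(3) in simp_all)
  qed
  also have "\<dots> = K ^ 6 * (x1 ^ 2 * x2 / (x3 * x4 ^ 2))"
    using K J x by (simp add: field_simps eval_nat_numeral)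
  also have "\<dots> \<le> K ^ 8 * (x1 ^ 2 * x2 / (x3 * x4 ^ 2))"
    using K x by (intro mult_right_mono power_increasing) auto
  finally show "N1 ^ 2 * N2 / (N3 * N4 ^ 2) \<le> K ^ 8 * (x1 ^ 2 * x2 / (x3 * x4 ^ 2))" .
qed

lemma eta_quot_cusp_bounds_aux:
  obtains C where "C \<ge> 1"
    "\<And>a b c d z. a * d - b * c = 1 \<Longrightarrow> Im z \<ge> 1 \<Longrightarrow>
       (let w = (of_int a * z + of_int b) / (of_int c * z + of_int d); m = (\<lambda>n. of_int (gcd n c) ^ 2 / of_int n);
            x = (\<lambda>n. exp (- (pi * m n * Im z / 6)))
        in norm (eta_quot_U w) \<le> C * (x 1 * x 17 / (x 2 * x 34)) ^ 2 \<and>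
           norm (eta_quot_v w) \<le> C * (x 2 ^ 2 * x 17 / (x 1 * x 34 ^ 2)) \<and>
           norm (17 / eta_quot_v w) \<le> C * (x 34 ^ 2 * x 1 / (x 17 * x 2 ^ 2)))"
proof -
  obtain K where K: "K \<ge> 1"
    "\<And>a b c d n z. a * d - b * c = 1 \<Longrightarrow> n \<in> {1, 2, 17, 34} \<Longrightarrow> Im z \<ge> 1 \<Longrightarrow>
       norm (of_int c * z + of_int d) * exp (- (pi * (of_int (gcd n c) ^ 2 / of_int n) * Im z / 6)) / K
         \<le> norm (eta2 (of_int n * ((of_int a * z + of_int b) / (of_int c * z + of_int d)))) \<and>
       norm (eta2 (of_int n * ((of_int a * z + of_int b) / (of_int c * z + of_int d))))
         \<le> K * (norm (of_int c * z + of_int d) * exp (- (pi * (of_int (gcd n c) ^ 2 / of_int n) * Im z / 6)))"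
    using eta2_cusp_bounds by metis
  have K1: "K ^ 8 \<ge> 1" using K(1) by (simp add: one_le_power)
  show ?thesis
  \<comment> \<open>The factor 17 pays for the numerator of \<open>17 / v\<close>.\<close>
  proof (rule that[of "17 * K ^ 8"])
    fix a b c d :: int and z :: complex
    assume det: "a * d - b * c = 1" and z: "Im z \<ge> 1"
    define w where "w = (of_int a * z + of_int b) / (of_int c * z + of_int d)"
    define x where "x = (\<lambda>n::int. exp (- (pi * (of_int (gcd n c) ^ 2 / of_int n) * Im z / 6)))"
    define J where "J = norm (of_int c * z + of_int d)"
    have zu: "z \<in> uhp" using z by (simp add: uhp_def)
    have J: "J > 0" using int_moebius_aux(1)[OF det zu] by (simp add: J_def)
    have x: "x n > 0" for n by (simp add: x_def)
    have N: "J * x n / K \<le> norm (eta2 (of_int n * w))" "norm (eta2 (of_int n * w)) \<le> K * (J * x n)"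
      if "n \<in> {1, 2, 17, 34}" for n
      using K(2)[OF det that z] by (simp_all add: J_def x_def w_def)
    have b: "J * x 1 / K \<le> norm (eta2 w)" "norm (eta2 w) \<le> K * (J * x 1)"
      "J * x 2 / K \<le> norm (eta2 (2 * w))" "norm (eta2 (2 * w)) \<le> K * (J * x 2)"
      "J * x 17 / K \<le> norm (eta2 (17 * w))" "norm (eta2 (17 * w)) \<le> K * (J * x 17)"
      "J * x 34 / K \<le> norm (eta2 (34 * w))" "norm (eta2 (34 * w)) \<le> K * (J * x 34)"
      using N[of 1] N[of 2] N[of 17] N[of 34] by simp_all
    have le: "r \<le> 17 * K ^ 8 * y" if "r \<le> K ^ 8 * y" "y \<ge> 0" for r y
    proof -
      have "K ^ 8 * y \<ge> 0" using that K1 by simp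
      hence "r \<le> 17 * (K ^ 8 * y)" using that by linarith
      thus ?thesis by (simp only: mult.assoc)
    qed
    have "norm (eta_quot_U w) = (norm (eta2 w) * norm (eta2 (17 * w)) / (norm (eta2 (2 * w)) * norm (eta2 (34 * w)))) ^ 2"
      by (simp add: eta_quot_U_def norm_mult norm_divide norm_power)
    also have "\<dots> \<le> 17 * K ^ 8 * (x 1 * x 17 / (x 2 * x 34)) ^ 2"
      by (rule le, rule power_ratio_bounds(1)[OF K(1) J x x x x b(1,2) b(5,6) b(3,4) b(7,8)]) simp
    finally have 1: "norm (eta_quot_U w) \<le> 17 * K ^ 8 * (x 1 * x 17 / (x 2 * x 34)) ^ 2" .
    have "norm (eta_quot_v w) = norm (eta2 (2 * w)) ^ 2 * norm (eta2 (17 * w)) / (norm (eta2 w) * norm (eta2 (34 * w)) ^ 2)"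
      by (simp add: eta_quot_v_def norm_mult norm_divide norm_power)
    also have "\<dots> \<le> 17 * K ^ 8 * (x 2 ^ 2 * x 17 / (x 1 * x 34 ^ 2))"
      by (rule le, rule power_ratio_bounds(2)[OF K(1) J x x x x b(3,4) b(5,6) b(1,2) b(7,8)]) (intro divide_nonneg_nonneg mult_nonneg_nonneg zero_le_power less_imp_le[OF x])
    finally have 2: "norm (eta_quot_v w) \<le> 17 * K ^ 8 * (x 2 ^ 2 * x 17 / (x 1 * x 34 ^ 2))" .
    have "norm (17 / eta_quot_v w) = 17 * (norm (eta2 (34 * w)) ^ 2 * norm (eta2 w) / (norm (eta2 (17 * w)) * norm (eta2 (2 * w)) ^ 2))"
      by (simp add: eta_quot_v_def norm_mult norm_divide norm_power mult_ac)
    also have "\<dots> \<le> 17 * (K ^ 8 * (x 34 ^ 2 * x 1 / (x 17 * x 2 ^ 2)))"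
      by (intro mult_left_mono power_ratio_bounds(2)[OF K(1) J x x x x b(7,8) b(1,2) b(5,6) b(3,4)]) auto
    finally have 3: "norm (17 / eta_quot_v w) \<le> 17 * K ^ 8 * (x 34 ^ 2 * x 1 / (x 17 * x 2 ^ 2))" by simp
    from 1 2 3 show "let w = (of_int a * z + of_int b) / (of_int c * z + of_int d); m = (\<lambda>n. of_int (gcd n c) ^ 2 / of_int n);
            x = (\<lambda>n. exp (- (pi * m n * Im z / 6)))
        in norm (eta_quot_U w) \<le> 17 * K ^ 8 * (x 1 * x 17 / (x 2 * x 34)) ^ 2 \<and>
           norm (eta_quot_v w) \<le> 17 * K ^ 8 * (x 2 ^ 2 * x 17 / (x 1 * x 34 ^ 2)) \<and>
           norm (17 / eta_quot_v w) \<le> 17 * K ^ 8 * (x 34 ^ 2 * x 1 / (x 17 * x 2 ^ 2))"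
      unfolding Let_def w_def x_def by blast
  qed (use K1 in simp)
qed

text \<open>The numbers \<open>m n\<close> measure the decay of the four eta factors, so the orders
  of \<open>U\<close> and \<open>v\<close> are linear combinations of them. The three cases are the
  cusps 0 and 1/17 together, the cusp 1/2 of width 17, and infinity.\<close>

lemma eta_quot_cusp_bounds:
  obtains C where "C \<ge> 1"
    "\<And>a b c d z. a * d - b * c = 1 \<Longrightarrow> Im z \<ge> 1 \<Longrightarrow> odd c \<Longrightarrow>
       norm (eta_quot_U ((of_int a * z + of_int b) / (of_int c * z + of_int d))) \<le> C * exp (- Im z / 2) \<and>
       norm (eta_quot_v ((of_int a * z + of_int b) / (of_int c * z + of_int d))) \<le> C \<and>
       norm (17 / eta_quot_v ((of_int a * z + of_int b) / (of_int c * z + of_int d))) \<le> C"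
    "\<And>a b c d z. a * d - b * c = 1 \<Longrightarrow> Im z \<ge> 1 \<Longrightarrow> even c \<Longrightarrow> \<not> 17 dvd c \<Longrightarrow>
       norm (eta_quot_U ((of_int a * z + of_int b) / (of_int c * z + of_int d))) \<le> C * exp (2 * pi * Im z / 17) ^ 3 \<and>
       norm (eta_quot_v ((of_int a * z + of_int b) / (of_int c * z + of_int d))) \<le> C \<and>
       norm (17 / eta_quot_v ((of_int a * z + of_int b) / (of_int c * z + of_int d))) \<le> C * exp (2 * pi * Im z / 17) ^ 4"
    "\<And>z. Im z \<ge> 1 \<Longrightarrow> norm (eta_quot_U z) \<le> C * exp (2 * pi * Im z) ^ 3 \<and>
       norm (eta_quot_v z) \<le> C * exp (2 * pi * Im z) ^ 4 \<and> norm (17 / eta_quot_v z) \<le> C"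
proof -
  obtain C where C: "C \<ge> 1" and b:
    "\<And>a b c d z. a * d - b * c = 1 \<Longrightarrow> Im z \<ge> 1 \<Longrightarrow>
       (let w = (of_int a * z + of_int b) / (of_int c * z + of_int d); m = (\<lambda>n. of_int (gcd n c) ^ 2 / of_int n);
            x = (\<lambda>n. exp (- (pi * m n * Im z / 6)))
        in norm (eta_quot_U w) \<le> C * (x 1 * x 17 / (x 2 * x 34)) ^ 2 \<and>
           norm (eta_quot_v w) \<le> C * (x 2 ^ 2 * x 17 / (x 1 * x 34 ^ 2)) \<and>
           norm (17 / eta_quot_v w) \<le> C * (x 34 ^ 2 * x 1 / (x 17 * x 2 ^ 2)))"
    using eta_quot_cusp_bounds_aux by metis
  have e2: "exp y ^ 2 = exp (2 * y)" for y :: real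
    by (simp add: power2_eq_square exp_add[symmetric])
  have Uex: "(exp (- (pi * m1 * y / 6)) * exp (- (pi * m2 * y / 6)) / (exp (- (pi * m3 * y / 6)) * exp (- (pi * m4 * y / 6)))) ^ 2
      = exp (- (pi * (2 * (m1 + m2 - m3 - m4)) * y / 6))" for m1 m2 m3 m4 y :: real
    unfolding exp_add[symmetric] exp_diff[symmetric] e2 by (simp add: field_simps)
  have Vex: "exp (- (pi * m1 * y / 6)) ^ 2 * exp (- (pi * m2 * y / 6)) / (exp (- (pi * m3 * y / 6)) * exp (- (pi * m4 * y / 6)) ^ 2)
      = exp (- (pi * (2 * m1 + m2 - m3 - 2 * m4) * y / 6))" for m1 m2 m3 m4 y :: real
    unfolding e2 exp_add[symmetric] exp_diff[symmetric] by (simp add: field_simps)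
  have flip: "exp (- (pi * (2 * m4 + m3 - m2 - 2 * m1) * y / 6)) = exp (pi * (2 * m1 + m2 - m3 - 2 * m4) * y / 6)"
    for m1 m2 m3 m4 y :: real
  proof -
    have "- (pi * (2 * m4 + m3 - m2 - 2 * m1) * y / 6) = pi * (2 * m1 + m2 - m3 - 2 * m4) * y / 6"
      by (simp add: field_simps)
    thus ?thesis by (simp only:)
  qed
  have b': "norm (eta_quot_U w) \<le> C * exp (- (pi * (2 * (m 1 + m 17 - m 2 - m 34)) * Im z / 6)) \<and>
      norm (eta_quot_v w) \<le> C * exp (- (pi * (2 * m 2 + m 17 - m 1 - 2 * m 34) * Im z / 6)) \<and>
      norm (17 / eta_quot_v w) \<le> C * exp (pi * (2 * m 2 + m 17 - m 1 - 2 * m 34) * Im z / 6)"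
    if "a * d - b * c = 1" "Im z \<ge> 1" "w = (of_int a * z + of_int b) / (of_int c * z + of_int d)"
      "\<And>n. m n = of_int (gcd n c) ^ 2 / of_int n" for a b c d :: int and z w m
  proof -
    from b[OF that(1,2)] have "norm (eta_quot_U w) \<le> C * exp (- (pi * (2 * (m 1 + m 17 - m 2 - m 34)) * Im z / 6))"
      "norm (eta_quot_v w) \<le> C * exp (- (pi * (2 * m 2 + m 17 - m 1 - 2 * m 34) * Im z / 6))"
      "norm (17 / eta_quot_v w) \<le> C * exp (- (pi * (2 * m 34 + m 1 - m 17 - 2 * m 2) * Im z / 6))"
      unfolding Let_def Uex Vex that(3) that(4) by blast+
    thus ?thesis by (simp only: flip simp_thms)
  qed
  have le1: "C * exp u \<le> C * exp u'" if "u \<le> u'" for u u' :: real using that C by simp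
  show ?thesis
  proof (rule that[OF C])
    fix a b c d :: int and z :: complex
    assume det: "a * d - b * c = 1" and z: "Im z \<ge> 1" and c: "odd c"
    define w where "w = (of_int a * z + of_int b) / (of_int c * z + of_int d)"
    define m :: "int \<Rightarrow> real" where "m = (\<lambda>n. of_int (gcd n c) ^ 2 / of_int n)"
    \<comment> \<open>The two possible values are \<open>18 / 17\<close> and 18. With
      \<open>pi \<ge> 3\<close> the smaller one gives \<open>exp (- Im z / 2)\<close>, a crude rate
      that is enough to force vanishing at both cusps.\<close>
    have m: "2 * (m 1 + m 17 - m 2 - m 34) \<ge> 18 / 17" "2 * m 2 + m 17 - m 1 - 2 * m 34 = 0"
      using c by (cases "17 dvd c"; simp add: m_def gcd_values)+
    have pi3: "pi \<ge> 3" using pi_gt3 by simp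
    have "pi * (2 * (m 1 + m 17 - m 2 - m 34)) \<ge> 3 * (18 / 17)" using m pi3 by (intro mult_mono) auto
    hence "pi * (2 * (m 1 + m 17 - m 2 - m 34)) * Im z \<ge> 3 * Im z" using z by (intro mult_right_mono) auto
    hence "- (pi * (2 * (m 1 + m 17 - m 2 - m 34)) * Im z / 6) \<le> - Im z / 2" by simp
    note le = le1[OF this]
    have mm: "m n = of_int (gcd n c) ^ 2 / of_int n" for n by (simp add: m_def)
    note B = b'[OF det z w_def mm]
    have "norm (eta_quot_U w) \<le> C * exp (- Im z / 2)" using B le by linarith
    moreover have "norm (eta_quot_v w) \<le> C" "norm (17 / eta_quot_v w) \<le> C" using B unfolding m(2) by simp_all
    ultimately show "norm (eta_quot_U ((of_int a * z + of_int b) / (of_int c * z + of_int d))) \<le> C * exp (- Im z / 2) \<and>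
       norm (eta_quot_v ((of_int a * z + of_int b) / (of_int c * z + of_int d))) \<le> C \<and>
       norm (17 / eta_quot_v ((of_int a * z + of_int b) / (of_int c * z + of_int d))) \<le> C"
      unfolding w_def[symmetric] by blast
  next
    fix a b c d :: int and z :: complex
    assume det: "a * d - b * c = 1" and z: "Im z \<ge> 1" and c: "even c" "\<not> 17 dvd c"
    define w where "w = (of_int a * z + of_int b) / (of_int c * z + of_int d)"
    define m :: "int \<Rightarrow> real" where "m = (\<lambda>n. of_int (gcd n c) ^ 2 / of_int n)"
    \<comment> \<open>Multiplied by the width 17 and divided by 12, these become a pole of order 3
      for \<open>U\<close> and a zero of order 4 for \<open>v\<close>.\<close>
    have m: "2 * (m 1 + m 17 - m 2 - m 34) = - 36 / 17" "2 * m 2 + m 17 - m 1 - 2 * m 34 = 48 / 17"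
      using c by (simp_all add: m_def gcd_values)
    have eq: "- (pi * (- 36 / 17) * Im z / 6) = of_nat 3 * (2 * pi * Im z / 17)" "pi * (48 / 17) * Im z / 6 = of_nat 4 * (2 * pi * Im z / 17)"
      by simp_all
    have neg: "C * exp (- (pi * (48 / 17) * Im z / 6)) \<le> C" using C z by simp
    have mm: "m n = of_int (gcd n c) ^ 2 / of_int n" for n by (simp add: m_def)
    from b'[OF det z w_def mm] neg
    show "norm (eta_quot_U ((of_int a * z + of_int b) / (of_int c * z + of_int d))) \<le> C * exp (2 * pi * Im z / 17) ^ 3 \<and>
       norm (eta_quot_v ((of_int a * z + of_int b) / (of_int c * z + of_int d))) \<le> C \<and>
       norm (17 / eta_quot_v ((of_int a * z + of_int b) / (of_int c * z + of_int d))) \<le> C * exp (2 * pi * Im z / 17) ^ 4"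
      unfolding w_def[symmetric] m eq exp_of_nat_mult by linarith
  next
    fix z :: complex assume z: "Im z \<ge> 1"
    define m :: "int \<Rightarrow> real" where "m = (\<lambda>n. of_int (gcd n 0) ^ 2 / of_int n)"
    have m: "2 * (m 1 + m 17 - m 2 - m 34) = - 36" "2 * m 2 + m 17 - m 1 - 2 * m 34 = - 48"
      by (simp_all add: m_def)
    have eq: "- (pi * (- 36) * Im z / 6) = of_nat 3 * (2 * pi * Im z)" "- (pi * (- 48) * Im z / 6) = of_nat 4 * (2 * pi * Im z)"
      by simp_all
    have neg: "C * exp (pi * (- 48) * Im z / 6) \<le> C" using C z by simp
    have mm: "m n = of_int (gcd n 0) ^ 2 / of_int n" for n by (simp add: m_def)
    have w: "z = (of_int 1 * z + of_int 0) / (of_int 0 * z + of_int 1)" by simp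
    have det: "1 * 1 - 0 * 0 = (1 :: int)" by simp
    from b'[OF det z w mm] neg
    show "norm (eta_quot_U z) \<le> C * exp (2 * pi * Im z) ^ 3 \<and>
       norm (eta_quot_v z) \<le> C * exp (2 * pi * Im z) ^ 4 \<and> norm (17 / eta_quot_v z) \<le> C"
      unfolding m eq exp_of_nat_mult by linarith
  qed
qed

section \<open>Power series of eta products and their computation\<close>

lemma lambert_has_fps_expansion:
  "lambert has_fps_expansion Abs_fps (\<lambda>n. of_nat (divisor_sum n))"
proof (rule has_fps_expansionI)

  have "\<forall>\<^sub>F q in nhds 0. q \<in> ball (0::complex) 1"
    by (intro eventually_nhds_in_open) auto
  thus "\<forall>\<^sub>F q in nhds 0. (\<lambda>n. fps_nth (Abs_fps (\<lambda>n. of_nat (divisor_sum n))) n * q ^ n) sums lambert q"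
    by eventually_elim (use divisor_sum_sums_lambert in simp)
qed

text \<open>As \<open>log_euler\<close> is minus a logarithm, this is the product over
  \<open>k\<close> of Euler products in \<open>w^k\<close> raised to the power \<open>- c k\<close>;
  hence the signs in \<open>U_exponent\<close> and \<open>v_exponent\<close>.\<close>

definition eta_product :: "nat set \<Rightarrow> (nat \<Rightarrow> int) \<Rightarrow> complex \<Rightarrow> complex" where
  "eta_product S c w = exp (\<Sum>k\<in>S. of_int (c k) * log_euler (w ^ k))"

text \<open>The coefficients of \<open>w E' / E\<close> for the eta product \<open>E\<close>; they
  are integers, whereas those of its logarithm are not.\<close>

definition eta_product_log_coeff :: "nat set \<Rightarrow> (nat \<Rightarrow> int) \<Rightarrow> nat \<Rightarrow> int" where
  "eta_product_log_coeff S c i = (\<Sum>k\<in>S. if k dvd i then c k * int k * int (divisor_sum (i div k)) else 0)"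

lemma has_field_derivative_eta_product:
  assumes S: "finite S" "0 \<notin> S" and w: "norm w < 1"
  shows "\<exists>D. (eta_product S c has_field_derivative D) (at w) \<and>
     w * D = eta_product S c w * (\<Sum>k\<in>S. of_int (c k * int k) * lambert (w ^ k))"
proof -
  have "\<exists>E. ((\<lambda>w. log_euler (w ^ k)) has_field_derivative E) (at w) \<and> w * E = of_nat k * lambert (w ^ k)" if "k \<in> S" for k
  proof -
    have k: "k > 0" using that S by (auto intro: Nat.gr0I)
    have "norm (w ^ k) < 1" using w k by (simp add: norm_power power_less_one_iff)
    then obtain E where E: "(log_euler has_field_derivative E) (at (w ^ k))" "w ^ k * E = lambert (w ^ k)"
      using has_field_derivative_log_euler by blast
    have "((\<lambda>w. w ^ k) has_field_derivative of_nat k * w ^ (k - 1)) (at w)"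
      by (auto intro!: derivative_eq_intros)
    from DERIV_chain2[OF E(1) this] have "((\<lambda>w. log_euler (w ^ k)) has_field_derivative E * (of_nat k * w ^ (k - 1))) (at w)" .
    moreover have "w * (E * (of_nat k * w ^ (k - 1))) = of_nat k * (w ^ k * E)"
      using k by (simp add: power_eq_if[of w k] mult_ac)
    ultimately show ?thesis using E(2) by metis
  qed
  then obtain E where E: "\<And>k. k \<in> S \<Longrightarrow> ((\<lambda>w. log_euler (w ^ k)) has_field_derivative E k) (at w)"
    "\<And>k. k \<in> S \<Longrightarrow> w * E k = of_nat k * lambert (w ^ k)" by metis
  have "((\<lambda>w. \<Sum>k\<in>S. of_int (c k) * log_euler (w ^ k)) has_field_derivative (\<Sum>k\<in>S. of_int (c k) * E k)) (at w)"
    by (intro DERIV_sum DERIV_cmult E)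
  hence "(eta_product S c has_field_derivative eta_product S c w * (\<Sum>k\<in>S. of_int (c k) * E k)) (at w)"
    unfolding eta_product_def[abs_def] by (rule DERIV_fun_exp)
  moreover have "w * (eta_product S c w * (\<Sum>k\<in>S. of_int (c k) * E k)) =
      eta_product S c w * (\<Sum>k\<in>S. of_int (c k) * (w * E k))"
    by (simp add: sum_distrib_left mult_ac)
  hence "w * (eta_product S c w * (\<Sum>k\<in>S. of_int (c k) * E k)) =
      eta_product S c w * (\<Sum>k\<in>S. of_int (c k * int k) * lambert (w ^ k))"
    by (simp add: E(2) mult_ac cong: sum.cong)
  ultimately show ?thesis by blast
qed

text \<open>Comparing coefficients in \<open>w E' = E L\<close>, with \<open>L\<close> the series of
  \<open>w E' / E\<close>, gives a recursion that both computes the coefficients and shows that they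
  are rational.\<close>

lemma eta_product_has_fps_expansion:
  assumes S: "finite S" "0 \<notin> S"
  obtains f where "eta_product S c has_fps_expansion f" "fps_nth f 0 = 1"
    "\<And>n. of_nat n * fps_nth f n = (\<Sum>i=0..n. of_int (eta_product_log_coeff S c i) * fps_nth f (n - i))"
proof -
  have hol: "eta_product S c holomorphic_on ball 0 1"
    using has_field_derivative_eta_product[OF S]
    by (intro holomorphic_onI) (metis dist_0_norm field_differentiable_at_within field_differentiable_def mem_ball)
  define f where "f = fps_expansion (eta_product S c) 0"
  have f: "eta_product S c has_fps_expansion f"
    unfolding f_def by (rule has_fps_expansion_fps_expansion[OF _ _ hol]) auto
  have "fps_nth f 0 = eta_product S c 0" using has_fps_expansion_imp_0_eq_fps_nth_0[OF f] by simp
  also have "\<dots> = 1"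
  proof -
    have "(\<Sum>k\<in>S. of_int (c k) * log_euler (0 ^ k)) = 0"
      using S by (intro sum.neutral) (auto simp: power_0_left)
    thus ?thesis by (simp only: eta_product_def exp_zero)
  qed
  finally have f0: "fps_nth f 0 = 1" .
  define lf :: "complex fps" where "lf = Abs_fps (\<lambda>n. of_nat (divisor_sum n))"
  have comp: "(\<lambda>w. lambert (w ^ k)) has_fps_expansion (lf oo fps_X ^ k)" if "k \<in> S" for k
  proof -
    have k: "k > 0" using that S by (auto intro: Nat.gr0I)
    have "(lambert \<circ> (\<lambda>w. w ^ k)) has_fps_expansion (lf oo fps_X ^ k)"
      using lambert_has_fps_expansion k unfolding lf_def
      by (intro has_fps_expansion_compose fps_expansion_intros) auto
    thus ?thesis by (simp add: o_def)
  qed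
  define E where "E = (\<Sum>k\<in>S. fps_const (of_int (c k * int k)) * (lf oo fps_X ^ k))"
  have E: "(\<lambda>w. \<Sum>k\<in>S. of_int (c k * int k) * lambert (w ^ k)) has_fps_expansion E"
    unfolding E_def by (intro has_fps_expansion_sum has_fps_expansion_cmult_left comp)
  have "(\<lambda>w. w * deriv (eta_product S c) w) has_fps_expansion (fps_X * fps_deriv f)"
    by (intro has_fps_expansion_mult has_fps_expansion_fps_X has_fps_expansion_deriv f)
  moreover have "(\<lambda>w. eta_product S c w * (\<Sum>k\<in>S. of_int (c k * int k) * lambert (w ^ k))) has_fps_expansion (f * E)"
    by (intro has_fps_expansion_mult f E)
  moreover have "\<forall>\<^sub>F w in nhds 0. w * deriv (eta_product S c) w = eta_product S c w * (\<Sum>k\<in>S. of_int (c k * int k) * lambert (w ^ k))"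
  proof -
    have "\<forall>\<^sub>F q in nhds 0. q \<in> ball (0::complex) 1" by (intro eventually_nhds_in_open) auto
    thus ?thesis
    proof eventually_elim
      case (elim w)
      thus ?case using has_field_derivative_eta_product[OF S, of w c] DERIV_imp_deriv by force
    qed
  qed
  ultimately have "(\<lambda>w. eta_product S c w * (\<Sum>k\<in>S. of_int (c k * int k) * lambert (w ^ k))) has_fps_expansion (fps_X * fps_deriv f)"
    using has_fps_expansion_cong by fast
  hence main: "fps_X * fps_deriv f = f * E"
    using \<open>(\<lambda>w. eta_product S c w * (\<Sum>k\<in>S. of_int (c k * int k) * lambert (w ^ k))) has_fps_expansion (f * E)\<close>
    by (rule fps_expansion_unique_complex)
  have Ei: "fps_nth E i = of_int (eta_product_log_coeff S c i)" for i
  proof -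
    have "fps_nth (fps_const (of_int (c k * int k)) * (lf oo fps_X ^ k)) i =
        (of_int (if k dvd i then c k * int k * int (divisor_sum (i div k)) else 0) :: complex)" if "k \<in> S" for k
    proof -
      have k: "k > 0" using that S by (auto intro: Nat.gr0I)
      thus ?thesis by (simp add: fps_nth_compose_X_power lf_def)
    qed
    thus ?thesis by (simp add: E_def fps_sum_nth eta_product_log_coeff_def)
  qed
  have rec: "of_nat n * fps_nth f n = (\<Sum>i=0..n. of_int (eta_product_log_coeff S c i) * fps_nth f (n - i))" for n
  proof -
    have "of_nat n * fps_nth f n = fps_nth (fps_X * fps_deriv f) n" by (cases n) simp_all
    also have "\<dots> = fps_nth (E * f) n" unfolding main by (simp add: mult.commute)
    also have "\<dots> = (\<Sum>i=0..n. of_int (eta_product_log_coeff S c i) * fps_nth f (n - i))"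
      by (simp add: fps_mult_nth Ei)
    finally show ?thesis .
  qed
  from that[OF f f0 rec] show ?thesis .
qed

lemma log_coeff_0: "eta_product_log_coeff S c 0 = 0"
  by (simp add: eta_product_log_coeff_def divisor_sum_def)

lemma rational_of_recurrence:
  fixes f :: "complex fps"
  assumes "fps_nth f 0 = 1"
    and rec: "\<And>n. of_nat n * fps_nth f n = (\<Sum>i=0..n. of_int (e i) * fps_nth f (n - i))" and e: "e 0 = 0"
  shows "fps_nth f n \<in> \<rat>"
proof (induction n rule: less_induct)
  case (less n)
  show ?case
  proof (cases "n = 0")
    case False
    have eq: "fps_nth f n = (\<Sum>i=0..n. of_int (e i) * fps_nth f (n - i)) / of_nat n"
      using rec[of n, symmetric] False by simp
    have "(\<Sum>i=0..n. of_int (e i) * fps_nth f (n - i)) \<in> \<rat>"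
    proof (rule Rats_sum)
      fix i assume "i \<in> {0..n}"
      show "of_int (e i) * fps_nth f (n - i) \<in> \<rat>"
        using less[of "n - i"] False e by (cases "i = 0") auto
    qed
    thus ?thesis unfolding eq by (intro Rats_divide) auto
  qed (use assms in simp)
qed

text \<open>Truncation to integer lists turns identities between leading coefficients of complex
  power series into evaluations.\<close>

definition fps_starts_with :: "complex fps \<Rightarrow> int list \<Rightarrow> bool" where
  "fps_starts_with f xs \<longleftrightarrow> (\<forall>n<length xs. fps_nth f n = of_int (xs ! n))"

lemma fps_starts_with_rec:
  fixes f :: "complex fps"
  assumes f0: "fps_nth f 0 = 1"
    and rec: "\<And>n. of_nat n * fps_nth f n = (\<Sum>i=0..n. of_int (e i) * fps_nth f (n - i))" and e: "e 0 = 0"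
    and es: "\<And>i. i < length xs \<Longrightarrow> e i = es ! i"
    and xs: "xs ! 0 = 1" "list_all (\<lambda>n. int n * xs ! n = (\<Sum>i\<leftarrow>[1..<Suc n]. es ! i * xs ! (n - i))) [1..<length xs]"
  shows "fps_starts_with f xs"
  unfolding fps_starts_with_def
proof (intro allI impI)
  fix n assume "n < length xs"
  thus "fps_nth f n = of_int (xs ! n)"
  proof (induction n rule: less_induct)
    case (less n)
    show ?case
    proof (cases "n = 0")
      case False
      have "of_nat n * fps_nth f n = (\<Sum>i=1..<Suc n. of_int (e i) * fps_nth f (n - i))"
        unfolding rec using e by (simp add: sum.atLeast_Suc_atMost atLeastLessThanSuc_atLeastAtMost)
      also have "\<dots> = (\<Sum>i=1..<Suc n. of_int (es ! i * xs ! (n - i)))"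
        using less False es by (intro sum.cong) auto
      also have "\<dots> = of_int (\<Sum>i\<leftarrow>[1..<Suc n]. es ! i * xs ! (n - i))"
        by (simp only: interv_sum_list_conv_sum_set_nat set_upt of_int_sum)
      also have "\<dots> = of_int (int n * xs ! n)" using xs(2) less.prems False by (simp add: list_all_iff)
      finally show ?thesis using False by simp
    qed (use f0 xs in simp)
  qed
qed

definition list_conv :: "int list \<Rightarrow> int list \<Rightarrow> int list" where
  "list_conv xs ys = map (\<lambda>n. \<Sum>i\<leftarrow>[0..<Suc n]. xs ! i * ys ! (n - i)) [0..<min (length xs) (length ys)]"

lemma fps_starts_with_mult:
  assumes "fps_starts_with f xs" "fps_starts_with g ys" "list_conv xs ys = zs"
  shows "fps_starts_with (f * g) zs"
  unfolding fps_starts_with_def assms(3)[symmetric]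
proof (intro allI impI)
  fix n assume n: "n < length (list_conv xs ys)"
  have "fps_nth (f * g) n = (\<Sum>i=0..<Suc n. fps_nth f i * fps_nth g (n - i))"
    by (simp only: fps_mult_nth atLeastLessThanSuc_atLeastAtMost)
  also have "\<dots> = (\<Sum>i=0..<Suc n. of_int (xs ! i * ys ! (n - i)))"
    using n assms by (intro sum.cong) (auto simp: fps_starts_with_def list_conv_def)
  also have "\<dots> = of_int (list_conv xs ys ! n)"
    using n by (simp only: list_conv_def interv_sum_list_conv_sum_set_nat set_upt of_int_sum nth_map_upt length_map length_upt) simp
  finally show "fps_nth (f * g) n = of_int (list_conv xs ys ! n)" .
qed

lemma fps_starts_with_add:
  assumes "fps_starts_with f xs" "fps_starts_with g ys" "map2 (+) xs ys = zs"
  shows "fps_starts_with (f + g) zs"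
  using assms by (auto simp: fps_starts_with_def)

lemma fps_starts_with_diff:
  assumes "fps_starts_with f xs" "fps_starts_with g ys" "map2 (-) xs ys = zs"
  shows "fps_starts_with (f - g) zs"
  using assms by (auto simp: fps_starts_with_def)

lemma fps_starts_with_monomial:
  assumes "map (\<lambda>n. if n = k then c else 0) [0..<m] = zs"
  shows "fps_starts_with (fps_const (of_int c) * fps_X ^ k) zs"
  unfolding assms[symmetric] by (auto simp: fps_starts_with_def fps_X_power_iff)

lemma divisor_sum_code: "divisor_sum n = sum_list (filter (\<lambda>d. d dvd n) [1..<Suc n])"
proof (cases "n = 0")
  case False
  have "x dvd n \<Longrightarrow> 0 < x \<and> x < Suc n" for x
    using False dvd_pos_nat[of n x] dvd_imp_le[of x n] by (simp add: less_Suc_eq_le)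
  hence "x \<in> {d. d dvd n} \<longleftrightarrow> x \<in> set (filter (\<lambda>d. d dvd n) [1..<Suc n])" for x
    by (auto simp: Suc_le_eq simp del: upt_Suc)
  hence "{d. d dvd n} = set (filter (\<lambda>d. d dvd n) [1..<Suc n])" by blast
  moreover have "distinct (filter (\<lambda>d. d dvd n) [1..<Suc n])" by simp
  ultimately show ?thesis
    using False unfolding divisor_sum_def by (simp only: sum_list_distinct_conv_sum_set[of _ "\<lambda>d. d", simplified] if_False)
qed (simp add: divisor_sum_def)

text \<open>For indices below 13 the scalings by 17 and 34 contribute nothing, so two divisor sums
  suffice.\<close>

lemma eta_product_log_coeff_level34:
  assumes i: "i < 13" and c: "c 1 = c1" "c 2 = c2"
    and es: "map (\<lambda>i. c1 * int (sum_list (filter (\<lambda>d. d dvd i) [1..<Suc i]))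
     + (if even i then c2 * 2 * int (sum_list (filter (\<lambda>d. d dvd (i div 2)) [1..<Suc (i div 2)])) else 0)) [0..<13] = es"
  shows "eta_product_log_coeff {1, 2, 17, 34} c i = es ! i"
proof -
  have 0: "(if k dvd i then c k * int k * int (divisor_sum (i div k)) else 0) = 0" if "k \<in> {17, 34}" for k
  proof (cases "i = 0")
    case False
    hence "\<not> k dvd i" using i that by (auto dest!: dvd_imp_le)
    thus ?thesis by simp
  qed (simp add: divisor_sum_def)
  have "eta_product_log_coeff {1, 2, 17, 34} c i = c 1 * int (divisor_sum i) + (if even i then c 2 * 2 * int (divisor_sum (i div 2)) else 0)"
    using 0[of 17] 0[of 34] unfolding eta_product_log_coeff_def by simp
  also have "\<dots> = es ! i"
    unfolding es[symmetric] c divisor_sum_code using i by (subst nth_map) (simp_all del: upt_Suc)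
  finally show ?thesis .
qed

definition U_exponent :: "nat \<Rightarrow> int" where
  "U_exponent = (\<lambda>_. 0)(1 := - 4, 2 := 4, 17 := - 4, 34 := 4)"

definition v_exponent :: "nat \<Rightarrow> int" where
  "v_exponent = (\<lambda>_. 0)(1 := 2, 2 := - 4, 17 := - 2, 34 := 4)"

definition U_prod :: "complex \<Rightarrow> complex" where "U_prod = eta_product {1, 2, 17, 34} U_exponent"
definition v_prod :: "complex \<Rightarrow> complex" where "v_prod = eta_product {1, 2, 17, 34} v_exponent"
definition v_inv_prod :: "complex \<Rightarrow> complex" where "v_inv_prod = eta_product {1, 2, 17, 34} (\<lambda>k. - v_exponent k)"

lemma v_inv_prod: "v_inv_prod w = inverse (v_prod w)"
  by (simp add: v_inv_prod_def v_prod_def eta_product_def exp_minus[symmetric] sum_negf)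

lemma U_prod_fps:
  obtains f where "U_prod has_fps_expansion f" "\<And>n. fps_nth f n \<in> \<rat>"
    "fps_starts_with f [1, -4, 6, -8, 17, -28, 38, -56, 84, -124, 172, -232, 325]"
proof -
  obtain f where f: "U_prod has_fps_expansion f" "fps_nth f 0 = 1"
    "\<And>n. of_nat n * fps_nth f n = (\<Sum>i=0..n. of_int (eta_product_log_coeff {1, 2, 17, 34} U_exponent i) * fps_nth f (n - i))"
    using eta_product_has_fps_expansion[of "{1, 2, 17, 34}" U_exponent] unfolding U_prod_def by auto
  have "fps_starts_with f [1, -4, 6, -8, 17, -28, 38, -56, 84, -124, 172, -232, 325]"
  proof (rule fps_starts_with_rec[OF f(2,3) log_coeff_0])
    show "eta_product_log_coeff {1, 2, 17, 34} U_exponent i = [0, -4, -4, -16, -4, -24, -16, -32, -4, -52, -24, -48, -16] ! i"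
      if "i < length [1, -4, 6, -8, 17, -28, 38, -56, 84, -124, 172, -232, 325 :: int]" for i
    proof -
      have "map (\<lambda>i. (-4) * int (sum_list (filter (\<lambda>d. d dvd i) [1..<Suc i])) + (if even i then (4) * 2 *
          int (sum_list (filter (\<lambda>d. d dvd (i div 2)) [1..<Suc (i div 2)])) else 0)) [0..<13] = ([0, -4, -4, -16, -4, -24, -16, -32, -4, -52, -24, -48, -16] :: int list)"
        by code_simp
      thus ?thesis
        by (rule eta_product_log_coeff_level34[rotated 3]) (use that in \<open>simp_all add: U_exponent_def\<close>)
    qed
  qed (simp, code_simp)
  with that[OF f(1)] rational_of_recurrence[OF f(2,3) log_coeff_0] show ?thesis by blast
qed

lemma v_prod_fps:
  obtains f where "v_prod has_fps_expansion f" "\<And>n. fps_nth f n \<in> \<rat>"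
    "fps_starts_with f [1, 2, 1, 2, 2, 0, 3, 2, 0, 2, 2, 2, 1]"
proof -
  obtain f where f: "v_prod has_fps_expansion f" "fps_nth f 0 = 1"
    "\<And>n. of_nat n * fps_nth f n = (\<Sum>i=0..n. of_int (eta_product_log_coeff {1, 2, 17, 34} v_exponent i) * fps_nth f (n - i))"
    using eta_product_has_fps_expansion[of "{1, 2, 17, 34}" v_exponent] unfolding v_prod_def by auto
  have "fps_starts_with f [1, 2, 1, 2, 2, 0, 3, 2, 0, 2, 2, 2, 1]"
  proof (rule fps_starts_with_rec[OF f(2,3) log_coeff_0])
    show "eta_product_log_coeff {1, 2, 17, 34} v_exponent i = [0, 2, -2, 8, -10, 12, -8, 16, -26, 26, -12, 24, -40] ! i"
      if "i < length [1, 2, 1, 2, 2, 0, 3, 2, 0, 2, 2, 2, 1 :: int]" for i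
    proof -
      have "map (\<lambda>i. (2) * int (sum_list (filter (\<lambda>d. d dvd i) [1..<Suc i])) + (if even i then (-4) * 2 *
          int (sum_list (filter (\<lambda>d. d dvd (i div 2)) [1..<Suc (i div 2)])) else 0)) [0..<13] = ([0, 2, -2, 8, -10, 12, -8, 16, -26, 26, -12, 24, -40] :: int list)"
        by code_simp
      thus ?thesis
        by (rule eta_product_log_coeff_level34[rotated 3]) (use that in \<open>simp_all add: v_exponent_def\<close>)
    qed
  qed (simp, code_simp)
  with that[OF f(1)] rational_of_recurrence[OF f(2,3) log_coeff_0] show ?thesis by blast
qed

lemma v_inv_prod_fps:
  obtains f where "v_inv_prod has_fps_expansion f" "\<And>n. fps_nth f n \<in> \<rat>"
    "fps_starts_with f [1, -2, 3, -6, 11, -18, 28, -44, 69, -104, 152, -222, 323]"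
proof -
  obtain f where f: "v_inv_prod has_fps_expansion f" "fps_nth f 0 = 1"
    "\<And>n. of_nat n * fps_nth f n = (\<Sum>i=0..n. of_int (eta_product_log_coeff {1, 2, 17, 34} (\<lambda>k. - v_exponent k) i) * fps_nth f (n - i))"
    using eta_product_has_fps_expansion[of "{1, 2, 17, 34}" "\<lambda>k. - v_exponent k"] unfolding v_inv_prod_def by auto
  have "fps_starts_with f [1, -2, 3, -6, 11, -18, 28, -44, 69, -104, 152, -222, 323]"
  proof (rule fps_starts_with_rec[OF f(2,3) log_coeff_0])
    show "eta_product_log_coeff {1, 2, 17, 34} (\<lambda>k. - v_exponent k) i = [0, -2, 2, -8, 10, -12, 8, -16, 26, -26, 12, -24, 40] ! i"
      if "i < length [1, -2, 3, -6, 11, -18, 28, -44, 69, -104, 152, -222, 323 :: int]" for i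
    proof -
      have "map (\<lambda>i. (-2) * int (sum_list (filter (\<lambda>d. d dvd i) [1..<Suc i])) + (if even i then (4) * 2 *
          int (sum_list (filter (\<lambda>d. d dvd (i div 2)) [1..<Suc (i div 2)])) else 0)) [0..<13] = ([0, -2, 2, -8, 10, -12, 8, -16, 26, -26, 12, -24, 40] :: int list)"
        by code_simp
      thus ?thesis
        by (rule eta_product_log_coeff_level34[rotated 3]) (use that in \<open>simp_all add: v_exponent_def\<close>)
    qed
  qed (simp, code_simp)
  with that[OF f(1)] rational_of_recurrence[OF f(2,3) log_coeff_0] show ?thesis by blast
qed

section \<open>An identity between the eta quotients\<close>

lemma q_par_1: "q_par 1 z = e2pi z"
  by (simp add: e2pi_def)

lemma eta_quot_eq_product:
  "eta_quot_U z = U_prod (e2pi z) / e2pi z ^ 3" "eta_quot_v z = v_prod (e2pi z) / e2pi z ^ 4"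
proof -
  define q where "q = e2pi z"
  have sc: "eta2 (of_nat k * z) = e2pi (of_nat k * z / 12) * exp (- 2 * log_euler (q ^ k))" for k
    by (simp add: eta2_def q_def e2pi_of_nat_mult)
  have e: "eta2 z = e2pi (z / 12) * exp (- 2 * log_euler (q ^ 1))"
    "eta2 (2 * z) = e2pi (2 * z / 12) * exp (- 2 * log_euler (q ^ 2))"
    "eta2 (17 * z) = e2pi (17 * z / 12) * exp (- 2 * log_euler (q ^ 17))"
    "eta2 (34 * z) = e2pi (34 * z / 12) * exp (- 2 * log_euler (q ^ 34))"
    using sc[of 1] sc[of 2] sc[of 17] sc[of 34] by simp_all
  have 1: "(e2pi (z / 12) * e2pi (17 * z / 12) / (e2pi (2 * z / 12) * e2pi (34 * z / 12))) ^ 2 = 1 / q ^ 3"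
  proof -
    have "(e2pi (z / 12) * e2pi (17 * z / 12) / (e2pi (2 * z / 12) * e2pi (34 * z / 12))) ^ 2 =
        e2pi ((z / 12 + 17 * z / 12 - (2 * z / 12 + 34 * z / 12)) + (z / 12 + 17 * z / 12 - (2 * z / 12 + 34 * z / 12)))"
      by (simp only: e2pi_add e2pi_diff power2_eq_square)
    also have "(z / 12 + 17 * z / 12 - (2 * z / 12 + 34 * z / 12)) + (z / 12 + 17 * z / 12 - (2 * z / 12 + 34 * z / 12)) = - (of_nat 3 * z)"
      by simp
    finally show ?thesis unfolding e2pi_minus e2pi_of_nat_mult q_def by (simp add: inverse_eq_divide)
  qed
  have 2: "e2pi (2 * z / 12) ^ 2 * e2pi (17 * z / 12) / (e2pi (z / 12) * e2pi (34 * z / 12) ^ 2) = 1 / q ^ 4"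
  proof -
    have "e2pi (2 * z / 12) ^ 2 * e2pi (17 * z / 12) / (e2pi (z / 12) * e2pi (34 * z / 12) ^ 2) =
        e2pi (((2 * z / 12 + 2 * z / 12) + 17 * z / 12) - (z / 12 + (34 * z / 12 + 34 * z / 12)))"
      by (simp only: e2pi_add e2pi_diff power2_eq_square)
    also have "((2 * z / 12 + 2 * z / 12) + 17 * z / 12) - (z / 12 + (34 * z / 12 + 34 * z / 12)) = - (of_nat 4 * z)"
      by simp
    finally show ?thesis unfolding e2pi_minus e2pi_of_nat_mult q_def by (simp add: inverse_eq_divide)
  qed
  have 3: "(exp (- 2 * l1) * exp (- 2 * l17) / (exp (- 2 * l2) * exp (- 2 * l34))) ^ 2 =
     exp ((- 4) * l1 + (4 * l2 + ((- 4) * l17 + 4 * l34)))" for l1 l2 l17 l34 :: complex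
    unfolding power2_eq_square exp_add[symmetric] exp_diff[symmetric] by (simp add: algebra_simps)
  have 4: "exp (- 2 * l2) ^ 2 * exp (- 2 * l17) / (exp (- 2 * l1) * exp (- 2 * l34) ^ 2) =
     exp (2 * l1 + ((- 4) * l2 + ((- 2) * l17 + 4 * l34)))" for l1 l2 l17 l34 :: complex
    unfolding power2_eq_square exp_add[symmetric] exp_diff[symmetric] by (simp add: algebra_simps)
  have "eta_quot_U z = (e2pi (z / 12) * e2pi (17 * z / 12) / (e2pi (2 * z / 12) * e2pi (34 * z / 12))) ^ 2 *
      (exp (- 2 * log_euler (q ^ 1)) * exp (- 2 * log_euler (q ^ 17)) / (exp (- 2 * log_euler (q ^ 2)) * exp (- 2 * log_euler (q ^ 34)))) ^ 2"
    unfolding eta_quot_U_def e by (simp add: power_mult_distrib power_divide mult_ac)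
  thus "eta_quot_U z = U_prod (e2pi z) / e2pi z ^ 3"
    unfolding 1 3 by (simp add: q_def[symmetric] U_prod_def eta_product_def U_exponent_def)
  have "eta_quot_v z = e2pi (2 * z / 12) ^ 2 * e2pi (17 * z / 12) / (e2pi (z / 12) * e2pi (34 * z / 12) ^ 2) *
      (exp (- 2 * log_euler (q ^ 2)) ^ 2 * exp (- 2 * log_euler (q ^ 17)) / (exp (- 2 * log_euler (q ^ 1)) * exp (- 2 * log_euler (q ^ 34)) ^ 2))"
    unfolding eta_quot_v_def e by (simp add: power_mult_distrib power_divide mult_ac)
  thus "eta_quot_v z = v_prod (e2pi z) / e2pi z ^ 4"
    unfolding 2 4 by (simp add: q_def[symmetric] v_prod_def eta_product_def v_exponent_def)
qed

definition sum_v :: "complex \<Rightarrow> complex" where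
  "sum_v z = eta_quot_v z + 17 / eta_quot_v z"

text \<open>
  \<open>X_rel = 0\<close> is the equation \<open>X\<^sup>2 + 16 X + 18 + 4 U = v + 17 / v\<close> for \<open>X = X_num / X_den\<close>, without denominators.
  The pole of \<open>X_rel\<close> at \<open>\<infinity>\<close> has order at most 12, so 13 vanishing coefficients suffice.
\<close>
definition X_num :: "complex \<Rightarrow> complex" where
  "X_num z = eta_quot_U z ^ 2 - 60 * eta_quot_U z + 16 * sum_v z - 288"

definition X_den :: "complex \<Rightarrow> complex" where
  "X_den z = sum_v z + 238 - 9 * eta_quot_U z"

definition X_rel :: "complex \<Rightarrow> complex" where
  "X_rel z = X_num z ^ 2 + 16 * X_num z * X_den z + (18 + 4 * eta_quot_U z - sum_v z) * X_den z ^ 2"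

text \<open>Each quantity is \<open>q^-k\<close> times a power series, with \<open>k = 3\<close> for
  \<open>U\<close>, 4 for \<open>s\<close> and the denominator, 6 for the numerator and 12 for the
  relation; the monomials below equalise these orders. The last claim records the leading
  coefficient 1 of the denominator for \<open>den_fun_nonzero\<close>.\<close>

lemma X_rel_fps:
  obtains F f where "F has_fps_expansion f" "\<And>n. n < 13 \<Longrightarrow> fps_nth f n = 0" "\<And>z. X_rel z = F (e2pi z) / e2pi z ^ 12"
    and "\<exists>D d. D has_fps_expansion d \<and> fps_nth d 0 = 1 \<and> (\<forall>z. X_den z = D (e2pi z) / e2pi z ^ 4)"
proof -
  obtain u0 where u': "U_prod has_fps_expansion u0" and u: "fps_starts_with u0 [1, -4, 6, -8, 17, -28, 38, -56, 84, -124, 172, -232, 325]"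
    using U_prod_fps by metis
  obtain v0 where v': "v_prod has_fps_expansion v0" and v: "fps_starts_with v0 [1, 2, 1, 2, 2, 0, 3, 2, 0, 2, 2, 2, 1]"
    using v_prod_fps by metis
  obtain w0 where w': "v_inv_prod has_fps_expansion w0" and w: "fps_starts_with w0 [1, -2, 3, -6, 11, -18, 28, -44, 69, -104, 152, -222, 323]"
    using v_inv_prod_fps by metis
  \<comment> \<open>\<open>17 / v\<close> begins with \<open>17 q^4\<close>, which becomes
    \<open>17 q^8\<close> after the common factor \<open>q^-4\<close> of \<open>s\<close> is taken
    out.\<close>
  define c170 :: "complex fps" where "c170 = fps_const (of_int (17)) * fps_X ^ 8"
  have c17: "fps_starts_with c170 [0, 0, 0, 0, 0, 0, 0, 0, 17, 0, 0, 0, 0]"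
    unfolding c170_def by (rule fps_starts_with_monomial[where m = 13]) code_simp
  define m10 where "m10 = c170 * w0"
  have m1: "fps_starts_with m10 [0, 0, 0, 0, 0, 0, 0, 0, 17, - 34, 51, - 102, 187]"
    unfolding m10_def by (rule fps_starts_with_mult[OF c17 w]) code_simp
  define S0 where "S0 = v0 + m10"
  have S: "fps_starts_with S0 [1, 2, 1, 2, 2, 0, 3, 2, 17, - 32, 53, - 100, 188]"
    unfolding S0_def by (rule fps_starts_with_add[OF v m1]) code_simp
  define uu0 where "uu0 = u0 * u0"
  have uu: "fps_starts_with uu0 [1, - 8, 28, - 64, 134, - 288, 568, - 1024, 1809, - 3152, 5316, - 8704, 13990]"
    unfolding uu0_def by (rule fps_starts_with_mult[OF u u]) code_simp
  define c600 :: "complex fps" where "c600 = fps_const (of_int (60)) * fps_X ^ 3"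
  have c60: "fps_starts_with c600 [0, 0, 0, 60, 0, 0, 0, 0, 0, 0, 0, 0, 0]"
    unfolding c600_def by (rule fps_starts_with_monomial[where m = 13]) code_simp
  define m20 where "m20 = c600 * u0"
  have m2: "fps_starts_with m20 [0, 0, 0, 60, - 240, 360, - 480, 1020, - 1680, 2280, - 3360, 5040, - 7440]"
    unfolding m20_def by (rule fps_starts_with_mult[OF c60 u]) code_simp
  define n10 where "n10 = uu0 - m20"
  have n1: "fps_starts_with n10 [1, - 8, 28, - 124, 374, - 648, 1048, - 2044, 3489, - 5432, 8676, - 13744, 21430]"
    unfolding n10_def by (rule fps_starts_with_diff[OF uu m2]) code_simp
  define c160 :: "complex fps" where "c160 = fps_const (of_int (16)) * fps_X ^ 2"
  have c16: "fps_starts_with c160 [0, 0, 16, 0, 0, 0, 0, 0, 0, 0, 0, 0, 0]"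
    unfolding c160_def by (rule fps_starts_with_monomial[where m = 13]) code_simp
  define m30 where "m30 = c160 * S0"
  have m3: "fps_starts_with m30 [0, 0, 16, 32, 16, 32, 32, 0, 48, 32, 272, - 512, 848]"
    unfolding m30_def by (rule fps_starts_with_mult[OF c16 S]) code_simp
  define n20 where "n20 = n10 + m30"
  have n2: "fps_starts_with n20 [1, - 8, 44, - 92, 390, - 616, 1080, - 2044, 3537, - 5400, 8948, - 14256, 22278]"
    unfolding n20_def by (rule fps_starts_with_add[OF n1 m3]) code_simp
  define c2880 :: "complex fps" where "c2880 = fps_const (of_int (288)) * fps_X ^ 6"
  have c288: "fps_starts_with c2880 [0, 0, 0, 0, 0, 0, 288, 0, 0, 0, 0, 0, 0]"
    unfolding c2880_def by (rule fps_starts_with_monomial[where m = 13]) code_simp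
  define n0 where "n0 = n20 - c2880"
  have n: "fps_starts_with n0 [1, - 8, 44, - 92, 390, - 616, 792, - 2044, 3537, - 5400, 8948, - 14256, 22278]"
    unfolding n0_def by (rule fps_starts_with_diff[OF n2 c288]) code_simp
  define c2380 :: "complex fps" where "c2380 = fps_const (of_int (238)) * fps_X ^ 4"
  have c238: "fps_starts_with c2380 [0, 0, 0, 0, 238, 0, 0, 0, 0, 0, 0, 0, 0]"
    unfolding c2380_def by (rule fps_starts_with_monomial[where m = 13]) code_simp
  define d10 where "d10 = S0 + c2380"
  have d1: "fps_starts_with d10 [1, 2, 1, 2, 240, 0, 3, 2, 17, - 32, 53, - 100, 188]"
    unfolding d10_def by (rule fps_starts_with_add[OF S c238]) code_simp
  define c90 :: "complex fps" where "c90 = fps_const (of_int (9)) * fps_X ^ 1"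
  have c9: "fps_starts_with c90 [0, 9, 0, 0, 0, 0, 0, 0, 0, 0, 0, 0, 0]"
    unfolding c90_def by (rule fps_starts_with_monomial[where m = 13]) code_simp
  define m40 where "m40 = c90 * u0"
  have m4: "fps_starts_with m40 [0, 9, - 36, 54, - 72, 153, - 252, 342, - 504, 756, - 1116, 1548, - 2088]"
    unfolding m40_def by (rule fps_starts_with_mult[OF c9 u]) code_simp
  define d0 where "d0 = d10 - m40"
  have d: "fps_starts_with d0 [1, - 7, 37, - 52, 312, - 153, 255, - 340, 521, - 788, 1169, - 1648, 2276]"
    unfolding d0_def by (rule fps_starts_with_diff[OF d1 m4]) code_simp
  define nn0 where "nn0 = n0 * n0"
  have nn: "fps_starts_with nn0 [1, - 16, 152, - 888, 4188, - 15568, 54224, - 142728, 374918, - 873472, 1788864, - 3867752, 7958008]"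
    unfolding nn0_def by (rule fps_starts_with_mult[OF n n]) code_simp
  define nd0 where "nd0 = n0 * d0"
  have nd: "fps_starts_with nd0 [1, - 15, 137, - 748, 3390, - 11687, 39525, - 88476, 229398, - 442209, 786384, - 1602804, 2904204]"
    unfolding nd0_def by (rule fps_starts_with_mult[OF n d]) code_simp
  define m50 where "m50 = c160 * nd0"
  have m5: "fps_starts_with m50 [0, 0, 16, - 240, 2192, - 11968, 54240, - 186992, 632400, - 1415616, 3670368, - 7075344, 12582144]"
    unfolding m50_def by (rule fps_starts_with_mult[OF c16 nd]) code_simp
  define c180 :: "complex fps" where "c180 = fps_const (of_int (18)) * fps_X ^ 4"
  have c18: "fps_starts_with c180 [0, 0, 0, 0, 18, 0, 0, 0, 0, 0, 0, 0, 0]"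
    unfolding c180_def by (rule fps_starts_with_monomial[where m = 13]) code_simp
  define c40 :: "complex fps" where "c40 = fps_const (of_int (4)) * fps_X ^ 1"
  have c4: "fps_starts_with c40 [0, 4, 0, 0, 0, 0, 0, 0, 0, 0, 0, 0, 0]"
    unfolding c40_def by (rule fps_starts_with_monomial[where m = 13]) code_simp
  define m60 where "m60 = c40 * u0"
  have m6: "fps_starts_with m60 [0, 4, - 16, 24, - 32, 68, - 112, 152, - 224, 336, - 496, 688, - 928]"
    unfolding m60_def by (rule fps_starts_with_mult[OF c4 u]) code_simp
  define e10 where "e10 = c180 + m60"
  have e1: "fps_starts_with e10 [0, 4, - 16, 24, - 14, 68, - 112, 152, - 224, 336, - 496, 688, - 928]"
    unfolding e10_def by (rule fps_starts_with_add[OF c18 m6]) code_simp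
  define e20 where "e20 = e10 - S0"
  have e2: "fps_starts_with e20 [- 1, 2, - 17, 22, - 16, 68, - 115, 150, - 241, 368, - 549, 788, - 1116]"
    unfolding e20_def by (rule fps_starts_with_diff[OF e1 S]) code_simp
  define dd0 where "dd0 = d0 * d0"
  have dd: "fps_starts_with dd0 [1, - 14, 123, - 622, 2721, - 8522, 28444, - 48020, 137928, - 156022, 269813, - 422348, 690251]"
    unfolding dd0_def by (rule fps_starts_with_mult[OF d d]) code_simp
  define m70 where "m70 = e20 * dd0"
  have m7: "fps_starts_with m70 [- 1, 16, - 168, 1128, - 6380, 27536, - 108464, 329720, - 1007318, 2289088, - 5459232, 10943096, - 20540152]"
    unfolding m70_def by (rule fps_starts_with_mult[OF e2 dd]) code_simp
  define g10 where "g10 = nn0 + m50"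
  have g1: "fps_starts_with g10 [1, - 16, 168, - 1128, 6380, - 27536, 108464, - 329720, 1007318, - 2289088, 5459232, - 10943096, 20540152]"
    unfolding g10_def by (rule fps_starts_with_add[OF nn m5]) code_simp
  define G0 where "G0 = g10 + m70"
  \<comment> \<open>These are the coefficients of \<open>q^-12\<close> up to \<open>q^0\<close> in
    \<open>X_rel\<close>: the whole polar part and the constant term.\<close>
  have G: "fps_starts_with G0 [0, 0, 0, 0, 0, 0, 0, 0, 0, 0, 0, 0, 0]"
    unfolding G0_def by (rule fps_starts_with_add[OF g1 m7]) code_simp
  define SF where "SF = (\<lambda>q. v_prod q + of_int 17 * q ^ 8 * v_inv_prod q)"
  define NF where "NF = (\<lambda>q. U_prod q * U_prod q - of_int 60 * q ^ 3 * U_prod q + of_int 16 * q ^ 2 * SF q - of_int 288 * q ^ 6)"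
  define DF where "DF = (\<lambda>q. SF q + of_int 238 * q ^ 4 - of_int 9 * q ^ 1 * U_prod q)"
  define GF where "GF = (\<lambda>q. NF q * NF q + of_int 16 * q ^ 2 * (NF q * DF q) + (of_int 18 * q ^ 4 + of_int 4 * q ^ 1 * U_prod q - SF q) * (DF q * DF q))"
  have mono: "(\<lambda>q :: complex. of_int c * q ^ k) has_fps_expansion (fps_const (of_int c) * fps_X ^ k)" for c :: int and k
    by (intro has_fps_expansion_mult has_fps_expansion_const has_fps_expansion_power has_fps_expansion_fps_X)
  have SF: "SF has_fps_expansion S0"
    unfolding SF_def S0_def m10_def c170_def by (intro has_fps_expansion_add has_fps_expansion_mult mono v' w')
  have NF: "NF has_fps_expansion n0"
    unfolding NF_def n0_def n20_def n10_def m20_def m30_def uu0_def c600_def c160_def c2880_def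
    by (intro has_fps_expansion_add has_fps_expansion_diff has_fps_expansion_mult mono u' SF)
  have DF: "DF has_fps_expansion d0"
    unfolding DF_def d0_def d10_def m40_def c2380_def c90_def
    by (intro has_fps_expansion_add has_fps_expansion_diff has_fps_expansion_mult mono u' SF)
  have GF: "GF has_fps_expansion G0"
    unfolding GF_def G0_def g10_def nn0_def m50_def nd0_def c160_def m70_def e20_def e10_def c180_def m60_def c40_def dd0_def
    by (intro has_fps_expansion_add has_fps_expansion_diff has_fps_expansion_mult mono u' SF NF DF)
  have G0: "fps_nth G0 n = 0" if "n < 13" for n
  proof -
    have "[0, 0, 0, 0, 0, 0, 0, 0, 0, 0, 0, 0, 0] = replicate 13 (0::int)" by (simp add: numeral_eq_Suc)
    thus ?thesis using G that by (simp add: fps_starts_with_def)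
  qed
  have cancel: "a * a / (r * r) = (a / r) ^ 2" "r \<noteq> 0 \<Longrightarrow> a * r * b / (r * r) = a * (b / r)"
      "r \<noteq> 0 \<Longrightarrow> a * r * b / (r * p) = a * (b / p)" "r \<noteq> 0 \<Longrightarrow> a * r / r = a"
      "r \<noteq> 0 \<Longrightarrow> a * r * b = a * (r * r) * b / r"
      "r \<noteq> 0 \<Longrightarrow> a * r * (b * c) / (r * p * p') = a * (b / p) * (c / p')"
      "a * (b * b) / (r * r * r) = a / r * (b / r) ^ 2" for a b c r p p' :: complex
    by (simp_all add: power2_eq_square)
  have sv: "sum_v z = SF (e2pi z) / e2pi z ^ 4" for z
  proof -
    have "17 / eta_quot_v z = 17 * e2pi z ^ 4 * v_inv_prod (e2pi z)"
      by (simp add: eta_quot_eq_product v_inv_prod divide_inverse)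
    also have "\<dots> = 17 * e2pi z ^ 8 * v_inv_prod (e2pi z) / e2pi z ^ 4"
    proof -
      have p8: "e2pi z ^ 8 = e2pi z ^ 4 * e2pi z ^ 4" by (simp flip: power_add)
      show ?thesis unfolding p8 by (rule cancel(5)) simp
    qed
    finally show ?thesis by (simp add: sum_v_def eta_quot_eq_product SF_def add_divide_distrib)
  qed
  have N: "X_num z = NF q / q ^ 6" and D: "X_den z = DF q / q ^ 4" and R: "X_rel z = GF q / q ^ 12" if "q = e2pi z" for z q
  proof -
    have q: "q \<noteq> 0" using that by simp
    have p: "q ^ 6 = q ^ 3 * q ^ 3" "q ^ 6 = q ^ 2 * q ^ 4" "q ^ 12 = q ^ 6 * q ^ 6" "q ^ 12 = q ^ 2 * q ^ 6 * q ^ 4"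
       "q ^ 12 = q ^ 4 * q ^ 4 * q ^ 4" by (simp_all flip: power_add)
    have p6: "q ^ 4 = q ^ 1 * q ^ 3" unfolding power_add[symmetric] by simp
    show N: "X_num z = NF q / q ^ 6"
    proof -
      have "U_prod q * U_prod q / q ^ 6 = (U_prod q / q ^ 3) ^ 2" unfolding p(1) by (rule cancel)
      moreover have "of_int 60 * q ^ 3 * U_prod q / q ^ 6 = of_int 60 * (U_prod q / q ^ 3)" unfolding p(1) by (rule cancel) (simp add: q)
      moreover have "of_int 16 * q ^ 2 * SF q / q ^ 6 = of_int 16 * (SF q / q ^ 4)" unfolding p(2) by (rule cancel) (simp add: q)
      moreover have "of_int 288 * q ^ 6 / q ^ 6 = (of_int 288 :: complex)" by (rule cancel) (simp add: q)
      ultimately show ?thesis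
        unfolding X_num_def sv eta_quot_eq_product that[symmetric] NF_def add_divide_distrib diff_divide_distrib by (simp only: of_int_numeral)
    qed
    show D: "X_den z = DF q / q ^ 4"
    proof -
      have "of_int 9 * q ^ 1 * U_prod q / q ^ 4 = of_int 9 * (U_prod q / q ^ 3)" unfolding p6 by (rule cancel) (simp add: q)
      moreover have "of_int 238 * q ^ 4 / q ^ 4 = (of_int 238 :: complex)" by (rule cancel) (simp add: q)
      ultimately show ?thesis
        unfolding X_den_def sv eta_quot_eq_product that[symmetric] DF_def add_divide_distrib diff_divide_distrib by (simp only: of_int_numeral)
    qed
    have a: "NF q * NF q / q ^ 12 = (NF q / q ^ 6) ^ 2" unfolding p(3) by (rule cancel)
    have b: "of_int 16 * q ^ 2 * (NF q * DF q) / q ^ 12 = of_int 16 * (NF q / q ^ 6) * (DF q / q ^ 4)"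
      unfolding p(4) by (rule cancel) (simp add: q)
    have c: "(of_int 18 * q ^ 4 + of_int 4 * q ^ 1 * U_prod q - SF q) * (DF q * DF q) / q ^ 12 =
        (of_int 18 + of_int 4 * (U_prod q / q ^ 3) - SF q / q ^ 4) * (DF q / q ^ 4) ^ 2"
    proof -
      have 1: "of_int 4 * q ^ 1 * U_prod q / q ^ 4 = of_int 4 * (U_prod q / q ^ 3)" unfolding p6 by (rule cancel) (simp add: q)
      have 2: "of_int 18 * q ^ 4 / q ^ 4 = (of_int 18 :: complex)" by (rule cancel) (simp add: q)
      have "(of_int 18 * q ^ 4 + of_int 4 * q ^ 1 * U_prod q - SF q) / q ^ 4 = of_int 18 + of_int 4 * (U_prod q / q ^ 3) - SF q / q ^ 4"
        unfolding add_divide_distrib diff_divide_distrib 1 2 ..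
      thus ?thesis unfolding p(5) cancel(7) by (simp only:)
    qed
    show "X_rel z = GF q / q ^ 12"
      unfolding X_rel_def N D GF_def add_divide_distrib a b c eta_quot_eq_product sv that[symmetric] by (simp only: of_int_numeral)
  qed
  have d00: "fps_nth d0 0 = 1" using d by (simp add: fps_starts_with_def)
  show ?thesis
    by (rule that[OF GF G0 R[OF refl]]) (use DF d00 D in blast)+
qed

text \<open>Matrices with odd \<open>c\<close> are left as they are, since the bounds at those cusps
  are uniform in the matrix. For even \<open>c\<close> the cusp is infinity if 17 divides
  \<open>c\<close>, and otherwise equivalent to 1/2; in the latter case a translation has to be
  allowed.\<close>

lemma cusp_representative:
  assumes A: "A \<in> SL2Z"
    and f: "\<And>G z. G \<in> Gamma0 34 \<Longrightarrow> z \<in> uhp \<Longrightarrow> f (moebius_act G z) = f z"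
  shows "(\<exists>a b c d. A = int_mat2 a b c d \<and> a * d - b * c = 1 \<and> odd c) \<or> (\<forall>z\<in>uhp. f (moebius_act A z) = f z) \<or>
    (\<exists>j :: int. \<forall>z\<in>uhp. f (moebius_act A z) = f (moebius_act (int_mat2 1 0 2 1) (z + of_int j)))"
proof -
  obtain a b c d where abcd: "A = int_mat2 a b c d" and det: "a * d - b * c = 1" using A by (rule SL2Z_cases)
  show ?thesis
  proof (cases "odd c")
    case True thus ?thesis using abcd det by blast
  next
    case even: False
    then obtain c' where c': "c = 2 * c'" by blast
    show ?thesis
    proof (cases "17 dvd c'")
      case True
      hence "A \<in> Gamma0 34" using det by (auto simp: abcd int_mat2_in_Gamma0_iff c')
      thus ?thesis using f by blast
    next
      case False
      have "Factorial_Ring.prime (17::int)" by simp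
      hence "coprime c' 17" using False prime_imp_coprime[of 17 c'] by (simp add: coprime_commute)
      then obtain u v where uv: "u * c' + v * 17 = 1" by (metis bezout_int coprime_iff_gcd_eq_1)
      \<comment> \<open>Solves \<open>c' (1 + 2 j) = d\<close> modulo 17: \<open>u\<close> inverts
        \<open>c'\<close> and 9 inverts 2.\<close>
      define j where "j = 9 * u * (d - c')"
      have "c' * (1 + 2 * j) - d = 17 * ((d - c') * (u * c' - v))"
      proof -
        have "c' * (1 + 2 * j) - d = 18 * (u * c') * (d - c') - (d - c')" by (simp add: j_def algebra_simps)
        also have "\<dots> = 17 * (u * c') * (d - c') + (u * c' - 1) * (d - c')" by (simp add: algebra_simps)
        also have "u * c' - 1 = - v * 17" using uv by simp
        finally show ?thesis by (simp add: algebra_simps)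
      qed
      hence "c * (1 + 2 * j) - 2 * d = 34 * ((d - c') * (u * c' - v))" unfolding c' by (simp add: algebra_simps)
      hence dvd: "34 dvd c * (1 + 2 * j) - 2 * d" by (rule dvdI)
      define G where "G = int_mat2 (a * (1 + 2 * j) - 2 * b) (b - a * j) (c * (1 + 2 * j) - 2 * d) (d - c * j)"
      have "(a * (1 + 2 * j) - 2 * b) * (d - c * j) - (b - a * j) * (c * (1 + 2 * j) - 2 * d) = a * d - b * c"
        by (simp add: algebra_simps)
      hence G: "G \<in> Gamma0 34" using det dvd by (simp add: G_def int_mat2_in_Gamma0_iff)
      have "A = G ** int_mat2 1 j 2 (1 + 2 * j)"
        unfolding G_def int_mat2_mult abcd by (simp add: algebra_simps)
      moreover have "int_mat2 1 j 2 (1 + 2 * j) = int_mat2 1 0 2 1 ** int_mat2 1 j 0 1"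
        by (simp add: int_mat2_mult add.commute)
      ultimately have Aeq: "A = G ** (int_mat2 1 0 2 1 ** int_mat2 1 j 0 1)" by simp
      have S: "int_mat2 1 0 2 1 \<in> SL2Z" "int_mat2 1 j 0 1 \<in> SL2Z" by (simp_all add: int_mat2_in_SL2Z_iff)
      have "f (moebius_act A z) = f (moebius_act (int_mat2 1 0 2 1) (z + of_int j))" if z: "z \<in> uhp" for z
      proof -
        have zj: "z + of_int j \<in> uhp" using z by (simp add: uhp_def)
        have Tj: "moebius_act (int_mat2 1 j 0 1) z = z + of_int j" by (simp add: moebius_act_int_mat2)
        have GS: "G \<in> SL2Z" using G Gamma0_subset_SL2Z by blast
        have "moebius_act A z = moebius_act G (moebius_act (int_mat2 1 0 2 1 ** int_mat2 1 j 0 1) z)"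
          unfolding Aeq by (rule SL2Z_moebius_mult[OF SL2Z_mult[OF S] z])
        also have "moebius_act (int_mat2 1 0 2 1 ** int_mat2 1 j 0 1) z = moebius_act (int_mat2 1 0 2 1) (z + of_int j)"
          unfolding Tj[symmetric] by (rule SL2Z_moebius_mult[OF S(2) z])
        finally show ?thesis using f[OF G SL2Z_moebius_in_uhp[OF S(1) zj]] by simp
      qed
      thus ?thesis by blast
    qed
  qed
qed

text \<open>Exhibits the cusp 1/2 as the image of infinity under \<open>w_17\<close>, so that
  statements at infinity can be transferred there.\<close>

lemma moebius_half: "moebius_act (int_mat2 1 0 2 1) w = (17 * ((w - 8) / 17) + 8) / (34 * ((w - 8) / 17) + 17)"
proof -
  have "17 * (u / 17) + 8 = u + 8" "34 * (u / 17) + 17 = 2 * u + 17" for u :: complex by simp_all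
  from this[of "w - 8"] show ?thesis by (simp only: moebius_act_int_mat2) simp
qed

text \<open>Invariance under \<open>w_17\<close> carries the decay at infinity over to the cusp 1/2.
  At the odd cusps \<open>U\<close>, \<open>v\<close> and \<open>17 / v\<close> are bounded, and
  \<open>X_rel\<close> is a polynomial in them.\<close>

lemma X_rel_eq_0:
  assumes z: "z \<in> uhp"
  shows "X_rel z = 0"
proof -
  obtain F f where F: "F has_fps_expansion f" "\<And>n. n < 13 \<Longrightarrow> fps_nth f n = 0" "\<And>z. X_rel z = F (e2pi z) / e2pi z ^ 12"
    using X_rel_fps by metis
  have lim: "\<exists>Y. \<forall>z. Im z > Y \<longrightarrow> norm (X_rel z) < e" if e: "e > 0" for e
  proof -
    obtain Y where Y: "\<And>z. Im z > Y \<Longrightarrow> norm (F (q_par 1 z) / q_par 1 z ^ 12 - fps_nth f 12) < e"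
    proof (rule fps_cusp_limit[OF F(1) _ zero_less_one e, of 12])
      show "fps_nth f n = 0" if "n < 12" for n using F(2) that by simp
    qed blast
    have "fps_nth f 12 = 0" by (rule F(2)) simp
    thus ?thesis using Y unfolding F(3) q_par_1 by auto
  qed
  have inv: "X_rel (moebius_act A z) = X_rel z" if "A \<in> Gamma0 34" "z \<in> uhp" for A z
    using that by (simp add: X_rel_def X_num_def X_den_def sum_v_def eta_quot_Gamma0)
  have w_inv: "X_rel ((17 * z + 8) / (34 * z + 17)) = X_rel z" if "z \<in> uhp" for z
  proof -
    have "sum_v ((17 * z + 8) / (34 * z + 17)) = sum_v z"
      using that by (simp add: sum_v_def eta_quot_involution)
    thus ?thesis using that by (simp add: X_rel_def X_num_def X_den_def eta_quot_involution)
  qed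
  have hol: "X_rel holomorphic_on uhp"
    unfolding X_rel_def[abs_def] X_num_def[abs_def] X_den_def[abs_def] sum_v_def[abs_def]
    by (intro holomorphic_intros holomorphic_eta_quot) auto
  obtain Y1 where Y1: "\<And>z. Im z > Y1 \<Longrightarrow> norm (X_rel z) < 1" using lim[of 1] by auto
  obtain C where C: "C \<ge> 1"
    "\<And>a b c d z. a * d - b * c = 1 \<Longrightarrow> Im z \<ge> 1 \<Longrightarrow> odd c \<Longrightarrow>
       norm (eta_quot_U ((of_int a * z + of_int b) / (of_int c * z + of_int d))) \<le> C * exp (- Im z / 2) \<and>
       norm (eta_quot_v ((of_int a * z + of_int b) / (of_int c * z + of_int d))) \<le> C \<and>
       norm (17 / eta_quot_v ((of_int a * z + of_int b) / (of_int c * z + of_int d))) \<le> C"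
    by (rule eta_quot_cusp_bounds) blast
  show ?thesis
  proof (rule modular_function_eq_0[OF _ hol inv _ lim z])
    fix A assume A: "A \<in> SL2Z"
    show "\<exists>K Y. \<forall>z. Im z > Y \<longrightarrow> norm (X_rel (moebius_act A z)) \<le> K"
    proof -
      consider (odd) a b c d where "A = int_mat2 a b c d" "a * d - b * c = 1" "odd c"
        | (infinity) "\<And>z. z \<in> uhp \<Longrightarrow> X_rel (moebius_act A z) = X_rel z"
        | (half) j :: int where "\<And>z. z \<in> uhp \<Longrightarrow> X_rel (moebius_act A z) = X_rel (moebius_act (int_mat2 1 0 2 1) (z + of_int j))"
        using cusp_representative[of A X_rel, OF A inv] by blast
      thus ?thesis
      proof cases
      case (odd a b c d)
      \<comment> \<open>\<open>X_rel\<close> as a polynomial in \<open>U\<close> and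
        \<open>s\<close>, bounded on a product of discs by compactness.\<close>
      define P where "P = (\<lambda>(u, s). ((u ^ 2 - 60 * u + 16 * s - 288) ^ 2 + 16 * (u ^ 2 - 60 * u + 16 * s - 288) * (s + 238 - 9 * u)
         + (18 + 4 * u - s) * (s + 238 - 9 * u) ^ 2 :: complex))"
      have "compact (P ` (cball 0 C \<times> cball 0 (2 * C)))"
        unfolding P_def case_prod_beta by (intro compact_continuous_image compact_Times compact_cball continuous_intros)
      hence "bounded (P ` (cball 0 C \<times> cball 0 (2 * C)))" by (rule compact_imp_bounded)
      then obtain K where "\<forall>y\<in>P ` (cball 0 C \<times> cball 0 (2 * C)). norm y \<le> K" unfolding bounded_iff by blast
      hence K: "norm (P (u, s)) \<le> K" if "norm u \<le> C" "norm s \<le> 2 * C" for u s using that by auto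
      have "norm (X_rel (moebius_act A z)) \<le> K" if z: "Im z > 1" for z
      proof -
        define w where "w = (of_int a * z + of_int b) / (of_int c * z + of_int d)"
        have b: "norm (eta_quot_U w) \<le> C * exp (- Im z / 2)" "norm (eta_quot_v w) \<le> C" "norm (17 / eta_quot_v w) \<le> C"
          using C(2)[OF odd(2) _ odd(3), of z] z unfolding w_def by auto
        have "C * exp (- Im z / 2) \<le> C * 1" using C(1) z by (intro mult_left_mono) auto
        hence "norm (eta_quot_U w) \<le> C" using b(1) by linarith
        moreover have "norm (sum_v w) \<le> 2 * C"
          unfolding sum_v_def using norm_triangle_ineq[of "eta_quot_v w" "17 / eta_quot_v w"] b(2,3) by linarith
        ultimately have "norm (P (eta_quot_U w, sum_v w)) \<le> K" by (rule K)
        thus ?thesis by (simp add: P_def X_rel_def X_num_def X_den_def odd(1) moebius_act_int_mat2 w_def)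
      qed
      thus ?thesis by blast
    next
      case infinity
      thus ?thesis using Y1 by (intro exI[of _ 1] exI[of _ "max 0 Y1"]) (auto simp: uhp_def less_imp_le)
    next
      case (half j)
      have "norm (X_rel (moebius_act A z)) \<le> 1" if z: "Im z > max 0 (17 * Y1)" for z
      proof -
        have zu: "z \<in> uhp" using z by (simp add: uhp_def)
        define w where "w = (z + of_int j - 8) / 17"
        have "Im w = Im z / 17"
        proof -
          have "w = (z + of_int j - 8) / of_real 17" by (simp add: w_def)
          thus ?thesis by (simp only: Im_divide_of_real) simp
        qed
        hence w: "w \<in> uhp" "Im w > Y1" using z by (auto simp: uhp_def)
        have "X_rel (moebius_act A z) = X_rel ((17 * w + 8) / (34 * w + 17))"
          unfolding half[OF zu] moebius_half w_def ..
        thus ?thesis using w_inv[OF w(1)] Y1[OF w(2)] by simp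
      qed
      thus ?thesis by blast
      qed
    qed
  qed auto
qed

section \<open>The functions x, y and t\<close>

text \<open>On these elements evaluation at any point respects sums and products, since no value set
  at a pole interferes.\<close>

definition mero_hol :: "uhp_mero \<Rightarrow> bool" where
  "mero_hol f \<longleftrightarrow> mero_eval f holomorphic_on uhp"

lemma mero_hol_analytic: "mero_hol f \<Longrightarrow> z \<in> uhp \<Longrightarrow> mero_eval f analytic_on {z}"
  unfolding mero_hol_def using analytic_on_open[OF open_uhp] analytic_on_subset by blast

lemma mero_hol_eval:
  assumes "mero_hol f" "mero_hol g" "z \<in> uhp"
  shows mero_hol_eval_add: "mero_eval (f + g) z = mero_eval f z + mero_eval g z"
    and mero_hol_eval_mult: "mero_eval (f * g) z = mero_eval f z * mero_eval g z"
    and mero_hol_eval_diff: "mero_eval (f - g) z = mero_eval f z - mero_eval g z"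
    and mero_hol_eval_uminus: "mero_eval (- f) z = - mero_eval f z"
  using mero_eval_analytic_op[OF assms(3) mero_hol_analytic[OF assms(1,3)] mero_hol_analytic[OF assms(2,3)]] by blast+

lemma mero_hol_ops:
  assumes f: "mero_hol f" and g: "mero_hol g"
  shows "mero_hol (f + g)" "mero_hol (f * g)" "mero_hol (f - g)" "mero_hol (- f)"
proof -
  note h = f[unfolded mero_hol_def] g[unfolded mero_hol_def]
  show "mero_hol (f + g)" unfolding mero_hol_def
    by (rule holomorphic_transform[OF holomorphic_on_add[OF h]]) (simp add: mero_hol_eval[OF f g])
  show "mero_hol (f * g)" unfolding mero_hol_def
    by (rule holomorphic_transform[OF holomorphic_on_mult[OF h]]) (simp add: mero_hol_eval[OF f g])
  show "mero_hol (f - g)" unfolding mero_hol_def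
    by (rule holomorphic_transform[OF holomorphic_on_diff[OF h]]) (simp add: mero_hol_eval[OF f g])
  show "mero_hol (- f)" unfolding mero_hol_def
    by (rule holomorphic_transform[OF holomorphic_on_minus[OF h(1)]]) (simp add: mero_hol_eval[OF f f])
qed

lemma mero_hol_const: "mero_hol (mero_const c)"
  unfolding mero_hol_def by (rule holomorphic_transform[OF holomorphic_on_const[of c]]) (simp add: mero_eval_const)

lemma mero_const_numeral: "mero_const (numeral k) = numeral k" "mero_const 1 = 1" "mero_const 0 = 0"
  by (simp_all add: is_ring_hom_simps[OF is_ring_hom_mero_const])

lemma mero_hol_numeral: "mero_hol (numeral k)" "mero_hol 1" "mero_hol 0"
  using mero_hol_const by (metis mero_const_numeral)+

lemma mero_eval_numeral:
  assumes "z \<in> uhp" shows "mero_eval (numeral k) z = numeral k" "mero_eval 1 z = 1" "mero_eval 0 z = 0"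
  using mero_eval_const[OF assms] by (metis mero_const_numeral)+

lemma mero_hol_power: "mero_hol f \<Longrightarrow> mero_hol (f ^ n)"
  by (induction n) (auto intro: mero_hol_ops mero_hol_numeral)

lemma mero_hol_eval_power: "mero_hol f \<Longrightarrow> z \<in> uhp \<Longrightarrow> mero_eval (f ^ n) z = mero_eval f z ^ n"
  by (induction n) (simp_all add: mero_eval_numeral mero_hol_eval mero_hol_power)

lemma mero_hol_eqI:
  assumes "\<And>z. z \<in> uhp \<Longrightarrow> mero_eval f z = mero_eval g z"
  shows "f = g"
proof -
  have "mero_eval f = mero_eval g" using assms mero_eval_outside by (metis ext)
  thus ?thesis by (simp add: mero_eval_inject)
qed

lemma
  assumes "g holomorphic_on uhp"
  shows mero_eval_mk_hol: "z \<in> uhp \<Longrightarrow> mero_eval (mk_mero g) z = g z"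
    and mero_hol_mk: "mero_hol (mk_mero g)"
proof -
  have "g analytic_on uhp" using assms by (simp add: analytic_on_open)
  hence "g nicely_meromorphic_on uhp" by (rule analytic_on_imp_nicely_meromorphic_on)
  thus 1: "mero_eval (mk_mero g) z = g z" if "z \<in> uhp" for z using that by (rule mero_eval_mk_mero_nice)
  show "mero_hol (mk_mero g)" unfolding mero_hol_def
    by (rule holomorphic_transform[OF assms]) (simp add: 1)
qed

definition U_fun :: uhp_mero where "U_fun = mk_mero eta_quot_U"
definition v_fun :: uhp_mero where "v_fun = mk_mero eta_quot_v"
definition v'_fun :: uhp_mero where "v'_fun = mk_mero (\<lambda>z. 17 / eta_quot_v z)"
definition s_fun :: uhp_mero where "s_fun = v_fun + v'_fun"
definition num_fun :: uhp_mero where "num_fun = U_fun ^ 2 - 60 * U_fun + 16 * s_fun - 288"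
definition den_fun :: uhp_mero where "den_fun = s_fun + 238 - 9 * U_fun"
definition X_fun :: uhp_mero where "X_fun = num_fun / den_fun"
definition x_fun :: uhp_mero where "x_fun = X_fun + 2"
definition y_fun :: uhp_mero where "y_fun = U_fun + 2 * x_fun - 3"
definition t_fun :: uhp_mero where "t_fun = v_fun - v'_fun"

lemma holomorphic_v': "(\<lambda>z. 17 / eta_quot_v z) holomorphic_on uhp"
  by (intro holomorphic_intros holomorphic_eta_quot) simp

lemma basic_funs_eval:
  assumes "z \<in> uhp"
  shows "mero_eval U_fun z = eta_quot_U z" "mero_eval v_fun z = eta_quot_v z" "mero_eval v'_fun z = 17 / eta_quot_v z"
  using assms holomorphic_eta_quot holomorphic_v' by (simp_all add: U_fun_def v_fun_def v'_fun_def mero_eval_mk_hol)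

lemma basic_funs_hol: "mero_hol U_fun" "mero_hol v_fun" "mero_hol v'_fun"
  using holomorphic_eta_quot holomorphic_v' by (simp_all add: U_fun_def v_fun_def v'_fun_def mero_hol_mk)

lemmas mero_hol_intros = mero_hol_ops mero_hol_const mero_hol_numeral mero_hol_power basic_funs_hol

lemma s_fun_hol: "mero_hol s_fun" and num_fun_hol: "mero_hol num_fun" and den_fun_hol: "mero_hol den_fun" and t_fun_hol: "mero_hol t_fun"
proof -
  show s: "mero_hol s_fun" unfolding s_fun_def by (intro mero_hol_intros)
  show "mero_hol num_fun" unfolding num_fun_def by (intro mero_hol_intros s)
  show "mero_hol den_fun" unfolding den_fun_def by (intro mero_hol_intros s)
  show "mero_hol t_fun" unfolding t_fun_def by (intro mero_hol_intros)
qed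

lemma s_fun_eval: "z \<in> uhp \<Longrightarrow> mero_eval s_fun z = sum_v z"
  unfolding s_fun_def sum_v_def by (subst mero_hol_eval_add[OF basic_funs_hol(2,3)]) (simp_all add: basic_funs_eval)

lemma num_fun_eval: "z \<in> uhp \<Longrightarrow> mero_eval num_fun z = X_num z"
  unfolding num_fun_def X_num_def
  by (simp add: mero_hol_eval mero_hol_intros mero_hol_eval_power s_fun_hol s_fun_eval basic_funs_eval mero_eval_numeral)

lemma den_fun_eval: "z \<in> uhp \<Longrightarrow> mero_eval den_fun z = X_den z"
  unfolding den_fun_def X_den_def
  by (simp add: mero_hol_eval mero_hol_intros mero_hol_eval_power s_fun_hol s_fun_eval basic_funs_eval mero_eval_numeral)

lemma v_v': "v_fun * v'_fun = 17"
  by (rule mero_hol_eqI) (simp add: mero_hol_eval basic_funs_hol basic_funs_eval mero_eval_numeral)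

lemma v_fun_nonzero: "v_fun \<noteq> 0"
  using v_v' by auto

lemma v'_fun_eq: "v'_fun = 17 / v_fun"
  using v_v' v_fun_nonzero by (simp add: field_simps)

lemma X_rel_fun: "num_fun ^ 2 + 16 * num_fun * den_fun + (18 + 4 * U_fun - s_fun) * den_fun ^ 2 = 0"
proof (rule mero_hol_eqI)
  fix z assume z: "z \<in> uhp"
  note h = num_fun_hol den_fun_hol s_fun_hol
  have "mero_eval (num_fun ^ 2 + 16 * num_fun * den_fun + (18 + 4 * U_fun - s_fun) * den_fun ^ 2) z = X_rel z"
    unfolding X_rel_def using z
    by (simp add: mero_hol_eval mero_hol_intros h mero_hol_eval_power s_fun_eval num_fun_eval den_fun_eval basic_funs_eval mero_eval_numeral)
  also have "\<dots> = mero_eval 0 z" using X_rel_eq_0[OF z] z by (simp add: mero_eval_numeral)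
  finally show "mero_eval (num_fun ^ 2 + 16 * num_fun * den_fun + (18 + 4 * U_fun - s_fun) * den_fun ^ 2) z = mero_eval 0 z" .
qed

text \<open>The power series of \<open>q^4 X_den\<close> has constant coefficient 1, so the
  denominator does not vanish near infinity.\<close>

lemma den_fun_nonzero: "den_fun \<noteq> 0"
proof
  assume 0: "den_fun = 0"
  obtain D d where D: "D has_fps_expansion d" "fps_nth d 0 = 1" "\<And>z. X_den z = D (e2pi z) / e2pi z ^ 4"
    using X_rel_fps by metis
  obtain Y where Y: "Y \<ge> 0" "\<And>z. Im z > Y \<Longrightarrow> norm (D (q_par 1 z) / q_par 1 z ^ 0 - fps_nth d 0) < 1"
    using fps_cusp_limit[OF D(1), of 0 1 1] by auto
  define z where "z = Complex 0 (Y + 1)"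
  have z: "z \<in> uhp" "Im z > Y" using Y(1) by (simp_all add: z_def uhp_def)
  have "X_den z = 0" using den_fun_eval[OF z(1)] z(1) by (simp add: 0 mero_eval_numeral)
  hence "D (e2pi z) = 0" using D(3) by simp
  thus False using Y(2)[OF z(2)] D(2) unfolding q_par_1 by simp
qed

lemma X_fun_quadratic: "X_fun ^ 2 + 16 * X_fun + 18 + 4 * U_fun = s_fun"
proof -
  have n: "num_fun = X_fun * den_fun" using den_fun_nonzero by (simp add: X_fun_def)
  have "(X_fun ^ 2 + 16 * X_fun + (18 + 4 * U_fun - s_fun)) * den_fun ^ 2 = 0"
    using X_rel_fun unfolding n by (simp add: algebra_simps power2_eq_square)
  hence "X_fun ^ 2 + 16 * X_fun + (18 + 4 * U_fun - s_fun) = 0" using den_fun_nonzero by simp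
  thus ?thesis by (simp add: algebra_simps)
qed

text \<open>Substituting the quadratic relation for \<open>s\<close> in
  \<open>X_fun * den_fun = num_fun\<close> makes the terms \<open>16 X^2\<close> and
  \<open>256 X\<close> cancel, and the cubic is what remains.\<close>

lemma X_fun_cubic: "X_fun ^ 3 = U_fun ^ 2 + 5 * U_fun * X_fun + 4 * U_fun"
proof -
  have "X_fun * den_fun = num_fun" using den_fun_nonzero by (simp add: X_fun_def)
  thus ?thesis unfolding den_fun_def num_fun_def X_fun_quadratic[symmetric]
    by (simp add: algebra_simps power2_eq_square power3_eq_cube)
qed

lemma curve_equations:
  "y_fun ^ 2 + x_fun * y_fun = x_fun ^ 3 - 3 * x_fun + 1"
  "t_fun ^ 2 = - 48 - 32 * x_fun + 20 * x_fun ^ 2 + 24 * x_fun ^ 3 + x_fun ^ 4 + 8 * (2 + 2 * x_fun + x_fun ^ 2) * y_fun"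
proof -
  show 1: "y_fun ^ 2 + x_fun * y_fun = x_fun ^ 3 - 3 * x_fun + 1"
    using X_fun_cubic unfolding y_fun_def x_fun_def
    by (simp add: algebra_simps power2_eq_square power3_eq_cube)
  \<comment> \<open>From \<open>(v - v')^2 = s^2 - 4 v v'\<close> and \<open>v v' = 17\<close> it
    follows that \<open>t^2 = s^2 - 68\<close>; the term \<open>16 y^2\<close> that arises is
    removed by the Weierstrass equation.\<close>
  have "s_fun = x_fun ^ 2 + 4 * x_fun + 2 + 4 * y_fun"
    unfolding X_fun_quadratic[symmetric] y_fun_def x_fun_def by (simp add: algebra_simps power2_eq_square)
  moreover have "t_fun ^ 2 = s_fun ^ 2 - 4 * (v_fun * v'_fun)"
    unfolding t_fun_def s_fun_def by (simp add: algebra_simps power2_eq_square)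
  ultimately have "t_fun ^ 2 = (x_fun ^ 2 + 4 * x_fun + 2 + 4 * y_fun) ^ 2 - 68" unfolding v_v' by simp
  also have "\<dots> = (x_fun ^ 2 + 4 * x_fun + 2) ^ 2 + 8 * (x_fun ^ 2 + 2 * x_fun + 2) * y_fun + 16 * (y_fun ^ 2 + x_fun * y_fun) - 68"
    by (simp add: algebra_simps power2_eq_square)
  also have "\<dots> = - 48 - 32 * x_fun + 20 * x_fun ^ 2 + 24 * x_fun ^ 3 + x_fun ^ 4 + 8 * (2 + 2 * x_fun + x_fun ^ 2) * y_fun"
    unfolding 1 by (simp add: algebra_simps power2_eq_square power3_eq_cube power4_eq_xxxx)
  finally show "t_fun ^ 2 = - 48 - 32 * x_fun + 20 * x_fun ^ 2 + 24 * x_fun ^ 3 + x_fun ^ 4 + 8 * (2 + 2 * x_fun + x_fun ^ 2) * y_fun" .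
qed

text \<open>\<open>X_fun\<close> is integral over the holomorphic functions, so it has no poles.\<close>
lemma X_fun_hol: "mero_hol X_fun"
proof -
  define R where "R = s_fun - 18 - 4 * U_fun"
  have R: "mero_hol R" unfolding R_def by (intro mero_hol_intros s_fun_hol)
  have eq: "X_fun * (X_fun + 16) = R"
    unfolding R_def X_fun_quadratic[symmetric] by (simp add: algebra_simps power2_eq_square)
  have "mero_eval X_fun analytic_on {z}" if z: "z \<in> uhp" for z
  proof -
    have "\<not> is_pole (mero_eval X_fun) z"
    proof
      assume pole: "is_pole (mero_eval X_fun) z"
      hence lim: "filterlim (mero_eval X_fun) at_infinity (at z)" by (simp add: is_pole_def)
      have lim2: "filterlim (\<lambda>w. mero_eval X_fun w + 16) at_infinity (at z)"
        by (rule tendsto_add_filterlim_at_infinity'[OF lim tendsto_const])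
      have "filterlim (\<lambda>w. mero_eval X_fun w * (mero_eval X_fun w + 16)) at_infinity (at z)"
        by (rule filterlim_at_infinity_times[OF lim lim2])
      moreover have "\<forall>\<^sub>\<approx>w\<in>uhp. mero_eval X_fun w * (mero_eval X_fun w + 16) = mero_eval R w"
      proof -
        have "\<forall>\<^sub>\<approx>z\<in>uhp. z \<in> uhp" by (simp add: eventually_in_cosparse)
        thus ?thesis using mero_eval_mult[of X_fun "X_fun + 16"] mero_eval_add[of X_fun 16] unfolding eq
          by eventually_elim (simp add: mero_eval_numeral)
      qed
      hence ev: "\<forall>\<^sub>F w in at z. mero_eval X_fun w * (mero_eval X_fun w + 16) = mero_eval R w"
        using z by (rule eventually_cosparse_uhp_at)
      ultimately have "filterlim (mero_eval R) at_infinity (at z)" by (subst (asm) filterlim_cong[OF refl refl ev])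
      moreover have "mero_eval R \<midarrow>z\<rightarrow> mero_eval R z"
        using analytic_at_imp_isCont[OF mero_hol_analytic[OF R z]] by (simp add: isCont_def)
      ultimately show False using not_tendsto_and_filterlim_at_infinity[of "at z" "mero_eval R"] by auto
    qed
    thus ?thesis using nicely_meromorphic_on_imp_analytic_at[OF nicely_meromorphic_mero_eval z] by blast
  qed
  hence "mero_eval X_fun analytic_on uhp" using analytic_on_analytic_at by blast
  thus ?thesis unfolding mero_hol_def by (rule analytic_imp_holomorphic)
qed

lemma x_fun_hol: "mero_hol x_fun" and y_fun_hol: "mero_hol y_fun"
proof -
  show x: "mero_hol x_fun" unfolding x_fun_def by (intro mero_hol_intros X_fun_hol)
  show "mero_hol y_fun" unfolding y_fun_def by (intro mero_hol_intros x)
qed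

section \<open>Invariance and rationality of the generators\<close>

definition W17 :: "real^2^2" where
  "W17 = (1 / sqrt (real 17)) *\<^sub>R vector [vector [of_int (1 * int 17), of_int 8], vector [of_int (int 34 * 1), of_int (1 * int 17)]]"

lemma W17_in: "W17 \<in> atkin_lehner_matrices 34 17"
proof -
  have "det W17 = 1" unfolding W17_def by (subst det_atkin_lehner_form) simp_all
  thus ?thesis unfolding atkin_lehner_matrices_def W17_def by blast
qed

lemma det_W17: "det W17 > 0"
  using W17_in by (simp add: atkin_lehner_matrices_def)

lemma moebius_W17:
  assumes "z \<in> uhp"
  shows "moebius_act W17 z = (17 * z + 8) / (34 * z + 17)"
proof -
  define s where "s = complex_of_real (1 / sqrt 17)"
  have s: "s \<noteq> 0" by (simp add: s_def)
  have "moebius_act W17 z = (s * 17 * z + s * 8) / (s * 34 * z + s * 17)"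
    by (simp add: moebius_act_eq W17_def s_def)
  also have "\<dots> = (s * (17 * z + 8)) / (s * (34 * z + 17))" by (simp only: distrib_left mult.assoc)
  finally show ?thesis by (simp only: nonzero_mult_divide_mult_cancel_left[OF s])
qed

lemma W17_basic:
  "moebius_pullback W17 U_fun = U_fun" "moebius_pullback W17 v_fun = v'_fun" "moebius_pullback W17 v'_fun = v_fun"
  by (rule mero_hol_eqI; use moebius_in_uhp[OF det_W17] in \<open>simp add: mero_eval_moebius_pullback[OF det_W17] basic_funs_eval moebius_W17 eta_quot_involution\<close>;
      metis moebius_W17 moebius_in_uhp[OF det_W17] basic_funs_eval eta_quot_involution)+

lemma Gamma0_basic:
  assumes "A \<in> Gamma0 34"
  shows "moebius_pullback A U_fun = U_fun" "moebius_pullback A v_fun = v_fun" "moebius_pullback A v'_fun = v'_fun"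
proof -
  have A: "det A > 0" using assms by (simp add: Gamma0_def)
  show "moebius_pullback A U_fun = U_fun" "moebius_pullback A v_fun = v_fun" "moebius_pullback A v'_fun = v'_fun"
    by (rule mero_hol_eqI; simp add: mero_eval_moebius_pullback[OF A] basic_funs_eval moebius_in_uhp[OF A] eta_quot_Gamma0[OF assms])+
qed

text \<open>\<open>X\<close>, \<open>x\<close> and \<open>y\<close> are rational expressions in
  \<open>U\<close> and \<open>s\<close>, so one argument settles both \<open>Gamma0 34\<close> and
  \<open>W17\<close>.\<close>

lemma pullback_funs:
  assumes A: "det A > 0" and U: "moebius_pullback A U_fun = U_fun" and s: "moebius_pullback A s_fun = s_fun"
  shows "moebius_pullback A X_fun = X_fun" "moebius_pullback A x_fun = x_fun" "moebius_pullback A y_fun = y_fun"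
proof -
  note h = is_ring_hom_simps[OF is_ring_hom_moebius_pullback[OF A]]
  have "moebius_pullback A num_fun = num_fun" "moebius_pullback A den_fun = den_fun"
    by (simp_all only: num_fun_def den_fun_def h U s)
  thus X: "moebius_pullback A X_fun = X_fun"
    unfolding X_fun_def divide_inverse by (simp only: h moebius_pullback_inverse[OF A])
  thus x: "moebius_pullback A x_fun = x_fun" by (simp only: x_fun_def h)
  thus "moebius_pullback A y_fun = y_fun" by (simp only: y_fun_def h U)
qed

lemma W17_funs: "moebius_pullback W17 x_fun = x_fun" "moebius_pullback W17 y_fun = y_fun" "moebius_pullback W17 t_fun = - t_fun"
    "moebius_pullback W17 X_fun = X_fun"
proof -
  note h = is_ring_hom_simps[OF is_ring_hom_moebius_pullback[OF det_W17]]
  have s: "moebius_pullback W17 s_fun = s_fun" by (simp add: s_fun_def h W17_basic add.commute)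
  show "moebius_pullback W17 x_fun = x_fun" "moebius_pullback W17 y_fun = y_fun" "moebius_pullback W17 X_fun = X_fun"
    using pullback_funs[OF det_W17 W17_basic(1) s] by blast+
  show "moebius_pullback W17 t_fun = - t_fun" by (simp add: t_fun_def h W17_basic)
qed

lemma Gamma0_funs:
  assumes "A \<in> Gamma0 34"
  shows "moebius_pullback A X_fun = X_fun" "moebius_pullback A x_fun = x_fun" "moebius_pullback A y_fun = y_fun" "moebius_pullback A t_fun = t_fun"
proof -
  have A: "det A > 0" using assms by (simp add: Gamma0_def)
  note h = is_ring_hom_simps[OF is_ring_hom_moebius_pullback[OF A]]
  have s: "moebius_pullback A s_fun = s_fun" by (simp add: s_fun_def h Gamma0_basic[OF assms])
  show "moebius_pullback A X_fun = X_fun" "moebius_pullback A x_fun = x_fun" "moebius_pullback A y_fun = y_fun"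
    using pullback_funs[OF A Gamma0_basic(1)[OF assms] s] by blast+
  show "moebius_pullback A t_fun = t_fun" by (simp add: t_fun_def h Gamma0_basic[OF assms])
qed

text \<open>Every conjugate of the translation by 34 is congruent to the identity modulo 34 and
  hence lies in \<open>Gamma0 34\<close>. This gives one common width for all cusps.\<close>

lemma translation_Gamma0_conj:
  assumes A: "A \<in> SL2Z" and z: "z \<in> uhp" and f: "\<And>G. G \<in> Gamma0 34 \<Longrightarrow> moebius_pullback G f = f"
  shows "mero_eval f (moebius_act A (z + of_nat 34)) = mero_eval f (moebius_act A z)"
proof -
  obtain a b c d where abcd: "A = int_mat2 a b c d" and det: "a * d - b * c = 1" using A by (rule SL2Z_cases)
  define G where "G = int_mat2 (1 - 34 * a * c) (34 * a * a) (- 34 * c * c) (1 + 34 * a * c)"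
  have G: "G \<in> Gamma0 34" by (simp add: G_def int_mat2_in_Gamma0_iff algebra_simps)
  have T: "int_mat2 1 34 0 1 \<in> SL2Z" by (simp add: int_mat2_in_SL2Z_iff)
  have e: "- (34 * a * c) * b + 34 * a * a * d = 34 * a" "- (34 * c * c) * b + 34 * a * c * d = 34 * c"
  proof -
    have "- (34 * a * c) * b + 34 * a * a * d = 34 * a * (a * d - b * c)" by (simp add: algebra_simps)
    thus "- (34 * a * c) * b + 34 * a * a * d = 34 * a" using det by simp
    have "- (34 * c * c) * b + 34 * a * c * d = 34 * c * (a * d - b * c)" by (simp add: algebra_simps)
    thus "- (34 * c * c) * b + 34 * a * c * d = 34 * c" using det by simp
  qed
  have "G ** A = A ** int_mat2 1 34 0 1"
    unfolding G_def abcd int_mat2_mult using e by (simp add: algebra_simps)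
  hence "moebius_act (G ** A) z = moebius_act (A ** int_mat2 1 34 0 1) z" by simp
  hence "moebius_act G (moebius_act A z) = moebius_act A (z + of_nat 34)"
    using A T z by (simp add: SL2Z_moebius_mult moebius_act_int_mat2)
  moreover have "mero_eval f (moebius_act G (moebius_act A z)) = mero_eval f (moebius_act A z)"
    using mero_eval_moebius_pullback[of G "moebius_act A z" f] f[OF G] G A z by (simp add: Gamma0_def)
  ultimately show ?thesis by simp
qed

lemma X0_complexI:
  assumes hol: "mero_hol f" and f: "\<And>G. G \<in> Gamma0 34 \<Longrightarrow> moebius_pullback G f = f"
    and bnd: "\<And>A. A \<in> SL2Z \<Longrightarrow> \<exists>C D. \<forall>z. Im z > 1 \<longrightarrow> norm (mero_eval f (moebius_act A z)) \<le> C * exp (2 * pi * Im z / 34) ^ D"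
  shows "f \<in> X0_complex_functions 34"
proof -
  have "cusp_mero (moebius_pullback A f)" if A: "A \<in> SL2Z" for A
  proof -
    obtain C D where CD: "\<And>z. Im z > 1 \<Longrightarrow> norm (mero_eval f (moebius_act A z)) \<le> C * exp (2 * pi * Im z / real 34) ^ D"
      using bnd[OF A] by auto
    have sub: "{z. Im z > 1} \<subseteq> uhp" by (auto simp: uhp_def)
    have pb: "mero_eval (moebius_pullback A f) z = mero_eval f (moebius_act A z)" if "z \<in> uhp" for z
      using A that by (simp add: mero_eval_moebius_pullback)
    have "moebius_act A holomorphic_on uhp" using analytic_moebius[of A] A by (simp add: analytic_imp_holomorphic)
    from holomorphic_on_compose_gen[OF this hol[unfolded mero_hol_def]]
    have "(mero_eval f \<circ> moebius_act A) holomorphic_on uhp" using SL2Z_moebius_in_uhp[OF A] by blast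
    hence "mero_eval (moebius_pullback A f) holomorphic_on uhp"
      by (rule holomorphic_transform) (simp add: pb)
    hence h: "mero_eval (moebius_pullback A f) holomorphic_on {z. Im z > 1}" using sub by (rule holomorphic_on_subset)
    have "\<exists>L. has_q_expansion (mero_eval (moebius_pullback A f)) 34 L"
    proof (rule has_q_expansion_of_growth[OF _ h])
      fix z :: complex assume z: "Im z > 1"
      hence "z \<in> uhp" "z + of_nat 34 \<in> uhp" by (simp_all add: uhp_def)
      thus "mero_eval (moebius_pullback A f) (z + of_nat 34) = mero_eval (moebius_pullback A f) z"
        using translation_Gamma0_conj[OF A _ f] by (simp only: pb)
      show "norm (mero_eval (moebius_pullback A f) z) \<le> C * exp (2 * pi * Im z / real 34) ^ D"
        using CD[OF z] \<open>z \<in> uhp\<close> by (simp only: pb)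
    qed simp
    thus ?thesis unfolding cusp_mero_def using zero_less_numeral by blast
  qed
  thus ?thesis using f by (simp add: X0_complex_functions_altdef)
qed

lemma basic_funs_rational: "U_fun \<in> X0_rational_functions 34" "v_fun \<in> X0_rational_functions 34"
proof -
  obtain C where C: "C \<ge> 1"
    "\<And>a b c d z. a * d - b * c = 1 \<Longrightarrow> Im z \<ge> 1 \<Longrightarrow> odd c \<Longrightarrow>
       norm (eta_quot_U ((of_int a * z + of_int b) / (of_int c * z + of_int d))) \<le> C * exp (- Im z / 2) \<and>
       norm (eta_quot_v ((of_int a * z + of_int b) / (of_int c * z + of_int d))) \<le> C"
    "\<And>a b c d z. a * d - b * c = 1 \<Longrightarrow> Im z \<ge> 1 \<Longrightarrow> even c \<Longrightarrow> \<not> 17 dvd c \<Longrightarrow>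
       norm (eta_quot_U ((of_int a * z + of_int b) / (of_int c * z + of_int d))) \<le> C * exp (2 * pi * Im z / 17) ^ 3 \<and>
       norm (eta_quot_v ((of_int a * z + of_int b) / (of_int c * z + of_int d))) \<le> C"
    "\<And>z. Im z \<ge> 1 \<Longrightarrow> norm (eta_quot_U z) \<le> C * exp (2 * pi * Im z) ^ 3 \<and>
       norm (eta_quot_v z) \<le> C * exp (2 * pi * Im z) ^ 4"
    by (rule eta_quot_cusp_bounds) blast
  \<comment> \<open>All bounds are rewritten at the common width 34; the largest exponent that
    occurs is \<open>4 * 34 = 136\<close>.\<close>
  have e: "exp (2 * pi * y / 17) ^ 3 = exp (2 * pi * y / 34) ^ 6" "exp (2 * pi * y) ^ 3 = exp (2 * pi * y / 34) ^ 102"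
    "exp (2 * pi * y) ^ 4 = exp (2 * pi * y / 34) ^ 136" for y :: real
    by (simp_all flip: exp_of_nat_mult)
  have big: "C * exp (2 * pi * y / 34) ^ n \<le> C * exp (2 * pi * y / 34) ^ 136" "C \<le> C * exp (2 * pi * y / 34) ^ 136"
    "C * exp (- y / 2) \<le> C * exp (2 * pi * y / 34) ^ 136" if "y > 1" "n \<le> 136" for y :: real and n
  proof -
    have 1: "exp (2 * pi * y / 34) \<ge> 1" using that by simp
    show "C * exp (2 * pi * y / 34) ^ n \<le> C * exp (2 * pi * y / 34) ^ 136"
      using that C(1) 1 by (intro mult_left_mono power_increasing) auto
    show 2: "C \<le> C * exp (2 * pi * y / 34) ^ 136" using C(1) one_le_power[OF 1, of 136] by simp
    have "C * exp (- y / 2) \<le> C * 1" using C(1) that by (intro mult_left_mono) auto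
    thus "C * exp (- y / 2) \<le> C * exp (2 * pi * y / 34) ^ 136" using 2 by linarith
  qed
  have b: "norm (eta_quot_U (moebius_act A z)) \<le> C * exp (2 * pi * Im z / 34) ^ 136 \<and> norm (eta_quot_v (moebius_act A z)) \<le> C * exp (2 * pi * Im z / 34) ^ 136"
    if A: "A \<in> SL2Z" and z: "Im z > 1" for A z
  proof -
    obtain a b c d where abcd: "A = int_mat2 a b c d" and det: "a * d - b * c = 1" using A by (rule SL2Z_cases)
    have zu: "z \<in> uhp" using z by (simp add: uhp_def)
    note bg = big[OF z, of 6] big[OF z, of 102]
    show ?thesis
    proof (cases "odd c")
      case True
      thus ?thesis using C(2)[OF det, of z] z bg unfolding abcd moebius_act_int_mat2 by force
    next
      case even: False
      show ?thesis
      proof (cases "17 dvd c")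
        case True
        hence "34 dvd c" using even by presburger
        hence "A \<in> Gamma0 34" using det by (simp add: abcd int_mat2_in_Gamma0_iff)
        thus ?thesis using C(4)[of z] z bg eta_quot_Gamma0[of A z] zu unfolding e by force
      next
        case False
        thus ?thesis using C(3)[OF det, of z] even z bg unfolding abcd moebius_act_int_mat2 e by force
      qed
    qed
  qed
  have cU: "U_fun \<in> X0_complex_functions 34"
  proof (rule X0_complexI[OF basic_funs_hol(1) Gamma0_basic(1)])
    fix A assume A: "A \<in> SL2Z"
    have "norm (mero_eval U_fun (moebius_act A z)) \<le> C * exp (2 * pi * Im z / 34) ^ 136" if z: "Im z > 1" for z
    proof -
      have "z \<in> uhp" using z by (simp add: uhp_def)
      thus ?thesis using b[OF A z] SL2Z_moebius_in_uhp[OF A] by (simp only: basic_funs_eval)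
    qed
    thus "\<exists>C D. \<forall>z. Im z > 1 \<longrightarrow> norm (mero_eval U_fun (moebius_act A z)) \<le> C * exp (2 * pi * Im z / 34) ^ D" by blast
  qed
  have cv: "v_fun \<in> X0_complex_functions 34"
  proof (rule X0_complexI[OF basic_funs_hol(2) Gamma0_basic(2)])
    fix A assume A: "A \<in> SL2Z"
    have "norm (mero_eval v_fun (moebius_act A z)) \<le> C * exp (2 * pi * Im z / 34) ^ 136" if z: "Im z > 1" for z
    proof -
      have "z \<in> uhp" using z by (simp add: uhp_def)
      thus ?thesis using b[OF A z] SL2Z_moebius_in_uhp[OF A] by (simp only: basic_funs_eval)
    qed
    thus "\<exists>C D. \<forall>z. Im z > 1 \<longrightarrow> norm (mero_eval v_fun (moebius_act A z)) \<le> C * exp (2 * pi * Im z / 34) ^ D" by blast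
  qed
  have rat: "\<exists>L. has_q_expansion (mero_eval g) 1 L \<and> rational_fls L"
    if F: "F has_fps_expansion f" "\<And>n. fps_nth f n \<in> \<rat>" and g: "\<And>z. z \<in> uhp \<Longrightarrow> mero_eval g z = F (e2pi z) / e2pi z ^ k" for F f g k
  proof (intro exI conjI)
    have "(\<lambda>w. F w * w powi (- int k)) has_laurent_expansion fls_shift (int k) (fps_to_fls f)"
      by (intro has_laurent_expansion_shift' has_laurent_expansion_fps F(1))
    thus "has_q_expansion (mero_eval g) 1 (fls_shift (int k) (fps_to_fls f))"
      by (rule has_q_expansionI[where Y = 0]) (simp_all only: q_par_1 zero_less_one, simp add: g uhp_def power_int_minus divide_inverse)
    show "rational_fls (fls_shift (int k) (fps_to_fls f))" using F(2) by (auto simp: rational_fls_def)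
  qed
  obtain fU where fU: "U_prod has_fps_expansion fU" "\<And>n. fps_nth fU n \<in> \<rat>" using U_prod_fps by metis
  obtain fv where fv: "v_prod has_fps_expansion fv" "\<And>n. fps_nth fv n \<in> \<rat>" using v_prod_fps by metis
  show "U_fun \<in> X0_rational_functions 34"
    unfolding X0_rational_functions_altdef using cU rat[OF fU, of U_fun 3] by (simp add: basic_funs_eval eta_quot_eq_product)
  show "v_fun \<in> X0_rational_functions 34"
    unfolding X0_rational_functions_altdef using cv rat[OF fv, of v_fun 4] by (simp add: basic_funs_eval eta_quot_eq_product)
qed

lemma X0_rational_numeral: "numeral k \<in> X0_rational_functions N"
  using X0_rational_of_rat[of "numeral k" N] by simp

lemma X0_rational_more:
  assumes "f \<in> X0_rational_functions N" "g \<in> X0_rational_functions N"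
  shows "f - g \<in> X0_rational_functions N" "f / g \<in> X0_rational_functions N" "f ^ n \<in> X0_rational_functions N"
proof -
  show "f - g \<in> X0_rational_functions N" using X0_rational_ops[OF assms(1)] X0_rational_ops(3)[OF assms(2,2)] by (simp only: diff_conv_add_uminus)
  show "f / g \<in> X0_rational_functions N" using X0_rational_ops[OF assms(1)] X0_rational_ops(4)[OF assms(2,2)] by (simp only: divide_inverse)
  show "f ^ n \<in> X0_rational_functions N"
    using X0_rational_of_rat[of 1 N] by (induction n) (simp_all add: X0_rational_ops assms)
qed

lemma curve_funs_rational: "x_fun \<in> X0_rational_functions 34" "y_fun \<in> X0_rational_functions 34" "t_fun \<in> X0_rational_functions 34"
    "X_fun \<in> X0_rational_functions 34"
proof -
  note r = X0_rational_ops(1,2) X0_rational_more(1,2) X0_rational_more(3)[OF basic_funs_rational(1,1)] X0_rational_numeral basic_funs_rational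
  have v': "v'_fun \<in> X0_rational_functions 34" unfolding v'_fun_eq by (intro r)
  show X: "X_fun \<in> X0_rational_functions 34" unfolding X_fun_def num_fun_def den_fun_def s_fun_def by (intro r v')
  show x: "x_fun \<in> X0_rational_functions 34" unfolding x_fun_def by (intro r X)
  show "y_fun \<in> X0_rational_functions 34" unfolding y_fun_def by (intro r x)
  show "t_fun \<in> X0_rational_functions 34" unfolding t_fun_def by (intro r v')
qed

section \<open>Growth at the cusps\<close>

text \<open>A pole of order at most \<open>m\<close> in \<open>e2pi z\<close>, put as an estimate so
  that it makes sense before any expansion is available.\<close>

definition grows :: "(complex \<Rightarrow> complex) \<Rightarrow> nat \<Rightarrow> bool" where
  "grows g m \<longleftrightarrow> (\<exists>C Y. C \<ge> 0 \<and> Y \<ge> 0 \<and> (\<forall>z. Im z > Y \<longrightarrow> norm (g z) \<le> C * exp (2 * pi * Im z) ^ m))"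

lemma growsI:
  assumes "\<And>z. Im z > Y \<Longrightarrow> norm (g z) \<le> C * exp (2 * pi * Im z) ^ m"
  shows "grows g m"
proof -
  have "norm (g z) \<le> max 0 C * exp (2 * pi * Im z) ^ m" if "Im z > max 0 Y" for z
  proof -
    have "C * exp (2 * pi * Im z) ^ m \<le> max 0 C * exp (2 * pi * Im z) ^ m" by (intro mult_right_mono) auto
    thus ?thesis using assms[of z] that by linarith
  qed
  thus ?thesis unfolding grows_def by (intro exI[of _ "max 0 C"] exI[of _ "max 0 Y"]) auto
qed

lemma growsE:
  assumes "grows g m"
  obtains C Y where "C \<ge> 0" "Y \<ge> 0" "\<And>z. Im z > Y \<Longrightarrow> norm (g z) \<le> C * exp (2 * pi * Im z) ^ m"
  using assms unfolding grows_def by blast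

lemma grows_add:
  assumes "grows g m" "grows h m"
  shows "grows (\<lambda>z. g z + h z) m"
proof -
  obtain C Y where C: "\<And>z. Im z > Y \<Longrightarrow> norm (g z) \<le> C * exp (2 * pi * Im z) ^ m" using assms(1) by (rule growsE) blast
  obtain D Z where D: "\<And>z. Im z > Z \<Longrightarrow> norm (h z) \<le> D * exp (2 * pi * Im z) ^ m" using assms(2) by (rule growsE) blast
  show ?thesis
  proof (rule growsI[of "max Y Z" _ "C + D"])
    fix z assume "Im z > max Y Z"
    thus "norm (g z + h z) \<le> (C + D) * exp (2 * pi * Im z) ^ m"
      using C[of z] D[of z] norm_triangle_ineq[of "g z" "h z"] unfolding distrib_right by simp
  qed
qed

lemma grows_mult:
  assumes "grows g m" "grows h n"
  shows "grows (\<lambda>z. g z * h z) (m + n)"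
proof -
  obtain C Y where C: "C \<ge> 0" "\<And>z. Im z > Y \<Longrightarrow> norm (g z) \<le> C * exp (2 * pi * Im z) ^ m" using assms(1) by (rule growsE) blast
  obtain D Z where D: "\<And>z. Im z > Z \<Longrightarrow> norm (h z) \<le> D * exp (2 * pi * Im z) ^ n" using assms(2) by (rule growsE) blast
  show ?thesis
  proof (rule growsI[of "max Y Z" _ "C * D"])
    fix z assume z: "Im z > max Y Z"
    have "norm (g z) * norm (h z) \<le> (C * exp (2 * pi * Im z) ^ m) * (D * exp (2 * pi * Im z) ^ n)"
      using C(2)[of z] D[of z] z C(1) by (intro mult_mono) auto
    also have "\<dots> = C * D * exp (2 * pi * Im z) ^ (m + n)" unfolding power_add by (simp only: mult_ac)
    finally show "norm (g z * h z) \<le> C * D * exp (2 * pi * Im z) ^ (m + n)" by (simp only: norm_mult)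
  qed
qed

lemma grows_mono:
  assumes "grows g m" "m \<le> n"
  shows "grows g n"
proof -
  obtain C Y where C: "C \<ge> 0" "Y \<ge> 0" "\<And>z. Im z > Y \<Longrightarrow> norm (g z) \<le> C * exp (2 * pi * Im z) ^ m" using assms(1) by (rule growsE) blast
  show ?thesis
  proof (rule growsI[of Y _ C])
    fix z assume z: "Im z > Y"
    have "exp (2 * pi * Im z) \<ge> 1" using z C(2) by simp
    hence "C * exp (2 * pi * Im z) ^ m \<le> C * exp (2 * pi * Im z) ^ n"
      using C(1) assms(2) by (intro mult_left_mono power_increasing)
    thus "norm (g z) \<le> C * exp (2 * pi * Im z) ^ n" using C(3)[OF z] by linarith
  qed
qed

lemma grows_cong:
  assumes "grows g m" "\<And>z. z \<in> uhp \<Longrightarrow> h z = g z"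
  shows "grows h m"
proof -
  obtain C Y where C: "Y \<ge> 0" "\<And>z. Im z > Y \<Longrightarrow> norm (g z) \<le> C * exp (2 * pi * Im z) ^ m" using assms(1) by (rule growsE) blast
  show ?thesis
  proof (rule growsI[of Y _ C])
    fix z assume z: "Im z > Y"
    hence "z \<in> uhp" using C(1) by (simp add: uhp_def)
    thus "norm (h z) \<le> C * exp (2 * pi * Im z) ^ m" using C(2)[OF z] assms(2) by simp
  qed
qed

lemma grows_const: "grows (\<lambda>_. c) 0"
  by (rule growsI[of 0 _ "norm c"]) simp

text \<open>Transfers the pole order through a quadratic equation and halves it; the constant 1024
  is that of \<open>X_fun_norm_square\<close>. Bounding \<open>2 C + 1024\<close> by its own square
  keeps square roots out.\<close>

lemma grows_root:
  assumes r: "grows r (2 * m)" and g: "\<And>z. z \<in> uhp \<Longrightarrow> norm (g z) ^ 2 \<le> 2 * norm (r z) + 1024"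
  shows "grows g m"
proof -
  obtain C Y where C: "C \<ge> 0" "Y \<ge> 0" "\<And>z. Im z > Y \<Longrightarrow> norm (r z) \<le> C * exp (2 * pi * Im z) ^ (2 * m)" using r by (rule growsE) blast
  show ?thesis
  proof (rule growsI[of Y _ "2 * C + 1024"])
    fix z assume z: "Im z > Y"
    define e where "e = exp (2 * pi * Im z) ^ m"
    have e: "e \<ge> 1" using z C(2) by (simp add: e_def one_le_power)
    have e2: "exp (2 * pi * Im z) ^ (2 * m) = e ^ 2" by (simp add: e_def power_mult[symmetric] mult.commute)
    have zu: "z \<in> uhp" using z C(2) by (simp add: uhp_def)
    have "norm (g z) ^ 2 \<le> 2 * (C * e ^ 2) + 1024 * 1" using g[OF zu] C(3)[OF z] unfolding e2 by linarith
    also have "\<dots> \<le> 2 * (C * e ^ 2) + 1024 * e ^ 2" using one_le_power[OF e, of 2] by simp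
    also have "\<dots> = (2 * C + 1024) * e ^ 2" by (simp add: algebra_simps)
    also have "\<dots> \<le> (2 * C + 1024) ^ 2 * e ^ 2"
    proof (rule mult_right_mono)
      have "(2 * C + 1024) * 1 \<le> (2 * C + 1024) * (2 * C + 1024)" using C(1) by (intro mult_left_mono) auto
      thus "2 * C + 1024 \<le> (2 * C + 1024) ^ 2" by (simp add: power2_eq_square)
    qed simp
    finally have "norm (g z) ^ 2 \<le> ((2 * C + 1024) * e) ^ 2" by (simp only: power_mult_distrib)
    thus "norm (g z) \<le> (2 * C + 1024) * exp (2 * pi * Im z) ^ m"
      unfolding e_def[symmetric] by (rule power2_le_imp_le) (use C(1) e in simp)
  qed
qed

text \<open>The flag marks infinity and the cusp 1/2, where poles are allowed; \<open>W17\<close>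
  represents the latter and normalises its width to 1. The other cusps enter through all matrices
  with odd \<open>c\<close>, which spares a choice of representatives.\<close>

definition cusp_maps :: "((complex \<Rightarrow> complex) \<times> bool) set" where
  "cusp_maps = {(\<lambda>z. z, True), (moebius_act W17, True)} \<union>
     {(moebius_act (int_mat2 a b c d), False) | a b c d. a * d - b * c = 1 \<and> odd c}"

lemma cusp_maps_in_uhp: "(T, b) \<in> cusp_maps \<Longrightarrow> z \<in> uhp \<Longrightarrow> T z \<in> uhp"
  using moebius_in_uhp[OF det_W17] by (auto simp: cusp_maps_def int_mat2_in_SL2Z_iff)

lemma cusp_maps_simps: "(\<lambda>z. z, True) \<in> cusp_maps" "(moebius_act W17, True) \<in> cusp_maps"
    "a * d - b * c = 1 \<Longrightarrow> odd c \<Longrightarrow> (moebius_act (int_mat2 a b c d), False) \<in> cusp_maps"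
  by (auto simp: cusp_maps_def)

lemma cusp_maps_cases [consumes 1, case_names infinity W17 odd]:
  assumes "(T, b) \<in> cusp_maps" "b \<Longrightarrow> T = (\<lambda>z. z) \<Longrightarrow> P" "b \<Longrightarrow> T = moebius_act W17 \<Longrightarrow> P"
    "\<And>a' b' c d. \<not> b \<Longrightarrow> T = moebius_act (int_mat2 a' b' c d) \<Longrightarrow> a' * d - b' * c = 1 \<Longrightarrow> odd c \<Longrightarrow> P"
  shows P
  using assms unfolding cusp_maps_def by blast

text \<open>A pole of order at most \<open>m\<close> at the cusps \<open>\<infinity>\<close> and \<open>w\<^sub>1\<^sub>7(\<infinity>)\<close>, and no other poles.\<close>
definition cusp_growth :: "nat \<Rightarrow> uhp_mero \<Rightarrow> bool" where
  "cusp_growth m f \<longleftrightarrow> mero_hol f \<and> (\<forall>G\<in>Gamma0 34. moebius_pullback G f = f) \<and>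
     (\<forall>T b. (T, b) \<in> cusp_maps \<longrightarrow> grows (\<lambda>z. mero_eval f (T z)) (if b then m else 0))"

lemma cusp_growth_mono:
  assumes "cusp_growth m f" "m \<le> n"
  shows "cusp_growth n f"
proof -
  have "grows (\<lambda>z. mero_eval f (T z)) (if b then n else 0)" if "(T, b) \<in> cusp_maps" for T b
    by (rule grows_mono[of _ "if b then m else 0"]) (use assms that in \<open>auto simp: cusp_growth_def\<close>)
  thus ?thesis using assms(1) unfolding cusp_growth_def by blast
qed

lemma Gamma0_det: "G \<in> Gamma0 N \<Longrightarrow> det G > 0"
  by (simp add: Gamma0_def)

lemma cusp_growth_add:
  assumes f: "cusp_growth m f" and g: "cusp_growth m g"
  shows "cusp_growth m (f + g)"
  unfolding cusp_growth_def
proof (intro conjI ballI allI impI)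
  have h: "mero_hol f" "mero_hol g" using f g by (simp_all add: cusp_growth_def)
  show "mero_hol (f + g)" using h by (rule mero_hol_ops)
  show "moebius_pullback G (f + g) = f + g" if "G \<in> Gamma0 34" for G
    using f g that by (simp add: cusp_growth_def moebius_pullback_add Gamma0_det)
  fix T b assume T: "(T, b) \<in> cusp_maps"
  show "grows (\<lambda>z. mero_eval (f + g) (T z)) (if b then m else 0)"
    by (rule grows_cong[OF grows_add[of "\<lambda>z. mero_eval f (T z)" _ "\<lambda>z. mero_eval g (T z)"]])
      (use f g T h cusp_maps_in_uhp in \<open>auto simp: cusp_growth_def mero_hol_eval_add\<close>)
qed

lemma cusp_growth_mult:
  assumes f: "cusp_growth m f" and g: "cusp_growth n g"
  shows "cusp_growth (m + n) (f * g)"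
  unfolding cusp_growth_def
proof (intro conjI ballI allI impI)
  have h: "mero_hol f" "mero_hol g" using f g by (simp_all add: cusp_growth_def)
  show "mero_hol (f * g)" using h by (rule mero_hol_ops)
  show "moebius_pullback G (f * g) = f * g" if "G \<in> Gamma0 34" for G
    using f g that by (simp add: cusp_growth_def moebius_pullback_mult Gamma0_det)
  fix T b assume T: "(T, b) \<in> cusp_maps"
  have e: "(if b then m + n else 0) = (if b then m else 0) + (if b then n else 0)" by simp
  have "grows (\<lambda>z. mero_eval f (T z)) (if b then m else 0)" "grows (\<lambda>z. mero_eval g (T z)) (if b then n else 0)"
    using f g T unfolding cusp_growth_def by blast+
  from grows_mult[OF this]
  show "grows (\<lambda>z. mero_eval (f * g) (T z)) (if b then m + n else 0)"
    unfolding e[symmetric] by (rule grows_cong) (use cusp_maps_in_uhp[OF T] h in \<open>simp add: mero_hol_eval_mult\<close>)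
qed

lemma cusp_growth_const: "cusp_growth 0 (mero_const c)"
  unfolding cusp_growth_def
proof (intro conjI ballI allI impI)
  fix T b assume T: "(T, b) \<in> cusp_maps"
  have "grows (\<lambda>z. mero_eval (mero_const c) (T z)) 0"
    by (rule grows_cong[OF grows_const[of c]]) (use cusp_maps_in_uhp[OF T] in \<open>simp add: mero_eval_const\<close>)
  thus "grows (\<lambda>z. mero_eval (mero_const c) (T z)) (if b then 0 else 0)" by simp
qed (simp_all add: mero_hol_const moebius_pullback_const Gamma0_det)

lemma cusp_growth_numeral: "cusp_growth 0 1" "cusp_growth 0 0" "cusp_growth 0 (numeral k)"
  using cusp_growth_const[of 1] cusp_growth_const[of 0] cusp_growth_const[of "numeral k"] by (simp_all add: mero_const_numeral)

lemma cusp_growth_power: "cusp_growth m f \<Longrightarrow> cusp_growth (k * m) (f ^ k)"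
  by (induction k) (use cusp_growth_mult cusp_growth_numeral in auto)

lemma cusp_growth_cmult: "cusp_growth m f \<Longrightarrow> cusp_growth m (mero_const c * f)"
  using cusp_growth_mult[OF cusp_growth_const] by simp

lemma cusp_growth_sum:
  "(\<And>j. j \<in> J \<Longrightarrow> cusp_growth m (b j)) \<Longrightarrow> cusp_growth m (\<Sum>j\<in>J. b j)"
  by (induction J rule: infinite_finite_induct)
    (auto intro: cusp_growth_add cusp_growth_mono[OF cusp_growth_numeral(2)])

lemma cusp_growth_basic: "cusp_growth 3 U_fun" "cusp_growth 4 v_fun" "cusp_growth 4 v'_fun"
proof -
  obtain C where C: "C \<ge> 1"
    "\<And>a b c d z. a * d - b * c = 1 \<Longrightarrow> Im z \<ge> 1 \<Longrightarrow> odd c \<Longrightarrow>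
       norm (eta_quot_U ((of_int a * z + of_int b) / (of_int c * z + of_int d))) \<le> C * exp (- Im z / 2) \<and>
       norm (eta_quot_v ((of_int a * z + of_int b) / (of_int c * z + of_int d))) \<le> C \<and>
       norm (17 / eta_quot_v ((of_int a * z + of_int b) / (of_int c * z + of_int d))) \<le> C"
    "\<And>z. Im z \<ge> 1 \<Longrightarrow> norm (eta_quot_U z) \<le> C * exp (2 * pi * Im z) ^ 3 \<and>
       norm (eta_quot_v z) \<le> C * exp (2 * pi * Im z) ^ 4 \<and> norm (17 / eta_quot_v z) \<le> C"
    by (rule eta_quot_cusp_bounds) blast
  have zu: "z \<in> uhp" if "Im z > 1" for z using that by (simp add: uhp_def)
  have inf: "grows eta_quot_U 3" "grows eta_quot_v 4" "grows (\<lambda>z. 17 / eta_quot_v z) 0"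
    by (rule growsI[of 1 _ C]; use C(3) in simp)+
  have W: "grows (\<lambda>z. eta_quot_U (moebius_act W17 z)) 3" "grows (\<lambda>z. eta_quot_v (moebius_act W17 z)) 0"
      "grows (\<lambda>z. 17 / eta_quot_v (moebius_act W17 z)) 4"
    using inf by (auto elim!: grows_cong simp: moebius_W17 eta_quot_involution)
  have odd: "grows (\<lambda>z. eta_quot_U (moebius_act (int_mat2 a b c d) z)) 0" "grows (\<lambda>z. eta_quot_v (moebius_act (int_mat2 a b c d) z)) 0"
      "grows (\<lambda>z. 17 / eta_quot_v (moebius_act (int_mat2 a b c d) z)) 0" if "a * d - b * c = 1" "odd c" for a b c d
  proof -
    show "grows (\<lambda>z. eta_quot_U (moebius_act (int_mat2 a b c d) z)) 0"
    proof (rule growsI[of 1 _ C])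
      fix z assume z: "Im z > 1"
      have "C * exp (- Im z / 2) \<le> C * 1" using C(1) z by (intro mult_left_mono) auto
      thus "norm (eta_quot_U (moebius_act (int_mat2 a b c d) z)) \<le> C * exp (2 * pi * Im z) ^ 0"
        using C(2)[OF that(1) _ that(2), of z] z by (simp add: moebius_act_int_mat2)
    qed
    show "grows (\<lambda>z. eta_quot_v (moebius_act (int_mat2 a b c d) z)) 0"
      "grows (\<lambda>z. 17 / eta_quot_v (moebius_act (int_mat2 a b c d) z)) 0"
      by (rule growsI[of 1 _ C]; use C(2)[OF that(1) _ that(2)] in \<open>simp add: moebius_act_int_mat2\<close>)+
  qed
  have g: "cusp_growth m f" if "mero_hol f" "\<And>G. G \<in> Gamma0 34 \<Longrightarrow> moebius_pullback G f = f"
    and e: "\<And>z. z \<in> uhp \<Longrightarrow> mero_eval f z = h z" and "grows h m" "grows (\<lambda>z. h (moebius_act W17 z)) m"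
    "\<And>a b c d. a * d - b * c = 1 \<Longrightarrow> odd c \<Longrightarrow> grows (\<lambda>z. h (moebius_act (int_mat2 a b c d) z)) 0" for f h m
    unfolding cusp_growth_def
  proof (intro conjI ballI allI impI)
    fix T b assume T: "(T, b) \<in> cusp_maps"
    have "grows (\<lambda>z. h (T z)) (if b then m else 0)" using T by (cases rule: cusp_maps_cases) (use that in auto)
    thus "grows (\<lambda>z. mero_eval f (T z)) (if b then m else 0)"
      by (rule grows_cong) (use e cusp_maps_in_uhp[OF T] in simp)
  qed (use that in auto)
  show "cusp_growth 3 U_fun" by (rule g[OF basic_funs_hol(1) Gamma0_basic(1) basic_funs_eval(1) inf(1) W(1) odd(1)])
  show "cusp_growth 4 v_fun" by (rule g[OF basic_funs_hol(2) Gamma0_basic(2) basic_funs_eval(2) inf(2) grows_mono[OF W(2)] odd(2)]) simp_all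
  show "cusp_growth 4 v'_fun" by (rule g[OF basic_funs_hol(3) Gamma0_basic(3) basic_funs_eval(3) grows_mono[OF inf(3)] W(3) odd(3)]) simp_all
qed

lemma cusp_growth_uminus: "cusp_growth m f \<Longrightarrow> cusp_growth m (- f)"
  using cusp_growth_cmult[of m f "-1"] by (simp add: is_ring_hom_simps[OF is_ring_hom_mero_const])

lemma cusp_growth_diff: "cusp_growth m f \<Longrightarrow> cusp_growth m g \<Longrightarrow> cusp_growth m (f - g)"
  using cusp_growth_add[OF _ cusp_growth_uminus, of m f g] by simp

text \<open>For \<open>norm a > 32\<close> the term \<open>16 a\<close> is at most half as large as
  \<open>a^2\<close>, and otherwise \<open>norm a ^ 2\<close> is at most
  \<open>32^2 = 1024\<close>.\<close>

lemma X_fun_norm_square: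
  assumes "z \<in> uhp"
  shows "norm (mero_eval X_fun z) ^ 2 \<le> 2 * norm (mero_eval (s_fun - (18 + 4 * U_fun)) z) + 1024"
proof -
  define a where "a = mero_eval X_fun z"
  have "s_fun - (18 + 4 * U_fun) = X_fun ^ 2 + 16 * X_fun" unfolding X_fun_quadratic[symmetric] by (simp add: algebra_simps)
  hence r: "mero_eval (s_fun - (18 + 4 * U_fun)) z = a ^ 2 + 16 * a"
    using assms by (simp add: a_def mero_hol_eval mero_hol_intros X_fun_hol mero_hol_eval_power mero_eval_numeral)
  have "norm a ^ 2 \<le> 2 * norm (a ^ 2 + 16 * a) + 1024"
  proof (cases "norm a \<le> 32")
    case True
    hence "norm a ^ 2 \<le> 32 ^ 2" by (rule power_mono) simp
    also have "32 ^ 2 = (1024 :: real)" by simp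
    finally show ?thesis using norm_ge_zero[of "a ^ 2 + 16 * a"] by linarith
  next
    case False
    have "norm (a ^ 2) \<le> norm (a ^ 2 + 16 * a) + norm (16 * a)" by (metis add_diff_cancel_right' norm_triangle_ineq4)
    hence 1: "norm a ^ 2 \<le> norm (a ^ 2 + 16 * a) + 16 * norm a" by (simp add: norm_power norm_mult)
    have "32 * norm a \<le> norm a * norm a" using False by (intro mult_right_mono) auto
    thus ?thesis using 1 by (simp add: power2_eq_square)
  qed
  thus ?thesis by (simp only: r a_def[symmetric])
qed

text \<open>\<open>X^2 + 16 X = s - 18 - 4 U\<close> has poles of order at most 4, so
  \<open>X\<close> has poles of order at most 2. The bound 3 for \<open>y\<close> comes from
  \<open>U\<close>.\<close>

lemma cusp_growth_curve: "cusp_growth 2 X_fun" "cusp_growth 2 x_fun" "cusp_growth 3 y_fun" "cusp_growth 4 t_fun"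
proof -
  have s: "cusp_growth 4 s_fun" unfolding s_fun_def by (intro cusp_growth_add cusp_growth_basic)
  have n: "cusp_growth m (numeral k)" "cusp_growth m 1" for m k using cusp_growth_mono[OF cusp_growth_numeral(3)] cusp_growth_mono[OF cusp_growth_numeral(1)] by auto
  have U: "cusp_growth 3 (numeral k * U_fun)" for k using cusp_growth_mult[OF cusp_growth_numeral(3)[of k] cusp_growth_basic(1)] by simp
  have R: "cusp_growth 4 (s_fun - (18 + 4 * U_fun))"
    by (intro cusp_growth_diff cusp_growth_add s n cusp_growth_mono[OF U]) simp
  show X: "cusp_growth 2 X_fun"
    unfolding cusp_growth_def
  proof (intro conjI ballI allI impI)
    fix T b assume T: "(T, b) \<in> cusp_maps"
    have "grows (\<lambda>z. mero_eval (s_fun - (18 + 4 * U_fun)) (T z)) (if b then 4 else 0)"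
      using R T unfolding cusp_growth_def by blast
    also have "(if b then 4 else 0) = 2 * (if b then 2 else 0 :: nat)" by simp
    finally show "grows (\<lambda>z. mero_eval X_fun (T z)) (if b then 2 else 0)"
      by (rule grows_root) (use X_fun_norm_square cusp_maps_in_uhp[OF T] in blast)
  qed (use X_fun_hol Gamma0_funs in auto)
  show x: "cusp_growth 2 x_fun" unfolding x_fun_def by (intro cusp_growth_add X n)
  have "cusp_growth (0 + 2) (2 * x_fun)" by (rule cusp_growth_mult[OF cusp_growth_numeral(3) x])
  hence "cusp_growth 2 (2 * x_fun)" by (simp only: add_0)
  thus "cusp_growth 3 y_fun" unfolding y_fun_def
    by (intro cusp_growth_diff cusp_growth_add n cusp_growth_basic cusp_growth_mono[of 2 _ 3]) auto
  show "cusp_growth 4 t_fun" unfolding t_fun_def by (intro cusp_growth_diff cusp_growth_basic)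
qed

lemma
  assumes x: "mero_hol x"
  shows mero_hol_eval_hom: "mero_hol (eval_hom mero_const x p)"
    and mero_eval_eval_hom: "z \<in> uhp \<Longrightarrow> mero_eval (eval_hom mero_const x p) z = poly p (mero_eval x z)"
proof -
  note h = eval_hom_pCons[OF is_ring_hom_mero_const] eval_hom_0[OF is_ring_hom_mero_const]
  show 1: "mero_hol (eval_hom mero_const x p)" for p
    by (induction p) (simp_all add: h mero_hol_ops mero_hol_const mero_hol_numeral x)
  show "mero_eval (eval_hom mero_const x p) z = poly p (mero_eval x z)" if "z \<in> uhp"
    using that by (induction p) (simp_all add: h mero_hol_eval mero_hol_ops mero_hol_const mero_eval_numeral mero_eval_const x 1)
qed

lemma moebius_pullback_eval_hom:
  assumes A: "det A > 0"
  shows "moebius_pullback A (eval_hom mero_const x p) = eval_hom mero_const (moebius_pullback A x) p"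
  by (induction p)
    (simp_all add: eval_hom_pCons[OF is_ring_hom_mero_const] eval_hom_0[OF is_ring_hom_mero_const]
      is_ring_hom_simps[OF is_ring_hom_moebius_pullback[OF A]] moebius_pullback_const[OF A])

section \<open>Removing the poles of an arbitrary function\<close>

lemma tendsto_imp_norm_bounded:
  assumes "(f \<longlongrightarrow> l) F"
  shows "\<exists>C. \<forall>\<^sub>F x in F. norm (f x) \<le> C"
proof -
  have "\<forall>\<^sub>F x in F. dist (f x) l < 1" using assms by (rule tendstoD) simp
  hence "\<forall>\<^sub>F x in F. norm (f x) \<le> norm l + 1"
  proof eventually_elim
    case (elim x)
    thus ?case using norm_triangle_sub[of "f x" l] by (simp add: dist_norm)
  qed
  thus ?thesis by blast
qed

lemma laurent_bounded:
  assumes F: "F has_laurent_expansion L"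
  shows "\<exists>n C. \<forall>\<^sub>F w in at 0. norm (F w) * norm w ^ n \<le> C"
proof -
  define n where "n = nat (- fls_subdegree L)"
  have e: "(\<lambda>w. F w * w powi int n) has_laurent_expansion fls_shift (- int n) L"
    by (rule has_laurent_expansion_shift[OF F])
  have "fls_subdegree (fls_shift (- int n) L) \<ge> 0"
  proof (cases "L = 0")
    case False thus ?thesis by (simp add: n_def)
  qed simp
  from tendsto_imp_norm_bounded[OF has_laurent_expansion_imp_tendsto_0[OF e this]]
  obtain C where "\<forall>\<^sub>F w in at 0. norm (F w * w powi int n) \<le> C" by blast
  thus ?thesis by (intro exI[of _ n] exI[of _ C]) (simp add: norm_mult norm_power)
qed

lemma bounded_imp_not_is_pole:
  fixes f :: "complex \<Rightarrow> complex"
  assumes "\<forall>\<^sub>F w in at z. norm (f w) \<le> C"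
  shows "\<not> is_pole f z"
proof
  assume "is_pole f z"
  hence "\<forall>r>0. \<forall>\<^sub>F w in at z. r \<le> norm (f w)" by (simp add: is_pole_def filterlim_at_infinity[of 0])
  hence "\<forall>\<^sub>F w in at z. \<bar>C\<bar> + 1 \<le> norm (f w)" by (rule allE[of _ "\<bar>C\<bar> + 1"]) simp
  with assms have "\<forall>\<^sub>F w in at z. False" by eventually_elim linarith
  thus False by simp
qed

text \<open>A finite polar part at width \<open>h\<close> is bounded by a power of
  \<open>exp (2 * pi * Im z / h)\<close>, which is at most \<open>exp (2 * pi * Im z)\<close>; so
  the width disappears.\<close>

lemma X0_complex_growth:
  assumes f: "f \<in> X0_complex_functions 34" and A: "A \<in> SL2Z"
  shows "\<exists>n. grows (\<lambda>z. mero_eval f (moebius_act A z)) n"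
proof -
  obtain h L where h: "h > 0" and L: "has_q_expansion (\<lambda>z. mero_eval f (moebius_act A z)) h L"
    using f A unfolding X0_complex_functions_def by blast
  obtain Y where Y: "Y \<ge> 0" "eval_fls L has_laurent_expansion L"
    "\<And>z. Im z > Y \<Longrightarrow> mero_eval f (moebius_act A z) = eval_fls L (q_par h z)"
    using L by (rule has_q_expansionE) blast
  obtain n C where "\<forall>\<^sub>F w in at 0. norm (eval_fls L w) * norm w ^ n \<le> C" using laurent_bounded[OF Y(2)] by blast
  from eventually_at_0_q_par[OF h this]
  obtain Y' where Y': "\<And>z. Im z > Y' \<Longrightarrow> norm (eval_fls L (q_par h z)) * norm (q_par h z) ^ n \<le> C" by blast
  have "grows (\<lambda>z. mero_eval f (moebius_act A z)) n"
  proof (rule growsI[of "max Y Y'" _ "max 0 C"])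
    fix z assume z: "Im z > max Y Y'"
    define e where "e = exp (2 * pi * Im z / real h)"
    have e: "e > 0" by (simp add: e_def)
    have ne: "norm (q_par h z) = inverse e" unfolding norm_q_par e_def exp_minus ..
    have "e \<le> exp (2 * pi * Im z)"
    proof -
      have "2 * pi * Im z * 1 \<le> 2 * pi * Im z * real h" using z Y(1) h by (intro mult_left_mono) auto
      thus ?thesis using h by (simp add: e_def divide_le_eq)
    qed
    hence E: "e ^ n \<le> exp (2 * pi * Im z) ^ n" using e by (intro power_mono) auto
    have "norm (eval_fls L (q_par h z)) * inverse e ^ n \<le> C" using Y'[of z] z unfolding ne by simp
    hence "norm (eval_fls L (q_par h z)) \<le> C * e ^ n" using e by (simp add: field_simps)
    also have "\<dots> \<le> max 0 C * e ^ n" using e by (intro mult_right_mono) auto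
    also have "\<dots> \<le> max 0 C * exp (2 * pi * Im z) ^ n" using E by (intro mult_left_mono) auto
    finally show "norm (mero_eval f (moebius_act A z)) \<le> max 0 C * exp (2 * pi * Im z) ^ n"
      using Y(3)[of z] z by simp
  qed
  thus ?thesis by blast
qed

text \<open>A locally bounded function has no pole; consequently poles cannot accumulate at a
  cusp.\<close>

lemma grows_not_is_pole:
  assumes "grows g n"
  shows "\<exists>Y. \<forall>z. Im z > Y \<longrightarrow> \<not> is_pole g z"
proof -
  obtain C Y where C: "C \<ge> 0" "\<And>z. Im z > Y \<Longrightarrow> norm (g z) \<le> C * exp (2 * pi * Im z) ^ n" using assms by (rule growsE) blast
  have "\<not> is_pole g z" if z: "Im z > Y" for z
  proof (rule bounded_imp_not_is_pole)
    have "open {w. Im w > Y \<and> Im w < Im z + 1}"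
      by (intro open_Collect_conj open_halfspace_Im_gt open_halfspace_Im_lt)
    hence "\<forall>\<^sub>F w in at z. w \<in> {w. Im w > Y \<and> Im w < Im z + 1}" using z by (intro eventually_at_in_open') auto
    thus "\<forall>\<^sub>F w in at z. norm (g w) \<le> C * exp (2 * pi * (Im z + 1)) ^ n"
    proof eventually_elim
      case (elim w)
      hence "C * exp (2 * pi * Im w) ^ n \<le> C * exp (2 * pi * (Im z + 1)) ^ n" using C(1)
        by (intro mult_left_mono power_mono) auto
      thus ?case using C(2)[of w] elim by simp
    qed
  qed
  thus ?thesis by blast
qed

lemma is_pole_moebius_pullback:
  assumes A: "det A > 0" and w: "w \<in> uhp" and f: "is_pole (mero_eval f) (moebius_act A w)"
  shows "is_pole (mero_eval (moebius_pullback A f)) w"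
proof -
  have "moebius_act A analytic_on {w}"
    using analytic_moebius[OF A] w by (simp add: analytic_on_subset)
  hence lim: "moebius_act A \<midarrow>w\<rightarrow> moebius_act A w"
    using analytic_at_imp_isCont isContD by blast
  have ne: "\<forall>\<^sub>F z in at w. moebius_act A z \<noteq> moebius_act A w"
  proof -
    have "\<forall>\<^sub>F z in at w. z \<in> uhp - {w}" using w by (intro eventually_at_in_open) auto
    thus ?thesis by eventually_elim (use inj_on_moebius[OF A] w in \<open>auto simp: inj_on_def\<close>)
  qed
  have "is_pole (\<lambda>z. mero_eval f (moebius_act A z)) w" using is_pole_compose[OF f lim ne] .
  moreover have "\<forall>\<^sub>F z in at w. mero_eval (moebius_pullback A f) z = mero_eval f (moebius_act A z)"
    using eventually_at_uhp[OF w] by eventually_elim (simp add: mero_eval_moebius_pullback A)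
  ultimately show ?thesis using is_pole_cong by metis
qed

lemma pole_order_bounded:
  assumes "p \<in> uhp"
  shows "\<exists>n C. \<forall>\<^sub>F z in at p. norm (mero_eval f z) * norm (z - p) ^ n \<le> C"
proof -
  have "(\<lambda>w. mero_eval f (p + w)) has_laurent_expansion laurent_expansion (mero_eval f) p"
    by (rule meromorphic_on_imp_has_laurent_expansion[OF meromorphic_mero_eval assms])
  from laurent_bounded[OF this] obtain n C where "\<forall>\<^sub>F w in at 0. norm (mero_eval f (p + w)) * norm w ^ n \<le> C" by blast
  hence "\<forall>\<^sub>F z in at p. norm (mero_eval f z) * norm (z - p) ^ n \<le> C"
    unfolding at_to_0[of p] eventually_filtermap by (simp add: add.commute)
  thus ?thesis by blast
qed

lemma uniform_bound_finite:
  fixes Q :: "'a \<Rightarrow> 'b::linorder \<Rightarrow> bool"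
  assumes "finite R" "\<And>B. B \<in> R \<Longrightarrow> \<exists>Y. Q B Y" "\<And>B Y Y'. Q B Y \<Longrightarrow> Y \<le> Y' \<Longrightarrow> Q B Y'"
  shows "\<exists>Y. \<forall>B\<in>R. Q B Y"
  using assms(1,2)
proof (induction R rule: finite_induct)
  case (insert B R)
  then obtain Y where "\<forall>B\<in>R. Q B Y" by auto
  moreover obtain Y' where "Q B Y'" using insert.prems by blast
  ultimately
  show ?case using assms(3) by (intro exI[of _ "max Y Y'"]) (metis insert_iff max.cobounded1 max.cobounded2)
qed simp

text \<open>Modulo \<open>Gamma0 34\<close> there are finitely many poles: the finitely many
  translates have none high up, so all poles can be moved into a compact set. Since \<open>x\<close>
  is holomorphic and invariant, a factor \<open>(x - x(p))^N\<close> removes the pole at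
  \<open>p\<close> together with its whole orbit.\<close>

lemma clear_finite_poles:
  assumes f: "f \<in> X0_complex_functions 34"
  shows "\<exists>p. p \<noteq> 0 \<and> mero_hol (f * eval_hom mero_const x_fun p)"
proof -
  have inv: "moebius_pullback G f = f" if "G \<in> Gamma0 34" for G using f that by (simp add: X0_complex_functions_altdef)
  obtain R where R: "finite R" "R \<subseteq> SL2Z" "\<And>A. A \<in> SL2Z \<Longrightarrow> \<exists>B\<in>R. \<exists>G\<in>Gamma0 34. A = G ** B"
    using finite_coset_representatives[of 34] by auto
  have "\<exists>Y. \<forall>B\<in>R. \<forall>z. Im z > Y \<longrightarrow> z \<in> uhp \<longrightarrow> \<not> is_pole (mero_eval (moebius_pullback B f)) z"
  proof (rule uniform_bound_finite[OF R(1)])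
    fix B assume "B \<in> R"
    hence B: "B \<in> SL2Z" using R(2) by blast
    obtain n where "grows (\<lambda>z. mero_eval f (moebius_act B z)) n" using X0_complex_growth[OF f B] by blast
    hence "grows (mero_eval (moebius_pullback B f)) n"
      by (rule grows_cong) (use B in \<open>simp add: mero_eval_moebius_pullback\<close>)
    from grows_not_is_pole[OF this]
    show "\<exists>Y. \<forall>z. Im z > Y \<longrightarrow> z \<in> uhp \<longrightarrow> \<not> is_pole (mero_eval (moebius_pullback B f)) z" by blast
  qed auto
  then obtain Y where Y: "\<And>B z. B \<in> R \<Longrightarrow> z \<in> uhp \<Longrightarrow> is_pole (mero_eval (moebius_pullback B f)) z \<Longrightarrow> Im z \<le> Y"
    by (metis not_le)
  define K where "K = cbox (Complex (- 1 / 2) (1 / 2)) (Complex (1 / 2) Y)"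
  have K: "z \<in> K \<longleftrightarrow> \<bar>Re z\<bar> \<le> 1 / 2 \<and> 1 / 2 \<le> Im z \<and> Im z \<le> Y" for z
    by (auto simp: K_def in_cbox_complex_iff abs_le_iff)
  have Ku: "K \<subseteq> uhp" by (auto simp: K uhp_def)
  define P where "P = (\<Union>B\<in>R. moebius_act B ` {w\<in>K. is_pole (mero_eval (moebius_pullback B f)) w})"
  have "finite {w\<in>K. is_pole (mero_eval g) w}" for g
  proof -
    have "{w. \<not> mero_eval g analytic_on {w}} sparse_in K"
      using meromorphic_on_imp_sparse_singularities[OF meromorphic_mero_eval] Ku sparse_in_subset by blast
    hence "finite (K \<inter> {w. \<not> mero_eval g analytic_on {w}})"
      by (rule sparse_in_compact_finite) (simp add: K_def compact_cbox)
    moreover have "{w\<in>K. is_pole (mero_eval g) w} \<subseteq> K \<inter> {w. \<not> mero_eval g analytic_on {w}}"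
    proof -
      have "\<not> is_pole (mero_eval g) w" if "mero_eval g analytic_on {w}" for w
        using that by (meson analytic_at not_is_pole_holomorphic)
      thus ?thesis by blast
    qed
    ultimately show ?thesis by (rule rev_finite_subset)
  qed
  hence P_fin: "finite P" unfolding P_def using R(1) by blast
  have P_uhp: "P \<subseteq> uhp" unfolding P_def using R(2) Ku SL2Z_moebius_in_uhp by blast
  have "\<exists>N. \<forall>p\<in>P. \<exists>C. \<forall>\<^sub>F z in at p. norm (mero_eval f z) * norm (z - p) ^ N \<le> C"
  proof (rule uniform_bound_finite[OF P_fin])
    fix p N N' assume "\<exists>C. \<forall>\<^sub>F z in at p. norm (mero_eval f z) * norm (z - p) ^ N \<le> C" and N: "(N::nat) \<le> N'"
    then obtain C where C: "\<forall>\<^sub>F z in at p. norm (mero_eval f z) * norm (z - p) ^ N \<le> C" by blast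
    have "\<forall>\<^sub>F z in at p. z \<in> ball p 1" by (intro eventually_at_in_open') auto
    with C have "\<forall>\<^sub>F z in at p. norm (mero_eval f z) * norm (z - p) ^ N' \<le> C"
    proof eventually_elim
      case (elim z)
      have "norm (z - p) ^ N' \<le> norm (z - p) ^ N" using elim N by (intro power_decreasing) (auto simp: dist_norm norm_minus_commute)
      hence "norm (mero_eval f z) * norm (z - p) ^ N' \<le> norm (mero_eval f z) * norm (z - p) ^ N" by (rule mult_left_mono) simp
      thus ?case using elim by linarith
    qed
    thus "\<exists>C. \<forall>\<^sub>F z in at p. norm (mero_eval f z) * norm (z - p) ^ N' \<le> C" by blast
  qed (use pole_order_bounded P_uhp in blast)
  then obtain N where N: "\<And>p. p \<in> P \<Longrightarrow> \<exists>C. \<forall>\<^sub>F z in at p. norm (mero_eval f z) * norm (z - p) ^ N \<le> C" by blast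
  define xv where "xv = mero_eval x_fun"
  define pol where "pol = (\<Prod>p\<in>P. [:- xv p, 1:] ^ N)"
  have pol0: "pol \<noteq> 0" using P_fin by (simp add: pol_def)
  define e where "e = eval_hom mero_const x_fun pol"
  have e_hol: "mero_hol e" unfolding e_def by (rule mero_hol_eval_hom[OF x_fun_hol])
  have e_eval: "mero_eval e z = poly pol (xv z)" if "z \<in> uhp" for z
    unfolding e_def xv_def by (rule mero_eval_eval_hom[OF x_fun_hol that])
  have g_ev: "\<forall>\<^sub>F z in at w. mero_eval (f * e) z = mero_eval f z * poly pol (xv z)" if "w \<in> uhp" for w
    using eventually_cosparse_uhp_at[OF mero_eval_mult[of f e] that] eventually_at_uhp[OF that]
    by eventually_elim (simp add: e_eval)
  have x_ana: "xv analytic_on {w}" if "w \<in> uhp" for w unfolding xv_def by (rule mero_hol_analytic[OF x_fun_hol that])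
  have x_cont: "isCont (\<lambda>z. poly r (xv z)) w" if "w \<in> uhp" for w r
    using analytic_at_imp_isCont[OF x_ana[OF that]] by (intro continuous_intros)
  have bnd: "\<exists>C. \<forall>\<^sub>F z in at w. norm (h z) \<le> C" if "isCont h w" for h :: "complex \<Rightarrow> complex" and w
    using that unfolding isCont_def by (rule tendsto_imp_norm_bounded)
  have noP: "\<not> is_pole (mero_eval (f * e)) p" if p: "p \<in> P" for p
  proof -
    have pu: "p \<in> uhp" using p P_uhp by blast
    have "[:- xv p, 1:] ^ N dvd pol" unfolding pol_def using P_fin p by (rule dvd_prodI)
    then obtain r where r: "pol = [:- xv p, 1:] ^ N * r" by blast
    have pol_eval: "poly pol (xv z) = (xv z - xv p) ^ N * poly r (xv z)" for z unfolding r by simp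
    \<comment> \<open>Only an upper bound for the difference quotient enters, so ramification of
      \<open>x\<close> at \<open>p\<close> does no harm.\<close>
    obtain D where "(xv has_field_derivative D) (at p)"
      using x_ana[OF pu] analytic_on_imp_differentiable_at[of xv "{p}" p] by (auto simp: field_differentiable_def)
    hence "((\<lambda>z. (xv z - xv p) / (z - p)) \<longlongrightarrow> D) (at p)" by (simp add: has_field_derivative_iff)
    then obtain C1 where C1: "\<forall>\<^sub>F z in at p. norm ((xv z - xv p) / (z - p)) \<le> C1"
      using tendsto_imp_norm_bounded by blast
    obtain C2 where C2: "\<forall>\<^sub>F z in at p. norm (poly r (xv z)) \<le> C2" using bnd[OF x_cont[OF pu]] by blast
    obtain C3 where C3: "\<forall>\<^sub>F z in at p. norm (mero_eval f z) * norm (z - p) ^ N \<le> C3" using N[OF p] by blast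
    have ne: "\<forall>\<^sub>F z in at p. z \<noteq> p" by (simp add: eventually_at_filter)
    have "\<forall>\<^sub>F z in at p. norm (mero_eval (f * e) z) \<le> C3 * (C1 ^ N * C2)"
      using g_ev[OF pu] C1 C2 C3 ne
    proof eventually_elim
      case (elim z)
      have z: "norm (z - p) > 0" using elim by simp
      have "norm (xv z - xv p) = norm (z - p) * norm ((xv z - xv p) / (z - p))" using z by (simp add: norm_divide)
      hence "norm (mero_eval (f * e) z) = (norm (mero_eval f z) * norm (z - p) ^ N) * (norm ((xv z - xv p) / (z - p)) ^ N * norm (poly r (xv z)))"
        unfolding elim(1) pol_eval norm_mult norm_power by (simp only: power_mult_distrib mult_ac)
      also have "\<dots> \<le> C3 * (C1 ^ N * C2)"
      proof (intro mult_mono power_mono elim)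
        have "0 \<le> norm ((xv z - xv p) / (z - p))" by simp
        hence C1: "0 \<le> C1" using elim(2) by linarith
        show "0 \<le> C3" using elim(4) by (rule order_trans[rotated]) simp
        show "0 \<le> C1 ^ N" using C1 by simp
      qed auto
      finally show ?case .
    qed
    thus ?thesis by (rule bounded_imp_not_is_pole)
  qed
  have "\<not> is_pole (mero_eval (f * e)) z" if z: "z \<in> uhp" for z
  proof
    assume pole: "is_pole (mero_eval (f * e)) z"
    have fpole: "is_pole (mero_eval f) z"
    proof (rule ccontr)
      assume "\<not> is_pole (mero_eval f) z"
      hence "mero_eval f analytic_on {z}" using nicely_meromorphic_on_imp_analytic_at[OF nicely_meromorphic_mero_eval z] by blast
      hence "isCont (\<lambda>w. mero_eval f w * poly pol (xv w)) z"
        by (intro continuous_mult analytic_at_imp_isCont x_cont[OF z])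
      then obtain C where "\<forall>\<^sub>F w in at z. norm (mero_eval f w * poly pol (xv w)) \<le> C" using bnd by blast
      with g_ev[OF z] have "\<forall>\<^sub>F w in at z. norm (mero_eval (f * e) w) \<le> C" by eventually_elim simp
      thus False using bounded_imp_not_is_pole pole by blast
    qed
    obtain A where A: "A \<in> SL2Z" "\<bar>Re (moebius_act A z)\<bar> \<le> 1 / 2" "Im (moebius_act A z) \<ge> 1 / 2"
      using SL2Z_fundamental_domain[OF z] by blast
    \<comment> \<open>The pole \<open>z\<close> is moved into the compact set; the inverse matrix
      splits as \<open>G ** B\<close>, and the intermediate point \<open>p\<close> lies in
      \<open>P\<close> and is equivalent to \<open>z\<close> under \<open>Gamma0 34\<close>.\<close>
    define w where "w = moebius_act A z"
    have w: "w \<in> uhp" unfolding w_def using A(1) z by simp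
    obtain A' where A': "A' \<in> SL2Z" "A' ** A = mat 1" using SL2Z_inverse[OF A(1)] by blast
    have "moebius_act A' w = moebius_act (A' ** A) z" unfolding w_def using A(1) z by (simp add: SL2Z_moebius_mult)
    also have "\<dots> = z" unfolding A'(2) by (simp add: moebius_act_eq mat_def)
    finally have zw: "moebius_act A' w = z" .
    obtain B G where B: "B \<in> R" and G: "G \<in> Gamma0 34" and A'B: "A' = G ** B" using R(3)[OF A'(1)] by blast
    have BS: "B \<in> SL2Z" using B R(2) by blast
    define p where "p = moebius_act B w"
    have p: "p \<in> uhp" unfolding p_def using BS w by simp
    have zp: "moebius_act G p = z" using zw unfolding A'B p_def using BS w by (simp add: SL2Z_moebius_mult)
    have "is_pole (mero_eval f) p"
      using is_pole_moebius_pullback[OF Gamma0_det[OF G] p, of f] fpole unfolding zp inv[OF G] by blast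
    hence "is_pole (mero_eval (moebius_pullback B f)) w"
      unfolding p_def using BS w by (intro is_pole_moebius_pullback) auto
    hence "p \<in> P" using Y[OF B w] A(2,3) B unfolding P_def p_def w_def[symmetric] by (auto simp: K)
    moreover have "moebius_pullback G (f * e) = f * e"
      using inv[OF G] Gamma0_funs(2)[OF G] Gamma0_det[OF G] by (simp add: moebius_pullback_mult e_def moebius_pullback_eval_hom)
    hence "is_pole (mero_eval (f * e)) p"
      using is_pole_moebius_pullback[OF Gamma0_det[OF G] p, of "f * e"] pole unfolding zp by simp
    ultimately show False using noP by blast
  qed
  hence "mero_eval (f * e) analytic_on {z}" if "z \<in> uhp" for z
    using nicely_meromorphic_on_imp_analytic_at[OF nicely_meromorphic_mero_eval that] that by blast
  hence "mero_hol (f * e)" unfolding mero_hol_def by (intro analytic_imp_holomorphic) (use analytic_on_analytic_at in blast)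
  thus ?thesis using pol0 unfolding e_def by blast
qed

text \<open>For the comparison of \<open>W17\<close> with the integral matrix at the cusp 1/2
  through \<open>W17_eq_half_cusp\<close>; the factor 17 is the width of that cusp.\<close>

lemma grows_rescale:
  assumes "grows g m"
  shows "grows (\<lambda>z. g (17 * z + 8)) (17 * m)"
proof -
  obtain C Y where C: "C \<ge> 0" "Y \<ge> 0" "\<And>z. Im z > Y \<Longrightarrow> norm (g z) \<le> C * exp (2 * pi * Im z) ^ m" using assms by (rule growsE) blast
  show ?thesis
  proof (rule growsI[of Y _ C])
    fix z :: complex assume z: "Im z > Y"
    have "Im (17 * z + 8) = 17 * Im z" by simp
    moreover have "17 * Im z > Y" using z C(2) by linarith
    ultimately have "norm (g (17 * z + 8)) \<le> C * exp (2 * pi * (17 * Im z)) ^ m" using C(3)[of "17 * z + 8"] by simp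
    also have "exp (2 * pi * (17 * Im z)) ^ m = exp (2 * pi * Im z) ^ (17 * m)"
      by (simp add: power_mult flip: exp_of_nat_mult)
    finally show "norm (g (17 * z + 8)) \<le> C * exp (2 * pi * Im z) ^ (17 * m)" .
  qed
qed

lemma W17_eq_half_cusp: "z \<in> uhp \<Longrightarrow> moebius_act W17 z = moebius_act (int_mat2 1 0 2 1) (17 * z + 8)"
  by (simp add: moebius_W17 moebius_act_int_mat2)

text \<open>\<open>X\<close> vanishes at the remaining cusps because \<open>U\<close> does and \<open>X\<^sup>3 = U (U + 5 X + 4)\<close>.\<close>
lemma X_fun_small_at_odd_cusps:
  assumes "a * d - b * c = 1" "odd c"
  obtains C Y where "C \<ge> 0" "Y \<ge> 0"
    "\<And>z. Im z > Y \<Longrightarrow> norm (mero_eval X_fun (moebius_act (int_mat2 a b c d) z)) ^ 3 \<le> C * exp (- Im z / 2)"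
proof -
  define T where "T = moebius_act (int_mat2 a b c d)"
  have T: "(T, False) \<in> cusp_maps" unfolding T_def using assms by (rule cusp_maps_simps)
  obtain C where C: "C \<ge> 1"
    "\<And>a b c d z. a * d - b * c = 1 \<Longrightarrow> Im z \<ge> 1 \<Longrightarrow> odd c \<Longrightarrow>
       norm (eta_quot_U ((of_int a * z + of_int b) / (of_int c * z + of_int d))) \<le> C * exp (- Im z / 2) \<and>
       norm (eta_quot_v ((of_int a * z + of_int b) / (of_int c * z + of_int d))) \<le> C \<and>
       norm (17 / eta_quot_v ((of_int a * z + of_int b) / (of_int c * z + of_int d))) \<le> C"
    by (rule eta_quot_cusp_bounds) blast
  have "grows (\<lambda>z. mero_eval X_fun (T z)) 0" using cusp_growth_curve(1) T unfolding cusp_growth_def by fastforce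
  then obtain K Y where K: "K \<ge> 0" "Y \<ge> 0" "\<And>z. Im z > Y \<Longrightarrow> norm (mero_eval X_fun (T z)) \<le> K * exp (2 * pi * Im z) ^ 0"
    by (rule growsE) blast
  have cubic: "mero_eval X_fun z ^ 3 = eta_quot_U z * (eta_quot_U z + 5 * mero_eval X_fun z + 4)" if "z \<in> uhp" for z
  proof -
    have "mero_eval (X_fun ^ 3) z = mero_eval (U_fun * (U_fun + 5 * X_fun + 4)) z"
      unfolding X_fun_cubic by (simp add: algebra_simps power2_eq_square)
    thus ?thesis using that
      by (simp add: mero_hol_eval mero_hol_intros X_fun_hol mero_hol_eval_power mero_eval_numeral basic_funs_eval)
  qed
  show ?thesis
  proof (rule that[of "C * (C + 5 * K + 4)" "max 1 Y"])
    fix z assume z: "Im z > max 1 Y"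
    have zu: "z \<in> uhp" using z by (simp add: uhp_def)
    have Tz: "T z \<in> uhp" using cusp_maps_in_uhp[OF T zu] .
    have U: "norm (eta_quot_U (T z)) \<le> C * exp (- Im z / 2)"
      using C(2)[OF assms(1) _ assms(2), of z] z by (simp add: T_def moebius_act_int_mat2)
    have "C * exp (- Im z / 2) \<le> C * 1" using C(1) z by (intro mult_left_mono) auto
    hence U1: "norm (eta_quot_U (T z)) \<le> C" using U by linarith
    have "norm (eta_quot_U (T z) + 5 * mero_eval X_fun (T z) + 4) \<le> norm (eta_quot_U (T z)) + norm (5 * mero_eval X_fun (T z)) + norm (4::complex)"
      by (intro norm_triangle_le add_right_mono norm_triangle_ineq)
    also have "\<dots> \<le> C + 5 * K + 4" using U1 K(3)[of z] z by (simp add: norm_mult)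
    finally have F: "norm (eta_quot_U (T z) + 5 * mero_eval X_fun (T z) + 4) \<le> C + 5 * K + 4" .
    have "norm (mero_eval X_fun (T z)) ^ 3 = norm (eta_quot_U (T z)) * norm (eta_quot_U (T z) + 5 * mero_eval X_fun (T z) + 4)"
      unfolding norm_power[symmetric] cubic[OF Tz] norm_mult ..
    also have "\<dots> \<le> (C * exp (- Im z / 2)) * (C + 5 * K + 4)"
      using C(1) by (intro mult_mono U F) auto
    finally show "norm (mero_eval X_fun (moebius_act (int_mat2 a b c d) z)) ^ 3 \<le> C * (C + 5 * K + 4) * exp (- Im z / 2)"
      unfolding T_def by (simp only: mult_ac)
  qed (use C(1) K in auto)
qed

text \<open>\<open>X\<close> vanishes at the odd cusps, so a high power outweighs the poles of
  \<open>f\<close> there; the poles of \<open>X\<close> itself lie at the two cusps where they are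
  allowed.\<close>

lemma clear_odd_cusps:
  assumes f: "f \<in> X0_complex_functions 34" and hol: "mero_hol f"
  shows "\<exists>k m. cusp_growth m (f * X_fun ^ k)"
proof -
  have inv: "moebius_pullback G f = f" if "G \<in> Gamma0 34" for G using f that by (simp add: X0_complex_functions_altdef)
  obtain R where R: "finite R" "R \<subseteq> SL2Z" "\<And>A. A \<in> SL2Z \<Longrightarrow> \<exists>B\<in>R. \<exists>G\<in>Gamma0 34. A = G ** B"
    using finite_coset_representatives[of 34] by auto
  have "\<exists>n. \<forall>B\<in>R. grows (\<lambda>z. mero_eval f (moebius_act B z)) n"
    by (rule uniform_bound_finite[OF R(1)]) (use X0_complex_growth[OF f] R(2) grows_mono in blast)+
  then obtain n where n: "\<And>B. B \<in> R \<Longrightarrow> grows (\<lambda>z. mero_eval f (moebius_act B z)) n" by blast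
  have gr: "grows (\<lambda>z. mero_eval f (moebius_act A z)) n" if A: "A \<in> SL2Z" for A
  proof -
    obtain B G where B: "B \<in> R" "G \<in> Gamma0 34" "A = G ** B" using R(3)[OF A] by blast
    have BS: "B \<in> SL2Z" using B(1) R(2) by blast
    show ?thesis
    proof (rule grows_cong[OF n[OF B(1)]])
      fix z assume z: "z \<in> uhp"
      have "mero_eval f (moebius_act A z) = mero_eval f (moebius_act G (moebius_act B z))"
        unfolding B(3) using BS z by (simp add: SL2Z_moebius_mult)
      also have "\<dots> = mero_eval (moebius_pullback G f) (moebius_act B z)"
        using BS z Gamma0_det[OF B(2)] by (simp add: mero_eval_moebius_pullback)
      finally show "mero_eval f (moebius_act A z) = mero_eval f (moebius_act B z)" unfolding inv[OF B(2)] .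
    qed
  qed
  \<comment> \<open>\<open>X^(3 k)\<close> decays like
    \<open>exp (- k * Im z / 2) = exp (- 8 * Im z) ^ n\<close>, which outweighs
    \<open>exp (2 * pi * Im z) ^ n\<close> because \<open>pi < 4\<close>.\<close>
  define k where "k = 16 * n"
  have Xk: "cusp_growth (3 * k * 2) (X_fun ^ (3 * k))" by (rule cusp_growth_power[OF cusp_growth_curve(1)])
  have Xh: "mero_hol (X_fun ^ (3 * k))" by (intro mero_hol_power X_fun_hol)
  define m where "m = 17 * n + 3 * k * 2"
  have "cusp_growth m (f * X_fun ^ (3 * k))"
    unfolding cusp_growth_def
  proof (intro conjI ballI allI impI)
    show "mero_hol (f * X_fun ^ (3 * k))" using hol Xh by (rule mero_hol_ops)
    show "moebius_pullback G (f * X_fun ^ (3 * k)) = f * X_fun ^ (3 * k)" if "G \<in> Gamma0 34" for G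
      using inv[OF that] Gamma0_funs(1)[OF that] is_ring_hom_simps[OF is_ring_hom_moebius_pullback[OF Gamma0_det[OF that]]] by simp
    fix T b assume T: "(T, b) \<in> cusp_maps"
    have ev: "mero_eval (f * X_fun ^ (3 * k)) (T z) = mero_eval f (T z) * mero_eval (X_fun ^ (3 * k)) (T z)" if "z \<in> uhp" for z
      using mero_hol_eval_mult[OF hol Xh cusp_maps_in_uhp[OF T that]] .
    have GX: "grows (\<lambda>z. mero_eval (X_fun ^ (3 * k)) (T z)) (if b then 3 * k * 2 else 0)"
      using Xk T unfolding cusp_growth_def by blast
    from T show "grows (\<lambda>z. mero_eval (f * X_fun ^ (3 * k)) (T z)) (if b then m else 0)"
    proof (cases rule: cusp_maps_cases)
      case infinity
      have S: "int_mat2 1 0 0 1 \<in> SL2Z" by (simp add: int_mat2_in_SL2Z_iff)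
      have "grows (\<lambda>z. mero_eval f (T z)) n"
        by (rule grows_cong[OF gr[OF S]]) (simp add: infinity moebius_act_int_mat2)
      hence "grows (\<lambda>z. mero_eval f (T z)) (17 * n)" by (rule grows_mono) simp
      from grows_mult[OF this GX] show ?thesis using infinity(1) by (simp add: m_def) (rule grows_cong, assumption, rule ev)
    next
      case W17
      have S: "int_mat2 1 0 2 1 \<in> SL2Z" by (simp add: int_mat2_in_SL2Z_iff)
      have "grows (\<lambda>z. mero_eval f (T z)) (17 * n)"
        by (rule grows_cong[OF grows_rescale[OF gr[OF S]]]) (simp add: W17 W17_eq_half_cusp)
      from grows_mult[OF this GX] show ?thesis using W17(1) by (simp add: m_def) (rule grows_cong, assumption, rule ev)
    next
      case (odd a b' c d)
      have S: "int_mat2 a b' c d \<in> SL2Z" using odd by (simp add: int_mat2_in_SL2Z_iff)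
      obtain C Y where C: "C \<ge> 0" "Y \<ge> 0" "\<And>z. Im z > Y \<Longrightarrow> norm (mero_eval X_fun (T z)) ^ 3 \<le> C * exp (- Im z / 2)"
        using X_fun_small_at_odd_cusps[OF odd(3,4)] odd(2) by metis
      obtain D Z where D: "D \<ge> 0" "\<And>z. Im z > Z \<Longrightarrow> norm (mero_eval f (T z)) \<le> D * exp (2 * pi * Im z) ^ n"
        using gr[OF S] unfolding odd(2) by (rule growsE) blast
      have "grows (\<lambda>z. mero_eval f (T z) * mero_eval (X_fun ^ (3 * k)) (T z)) 0"
      proof (rule growsI[of "max Y Z" _ "D * C ^ k"])
        fix z assume z: "Im z > max Y Z"
        have zu: "z \<in> uhp" using z C(2) by (simp add: uhp_def)
        have "norm (mero_eval (X_fun ^ (3 * k)) (T z)) = (norm (mero_eval X_fun (T z)) ^ 3) ^ k"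
          unfolding mero_hol_eval_power[OF X_fun_hol cusp_maps_in_uhp[OF T zu]] norm_power by (rule power_mult)
        also have "\<dots> \<le> (C * exp (- Im z / 2)) ^ k" using C(3)[of z] z by (intro power_mono) auto
        also have "\<dots> = C ^ k * exp (- 8 * Im z) ^ n"
          unfolding power_mult_distrib k_def power_mult by (simp flip: exp_of_nat_mult)
        finally have Xb: "norm (mero_eval (X_fun ^ (3 * k)) (T z)) \<le> C ^ k * exp (- 8 * Im z) ^ n" .
        have "norm (mero_eval f (T z) * mero_eval (X_fun ^ (3 * k)) (T z)) \<le> (D * exp (2 * pi * Im z) ^ n) * (C ^ k * exp (- 8 * Im z) ^ n)"
          unfolding norm_mult using D(2)[of z] z Xb D(1) by (intro mult_mono) auto
        also have "\<dots> = D * C ^ k * (exp (2 * pi * Im z) * exp (- 8 * Im z)) ^ n"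
          unfolding power_mult_distrib by (simp only: mult_ac)
        also have "\<dots> \<le> D * C ^ k * 1"
        proof (intro mult_left_mono power_le_one)
          have "2 * pi * Im z \<le> 8 * Im z" using pi_less_4 z C(2) by (intro mult_right_mono) auto
          thus "exp (2 * pi * Im z) * exp (- 8 * Im z) \<le> 1" by (simp flip: exp_add)
        qed (use D(1) C(1) in auto)
        finally show "norm (mero_eval f (T z) * mero_eval (X_fun ^ (3 * k)) (T z)) \<le> D * C ^ k * exp (2 * pi * Im z) ^ 0" by simp
      qed
      thus ?thesis using odd(1) by simp (rule grows_cong, assumption, rule ev)
    qed
  qed
  thus ?thesis by blast
qed

text \<open>As \<open>X = x - 2\<close>, both clearing factors are polynomials in \<open>x\<close>,
  and so is their product.\<close>

lemma clear_denominators: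
  assumes f: "f \<in> X0_complex_functions 34"
  shows "\<exists>p m. p \<noteq> 0 \<and> cusp_growth m (f * eval_hom mero_const x_fun p)"
proof -
  note hom = is_ring_hom_simps[OF is_ring_hom_eval_hom[OF is_ring_hom_mero_const]]
  obtain p where p: "p \<noteq> 0" "mero_hol (f * eval_hom mero_const x_fun p)" using clear_finite_poles[OF f] by blast
  have x: "x_fun \<in> X0_complex_functions 34" using curve_funs_rational(2,1) by (simp add: X0_rational_functions_altdef)
  have "eval_hom mero_const x_fun q \<in> X0_complex_functions 34" for q
    using X0_complex_const[of 0 34]
    by (induction q) (simp_all add: eval_hom_pCons[OF is_ring_hom_mero_const] eval_hom_0[OF is_ring_hom_mero_const] mero_const_numeral X0_complex_ops(1,2) X0_complex_const x)
  hence "f * eval_hom mero_const x_fun p \<in> X0_complex_functions 34" using f by (intro X0_complex_ops(2))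
  from clear_odd_cusps[OF this p(2)] obtain k m where "cusp_growth m (f * eval_hom mero_const x_fun p * X_fun ^ k)" by blast
  moreover have "X_fun = eval_hom mero_const x_fun [:- 2, 1:]"
    by (simp add: eval_hom_pCons[OF is_ring_hom_mero_const] eval_hom_0[OF is_ring_hom_mero_const] is_ring_hom_simps[OF is_ring_hom_mero_const] x_fun_def)
  hence "f * eval_hom mero_const x_fun p * X_fun ^ k = f * eval_hom mero_const x_fun (p * [:- 2, 1:] ^ k)"
    by (simp only: hom mult.assoc)
  ultimately have "cusp_growth m (f * eval_hom mero_const x_fun (p * [:- 2, 1:] ^ k))" by simp
  moreover have "p * [:- 2, 1:] ^ k \<noteq> 0" using p(1) by simp
  ultimately show ?thesis by blast
qed

section \<open>Expansions at the two cusps with poles, and linear relations\<close>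

lemma cusp_growth_invariant:
  assumes f: "cusp_growth m f" and z: "z \<in> uhp"
  shows "G \<in> Gamma0 34 \<Longrightarrow> mero_eval f (moebius_act G z) = mero_eval f z"
    and "mero_eval f (z + 1) = mero_eval f z"
    and "mero_eval f (moebius_act W17 (z + 1)) = mero_eval f (moebius_act W17 z)"
proof -
  have inv: "mero_eval f (moebius_act G z) = mero_eval f z" if G: "G \<in> Gamma0 34" and z: "z \<in> uhp" for G z
    using mero_eval_moebius_pullback[OF Gamma0_det[OF G] z, of f] f G by (simp add: cusp_growth_def)
  show "G \<in> Gamma0 34 \<Longrightarrow> mero_eval f (moebius_act G z) = mero_eval f z" using inv z by blast
  have z1: "z + 1 \<in> uhp" using z by (simp add: uhp_def)
  have "int_mat2 1 1 0 1 \<in> Gamma0 34" by (simp add: int_mat2_in_Gamma0_iff)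
  from inv[OF this z] show "mero_eval f (z + 1) = mero_eval f z" by (simp add: moebius_act_int_mat2)
  define w where "w = 17 * z + 8"
  have w: "w \<in> uhp" using z by (simp add: uhp_def w_def)
  \<comment> \<open>The conjugate of the translation by 17 under \<open>int_mat2 1 0 2 1\<close>; it
    belongs to the group because \<open>68 = 2 * 34\<close>.\<close>
  have G: "int_mat2 (- 33) 17 (- 68) 35 \<in> Gamma0 34" by (simp add: int_mat2_in_Gamma0_iff)
  have A: "int_mat2 1 0 2 1 \<in> SL2Z" and T: "int_mat2 1 17 0 1 \<in> SL2Z" by (simp_all add: int_mat2_in_SL2Z_iff)
  have "int_mat2 (- 33) 17 (- 68) 35 ** int_mat2 1 0 2 1 = int_mat2 1 0 2 1 ** int_mat2 1 17 0 1"
    by (simp add: int_mat2_mult)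
  hence "moebius_act (int_mat2 (- 33) 17 (- 68) 35) (moebius_act (int_mat2 1 0 2 1) w) = moebius_act (int_mat2 1 0 2 1) (moebius_act (int_mat2 1 17 0 1) w)"
    using SL2Z_moebius_mult[OF A w] SL2Z_moebius_mult[OF T w] by metis
  moreover have "moebius_act (int_mat2 1 17 0 1) w = 17 * (z + 1) + 8" by (simp add: moebius_act_int_mat2 w_def)
  ultimately have "moebius_act W17 (z + 1) = moebius_act (int_mat2 (- 33) 17 (- 68) 35) (moebius_act W17 z)"
    using W17_eq_half_cusp[OF z1] W17_eq_half_cusp[OF z] by (simp add: w_def)
  thus "mero_eval f (moebius_act W17 (z + 1)) = mero_eval f (moebius_act W17 z)"
    using inv[OF G moebius_in_uhp[OF det_W17 z]] by simp
qed

lemma cusp_growth_expansion: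
  assumes f: "cusp_growth m f" and T: "(T, True) \<in> cusp_maps"
  shows "\<exists>F p Y. F has_fps_expansion p \<and> (\<forall>z. Im z > Y \<longrightarrow> mero_eval f (T z) = F (q_par 1 z) / q_par 1 z ^ m)"
proof -
  have "grows (\<lambda>z. mero_eval f (T z)) m" using f T unfolding cusp_growth_def by fastforce
  then obtain C Y where C: "C \<ge> 0" "Y \<ge> 0" "\<And>z. Im z > Y \<Longrightarrow> norm (mero_eval f (T z)) \<le> C * exp (2 * pi * Im z) ^ m"
    by (rule growsE) blast
  have sub: "{z. Im z > Y} \<subseteq> uhp" using C(2) by (auto simp: uhp_def)
  have per: "mero_eval f (T (z + 1)) = mero_eval f (T z)" if "z \<in> uhp" for z
    using T cusp_growth_invariant(2,3)[OF f that] by (auto elim: cusp_maps_cases)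
  have "T holomorphic_on uhp"
    using T analytic_imp_holomorphic[OF analytic_moebius[OF det_W17]] by (auto elim!: cusp_maps_cases)
  moreover have "mero_eval f holomorphic_on uhp" using f by (simp add: cusp_growth_def mero_hol_def)
  moreover have "T ` uhp \<subseteq> uhp" using cusp_maps_in_uhp[OF T] by blast
  ultimately have "(mero_eval f \<circ> T) holomorphic_on uhp" by (rule holomorphic_on_compose_gen)
  hence hol: "(\<lambda>z. mero_eval f (T z)) holomorphic_on {z. Im z > Y}" using sub unfolding comp_def by (rule holomorphic_on_subset)
  obtain F p where "F has_fps_expansion p" "\<And>z. Im z > Y \<Longrightarrow> mero_eval f (T z) = F (q_par 1 z) / q_par 1 z ^ m"
  proof (rule q_series_of_growth[OF zero_less_one hol])
    show "mero_eval f (T (z + of_nat 1)) = mero_eval f (T z)" if "Im z > Y" for z using per sub that by auto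
    show "norm (mero_eval f (T z)) \<le> C * exp (2 * pi * Im z / real 1) ^ m" if "Im z > Y" for z using C(3)[OF that] by simp
  qed blast
  thus ?thesis by blast
qed

lemma mero_eval_sum:
  assumes "\<And>j. j \<in> J \<Longrightarrow> mero_hol (b j)" "z \<in> uhp"
  shows "mero_eval (\<Sum>j\<in>J. mero_const (c j) * b j) z = (\<Sum>j\<in>J. c j * mero_eval (b j) z)"
proof -
  have "mero_hol (\<Sum>j\<in>J. mero_const (c j) * b j) \<and> mero_eval (\<Sum>j\<in>J. mero_const (c j) * b j) z = (\<Sum>j\<in>J. c j * mero_eval (b j) z)"
    using assms(1)
  proof (induction J rule: infinite_finite_induct)
    case (insert j J)
    have "mero_hol (mero_const (c j) * b j)" "mero_eval (mero_const (c j) * b j) z = c j * mero_eval (b j) z"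
      using insert.prems assms(2) by (simp_all add: mero_hol_ops mero_hol_const mero_hol_eval_mult mero_eval_const)
    thus ?case using insert assms(2) by (simp add: mero_hol_ops mero_hol_eval_add)
  qed (use assms(2) in \<open>simp_all add: mero_hol_numeral mero_eval_numeral\<close>)
  thus ?thesis by blast
qed

text \<open>Decay at \<open>W17\<close> supplies the boundedness at the cusp 1/2 and growth of order
  0 that at the odd cusps, so \<open>modular_function_eq_0\<close> applies.\<close>

lemma cusp_growth_vanishing:
  assumes f: "cusp_growth m f"
    and lim: "\<And>T e. (T, True) \<in> cusp_maps \<Longrightarrow> e > 0 \<Longrightarrow> \<exists>Y. \<forall>z. Im z > Y \<longrightarrow> norm (mero_eval f (T z)) < e"
  shows "f = 0"
proof (rule mero_hol_eqI)
  fix z assume z: "z \<in> uhp"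
  have inv: "\<And>G z. G \<in> Gamma0 34 \<Longrightarrow> z \<in> uhp \<Longrightarrow> mero_eval f (moebius_act G z) = mero_eval f z" using cusp_growth_invariant(1)[OF f] by blast
  have "mero_eval f z = 0"
  proof (rule modular_function_eq_0[of 34 "mero_eval f", OF _ _ inv _ lim[OF cusp_maps_simps(1)] z])
    show "mero_eval f holomorphic_on uhp" using f by (simp add: cusp_growth_def mero_hol_def)
    fix A assume A: "A \<in> SL2Z"
    consider (odd) a b c d where "A = int_mat2 a b c d" "a * d - b * c = 1" "odd c"
      | (infinity) "\<And>z. z \<in> uhp \<Longrightarrow> mero_eval f (moebius_act A z) = mero_eval f z"
      | (half) j :: int where "\<And>z. z \<in> uhp \<Longrightarrow> mero_eval f (moebius_act A z) = mero_eval f (moebius_act (int_mat2 1 0 2 1) (z + of_int j))"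
      using cusp_representative[of A "mero_eval f", OF A inv] by blast
    thus "\<exists>C Y. \<forall>z. Im z > Y \<longrightarrow> norm (mero_eval f (moebius_act A z)) \<le> C"
    proof cases
      case (odd a b c d)
      have "grows (\<lambda>z. mero_eval f (moebius_act A z)) 0"
        using f cusp_maps_simps(3)[OF odd(2,3)] unfolding cusp_growth_def odd(1) by fastforce
      thus ?thesis unfolding grows_def by auto
    next
      case infinity
      obtain Y where "\<And>z. Im z > Y \<Longrightarrow> norm (mero_eval f z) < 1" using lim[OF cusp_maps_simps(1) zero_less_one] by blast
      hence "\<forall>z. Im z > max 0 Y \<longrightarrow> norm (mero_eval f (moebius_act A z)) \<le> 1"
        using infinity by (auto simp: uhp_def less_imp_le)
      thus ?thesis by blast
    next
      case (half j)
      obtain Y where Y: "\<And>z. Im z > Y \<Longrightarrow> norm (mero_eval f (moebius_act W17 z)) < 1" using lim[OF cusp_maps_simps(2) zero_less_one] by blast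
      have "norm (mero_eval f (moebius_act A z)) \<le> 1" if z: "Im z > max 0 (17 * Y)" for z
      proof -
        have zu: "z \<in> uhp" using z by (simp add: uhp_def)
        define w where "w = (z + of_int j - 8) / of_real 17"
        have "Im w = Im z / 17" unfolding w_def Im_divide_of_real by simp
        hence w: "w \<in> uhp" "Im w > Y" using z by (auto simp: uhp_def)
        have "17 * (u / of_real 17) + 8 = u + 8" for u :: complex by simp
        from this[of "z + of_int j - 8"] have "17 * w + 8 = z + of_int j" by (simp only: w_def) simp
        hence "mero_eval f (moebius_act A z) = mero_eval f (moebius_act W17 w)"
          using half[OF zu] W17_eq_half_cusp[OF w(1)] by simp
        thus ?thesis using Y[OF w(2)] by simp
      qed
      thus ?thesis by blast
    qed
  qed simp
  thus "mero_eval f z = mero_eval 0 z" using z by (simp add: mero_eval_numeral)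
qed

text \<open>
  A substitute for the Riemann-Roch theorem: a combination vanishes as soon as its \<open>D + 1\<close> leading
  \<open>q\<close>-coefficients vanish at each of the two cusps.
\<close>
lemma growth_relation:
  assumes J: "finite J" "2 * (D + 1) < card J" and b: "\<And>j. j \<in> J \<Longrightarrow> cusp_growth D (b j)"
  shows "\<exists>\<alpha>. (\<exists>j\<in>J. \<alpha> j \<noteq> 0) \<and> (\<Sum>j\<in>J. mero_const (\<alpha> j) * b j) = 0"
proof -
  define T where "T = (\<lambda>s::bool. if s then (\<lambda>z. z) else moebius_act W17)"
  have T: "(T s, True) \<in> cusp_maps" for s by (simp add: T_def cusp_maps_simps)
  have "\<exists>F p Y. F has_fps_expansion p \<and> (\<forall>z. Im z > Y \<longrightarrow> mero_eval (b j) (T s z) = F (q_par 1 z) / q_par 1 z ^ D)" if "j \<in> J" for j s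
    by (rule cusp_growth_expansion[OF b[OF that] T])
  then obtain F p Y where F: "\<And>j s. j \<in> J \<Longrightarrow> F j s has_fps_expansion p j s"
    "\<And>j s z. j \<in> J \<Longrightarrow> Im z > Y j s \<Longrightarrow> mero_eval (b j) (T s z) = F j s (q_par 1 z) / q_par 1 z ^ D"
    by metis
  \<comment> \<open>The first \<open>D + 1\<close> equations concern infinity and the rest the other
    cusp; at each one they kill the polar part and the constant term.\<close>
  define c where "c = (\<lambda>i j. if i < D + 1 then fps_nth (p j True) i else fps_nth (p j False) (i - (D + 1)))"
  obtain \<alpha> where \<alpha>: "\<exists>j\<in>J. \<alpha> j \<noteq> 0" "\<And>i. i < 2 * (D + 1) \<Longrightarrow> (\<Sum>j\<in>J. c i j * \<alpha> j) = 0"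
    using homogeneous_system_nontrivial[OF J, of c] by blast
  have coeff0: "(\<Sum>j\<in>J. fps_nth (p j s) i * \<alpha> j) = 0" if "i \<le> D" for i s
  proof (cases s)
    case True
    thus ?thesis using \<alpha>(2)[of i] that by (simp add: c_def)
  next
    case False
    thus ?thesis using \<alpha>(2)[of "D + 1 + i"] that by (simp add: c_def)
  qed
  define f where "f = (\<Sum>j\<in>J. mero_const (\<alpha> j) * b j)"
  have "f = 0"
  proof (rule cusp_growth_vanishing)
    show "cusp_growth D f" unfolding f_def by (intro cusp_growth_sum cusp_growth_cmult b)
    fix T' e assume T': "(T', True) \<in> cusp_maps" and e: "(e::real) > 0"
    have "T' = T True \<or> T' = T False" using T' by (cases rule: cusp_maps_cases) (simp_all add: T_def)
    then obtain s where s: "T' = T s" by blast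
    define H where "H = (\<lambda>w. \<Sum>j\<in>J. \<alpha> j * F j s w)"
    define h where "h = (\<Sum>j\<in>J. fps_const (\<alpha> j) * p j s)"
    have Hh: "H has_fps_expansion h" unfolding H_def h_def
      by (intro has_fps_expansion_sum has_fps_expansion_cmult_left F(1))
    have h0: "fps_nth h i = 0" if "i \<le> D" for i
      using coeff0[OF that, of s] by (simp add: h_def fps_sum_nth mult.commute)
    obtain Y1 where Y1: "\<And>z. Im z > Y1 \<Longrightarrow> norm (H (q_par 1 z) / q_par 1 z ^ D - fps_nth h D) < e"
    proof (rule fps_cusp_limit[OF Hh _ zero_less_one e, of D])
      show "fps_nth h n = 0" if "n < D" for n using h0 that by simp
    qed blast
    have "\<exists>Y2. \<forall>j\<in>J. Y j s \<le> Y2" by (rule uniform_bound_finite[OF J(1)]) (auto intro: order_trans)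
    then obtain Y2 where Y2: "\<And>j. j \<in> J \<Longrightarrow> Y j s \<le> Y2" by blast
    have "norm (mero_eval f (T' z)) < e" if z: "Im z > max 0 (max Y1 Y2)" for z
    proof -
      have zu: "z \<in> uhp" using z by (simp add: uhp_def)
      have "mero_eval f (T s z) = (\<Sum>j\<in>J. \<alpha> j * mero_eval (b j) (T s z))"
        unfolding f_def using b cusp_maps_in_uhp[OF T zu] by (intro mero_eval_sum) (auto simp: cusp_growth_def)
      also have "\<dots> = (\<Sum>j\<in>J. \<alpha> j * (F j s (q_par 1 z) / q_par 1 z ^ D))"
      proof (rule sum.cong[OF refl])
        fix j assume j: "j \<in> J"
        have "Im z > Y j s" using z Y2[OF j] by simp
        thus "\<alpha> j * mero_eval (b j) (T s z) = \<alpha> j * (F j s (q_par 1 z) / q_par 1 z ^ D)" using F(2)[OF j] by simp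
      qed
      also have "\<dots> = H (q_par 1 z) / q_par 1 z ^ D" by (simp add: H_def sum_divide_distrib)
      finally show ?thesis using Y1[of z] z h0[of D] by (simp add: s)
    qed
    thus "\<exists>Y. \<forall>z. Im z > Y \<longrightarrow> norm (mero_eval f (T' z)) < e" by blast
  qed
  thus ?thesis using \<alpha>(1) unfolding f_def by blast
qed

section \<open>Relations over the field of constants\<close>

text \<open>The leading term \<open>q^-3\<close> dominates along the imaginary axis. This is the
  form of nonconstancy that \<open>x_fun_transcendental\<close> uses.\<close>

lemma U_fun_unbounded: "\<exists>z\<in>uhp. norm (mero_eval U_fun z) > K"
proof -
  obtain f where f: "U_prod has_fps_expansion f" "fps_starts_with f [1, -4, 6, -8, 17, -28, 38, -56, 84, -124, 172, -232, 325]"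
    using U_prod_fps by metis
  have f0: "fps_nth f 0 = 1" using f(2) by (simp add: fps_starts_with_def)
  obtain Y where Y: "Y \<ge> 0" "\<And>z. Im z > Y \<Longrightarrow> norm (U_prod (q_par 1 z) / q_par 1 z ^ 0 - fps_nth f 0) < 1 / 2"
    by (rule fps_cusp_limit[OF f(1), of 0 1 "1 / 2"]) auto
  define z where "z = Complex 0 (Y + 2 * \<bar>K\<bar> + 1)"
  have z: "Im z > Y" "Im z > 2 * K" "Im z \<ge> 0" "z \<in> uhp" using Y(1) by (auto simp: z_def uhp_def)
  define q where "q = q_par 1 z"
  have nq: "norm q = exp (- (2 * pi * Im z))" using norm_q_par[of z 1] by (simp add: q_def)
  have "norm (1 :: complex) \<le> norm (U_prod q) + norm (U_prod q - 1)"
    using norm_triangle_ineq[of "U_prod q" "1 - U_prod q"] by (simp add: norm_minus_commute)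
  hence "norm (U_prod q) > 1 / 2" using Y(2)[OF z(1)] by (simp add: f0 q_def)
  moreover have "inverse (norm q ^ 3) \<ge> Im z"
  proof -
    have "Im z * 1 \<le> Im z * (6 * pi)" using z(3) pi_ge_two by (intro mult_left_mono) auto
    also have "\<dots> \<le> exp (Im z * (6 * pi))" using exp_ge_add_one_self[of "Im z * (6 * pi)"] by linarith
    also have "\<dots> = inverse (norm q ^ 3)"
    proof -
      have "norm q ^ 3 = exp (of_nat 3 * - (2 * pi * Im z))" unfolding nq exp_of_nat_mult ..
      also have "of_nat 3 * - (2 * pi * Im z) = - (Im z * (6 * pi))" by simp
      finally show ?thesis by (simp only: exp_minus inverse_inverse_eq)
    qed
    finally show ?thesis by simp
  qed
  ultimately have "norm (U_prod q) * inverse (norm q ^ 3) \<ge> 1 / 2 * Im z" using z(3) by (intro mult_mono) auto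
  moreover have "mero_eval U_fun z = U_prod q / q ^ 3"
    using z(4) q_par_1[of z] by (simp add: basic_funs_eval eta_quot_eq_product q_def)
  hence "norm (mero_eval U_fun z) = norm (U_prod q) * inverse (norm q ^ 3)"
    by (simp only: norm_mult norm_inverse norm_power divide_inverse)
  ultimately have "norm (mero_eval U_fun z) > K" using z(2) by linarith
  thus ?thesis using z(4) by blast
qed

text \<open>An algebraic relation would confine the values of \<open>x\<close> to finitely many
  roots. Then \<open>X\<close> would be bounded, and by the cubic, which is monic in
  \<open>U\<close>, so would \<open>U\<close>.\<close>

lemma x_fun_transcendental:
  assumes "eval_hom mero_const x_fun p = 0"
  shows "p = 0"
proof (rule ccontr)
  assume p: "p \<noteq> 0"
  define M where "M = (\<Sum>a | poly p a = 0. norm a)"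
  have fin: "finite {a. poly p a = 0}" using p by (rule poly_roots_finite)
  have x: "norm (mero_eval x_fun z) \<le> M" if "z \<in> uhp" for z
  proof -
    have "poly p (mero_eval x_fun z) = 0"
      using mero_eval_eval_hom[OF x_fun_hol that, of p] that by (simp add: assms mero_eval_numeral)
    thus ?thesis unfolding M_def by (intro member_le_sum fin) auto
  qed
  define K where "K = M + 2"
  have K0: "K \<ge> 0" unfolding K_def M_def by (intro add_nonneg_nonneg sum_nonneg) auto
  obtain z where z: "z \<in> uhp" "norm (mero_eval U_fun z) > K ^ 3 + 5 * K + 5" using U_fun_unbounded by blast
  define a u where "a = mero_eval X_fun z" and "u = mero_eval U_fun z"
  have "mero_eval x_fun z = a + 2"
    unfolding x_fun_def a_def using z(1) by (simp add: mero_hol_eval_add X_fun_hol mero_hol_numeral mero_eval_numeral)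
  hence a: "norm a \<le> K" using x[OF z(1)] norm_triangle_ineq4[of "a + 2" 2] by (simp add: K_def)
  have "mero_eval (X_fun ^ 3) z = mero_eval (U_fun ^ 2 + 5 * U_fun * X_fun + 4 * U_fun) z" by (simp only: X_fun_cubic)
  hence cubic: "a ^ 3 = u ^ 2 + 5 * u * a + 4 * u"
    using z(1) by (simp add: mero_hol_eval mero_hol_intros X_fun_hol mero_hol_eval_power mero_eval_numeral a_def u_def)
  have u: "norm u > K ^ 3 + 5 * K + 5" using z(2) by (simp add: u_def)
  have u1: "norm u \<ge> 1" using u K0 zero_le_power[OF K0, of 3] by linarith
  have "u ^ 2 = a ^ 3 - (5 * u * a + 4 * u)" using cubic by simp
  hence "norm u ^ 2 = norm (a ^ 3 - (5 * u * a + 4 * u))" by (simp flip: norm_power)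
  also have "\<dots> \<le> norm (a ^ 3) + norm (5 * u * a + 4 * u)" by (rule norm_triangle_ineq4)
  also have "\<dots> \<le> norm (a ^ 3) + (norm (5 * u * a) + norm (4 * u))" by (intro add_left_mono norm_triangle_ineq)
  also have "\<dots> = norm a ^ 3 + (5 * norm u * norm a + 4 * norm u)" by (simp add: norm_power norm_mult)
  also have "\<dots> \<le> K ^ 3 * norm u + (5 * norm u * K + 4 * norm u)"
  proof (intro add_mono mult_left_mono a)
    have "norm a ^ 3 * 1 \<le> K ^ 3 * norm u" using a u1 K0 by (intro mult_mono power_mono) auto
    thus "norm a ^ 3 \<le> K ^ 3 * norm u" by simp
  qed auto
  also have "\<dots> = (K ^ 3 + 5 * K + 4) * norm u" by (simp add: algebra_simps)
  finally have "norm u * norm u \<le> (K ^ 3 + 5 * K + 4) * norm u" by (simp add: power2_eq_square)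
  hence "norm u \<le> K ^ 3 + 5 * K + 4" by (rule mult_right_le_imp_le) (use u1 in linarith)
  thus False using u by simp
qed

abbreviation complex_in_x :: "complex poly \<Rightarrow> uhp_mero" where
  "complex_in_x \<equiv> eval_hom mero_const x_fun"

abbreviation rat_in_x :: "rat poly \<Rightarrow> uhp_mero" where
  "rat_in_x \<equiv> eval_hom of_rat x_fun"

lemma is_ring_hom_of_rat_mero: "is_ring_hom (of_rat :: rat \<Rightarrow> 'a::field_char_0)"
  by (simp add: is_ring_hom_def of_rat_add of_rat_mult)

lemmas complex_in_x_hom = is_ring_hom_simps[OF is_ring_hom_eval_hom[OF is_ring_hom_mero_const, of x_fun]]
lemmas rat_in_x_hom = is_ring_hom_simps[OF is_ring_hom_eval_hom[OF is_ring_hom_of_rat_mero, of x_fun]]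

lemma complex_elliptic_independent:
  "complex_in_x P + complex_in_x Q * y_fun = 0 \<Longrightarrow> P = 0 \<and> Q = 0"
  by (rule elliptic_independent[OF is_ring_hom_mero_const x_fun_transcendental curve_equations(1)])

text \<open>Otherwise the second equation would be a relation between 1 and \<open>y\<close> over
  polynomials in \<open>x\<close>, with coefficient \<open>8 x^2 + 16 x + 16\<close> at
  \<open>y\<close>.\<close>

lemma t_fun_nonzero: "t_fun \<noteq> 0"
proof
  assume "t_fun = 0"
  hence "complex_in_x [:- 48, - 32, 20, 24, 1:] + complex_in_x [:16, 16, 8:] * y_fun = 0"
    using curve_equations(2)
    by (simp add: eval_hom_pCons[OF is_ring_hom_mero_const] eval_hom_0[OF is_ring_hom_mero_const] is_ring_hom_simps[OF is_ring_hom_mero_const]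
        algebra_simps power2_eq_square power3_eq_cube power4_eq_xxxx)
  from complex_elliptic_independent[OF this] show False by simp
qed

text \<open>\<open>W17\<close> fixes both brackets and negates \<open>t\<close>, which separates the
  two halves of the relation; each is then a matter of \<open>1\<close> and \<open>y\<close>
  alone.\<close>

lemma complex_independent:
  assumes "complex_in_x P + complex_in_x Q * y_fun + (complex_in_x P' + complex_in_x Q' * y_fun) * t_fun = 0"
  shows "P = 0 \<and> Q = 0 \<and> P' = 0 \<and> Q' = 0"
proof -
  define a b where "a = complex_in_x P + complex_in_x Q * y_fun" and "b = complex_in_x P' + complex_in_x Q' * y_fun"
  have ab: "a + b * t_fun = 0" using assms by (simp add: a_def b_def)
  note h = is_ring_hom_simps[OF is_ring_hom_moebius_pullback[OF det_W17]]
  have fx: "moebius_pullback W17 a = a" "moebius_pullback W17 b = b"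
    by (simp_all add: a_def b_def h moebius_pullback_eval_hom[OF det_W17] W17_funs)
  have "moebius_pullback W17 (a + b * t_fun) = 0" unfolding ab by (rule h)
  hence "a - b * t_fun = 0" by (simp add: h fx W17_funs)
  hence "2 * a = 0" using ab by (simp add: algebra_simps)
  hence a: "a = 0" by simp
  hence "b = 0" using ab t_fun_nonzero by simp
  thus ?thesis using a complex_elliptic_independent unfolding a_def b_def by blast
qed

lemma eval_hom_sum_monom:
  assumes h: "is_ring_hom h"
  shows "eval_hom h x (\<Sum>i<n. Polynomial.monom (c i) i) = (\<Sum>i<n. h (c i) * x ^ i)"
proof (induction n)
  case (Suc n)
  have "eval_hom h x (Polynomial.monom a i) = h a * x ^ i" for a i
    by (simp add: eval_hom_def map_poly_monom is_ring_hom_simps[OF h] poly_monom)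
  thus ?case using Suc by (simp add: eval_hom_add[OF h])
qed (simp add: eval_hom_0[OF h])

lemma coeff_sum_monom: "Polynomial.coeff (\<Sum>i<n. Polynomial.monom (c i) i) j = (if j < n then c j else 0)"
  by (induction n) (auto simp: less_Suc_eq)

lemma sum_lessThan_5: "(\<Sum>k<(5::nat). F k) = F 0 + F 1 + F 2 + F 3 + (F 4 :: 'a::comm_monoid_add)"
proof -
  have "{..<5::nat} = {0, 1, 2, 3, 4}" by (simp add: eval_nat_numeral lessThan_Suc insert_commute)
  thus ?thesis by (simp add: add_ac)
qed

text \<open>
  With \<open>E = m + 6\<close> there are \<open>4 E + 3\<close> products of \<open>1, y, t, y t, g\<close> and powers of \<open>x\<close> with poles of order at most
  \<open>2 E\<close>, one more than the conditions in \<open>growth_relation\<close>.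
\<close>
lemma complex_relation:
  assumes f: "f \<in> X0_complex_functions 34"
  shows "\<exists>A P Q P' Q'. A \<noteq> 0 \<and>
    complex_in_x A * f = complex_in_x P + complex_in_x Q * y_fun + (complex_in_x P' + complex_in_x Q' * y_fun) * t_fun"
proof -
  obtain p m where p: "p \<noteq> 0" and g: "cusp_growth m (f * complex_in_x p)" using clear_denominators[OF f] by blast
  define E where "E = m + 6"
  \<comment> \<open>For \<open>k < 4\<close>, \<open>n k\<close> counts the powers
    \<open>x^i\<close> with \<open>gk k + 2 * i \<le> 2 * E\<close>. In the last block the seven
    powers up to \<open>x^6\<close> are admissible because
    \<open>m + 12 \<le> 2 * E\<close>.\<close>
  define n where "n = (\<lambda>k::nat. if k = 0 then E + 1 else if k = 1 then E - 1 else if k = 2 then E - 1 else if k = 3 then E - 3 else 7)"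
  define bb where "bb = (\<lambda>k::nat. if k = 0 then 1 else if k = 1 then y_fun else if k = 2 then t_fun else if k = 3 then y_fun * t_fun else f * complex_in_x p)"
  define gk where "gk = (\<lambda>k::nat. if k = 0 then 0 else if k = 1 then 3 else if k = 2 then 4 else if k = 3 then 7 else m)"
  have yt: "cusp_growth 7 (y_fun * t_fun)" using cusp_growth_mult[OF cusp_growth_curve(3,4)] by simp
  have bg: "cusp_growth (gk k) (bb k)" for k
    using cusp_growth_numeral(1) cusp_growth_curve(3,4) yt g by (simp add: gk_def bb_def)
  define J where "J = Sigma {..<5} (\<lambda>k. {..<n k})"
  have fin: "finite J" by (simp add: J_def)
  have "card J = (\<Sum>k<5. n k)" by (simp add: J_def)
  also have "\<dots> = 4 * E + 3" unfolding sum_lessThan_5 by (simp add: n_def E_def)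
  finally have card: "2 * (2 * E + 1) < card J" by simp
  define B where "B = (\<lambda>j. bb (fst j) * x_fun ^ snd j)"
  have growth: "cusp_growth (2 * E) (B j)" if "j \<in> J" for j
  proof -
    obtain k i where j: "j = (k, i)" "k < 5" "i < n k" using \<open>j \<in> J\<close> by (auto simp: J_def)
    have "gk k + i * 2 \<le> 2 * E" using j(2,3) by (auto simp: gk_def n_def E_def split: if_splits)
    from cusp_growth_mono[OF cusp_growth_mult[OF bg cusp_growth_power[OF cusp_growth_curve(2)]] this]
    show ?thesis by (simp add: j B_def)
  qed
  have "\<exists>\<alpha>. (\<exists>j\<in>J. \<alpha> j \<noteq> 0) \<and> (\<Sum>j\<in>J. mero_const (\<alpha> j) * B j) = 0"
    by (rule growth_relation[OF fin card]) (rule growth)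
  then obtain \<alpha> where \<alpha>: "\<exists>j\<in>J. \<alpha> j \<noteq> 0" "(\<Sum>j\<in>J. mero_const (\<alpha> j) * B j) = 0" by blast
  define PP where "PP = (\<lambda>k. \<Sum>i<n k. Polynomial.monom (\<alpha> (k, i)) i)"
  have cPP: "complex_in_x (PP k) * bb k = (\<Sum>i<n k. mero_const (\<alpha> (k, i)) * (bb k * x_fun ^ i))" for k
    unfolding PP_def eval_hom_sum_monom[OF is_ring_hom_mero_const] sum_distrib_right by (simp only: mult_ac)
  have "(\<Sum>k<5. complex_in_x (PP k) * bb k) = (\<Sum>(k, i)\<in>J. mero_const (\<alpha> (k, i)) * (bb k * x_fun ^ i))"
    unfolding cPP J_def by (rule sum.Sigma) auto
  also have "\<dots> = 0" using \<alpha>(2) by (simp add: case_prod_beta B_def)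
  finally have rel: "complex_in_x (PP 0) + complex_in_x (PP 1) * y_fun + complex_in_x (PP 2) * t_fun
      + complex_in_x (PP 3) * (y_fun * t_fun) + complex_in_x (PP 4) * (f * complex_in_x p) = 0"
    unfolding sum_lessThan_5 by (simp add: bb_def)
  have P4: "PP 4 \<noteq> 0"
  proof
    assume 0: "PP 4 = 0"
    have "complex_in_x (PP 0) + complex_in_x (PP 1) * y_fun + (complex_in_x (PP 2) + complex_in_x (PP 3) * y_fun) * t_fun = 0"
      using rel by (simp add: 0 complex_in_x_hom(1) algebra_simps)
    from complex_independent[OF this] have z: "PP 0 = 0" "PP 1 = 0" "PP 2 = 0" "PP 3 = 0" by auto
    obtain k i where ki: "k < 5" "i < n k" "\<alpha> (k, i) \<noteq> 0" using \<alpha>(1) by (auto simp: J_def)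
    have "k = 0 \<or> k = 1 \<or> k = 2 \<or> k = 3 \<or> k = 4" using ki(1) by linarith
    hence "PP k = 0" using z 0 by auto
    moreover have "Polynomial.coeff (PP k) i = \<alpha> (k, i)" using ki(2) by (simp add: PP_def coeff_sum_monom)
    ultimately show False using ki(3) by simp
  qed
  have "complex_in_x (PP 4 * p) * f = complex_in_x (- PP 0) + complex_in_x (- PP 1) * y_fun + (complex_in_x (- PP 2) + complex_in_x (- PP 3) * y_fun) * t_fun"
  proof -
    have "complex_in_x (PP 4 * p) * f = complex_in_x (PP 4) * (f * complex_in_x p)" by (simp only: complex_in_x_hom mult_ac)
    also have "\<dots> = - (complex_in_x (PP 0) + complex_in_x (PP 1) * y_fun + complex_in_x (PP 2) * t_fun + complex_in_x (PP 3) * (y_fun * t_fun))"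
      using rel by (simp only: add_eq_0_iff)
    finally show ?thesis by (simp add: complex_in_x_hom(5) algebra_simps)
  qed
  moreover have "PP 4 * p \<noteq> 0" using P4 p by simp
  ultimately show ?thesis by blast
qed

text \<open>Complex numbers form a vector space over \<open>\<rat>\<close>, and
  \<open>c \<mapsto> 1\<close> extends linearly from the independent set \<open>{c}\<close>. The
  prescribed value will protect one coefficient of a denominator.\<close>

lemma rational_functional:
  fixes c :: complex
  assumes "c \<noteq> 0"
  obtains ell :: "complex \<Rightarrow> rat" where "ell c \<noteq> 0" "\<And>a b. ell (a + b) = ell a + ell b" "\<And>r a. ell (of_rat r * a) = r * ell a"
proof -
  interpret V: vector_space_pair "\<lambda>(r::rat) (a::complex). of_rat r * a" "\<lambda>(r::rat) (a::rat). r * a"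
    by unfold_locales (auto simp: algebra_simps of_rat_add of_rat_mult)
  have "\<not> V.vs1.dependent {c}" using assms by (simp add: V.vs1.dependent_single)
  then obtain g where g: "Vector_Spaces.linear (\<lambda>(r::rat) (a::complex). of_rat r * a) (\<lambda>(r::rat) (a::rat). r * a) g" "g c = 1"
    using V.linear_independent_extend[of "{c}" "\<lambda>_. 1"] by auto
  interpret g: Vector_Spaces.linear "\<lambda>(r::rat) (a::complex). of_rat r * a" "\<lambda>(r::rat) (a::rat). r * a" g by (fact g(1))
  show ?thesis by (rule that[of g]) (simp_all add: g(2) g.add g.scale)
qed

lemma has_q_expansion_sum:
  assumes "finite J" "\<And>j. j \<in> J \<Longrightarrow> has_q_expansion (mero_eval (g j)) 1 (L j)"
  shows "has_q_expansion (mero_eval (\<Sum>j\<in>J. mero_const (d j) * g j)) 1 (\<Sum>j\<in>J. fls_const (d j) * L j)"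
  using assms
proof (induction J rule: finite_induct)
  case empty
  have "has_q_expansion (mero_eval (mero_const 0)) 1 (fls_const 0)" by (rule has_q_expansion_const) simp
  thus ?case by (simp add: mero_const_numeral)
next
  case (insert j J)
  have "has_q_expansion (mero_eval (mero_const (d j) * g j)) 1 (fls_const (d j) * L j)"
    using insert.prems has_q_expansion_const[of 1 "d j"] by (intro has_q_expansion_mult) auto
  thus ?case using insert by (simp add: has_q_expansion_add)
qed

text \<open>Applying a \<open>\<rat>\<close>-linear functional to all coefficients of a complex linear relation between functions with
  rational \<open>q\<close>-expansions gives a rational relation.\<close>
lemma rational_relation_of_complex:
  assumes J: "finite J" and g: "\<And>j. j \<in> J \<Longrightarrow> g j \<in> X0_rational_functions N"
    and rel: "(\<Sum>j\<in>J. mero_const (c j) * g j) = 0"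
    and ell: "\<And>a b. ell (a + b) = ell a + ell b" "\<And>r a. ell (of_rat r * a) = r * ell a"
  shows "(\<Sum>j\<in>J. of_rat (ell (c j)) * g j) = 0"
proof -
  have "\<exists>L. has_q_expansion (mero_eval (g j)) 1 L \<and> rational_fls L" if "j \<in> J" for j
    using g[OF that] by (simp add: X0_rational_functions_altdef)
  then obtain L where L: "\<And>j. j \<in> J \<Longrightarrow> has_q_expansion (mero_eval (g j)) 1 (L j)" "\<And>j. j \<in> J \<Longrightarrow> rational_fls (L j)" by metis
  have "\<exists>r. fls_nth (L j) n = of_rat r" if "j \<in> J" for j n
    using L(2)[OF that] unfolding rational_fls_def by (metis Rats_cases)
  then obtain r where r: "\<And>j n. j \<in> J \<Longrightarrow> fls_nth (L j) n = of_rat (r j n)" by metis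
  have zero: "has_q_expansion (mero_eval 0) 1 0"
    using has_q_expansion_const[of 1 0] by (simp add: mero_const_numeral)
  have q: "has_q_expansion (mero_eval (\<Sum>j\<in>J. mero_const (d j) * g j)) 1 (\<Sum>j\<in>J. fls_const (d j) * L j)" for d
    by (rule has_q_expansion_sum[OF J]) (rule L(1))
  have "has_q_expansion (mero_eval 0) 1 (\<Sum>j\<in>J. fls_const (c j) * L j)"
    using q[of c] by (simp only: rel)
  hence L0: "(\<Sum>j\<in>J. fls_const (c j) * L j) = 0" using has_q_expansion_unique[OF _ _ zero] by simp
  have ell0: "ell 0 = 0" using ell(1)[of 0 0] by simp
  have ellsum: "ell (\<Sum>j\<in>J. h j) = (\<Sum>j\<in>J. ell (h j))" for h
    using J by (induction J rule: finite_induct) (simp_all add: ell0 ell(1))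
  have "(\<Sum>j\<in>J. fls_const (of_rat (ell (c j))) * L j) = 0"
  proof (rule fls_eqI)
    fix n
    have "(\<Sum>j\<in>J. of_rat (r j n) * c j) = fls_nth (\<Sum>j\<in>J. fls_const (c j) * L j) n"
      unfolding fls_nth_sum by (intro sum.cong refl) (simp add: r mult.commute)
    hence "0 = ell (\<Sum>j\<in>J. of_rat (r j n) * c j)" by (simp add: L0 ell0)
    also have "\<dots> = (\<Sum>j\<in>J. r j n * ell (c j))" unfolding ellsum ell(2) ..
    finally have "of_rat (\<Sum>j\<in>J. r j n * ell (c j)) = (0 :: complex)" by simp
    hence "(\<Sum>j\<in>J. of_rat (ell (c j)) * of_rat (r j n)) = (0 :: complex)"
      by (simp only: of_rat_sum of_rat_mult mult.commute)
    moreover have "fls_nth (\<Sum>j\<in>J. fls_const (of_rat (ell (c j))) * L j) n = (\<Sum>j\<in>J. of_rat (ell (c j)) * of_rat (r j n))"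
      unfolding fls_nth_sum by (intro sum.cong refl) (simp add: r)
    ultimately show "fls_nth (\<Sum>j\<in>J. fls_const (of_rat (ell (c j))) * L j) n = fls_nth 0 n" by simp
  qed
  hence "has_q_expansion (mero_eval (\<Sum>j\<in>J. mero_const (of_rat (ell (c j))) * g j)) 1 0"
    using q[of "\<lambda>j. of_rat (ell (c j))"] by (simp only:)
  from has_q_expansion_eq_0[OF zero_less_one this]
  show ?thesis by (simp only: is_ring_hom_of_rat[OF is_ring_hom_mero_const])
qed

lemma rational_relation:
  assumes f: "f \<in> X0_rational_functions 34"
  shows "\<exists>A P Q P' Q'. A \<noteq> 0 \<and>
    rat_in_x A * f = rat_in_x P + rat_in_x Q * y_fun + (rat_in_x P' + rat_in_x Q' * y_fun) * t_fun"
proof -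
  obtain A P Q P' Q' where A: "A \<noteq> 0"
    "complex_in_x A * f = complex_in_x P + complex_in_x Q * y_fun + (complex_in_x P' + complex_in_x Q' * y_fun) * t_fun"
    using complex_relation[of f] f by (auto simp: X0_rational_functions_altdef)
  define PP where "PP = (\<lambda>k::nat. if k = 0 then - P else if k = 1 then - Q else if k = 2 then - P' else if k = 3 then - Q' else A)"
  define bb where "bb = (\<lambda>k::nat. if k = 0 then 1 else if k = 1 then y_fun else if k = 2 then t_fun else if k = 3 then y_fun * t_fun else f)"
  define n where "n = Suc (\<Sum>k<5. Polynomial.degree (PP k))"
  have deg: "Polynomial.degree (PP k) < n" if "k < 5" for k
    using member_le_sum[of k "{..<5}" "\<lambda>k. Polynomial.degree (PP k)"] that by (simp add: n_def)
  define J where "J = {..<5::nat} \<times> {..<n}"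
  have bbK: "bb k \<in> X0_rational_functions 34" for k
    using curve_funs_rational f X0_rational_ops(2)[OF curve_funs_rational(2,3)] X0_rational_of_rat[of 1 34] by (simp add: bb_def)
  have "(\<Sum>k<5. complex_in_x (PP k) * bb k) = 0"
    unfolding sum_lessThan_5 using A(2) by (simp add: PP_def bb_def complex_in_x_hom(5) algebra_simps)
  moreover have "(\<Sum>k<5. complex_in_x (PP k) * bb k) = (\<Sum>(k, i)\<in>J. mero_const (Polynomial.coeff (PP k) i) * (bb k * x_fun ^ i))"
  proof -
    have "complex_in_x (PP k) * bb k = (\<Sum>i<n. mero_const (Polynomial.coeff (PP k) i) * (bb k * x_fun ^ i))" if "k < 5" for k
      unfolding eval_hom_eq_sum[OF is_ring_hom_mero_const deg[OF that]] sum_distrib_right by (simp only: mult_ac)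
    thus ?thesis unfolding J_def by (simp add: sum.cartesian_product)
  qed
  ultimately have rel: "(\<Sum>j\<in>J. mero_const (Polynomial.coeff (PP (fst j)) (snd j)) * (bb (fst j) * x_fun ^ snd j)) = 0"
    by (simp add: case_prod_beta)
  \<comment> \<open>The functional is chosen nonzero on this coefficient, so that the rational
    denominator \<open>RR 4\<close> does not vanish.\<close>
  obtain i where i: "Polynomial.coeff A i \<noteq> 0" using A(1) by (auto simp: poly_eq_iff)
  obtain ell :: "complex \<Rightarrow> rat" where ell: "ell (Polynomial.coeff A i) \<noteq> 0" "\<And>a b. ell (a + b) = ell a + ell b" "\<And>r a. ell (of_rat r * a) = r * ell a"
    using rational_functional[OF i] by blast
  have ell0: "ell 0 = 0" using ell(2)[of 0 0] by simp
  define RR where "RR = (\<lambda>k. map_poly ell (PP k))"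
  have "(\<Sum>j\<in>J. of_rat (ell (Polynomial.coeff (PP (fst j)) (snd j))) * (bb (fst j) * x_fun ^ snd j)) = 0"
    by (rule rational_relation_of_complex[OF _ _ rel ell(2,3)])
      (auto simp: J_def intro!: X0_rational_ops(2) bbK X0_rational_more(3)[OF curve_funs_rational(1,1)])
  hence sum0: "(\<Sum>(k, i)\<in>J. of_rat (ell (Polynomial.coeff (PP k) i)) * (bb k * x_fun ^ i)) = 0"
    by (simp add: case_prod_beta)
  have "rat_in_x (RR k) * bb k = (\<Sum>i<n. of_rat (ell (Polynomial.coeff (PP k) i)) * (bb k * x_fun ^ i))" if "k < 5" for k
  proof -
    have "Polynomial.degree (RR k) \<le> Polynomial.degree (PP k)"
      unfolding RR_def by (rule degree_le) (simp add: coeff_map_poly ell0 coeff_eq_0)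
    hence d: "Polynomial.degree (RR k) < n" using deg[OF that] by simp
    have c: "Polynomial.coeff (RR k) i = ell (Polynomial.coeff (PP k) i)" for i by (simp add: RR_def coeff_map_poly ell0)
    show ?thesis unfolding eval_hom_eq_sum[OF is_ring_hom_of_rat_mero d] sum_distrib_right c by (simp only: mult_ac)
  qed
  hence "(\<Sum>k<5. rat_in_x (RR k) * bb k) = (\<Sum>(k, i)\<in>J. of_rat (ell (Polynomial.coeff (PP k) i)) * (bb k * x_fun ^ i))"
    unfolding J_def by (simp add: sum.cartesian_product)
  hence rel0: "rat_in_x (RR 0) + rat_in_x (RR 1) * y_fun + rat_in_x (RR 2) * t_fun + rat_in_x (RR 3) * (y_fun * t_fun) + rat_in_x (RR 4) * f = 0"
    unfolding sum0 sum_lessThan_5 by (simp add: bb_def)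
  have "rat_in_x (RR 4) * f = - (rat_in_x (RR 0) + rat_in_x (RR 1) * y_fun + rat_in_x (RR 2) * t_fun + rat_in_x (RR 3) * (y_fun * t_fun))"
    using rel0 by (simp only: add_eq_0_iff)
  hence "rat_in_x (RR 4) * f = rat_in_x (- RR 0) + rat_in_x (- RR 1) * y_fun + (rat_in_x (- RR 2) + rat_in_x (- RR 3) * y_fun) * t_fun"
    by (simp add: rat_in_x_hom(5) algebra_simps)
  moreover have "RR 4 \<noteq> 0"
  proof
    assume "RR 4 = 0"
    hence "Polynomial.coeff (RR 4) i = 0" by simp
    thus False using ell(1) by (simp add: RR_def PP_def coeff_map_poly ell0)
  qed
  ultimately show ?thesis by blast
qed

text \<open>Lets rational polynomials inherit independence and transcendence from the complex
  case.\<close>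

lemma rat_in_x_eq_complex: "rat_in_x p = complex_in_x (map_poly of_rat p)"
  by (induction p) (simp_all add: eval_hom_pCons[OF is_ring_hom_mero_const] eval_hom_0[OF is_ring_hom_mero_const]
      eval_hom_pCons[OF is_ring_hom_of_rat_mero] eval_hom_0[OF is_ring_hom_of_rat_mero] map_poly_pCons is_ring_hom_of_rat[OF is_ring_hom_mero_const])

lemma map_poly_of_rat_eq_0: "map_poly (of_rat :: rat \<Rightarrow> complex) p = 0 \<Longrightarrow> p = 0"
  by (auto simp: poly_eq_iff coeff_map_poly)

lemma rat_independent:
  assumes "rat_in_x P + rat_in_x Q * y_fun + (rat_in_x P' + rat_in_x Q' * y_fun) * t_fun = 0"
  shows "P = 0" "Q = 0" "P' = 0" "Q' = 0"
  using complex_independent[OF assms[unfolded rat_in_x_eq_complex]] map_poly_of_rat_eq_0 by blast+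

lemma rat_in_x_eq_0: "rat_in_x p = 0 \<Longrightarrow> p = 0"
  using x_fun_transcendental map_poly_of_rat_eq_0 unfolding rat_in_x_eq_complex by blast

section \<open>The function field and its equations\<close>

interpretation X0: X0_subfield 34
  by (rule X0_subfield)

lemma eval_hom_closed:
  assumes h: "is_ring_hom h" and "0 \<in> K" "\<And>a. h a \<in> K" "x \<in> K"
    and "\<And>f g. f \<in> K \<Longrightarrow> g \<in> K \<Longrightarrow> f + g \<in> K" "\<And>f g. f \<in> K \<Longrightarrow> g \<in> K \<Longrightarrow> f * g \<in> K"
  shows "eval_hom h x p \<in> K"
  using assms(2-) by (induction p) (simp_all add: eval_hom_pCons[OF h] eval_hom_0[OF h])

lemma Rats_subset_X0_rational: "\<rat> \<subseteq> X0_rational_functions N"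
  using X0_rational_of_rat by (auto elim: Rats_cases)

lemma curve_generators_subset:
  "\<rat> \<union> {x_fun, y_fun} \<subseteq> X0_rational_functions 34" "\<rat> \<union> {x_fun, y_fun, t_fun} \<subseteq> X0_rational_functions 34"
  using Rats_subset_X0_rational curve_funs_rational by auto

lemma rat_in_x_generated:
  assumes S: "S \<subseteq> X0_rational_functions 34" "\<rat> \<union> {x_fun} \<subseteq> S"
  shows "rat_in_x p \<in> generate_field (X0_field 34) S"
proof (rule eval_hom_closed[OF is_ring_hom_of_rat_mero])
  note G = X0.generate_field_closed[OF S(1)]
  show "0 \<in> generate_field (X0_field 34) S" by (rule G)
  show "of_rat r \<in> generate_field (X0_field 34) S" for r using G(2) S(2) Rats_of_rat by blast
  show "x_fun \<in> generate_field (X0_field 34) S" using G(2) S(2) by blast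
qed (use X0.generate_field_closed[OF S(1)] in blast)+

lemma atkin_lehner_rational:
  "f \<in> X0_rational_functions 34 \<Longrightarrow> atkin_lehner 34 17 f = moebius_pullback W17 f"
  by (rule atkin_lehner_eq[OF _ _ _ W17_in]) (auto simp: X0_rational_functions_altdef)

text \<open>So \<open>1, y, t, y t\<close> span the field over \<open>\<rat>(x)\<close>, with
  denominators polynomial in \<open>x\<close> alone. Generation, the fixed field and the
  presentation by fractions all rest on this normal form.\<close>

lemma rational_function_decomposition:
  assumes "f \<in> X0_rational_functions 34"
  obtains A P Q P' Q' where "rat_in_x A \<noteq> 0"
    "f = (rat_in_x P + rat_in_x Q * y_fun + (rat_in_x P' + rat_in_x Q' * y_fun) * t_fun) / rat_in_x A"
proof -
  obtain A P Q P' Q' where A: "A \<noteq> 0"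
    "rat_in_x A * f = rat_in_x P + rat_in_x Q * y_fun + (rat_in_x P' + rat_in_x Q' * y_fun) * t_fun"
    using rational_relation[OF assms] by blast
  have "rat_in_x A \<noteq> 0" using A(1) rat_in_x_eq_0 by blast
  moreover from this have "f = (rat_in_x P + rat_in_x Q * y_fun + (rat_in_x P' + rat_in_x Q' * y_fun) * t_fun) / rat_in_x A"
    unfolding A(2)[symmetric] by simp
  ultimately show ?thesis by (rule that)
qed

lemma generate_field_divide:
  assumes "S \<subseteq> X0_rational_functions 34" "f \<in> generate_field (X0_field 34) S" "g \<in> generate_field (X0_field 34) S"
  shows "f / g \<in> generate_field (X0_field 34) S"
  unfolding divide_inverse
  by (intro X0.generate_field_closed(6)[OF assms(1)] X0.generate_field_closed(8)[OF assms(1)] assms(2,3))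

lemma X0_rational_generated:
  "X0_rational_functions 34 = generate_field (X0_field 34) (\<rat> \<union> {x_fun, y_fun, t_fun})"
proof
  let ?S = "\<rat> \<union> {x_fun, y_fun, t_fun}"
  let ?G = "generate_field (X0_field 34) ?S"
  note G = X0.generate_field_closed[OF curve_generators_subset(2)]
  show "?G \<subseteq> X0_rational_functions 34" by (rule G)
  have r: "rat_in_x p \<in> ?G" for p by (rule rat_in_x_generated[OF curve_generators_subset(2)]) blast
  have yt: "y_fun \<in> ?G" "t_fun \<in> ?G" using G(2) by blast+
  have "rat_in_x P + rat_in_x Q * y_fun + (rat_in_x P' + rat_in_x Q' * y_fun) * t_fun \<in> ?G" for P Q P' Q'
    by (intro G(5) G(6) r yt)
  note D = generate_field_divide[OF curve_generators_subset(2) this r]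
  show "X0_rational_functions 34 \<subseteq> ?G"
  proof
    fix f assume "f \<in> X0_rational_functions 34"
    then obtain A P Q P' Q' where
      "f = (rat_in_x P + rat_in_x Q * y_fun + (rat_in_x P' + rat_in_x Q' * y_fun) * t_fun) / rat_in_x A"
      by (rule rational_function_decomposition)
    thus "f \<in> ?G" using D by simp
  qed
qed

text \<open>For \<open>f = (a + b t) / A\<close>, invariance gives \<open>b t = 0\<close> and hence
  \<open>f = a / A\<close>. The other inclusion holds because the fixed functions form a field
  containing the generators.\<close>

lemma fixed_field_generated:
  "{f \<in> X0_rational_functions 34. atkin_lehner 34 17 f = f} = generate_field (X0_field 34) (\<rat> \<union> {x_fun, y_fun})"
proof (intro equalityI subsetI)
  let ?S = "\<rat> \<union> {x_fun, y_fun}"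
  let ?G = "generate_field (X0_field 34) ?S"
  note G = X0.generate_field_closed[OF curve_generators_subset(1)]
  note h = is_ring_hom_simps[OF is_ring_hom_moebius_pullback[OF det_W17]]
  have r: "rat_in_x p \<in> ?G" for p by (rule rat_in_x_generated[OF curve_generators_subset(1)]) blast
  have y: "y_fun \<in> ?G" using G(2) by blast
  have W: "moebius_pullback W17 f = f" if "f \<in> ?G" for f
    using that
  proof (induction rule: generate_field.induct)
    case one
    show ?case by (simp add: X0_field_simps h)
  next
    case (incl f)
    thus ?case using W17_funs is_ring_hom_of_rat[OF is_ring_hom_moebius_pullback[OF det_W17]] by (auto elim: Rats_cases)
  next
    case (a_inv f)
    have "f \<in> X0_rational_functions 34" using a_inv.hyps G(1) by blast
    thus ?case using a_inv.IH by (simp add: X0.X0_field_a_inv h)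
  next
    case (m_inv f)
    have "f \<in> X0_rational_functions 34" using m_inv.hyps G(1) by blast
    thus ?case using m_inv by (simp add: X0.X0_field_inv X0_field_simps moebius_pullback_inverse[OF det_W17])
  qed (simp_all add: X0_field_simps h)
  fix f
  show "f \<in> {f \<in> X0_rational_functions 34. atkin_lehner 34 17 f = f}" if f: "f \<in> ?G"
  proof -
    have "f \<in> X0_rational_functions 34" using f G(1) by blast
    thus ?thesis using W[OF f] by (simp add: atkin_lehner_rational)
  qed
  show "f \<in> ?G" if f: "f \<in> {f \<in> X0_rational_functions 34. atkin_lehner 34 17 f = f}"
  proof -
    have fW: "moebius_pullback W17 f = f" and fK: "f \<in> X0_rational_functions 34" using f atkin_lehner_rational[of f] by auto
    obtain A P Q P' Q' where A: "rat_in_x A \<noteq> 0"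
      "f = (rat_in_x P + rat_in_x Q * y_fun + (rat_in_x P' + rat_in_x Q' * y_fun) * t_fun) / rat_in_x A"
      using fK by (rule rational_function_decomposition)
    define a b where "a = rat_in_x P + rat_in_x Q * y_fun" and "b = rat_in_x P' + rat_in_x Q' * y_fun"
    have aG: "a \<in> ?G" "b \<in> ?G" unfolding a_def b_def by (intro G(5) G(6) r y)+
    have fa: "f * rat_in_x A = a + b * t_fun" using A by (simp add: a_def b_def)
    have "moebius_pullback W17 (f * rat_in_x A) = moebius_pullback W17 (a + b * t_fun)" by (simp only: fa)
    hence "f * rat_in_x A = a - b * t_fun" by (simp add: h fW W[OF r] W[OF aG(1)] W[OF aG(2)] W17_funs)
    hence "2 * (b * t_fun) = 0" using fa by (simp add: algebra_simps)
    hence "b * t_fun = 0" by simp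
    hence "f = a / rat_in_x A" using fa A(1) by (simp add: field_simps)
    thus ?thesis using generate_field_divide[OF curve_generators_subset(1) aG(1) r] by simp
  qed
qed

section \<open>The ideal of the curve\<close>

definition curve_eval2 :: "rat poly poly \<Rightarrow> uhp_mero" where
  "curve_eval2 = eval_hom rat_in_x y_fun"
text \<open>Evaluation at the point \<open>(x, y, t)\<close>, nested in the same way as
  \<open>\<rat>[X][Y][T]\<close>.\<close>

definition curve_eval3 :: "rat poly poly poly \<Rightarrow> uhp_mero" where
  "curve_eval3 = eval_hom curve_eval2 t_fun"

lemma curve_eval_hom: "is_ring_hom rat_in_x" "is_ring_hom curve_eval2" "is_ring_hom curve_eval3"
  unfolding curve_eval2_def curve_eval3_def by (intro is_ring_hom_eval_hom is_ring_hom_of_rat_mero)+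

lemma curve_eval_pCons:
  "rat_in_x (pCons a p) = of_rat a + x_fun * rat_in_x p"
  "curve_eval2 (pCons q Q) = rat_in_x q + y_fun * curve_eval2 Q"
  "curve_eval3 (pCons u V) = curve_eval2 u + t_fun * curve_eval3 V"
  unfolding curve_eval3_def unfolding curve_eval2_def
  by (simp_all add: eval_hom_pCons is_ring_hom_eval_hom is_ring_hom_of_rat_mero)

lemmas curve_eval_0 = is_ring_hom_simps(1)[OF curve_eval_hom(1)] is_ring_hom_simps(1)[OF curve_eval_hom(2)] is_ring_hom_simps(1)[OF curve_eval_hom(3)]
lemmas curve_eval_1 = is_ring_hom_simps(2)[OF curve_eval_hom(1)] is_ring_hom_simps(2)[OF curve_eval_hom(2)] is_ring_hom_simps(2)[OF curve_eval_hom(3)]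

lemma curve_eval3_rational: "curve_eval3 p \<in> X0_rational_functions 34"
proof -
  have 1: "rat_in_x q \<in> X0_rational_functions 34" for q
    by (rule eval_hom_closed[OF is_ring_hom_of_rat_mero]) (simp_all add: X0_rational_of_rat X0.zero X0.add X0.mult curve_funs_rational)
  have 2: "curve_eval2 q \<in> X0_rational_functions 34" for q
    unfolding curve_eval2_def by (rule eval_hom_closed[OF curve_eval_hom(1)]) (simp_all add: 1 X0.zero X0.add X0.mult curve_funs_rational)
  show ?thesis
    unfolding curve_eval3_def by (rule eval_hom_closed[OF curve_eval_hom(2)]) (simp_all add: 2 X0.zero X0.add X0.mult curve_funs_rational)
qed

lemma is_ring_hom_const_poly: "is_ring_hom (\<lambda>a :: 'a::comm_ring_1. [:a:])"
  by (simp add: is_ring_hom_def)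

text \<open>Dividing by \<open>e2\<close> in \<open>T\<close>, and then both coefficients by
  \<open>e1\<close> in \<open>Y\<close>, leaves a remainder of degree at most 1 in each of
  \<open>Y\<close> and \<open>T\<close>. Its value is a combination of \<open>1, y, t, y t\<close>
  over polynomials in \<open>x\<close>, so it vanishes only if the remainder does.\<close>

lemma curve_eval3_kernel:
  fixes e1 e2 :: "rat poly poly poly"
  defines "e1 \<equiv> Y_var^2 + X_var * Y_var - (X_var^3 - 3 * X_var + 1)"
    and "e2 \<equiv> T_var^2 - (- 48 - 32 * X_var + 20 * X_var^2 + 24 * X_var^3 + X_var^4 + 8 * (2 + 2 * X_var + X_var^2) * Y_var)"
  shows "curve_eval3 e1 = 0" "curve_eval3 e2 = 0" "curve_eval3 p = 0 \<Longrightarrow> \<exists>u v. p = u * e2 + v * e1"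
proof -
  note h = is_ring_hom_simps[OF curve_eval_hom(3)]
  have var: "curve_eval3 X_var = x_fun" "curve_eval3 Y_var = y_fun" "curve_eval3 T_var = t_fun"
    by (simp_all add: X_var_def Y_var_def T_var_def curve_eval_pCons curve_eval_0 curve_eval_1)
  show "curve_eval3 e1 = 0" unfolding e1_def by (simp only: h var curve_equations(1)) simp
  show "curve_eval3 e2 = 0" unfolding e2_def by (simp only: h var curve_equations(2)) simp
  define X2 where "X2 = ([:[:0, 1:]:] :: rat poly poly)"
  define Y2 where "Y2 = ([:0, 1:] :: rat poly poly)"
  define g where "g = ([:0, 1:] ^ 3 - 3 * [:0, 1:] + 1 :: rat poly)"
  define E1 where "E1 = ([:0, 1:] ^ 2 + [:[:0, 1:]:] * [:0, 1:] - [:g:] :: rat poly poly)"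
  define c2 where "c2 = - 48 - 32 * X2 + 20 * X2^2 + 24 * X2^3 + X2^4 + 8 * (2 + 2 * X2 + X2^2) * Y2"
  note k = is_ring_hom_simps[OF is_ring_hom_const_poly]
  have X2: "[:X2:] = X_var" and Y2: "[:Y2:] = Y_var" by (simp_all add: X2_def Y2_def X_var_def Y_var_def)
  have "[:g:] = X2 ^ 3 - 3 * X2 + 1" unfolding g_def X2_def by (simp only: k)
  hence E1': "E1 = Y2 ^ 2 + X2 * Y2 - (X2 ^ 3 - 3 * X2 + 1)" unfolding E1_def X2_def Y2_def by simp
  have e1: "e1 = [:E1:]" unfolding e1_def E1' by (simp only: k X2 Y2)
  have "[:c2:] = - 48 - 32 * X_var + 20 * X_var^2 + 24 * X_var^3 + X_var^4 + 8 * (2 + 2 * X_var + X_var^2) * Y_var"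
    unfolding c2_def by (simp only: k X2 Y2)
  hence e2: "e2 = [:0, 1:] ^ 2 + [:0:] * [:0, 1:] - [:c2:]" unfolding e2_def T_var_def by simp
  assume p0: "curve_eval3 p = 0"
  obtain u P Q where p: "p = u * e2 + [:P, Q:]" unfolding e2 using weierstrass_reduce[of p 0 c2] by blast
  obtain u1 P0 P1 where P: "P = u1 * E1 + [:P0, P1:]" unfolding E1_def using weierstrass_reduce[of P "[:0, 1:]" g] by blast
  obtain u2 Q0 Q1 where Q: "Q = u2 * E1 + [:Q0, Q1:]" unfolding E1_def using weierstrass_reduce[of Q "[:0, 1:]" g] by blast
  have "curve_eval2 E1 = 0"
    using \<open>curve_eval3 e1 = 0\<close> unfolding e1 by (simp add: curve_eval_pCons curve_eval_0)
  hence PQ: "curve_eval2 P = rat_in_x P0 + rat_in_x P1 * y_fun" "curve_eval2 Q = rat_in_x Q0 + rat_in_x Q1 * y_fun"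
    unfolding P Q by (simp_all add: is_ring_hom_simps[OF curve_eval_hom(2)] curve_eval_pCons curve_eval_0 mult.commute)
  have "curve_eval3 p = curve_eval3 u * 0 + (curve_eval2 P + t_fun * curve_eval2 Q)"
    unfolding p h \<open>curve_eval3 e2 = 0\<close> by (simp add: curve_eval_pCons curve_eval_0)
  hence "rat_in_x P0 + rat_in_x P1 * y_fun + (rat_in_x Q0 + rat_in_x Q1 * y_fun) * t_fun = 0"
    using p0 by (simp add: PQ mult.commute)
  note z = rat_independent[OF this]
  \<comment> \<open>Since \<open>e1\<close> is constant in \<open>T\<close>, the quotients of the
    two coefficients assemble to a single multiplier.\<close>
  have "p = u * e2 + [:u1, u2:] * e1" unfolding p P Q e1 by (simp add: z)
  thus "\<exists>u v. p = u * e2 + v * e1" by blast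
qed

text \<open>The quotient ring embeds into the function field, so integrality comes with the kernel
  computation; that every function is a fraction follows from the normal form with denominator in
  \<open>x\<close>.\<close>

lemma affine_equations:
  "has_affine_equations (X0_field 34)
     {Y_var^2 + X_var * Y_var - (X_var^3 - 3 * X_var + 1),
      T_var^2 - (- 48 - 32 * X_var + 20 * X_var^2 + 24 * X_var^3 + X_var^4
        + 8 * (2 + 2 * X_var + X_var^2) * Y_var)}" (is "has_affine_equations ?K {?e1, ?e2}")
  unfolding has_affine_equations_def
proof (intro conjI bexI[of _ curve_eval3])
  note h = is_ring_hom_simps[OF curve_eval_hom(3)]
  interpret K: field "?K" by (rule X0.field_X0_field)
  show "field ?K" by (rule K.field_axioms)
  show hom: "curve_eval3 \<in> ring_hom rat_poly3 ?K"
    by (rule ring_hom_memI) (simp_all add: X0_field_simps curve_eval3_rational h)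
  have R: "cring rat_poly3" by (rule cring_from_type_algebra)
  interpret R: cring rat_poly3 by (rule R)
  interpret ring_hom_ring rat_poly3 ?K curve_eval3
    by (rule ring_hom_ringI2[OF R.ring_axioms K.ring_axioms hom])
  have ker: "p \<in> a_kernel rat_poly3 ?K curve_eval3 \<longleftrightarrow> curve_eval3 p = 0" for p
    unfolding a_kernel_def' X0_field_simps ring_of_type_algebra_simps by blast
  have S: "{?e1, ?e2} \<subseteq> carrier rat_poly3" by simp
  show "a_kernel rat_poly3 ?K curve_eval3 = genideal rat_poly3 {?e1, ?e2}"
  proof
    have "{?e1, ?e2} \<subseteq> a_kernel rat_poly3 ?K curve_eval3"
      unfolding insert_subset ker using curve_eval3_kernel(1,2) by blast
    thus "genideal rat_poly3 {?e1, ?e2} \<subseteq> a_kernel rat_poly3 ?K curve_eval3"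
      by (rule R.genideal_minimal[OF kernel_is_ideal])
    interpret I: ideal "genideal rat_poly3 {?e1, ?e2}" rat_poly3 by (rule R.genideal_ideal[OF S])
    have e: "?e1 \<in> genideal rat_poly3 {?e1, ?e2}" "?e2 \<in> genideal rat_poly3 {?e1, ?e2}" using R.genideal_self[OF S] by blast+
    show "a_kernel rat_poly3 ?K curve_eval3 \<subseteq> genideal rat_poly3 {?e1, ?e2}"
    proof
      fix p assume "p \<in> a_kernel rat_poly3 ?K curve_eval3"
      hence "curve_eval3 p = 0" unfolding ker .
      from curve_eval3_kernel(3)[OF this] obtain u v where p: "p = u * ?e2 + v * ?e1" by blast
      have 1: "u * ?e2 \<in> genideal rat_poly3 {?e1, ?e2}" using I.I_l_closed[OF e(2), of u] by (simp only: ring_of_type_algebra_simps UNIV_I)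
      have 2: "v * ?e1 \<in> genideal rat_poly3 {?e1, ?e2}" using I.I_l_closed[OF e(1), of v] by (simp only: ring_of_type_algebra_simps UNIV_I)
      show "p \<in> genideal rat_poly3 {?e1, ?e2}" unfolding p using I.a_closed[OF 1 2] by (simp only: ring_of_type_algebra_simps)
    qed
  qed
  show "carrier ?K = {curve_eval3 p \<otimes>\<^bsub>?K\<^esub> inv\<^bsub>?K\<^esub> curve_eval3 q | p q. curve_eval3 q \<noteq> \<zero>\<^bsub>?K\<^esub>}"
  proof (intro equalityI subsetI)
    fix f assume "f \<in> carrier ?K"
    hence "f \<in> X0_rational_functions 34" by (simp add: X0_field_simps)
    then obtain A P Q P' Q' where A: "rat_in_x A \<noteq> 0"
      "f = (rat_in_x P + rat_in_x Q * y_fun + (rat_in_x P' + rat_in_x Q' * y_fun) * t_fun) / rat_in_x A"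
      by (rule rational_function_decomposition)
    define p where "p = [:[:P, Q:], [:P', Q':]:]"
    define q where "q = [:[:A:]:]"
    have pq: "curve_eval3 p = rat_in_x P + rat_in_x Q * y_fun + (rat_in_x P' + rat_in_x Q' * y_fun) * t_fun"
      "curve_eval3 q = rat_in_x A" by (simp_all add: p_def q_def curve_eval_pCons(2,3) curve_eval_0 mult.commute)
    have inv: "inv\<^bsub>?K\<^esub> curve_eval3 q = inverse (rat_in_x A)"
      using X0.X0_field_inv[OF curve_eval3_rational, of q] A(1) unfolding pq(2) by blast
    have "f = curve_eval3 p \<otimes>\<^bsub>?K\<^esub> inv\<^bsub>?K\<^esub> curve_eval3 q"
      using A(2) by (simp only: inv X0_field_simps pq(1) divide_inverse)
    moreover have "curve_eval3 q \<noteq> \<zero>\<^bsub>?K\<^esub>" using A(1) by (simp only: X0_field_simps pq(2) not_False_eq_True)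
    ultimately show "f \<in> {curve_eval3 p \<otimes>\<^bsub>?K\<^esub> inv\<^bsub>?K\<^esub> curve_eval3 q | p q. curve_eval3 q \<noteq> \<zero>\<^bsub>?K\<^esub>}" by blast
  next
    fix f assume "f \<in> {curve_eval3 p \<otimes>\<^bsub>?K\<^esub> inv\<^bsub>?K\<^esub> curve_eval3 q | p q. curve_eval3 q \<noteq> \<zero>\<^bsub>?K\<^esub>}"
    then obtain p q where f: "f = curve_eval3 p \<otimes>\<^bsub>?K\<^esub> inv\<^bsub>?K\<^esub> curve_eval3 q" "curve_eval3 q \<noteq> \<zero>\<^bsub>?K\<^esub>" by blast
    have "f = curve_eval3 p * inverse (curve_eval3 q)"
      using f X0.X0_field_inv[OF curve_eval3_rational, of q] unfolding X0_field_simps by simp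
    thus "f \<in> carrier ?K" by (simp add: X0_field_simps X0.mult X0.inverse curve_eval3_rational)
  qed
qed

theorem mainTheorem1:
  shows "(\<exists>x \<in> carrier (X0_field 34). \<exists>y \<in> carrier (X0_field 34). \<exists>t \<in> carrier (X0_field 34).
            carrier (X0_field 34) = generate_field (X0_field 34) (\<rat> \<union> {x, y, t}) \<and>
            {f \<in> carrier (X0_field 34). atkin_lehner 34 17 f = f} =
              generate_field (X0_field 34) (\<rat> \<union> {x, y}) \<and>
            atkin_lehner 34 17 t = - t \<and>
            y^2 + x * y = x^3 - 3 * x + 1 \<and>
            t^2 = - 48 - 32 * x + 20 * x^2 + 24 * x^3 + x^4 + 8 * (2 + 2 * x + x^2) * y) \<and>
         has_affine_equations (X0_field 34)
           {Y_var^2 + X_var * Y_var - (X_var^3 - 3 * X_var + 1),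
            T_var^2 - (- 48 - 32 * X_var + 20 * X_var^2 + 24 * X_var^3 + X_var^4
              + 8 * (2 + 2 * X_var + X_var^2) * Y_var)}"
proof (rule conjI, rule bexI[of _ x_fun], rule bexI[of _ y_fun], rule bexI[of _ t_fun], intro conjI)
  show "carrier (X0_field 34) = generate_field (X0_field 34) (\<rat> \<union> {x_fun, y_fun, t_fun})"
    unfolding X0_field_simps by (rule X0_rational_generated)
  show "{f \<in> carrier (X0_field 34). atkin_lehner 34 17 f = f} = generate_field (X0_field 34) (\<rat> \<union> {x_fun, y_fun})"
    unfolding X0_field_simps by (rule fixed_field_generated)
  show "atkin_lehner 34 17 t_fun = - t_fun"
    by (simp add: atkin_lehner_rational curve_funs_rational W17_funs)
  show "y_fun^2 + x_fun * y_fun = x_fun^3 - 3 * x_fun + 1" by (rule curve_equations)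
  show "t_fun^2 = - 48 - 32 * x_fun + 20 * x_fun^2 + 24 * x_fun^3 + x_fun^4 + 8 * (2 + 2 * x_fun + x_fun^2) * y_fun"
    by (rule curve_equations)
  show "x_fun \<in> carrier (X0_field 34)" "y_fun \<in> carrier (X0_field 34)" "t_fun \<in> carrier (X0_field 34)"
    unfolding X0_field_simps by (rule curve_funs_rational)+
qed (rule affine_equations)

end
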